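(* Let $\mathbf{w}=(\omega_i)_{i\ge 0}$ be a sequence of non-negative reals with $\omega_0>0$ and $\omega_k>0$ for at least one $k\ge 2$, such that $\Phi(z)=\sum_{k\ge0}\omega_kz^k$ has radius of convergence $\rho_\Phi>0$. Let $\mathcal{U}_n$ be the simply generated unrooted plane tree and $\mathcal{T}_m$ the simply generated planted plane tree associated with $\mathbf{w}$, and let $\xi$ be the canonical offspring variable associated with $\mathbf{w}$, with mean $\mu$ and variance $\sigma^2$. Suppose that $\mu=1$ and $\sigma^2<\infty$. Then, as $n\to\infty$ along the integers for which $\mathcal{U}_n$ is defined: (1) Let $\mathcal{T}^\bullet$ denote the Benjamini--Schramm limit of the sequence $(\mathcal{T}_m)_m$ (the conditioned $\xi$-Galton--Watson trees). Then $\mathcal{U}_n$ also converges in the Benjamini--Schramm sense toward $\mathcal{T}^\bullet$. (2) For $d\ge1$, if $N_d$ denotes the number of vertices of degree $d$ in the tree $\mathcal{U}_n$, then \[ \frac{N_d-\mathbb{P}(\xi=d-1)\,n}{\sqrt n}\overset{d}{\longrightarrow}\mathcal{N}(0,\sigma_d^2) \] for some $0<\sigma_d<\infty$.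
   Context: Trees. An unrooted plane tree is an unlabelled tree in which each vertex is endowed with a cyclic ordering of its neighbourhood, up to isomorphism; a planted plane tree is a finite rooted tree where each vertex has a linearly ordered list of children. $\mathscr{U}_n$, $\mathscr{T}_n$ are the corresponding sets of trees with $n$ vertices. $U\in\mathscr{U}_n$ ($n\ge2$) has weight $\bar\omega(U)=\prod_{v\in U}\omega_{d_U(v)-1}$ ($d_U(v)$ the degree) and $\mathcal{U}_n$ is sampled from $\mathscr{U}_n$ with probability proportional to $\bar\omega$. $T\in\mathscr{T}_m$ has weight $\omega(T)=\prod_{v\in T}\omega_{d_T^+(v)}$ ($d_T^+(v)$ the number of children) and $\mathcal{T}_m$ is sampled from $\mathscr{T}_m$ with probability proportional to $\omega$. They are defined whenever trees of positive weight of the given size exist; for large sizes this means $n\equiv2$, resp. $m\equiv1$, modulo $\mathrm{span}(\mathbf{w})=\gcd\{i\ge0:\omega_i>0\}$. Canonical offspring variable. Set $\Psi(t)=t\Phi'(t)/\Phi(t)$, $\nu=\lim_{t\nearrow\rho_\Phi}\Psi(t)\in(0,\infty]$. If $\nu\ge1$ let $\tau$ be the unique finite number with $\Psi(\tau)=1$; if $\nu<1$ let $\tau=\rho_\Phi$. Then $\mathbb{P}(\xi=k)=\omega_k\tau^k/\Phi(\tau)$, $k\ge0$, $\mu=\mathbb{E}[\xi]=\min(\nu,1)$, and $\sigma^2=\mathrm{Var}(\xi)=\tau\Psi'(\tau)$. The tree $\mathcal{T}_m$ is distributed like a $\xi$-Galton--Watson tree conditioned on having $m$ vertices. Local weak convergence.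 For a locally finite graph $G$ with distinguished vertex $v_G$, $U_\ell(G,v_G)$ is the subgraph induced by the vertices at graph distance at most $\ell$ from $v_G$, regarded as a graph rooted at $v_G$; $\simeq$ denotes root-preserving graph isomorphism. Random rooted graphs $(G_n,v_n)$ converge in the local weak sense to $(G,v)$ if for each $\ell\ge0$ and each rooted graph $(Q,v_Q)$, $\mathbb{P}(U_\ell(G_n,v_n)\simeq(Q,v_Q))\to\mathbb{P}(U_\ell(G,v)\simeq(Q,v_Q))$. Benjamini--Schramm convergence of random finite graphs $G_n$ means local weak convergence of $(G_n,v_n)$ with $v_n$ a uniformly random vertex of $G_n$. The limit $\mathcal{T}^\bullet$ (existence of this limit for $\mathcal{T}_m$ is due to Aldous): it has an infinite spine $u_0,u_1,u_2,\dots$ with root vertex $u_0$, where $u_{i}$ is the parent of $u_{i-1}$; the fringe subtree at $u_0$ is a $\xi$-Galton--Watson tree; independently, each $u_i$, $i\ge1$, has a number of children distributed as $\hat\xi$ with $\mathbb{P}(\hat\xi=k)=k\,\mathbb{P}(\xi=k)$, one of them (chosen uniformly) being $u_{i-1}$, and each other child is the root of an independent $\xi$-Galton--Watson tree.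
   Formalization: In (2), σ_d>0 is claimed only if ω_{d-1}>0 and ω_i>0 for at least two indices i≥1; in the other cases N_d is deterministic, the limit is the point mass at 0, and convergence is stated with σ_d≥0 (N(0,0) being that point mass). *)

theory Defs
  imports "HOL-Probability.Probability" "HOL-Combinatorics.Orbits"
begin

section \<open>Graphs\<close>

text \<open>Undirected simple graphs; an edge is stored as the two pairs \<open>(u, v)\<close> and \<open>(v, u)\<close>.\<close>

record 'a graph =
  verts :: "'a set"
  edges :: "('a \<times> 'a) set"

definition simple_graph :: "'a graph \<Rightarrow> bool" where
  "simple_graph G \<longleftrightarrow> edges G \<subseteq> verts G \<times> verts G \<and> sym (edges G) \<and> irrefl (edges G)"

definition neighbours :: "'a graph \<Rightarrow> 'a \<Rightarrow> 'a set" where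
  "neighbours G v = edges G `` {v}"

definition degree :: "'a graph \<Rightarrow> 'a \<Rightarrow> nat" where
  "degree G v = card (neighbours G v)"

definition connected_graph :: "'a graph \<Rightarrow> bool" where
  "connected_graph G \<longleftrightarrow> verts G \<noteq> {} \<and> (\<forall>u\<in>verts G. \<forall>v\<in>verts G. (u, v) \<in> (edges G)\<^sup>*)"

definition cycle_in :: "'a graph \<Rightarrow> 'a list \<Rightarrow> bool" where
  "cycle_in G p \<longleftrightarrow> length p \<ge> 3 \<and> distinct p \<and>
     (\<forall>i<length p. (p ! i, p ! (Suc i mod length p)) \<in> edges G)"

definition tree_graph :: "'a graph \<Rightarrow> bool" where
  "tree_graph G \<longleftrightarrow> simple_graph G \<and> connected_graph G \<and> (\<nexists>p. cycle_in G p)"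

definition graph_iso_by :: "('a \<Rightarrow> 'b) \<Rightarrow> 'a graph \<Rightarrow> 'b graph \<Rightarrow> bool" where
  "graph_iso_by f G H \<longleftrightarrow> bij_betw f (verts G) (verts H) \<and>
     (\<forall>u\<in>verts G. \<forall>v\<in>verts G. (u, v) \<in> edges G \<longleftrightarrow> (f u, f v) \<in> edges H)"

section \<open>Local weak convergence\<close>

type_synonym 'a rooted_graph = "'a graph \<times> 'a"

definition rooted_iso :: "'a rooted_graph \<Rightarrow> 'b rooted_graph \<Rightarrow> bool"  (infix \<open>\<simeq>\<^sub>r\<close> 50) where
  "G \<simeq>\<^sub>r H \<longleftrightarrow> (\<exists>f. graph_iso_by f (fst G) (fst H) \<and> f (snd G) = snd H)"

text \<open>A vertex is at distance at most \<open>l\<close> from the root iff it is reached by a walk of length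
  \<open>k \<le> l\<close>, i.e. by the \<open>k\<close>-fold relational power of the edge relation.\<close>

definition nbhd :: "nat \<Rightarrow> 'a rooted_graph \<Rightarrow> 'a rooted_graph" where
  "nbhd l G =
     (let B = {v \<in> verts (fst G). \<exists>k\<le>l. (snd G, v) \<in> edges (fst G) ^^ k}
      in (\<lparr>verts = B, edges = edges (fst G) \<inter> B \<times> B\<rparr>, snd G))"

text \<open>A random rooted graph is given by a probability space \<open>M\<close> together with a map \<open>G\<close> on it.
  Neighbourhoods in locally finite graphs are finite, so it suffices to test against rooted
  graphs \<open>Q\<close> with vertices in \<open>nat\<close>: for any other \<open>Q\<close> all probabilities vanish.\<close>

definition local_weak_conv ::
  "(nat \<Rightarrow> 's measure) \<Rightarrow> (nat \<Rightarrow> 's \<Rightarrow> 'a rooted_graph) \<Rightarrow>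
     't measure \<Rightarrow> ('t \<Rightarrow> 'b rooted_graph) \<Rightarrow> bool" where
  "local_weak_conv Ms Gs M G \<longleftrightarrow>
     (\<forall>l. \<forall>Q :: nat rooted_graph.
        (\<lambda>n. \<P>(x in Ms n. nbhd l (Gs n x) \<simeq>\<^sub>r Q)) \<longlonglongrightarrow> \<P>(x in M. nbhd l (G x) \<simeq>\<^sub>r Q))"

definition uniformly_rooted :: "'a graph pmf \<Rightarrow> 'a rooted_graph pmf" where
  "uniformly_rooted p = bind_pmf p (\<lambda>G. map_pmf (Pair G) (pmf_of_set (verts G)))"

definition benjamini_schramm_conv ::
  "(nat \<Rightarrow> 'a graph pmf) \<Rightarrow> 't measure \<Rightarrow> ('t \<Rightarrow> 'b rooted_graph) \<Rightarrow> bool" where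
  "benjamini_schramm_conv p M G \<longleftrightarrow>
     local_weak_conv (\<lambda>n. measure_pmf (uniformly_rooted (p n))) (\<lambda>_ x. x) M G"

section \<open>Sampling proportionally to weights\<close>

text \<open>Meaningful only if \<open>A\<close> is finite, \<open>f\<close> is non-negative on \<open>A\<close>, and the total weight is
  positive.\<close>

definition weighted_pmf :: "'a set \<Rightarrow> ('a \<Rightarrow> real) \<Rightarrow> 'a pmf" where
  "weighted_pmf A f = embed_pmf (\<lambda>x. if x \<in> A then f x / sum f A else 0)"

section \<open>Unrooted plane trees\<close>

text \<open>A tree together with, for each vertex \<open>v\<close>, a cyclic permutation of the neighbours of \<open>v\<close>:
  \<open>rot v u\<close> is the successor of \<open>u\<close> in the cyclic order at \<open>v\<close>. Since \<open>rot v\<close> fixes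
  everything that is not a neighbour of \<open>v\<close>, no junk information is stored. Every vertex is
  required to have a neighbour, so there are at least two vertices.\<close>

type_synonym 'a plane_tree = "'a graph \<times> ('a \<Rightarrow> 'a \<Rightarrow> 'a)"

definition is_plane_tree :: "'a plane_tree \<Rightarrow> bool" where
  "is_plane_tree P \<longleftrightarrow> (case P of (G, rot) \<Rightarrow>
     tree_graph G \<and> (\<forall>v. rot v permutes neighbours G v) \<and>
     (\<forall>v\<in>verts G. cyclic_on (rot v) (neighbours G v)))"

definition plane_iso :: "'a plane_tree \<Rightarrow> 'b plane_tree \<Rightarrow> bool" where
  "plane_iso P P' \<longleftrightarrow> (case (P, P') of ((G, rot), (G', rot')) \<Rightarrow>
     \<exists>f. graph_iso_by f G G' \<and>
       (\<forall>v\<in>verts G. \<forall>u\<in>neighbours G v. f (rot v u) = rot' (f v) (f u)))"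

definition labelled_plane_trees :: "nat \<Rightarrow> nat plane_tree set" where
  "labelled_plane_trees n = {P. verts (fst P) = {..<n} \<and> is_plane_tree P}"

definition plane_iso_rel :: "nat \<Rightarrow> (nat plane_tree \<times> nat plane_tree) set" where
  "plane_iso_rel n =
     {(P, P'). P \<in> labelled_plane_trees n \<and> P' \<in> labelled_plane_trees n \<and> plane_iso P P'}"

definition unrooted_plane_trees :: "nat \<Rightarrow> nat plane_tree set set" where
  "unrooted_plane_trees n = labelled_plane_trees n // plane_iso_rel n"

text \<open>The underlying graph of an arbitrary representative; it is determined up to isomorphism.\<close>

definition underlying :: "nat plane_tree set \<Rightarrow> nat graph" where
  "underlying U = fst (SOME P. P \<in> U)"

definition unrooted_weight :: "(nat \<Rightarrow> real) \<Rightarrow> nat plane_tree set \<Rightarrow> real" where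
  "unrooted_weight w U = (\<Prod>v\<in>verts (underlying U). w (degree (underlying U) v - 1))"

definition unrooted_pmf :: "(nat \<Rightarrow> real) \<Rightarrow> nat \<Rightarrow> nat plane_tree set pmf" where
  "unrooted_pmf w n = weighted_pmf (unrooted_plane_trees n) (unrooted_weight w)"

definition unrooted_sizes :: "(nat \<Rightarrow> real) \<Rightarrow> nat set" where
  "unrooted_sizes w = {n. n \<ge> 2 \<and> (\<exists>U\<in>unrooted_plane_trees n. unrooted_weight w U > 0)}"

definition count_degree :: "nat \<Rightarrow> nat plane_tree set \<Rightarrow> nat" where
  "count_degree d U = card {v \<in> verts (underlying U). degree (underlying U) v = d}"

section \<open>Planted plane trees\<close>

datatype planted_tree = Node "planted_tree list"

text \<open>The vertices are identified with their Ulam--Harris words: the root is \<open>[]\<close>, and the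
  children of \<open>v\<close> are \<open>v @ [0], v @ [1], \<dots>\<close> in this order.\<close>

primrec positions :: "planted_tree \<Rightarrow> nat list set" where
  "positions (Node ts) =
     insert [] (\<Union>i<length ts. (#) i ` (map positions ts ! i))"

definition outdegree :: "planted_tree \<Rightarrow> nat list \<Rightarrow> nat" where
  "outdegree t v = card {i. v @ [i] \<in> positions t}"

definition planted_graph :: "planted_tree \<Rightarrow> nat list graph" where
  "planted_graph t =
     \<lparr>verts = positions t,
      edges = {(u, v). u \<in> positions t \<and> v \<in> positions t \<and>
                       ((\<exists>i. v = u @ [i]) \<or> (\<exists>i. u = v @ [i]))}\<rparr>"

definition planted_plane_trees :: "nat \<Rightarrow> planted_tree set" where
  "planted_plane_trees m = {t. card (positions t) = m}"

definition planted_weight :: "(nat \<Rightarrow> real) \<Rightarrow> planted_tree \<Rightarrow> real" where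
  "planted_weight w t = (\<Prod>v\<in>positions t. w (outdegree t v))"

definition planted_pmf :: "(nat \<Rightarrow> real) \<Rightarrow> nat \<Rightarrow> planted_tree pmf" where
  "planted_pmf w m = weighted_pmf (planted_plane_trees m) (planted_weight w)"

definition planted_sizes :: "(nat \<Rightarrow> real) \<Rightarrow> nat set" where
  "planted_sizes w = {m. \<exists>t\<in>planted_plane_trees m. planted_weight w t > 0}"

section \<open>The canonical offspring variable\<close>

definition Phi :: "(nat \<Rightarrow> real) \<Rightarrow> real \<Rightarrow> real" where
  "Phi w t = (\<Sum>k. w k * t ^ k)"

text \<open>The derivative of \<open>Phi w\<close> is written as the termwise differentiated series (\<open>diffs\<close>), so
  that \<open>Psi w\<close> also makes sense at the radius of convergence if the series converges there.\<close>

definition Psi :: "(nat \<Rightarrow> real) \<Rightarrow> real \<Rightarrow> real" where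
  "Psi w t = t * (\<Sum>k. diffs w k * t ^ k) / Phi w t"

definition nu :: "(nat \<Rightarrow> real) \<Rightarrow> ereal" where
  "nu w = Lim (at_left (conv_radius w)) (\<lambda>t. ereal (Psi w (real_of_ereal t)))"

text \<open>For \<open>nu w = 1\<close> the solution of \<open>Psi w t = 1\<close> is the radius of convergence itself. The
  summability condition excludes points at which \<open>Psi w\<close> is undefined (or infinite).\<close>

definition tau :: "(nat \<Rightarrow> real) \<Rightarrow> real" where
  "tau w = (if nu w \<ge> 1
     then THE t. t \<ge> 0 \<and> summable (\<lambda>k. diffs w k * t ^ k) \<and> Psi w t = 1
     else real_of_ereal (conv_radius w))"

definition offspring_pmf :: "(nat \<Rightarrow> real) \<Rightarrow> nat pmf" where
  "offspring_pmf w = embed_pmf (\<lambda>k. w k * tau w ^ k / Phi w (tau w))"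

section \<open>The limit tree\<close>

text \<open>For an offspring law \<open>p\<close> of mean one: the size-biased number \<open>k\<close> of children of a spine
  vertex together with the (uniform) position among them of the preceding spine vertex.\<close>

definition spine_pmf :: "nat pmf \<Rightarrow> (nat \<times> nat) pmf" where
  "spine_pmf p = bind_pmf (embed_pmf (\<lambda>k. real k * pmf p k))
     (\<lambda>k. map_pmf (Pair k) (pmf_of_set {..<k}))"

text \<open>The vertex \<open>(i, v)\<close> is the descendant of the spine vertex \<open>(i, [])\<close> with relative
  Ulam--Harris word \<open>v\<close>. A sample point consists of offspring numbers \<open>X (i, v)\<close>, used at all
  vertices other than the spine vertices with index \<open>i \<ge> 1\<close>, and of pairs \<open>S i\<close>, used at the
  latter. The child of \<open>(i, [])\<close>, \<open>i \<ge> 1\<close>, at position \<open>snd (S i)\<close> is \<open>(i - 1, [])\<close>, so this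
  position is omitted from the words.\<close>

type_synonym spine_vertex = "nat \<times> nat list"
type_synonym spine_sample = "(spine_vertex \<Rightarrow> nat) \<times> (nat \<Rightarrow> nat \<times> nat)"

definition limit_measure :: "nat pmf \<Rightarrow> spine_sample measure" where
  "limit_measure p =
     (\<Pi>\<^sub>M x\<in>UNIV. measure_pmf p) \<Otimes>\<^sub>M (\<Pi>\<^sub>M i\<in>UNIV. measure_pmf (spine_pmf p))"

definition child_positions :: "spine_sample \<Rightarrow> spine_vertex \<Rightarrow> nat set" where
  "child_positions s x = (case (s, x) of ((X, S), (i, v)) \<Rightarrow>
     if i \<ge> 1 \<and> v = [] then {..<fst (S i)} - {snd (S i)} else {..<X (i, v)})"

inductive_set limit_verts :: "spine_sample \<Rightarrow> spine_vertex set" for s where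
  spine: "(i, []) \<in> limit_verts s"
| child: "(i, v) \<in> limit_verts s \<Longrightarrow> j \<in> child_positions s (i, v) \<Longrightarrow> (i, v @ [j]) \<in> limit_verts s"

inductive limit_parent :: "spine_vertex \<Rightarrow> spine_vertex \<Rightarrow> bool" where
  "limit_parent (Suc i, []) (i, [])"
| "limit_parent (i, v) (i, v @ [j])"

definition limit_tree :: "spine_sample \<Rightarrow> spine_vertex rooted_graph" where
  "limit_tree s =
     (\<lparr>verts = limit_verts s,
       edges = {(x, y). x \<in> limit_verts s \<and> y \<in> limit_verts s \<and>
                        (limit_parent x y \<or> limit_parent y x)}\<rparr>,
      (0, []))"

section \<open>Centred normal laws\<close>

text \<open>The number \<open>N\<^sub>d\<close> of vertices of degree \<open>d\<close> is random only if \<open>w (d - 1) > 0\<close> and the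
  support of \<open>w\<close> has at least two positive elements. Otherwise \<open>N\<^sub>d\<close> is \<open>0\<close>, or the support is
  \<open>{0, k}\<close> and \<open>N\<^sub>1 + N\<^sub>k\<^sub>+\<^sub>1 = n\<close>, \<open>N\<^sub>1 + (k + 1) N\<^sub>k\<^sub>+\<^sub>1 = 2 (n - 1)\<close> determine it; the limit
  law is then the point mass at zero.\<close>

definition degree_count_nondegenerate :: "(nat \<Rightarrow> real) \<Rightarrow> nat \<Rightarrow> bool" where
  "degree_count_nondegenerate w d \<longleftrightarrow>
     w (d - 1) > 0 \<and> (\<exists>i j. 0 < i \<and> i < j \<and> w i > 0 \<and> w j > 0)"

definition centred_normal :: "real \<Rightarrow> real measure" where
  "centred_normal \<sigma> =
     (if \<sigma> = 0 then return borel 0 else density lborel (normal_density 0 \<sigma>))"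

end

theory Submission
  imports Defs "HOL-Real_Asymp.Real_Asymp"
begin

text \<open>Tilting the weights to the canonical offspring law \<open>p\<close> multiplies the weight of every tree
  of a given size by the same constant (\<open>planted_tilt\<close>, \<open>unrooted_tilt\<close>), so the weights may be
  taken to be \<open>p\<close> itself, which has mean one and finite variance.

  The unrooted tree is compared with a Galton--Watson forest. A plane tree with a marked corner is
  the same thing as a planted tree, its code (\<open>plane_model_rigid\<close>, \<open>corner_code_exists\<close>). Deleting
  the edge next to the marked corner leaves a pair of planted trees in which the out-degree of every
  vertex is its degree minus one; hence the weight \<open>unrooted_weight\<close> is exactly the weight of this
  pair, and a plane tree with a random marked corner is a conditioned forest of two Galton--Watson
  trees (\<open>bij_betw_corner_forest\<close>, \<open>sum_corner_weight\<close>). An unrooted tree with \<open>n\<close> vertices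
  has \<open>2 (n - 1)\<close> corners, which have different codes unless the tree has a non-trivial
  automorphism. Such an automorphism fixes a vertex or flips an edge, so the tree is put
  together from copies of a smaller piece (\<open>card_codes_asymmetric\<close>) and its weight is
  exponentially small (\<open>symmetric_weight_le\<close>), whereas the total weight of all trees decays only
  like \<open>n\<close> to the power \<open>-3/2\<close> (\<open>forest_sum_tendsto\<close>). Forgetting the corner therefore changes
  expectations of bounded statistics by \<open>o(1)\<close> (\<open>unrooted_expectation_tendsto\<close>).

  Conditioned forests are accessible through the Lagrange inversion formula
  (\<open>forest_sum_lagrange\<close>), which expresses the weight of all forests of a given size by a
  coefficient of a power of the offspring generating function. Marking every vertex with \<open>j\<close>
  children by a phase, writing the coefficient as a Fourier integral, and passing to the limit
  under the integral yields a local limit theorem together with the characteristic function of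
  the number of marked vertices (\<open>fourier_coeff_tendsto\<close>); with the continuity theorem of Levy
  this is the asymptotic normality of the degree counts. The limiting variance is the part of
  the variance of the indicator of \<open>\<xi> = j\<close> that is not explained by linear regression on \<open>\<xi>\<close>.

  The same recursion that gives the Lagrange formula counts the occurrences of a given tree as a
  fringe subtree (\<open>forest_sum_fringe_count\<close>): their frequency tends to the probability of this
  tree under the unconditioned Galton--Watson law (\<open>forest_fringe_fraction\<close>). The ball of radius
  \<open>l\<close> about a vertex of height at least \<open>l\<close> is determined by the fringe subtree at its \<open>l\<close>-th
  ancestor and its position in there (\<open>nbhd_subtree\<close>). In the limit tree each such configuration
  has exactly the limiting frequency as its probability (\<open>spine_event_prob\<close>). As a critical
  Galton--Watson tree is finite and its generations have mean size one, these probabilities add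
  up to one (\<open>pointed_trees_mass\<close>), so no mass is lost and the frequencies of all balls converge
  (\<open>nbhd_fraction_tendsto\<close>).\<close>

section \<open>Planted trees and forests\<close>

primrec nodes :: "planted_tree \<Rightarrow> nat" where
  "nodes (Node ts) = Suc (sum_list (map nodes ts))"

primrec tree_weight :: "(nat \<Rightarrow> 'b::comm_monoid_mult) \<Rightarrow> planted_tree \<Rightarrow> 'b" where
  "tree_weight a (Node ts) = a (length ts) * prod_list (map (tree_weight a) ts)"

primrec fringe_count :: "planted_tree \<Rightarrow> planted_tree \<Rightarrow> nat" where
  "fringe_count t (Node ts) = (if Node ts = t then 1 else 0) + sum_list (map (fringe_count t) ts)"

primrec outdegree_count :: "nat \<Rightarrow> planted_tree \<Rightarrow> nat" where
  "outdegree_count j (Node ts) = (if length ts = j then 1 else 0) + sum_list (map (outdegree_count j) ts)"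

lemma nodes_pos: "nodes t > 0" by (cases t) auto

lemma positions_Node:
  "positions (Node ts) = insert [] (\<Union>i<length ts. (#) i ` positions (ts ! i))"
  by auto

declare positions.simps [simp del]

lemma Nil_in_positions [simp]: "[] \<in> positions t"
  by (cases t) (simp add: positions_Node)

lemma Cons_in_positions [simp]:
  "i # v \<in> positions (Node ts) \<longleftrightarrow> i < length ts \<and> v \<in> positions (ts ! i)"
  by (auto simp: positions_Node)

lemma finite_positions [simp]: "finite (positions t)"
  by (induction t) (auto simp: positions_Node)

lemma outdegree_Nil [simp]: "outdegree (Node ts) [] = length ts"
proof -
  have "{i. [] @ [i] \<in> positions (Node ts)} = {..<length ts}" by auto
  thus ?thesis by (simp add: outdegree_def)
qed

lemma outdegree_Cons [simp]:
  "i < length ts \<Longrightarrow> outdegree (Node ts) (i # v) = outdegree (ts ! i) v"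
  by (simp add: outdegree_def)

lemma sum_positions_Node:
  "(\<Sum>v\<in>positions (Node ts). f v) = f [] + (\<Sum>i<length ts. \<Sum>v\<in>positions (ts ! i). f (i # v))"
proof -
  have "(\<Sum>v\<in>positions (Node ts). f v) = f [] + sum f (\<Union>i<length ts. (#) i ` positions (ts ! i))"
    unfolding positions_Node by (subst sum.insert) auto
  also have "sum f (\<Union>i<length ts. (#) i ` positions (ts ! i)) = (\<Sum>i<length ts. sum f ((#) i ` positions (ts ! i)))"
    by (rule sum.UNION_disjoint) auto
  also have "\<dots> = (\<Sum>i<length ts. \<Sum>v\<in>positions (ts ! i). f (i # v))"
    by (rule sum.cong[OF refl]) (simp add: sum.reindex)
  finally show ?thesis .
qed

lemma prod_positions_Node:
  "(\<Prod>v\<in>positions (Node ts). f v) = f [] * (\<Prod>i<length ts. \<Prod>v\<in>positions (ts ! i). f (i # v))"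
proof -
  have "(\<Prod>v\<in>positions (Node ts). f v) = f [] * prod f (\<Union>i<length ts. (#) i ` positions (ts ! i))"
    unfolding positions_Node by (subst prod.insert) auto
  also have "prod f (\<Union>i<length ts. (#) i ` positions (ts ! i)) = (\<Prod>i<length ts. prod f ((#) i ` positions (ts ! i)))"
    by (rule prod.UNION_disjoint) auto
  also have "\<dots> = (\<Prod>i<length ts. \<Prod>v\<in>positions (ts ! i). f (i # v))"
    by (rule prod.cong[OF refl]) (simp add: prod.reindex)
  finally show ?thesis .
qed

lemma sum_list_conv_index: "sum_list (map f ts) = (\<Sum>i<length ts. f (ts ! i))"
  for f :: "'a \<Rightarrow> 'b::comm_monoid_add"
  by (simp add: sum_list_sum_nth atLeast0LessThan)

lemma prod_list_conv_index: "prod_list (map f ts) = (\<Prod>i<length ts. f (ts ! i))"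
  for f :: "'a \<Rightarrow> 'b::comm_monoid_mult"
  by (induction ts) (simp_all add: prod.lessThan_Suc_shift del: prod.lessThan_Suc)

lemma card_positions: "card (positions t) = nodes t"
proof (induction t)
  case (Node ts)
  have "card (positions (Node ts)) = (\<Sum>v\<in>positions (Node ts). 1)" by simp
  also have "\<dots> = 1 + (\<Sum>i<length ts. card (positions (ts ! i)))"
    by (subst sum_positions_Node) simp
  also have "\<dots> = nodes (Node ts)" using Node by (simp add: sum_list_conv_index)
  finally show ?case .
qed

lemma planted_weight_eq: "planted_weight w t = tree_weight w t"
proof (induction t)
  case (Node ts)
  have "planted_weight w (Node ts) = w (length ts) *
      (\<Prod>i<length ts. \<Prod>v\<in>positions (ts ! i). w (outdegree (Node ts) (i # v)))"
    unfolding planted_weight_def by (subst prod_positions_Node) simp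
  also have "(\<Prod>i<length ts. \<Prod>v\<in>positions (ts ! i). w (outdegree (Node ts) (i # v)))
      = (\<Prod>i<length ts. planted_weight w (ts ! i))"
    unfolding planted_weight_def by (intro prod.cong refl) auto
  also have "\<dots> = (\<Prod>i<length ts. tree_weight w (ts ! i))"
    using Node by (intro prod.cong) auto
  finally show ?case by (simp add: prod_list_conv_index)
qed

lemma card_outdegree: "card {v \<in> positions t. outdegree t v = j} = outdegree_count j t"
proof (induction t)
  case (Node ts)
  have "card {v \<in> positions t. outdegree t v = j} = (\<Sum>v\<in>positions t. if outdegree t v = j then 1 else 0)" for t
    by (simp add: sum.If_cases Int_def)
  note * = this
  have "card {v \<in> positions (Node ts). outdegree (Node ts) v = j} =
     (if length ts = j then 1 else 0) + (\<Sum>i<length ts. \<Sum>v\<in>positions (ts ! i). if outdegree (Node ts) (i # v) = j then 1 else 0)"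
    unfolding * by (subst sum_positions_Node) simp
  also have "(\<Sum>i<length ts. \<Sum>v\<in>positions (ts ! i). if outdegree (Node ts) (i # v) = j then 1 else 0)
     = (\<Sum>i<length ts. card {v \<in> positions (ts ! i). outdegree (ts ! i) v = j})"
    unfolding * by (intro sum.cong refl) auto
  finally show ?case using Node by (simp add: sum_list_conv_index)
qed

lemma tree_weight_indicator:
  "tree_weight (\<lambda>k. a k * (if k = j then u else 1)) t = tree_weight a t * u ^ outdegree_count j t"
  for a :: "nat \<Rightarrow> 'b::comm_monoid_mult"
proof (induction t)
  case (Node ts)
  have "prod_list (map (tree_weight (\<lambda>k. a k * (if k = j then u else 1))) ts)
      = prod_list (map (tree_weight a) ts) * u ^ sum_list (map (outdegree_count j) ts)"
    using Node by (induction ts) (auto simp: power_add ac_simps)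
  thus ?case by (auto simp: power_add ac_simps)
qed

lemma tree_weight_scale:
  fixes a :: "nat \<Rightarrow> 'b::field"
  assumes "c \<noteq> 0"
  shows "tree_weight (\<lambda>k. a k * s ^ k / c) t * s = tree_weight a t * s ^ nodes t / c ^ nodes t"
proof (induction t)
  case (Node ts)
  have "prod_list (map (tree_weight (\<lambda>k. a k * s ^ k / c)) ts) * s ^ length ts
      = prod_list (map (tree_weight a) ts) * s ^ sum_list (map nodes ts) / c ^ sum_list (map nodes ts)"
    using Node
  proof (induction ts)
    case (Cons t ts)
    let ?b = "tree_weight (\<lambda>k. a k * s ^ k / c)"
    have 1: "prod_list (map ?b ts) * s ^ length ts
      = prod_list (map (tree_weight a) ts) * s ^ sum_list (map nodes ts) / c ^ sum_list (map nodes ts)"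
      using Cons by auto
    have 2: "?b t * s = tree_weight a t * s ^ nodes t / c ^ nodes t"
      using Cons by auto
    have "prod_list (map ?b (t # ts)) * s ^ length (t # ts) = (?b t * s) * (prod_list (map ?b ts) * s ^ length ts)"
      by simp
    also have "\<dots> = prod_list (map (tree_weight a) (t # ts)) * s ^ sum_list (map nodes (t # ts)) / c ^ sum_list (map nodes (t # ts))"
      unfolding 1 2 by (simp add: power_add)
    finally show ?case .
  qed simp
  thus ?case by (simp add: field_simps)
qed

definition forests :: "nat \<Rightarrow> nat \<Rightarrow> planted_tree list set" where
  "forests r n = {ts. length ts = r \<and> sum_list (map nodes ts) = n}"

definition forest_weight :: "(nat \<Rightarrow> 'b::comm_monoid_mult) \<Rightarrow> planted_tree list \<Rightarrow> 'b" where
  "forest_weight a ts = prod_list (map (tree_weight a) ts)"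

definition forest_fringe_count :: "planted_tree \<Rightarrow> planted_tree list \<Rightarrow> nat" where
  "forest_fringe_count t ts = sum_list (map (fringe_count t) ts)"

lemma length_le_nodes: "length ts \<le> sum_list (map nodes ts)"
proof (induction ts)
  case (Cons t ts) thus ?case using nodes_pos[of t] by simp
qed simp

lemma forests_empty: "n < r \<Longrightarrow> forests r n = {}"
  using length_le_nodes by (force simp: forests_def dest: leD)

lemma forests_0: "forests 0 n = (if n = 0 then {[]} else {})"
  by (auto simp: forests_def)

text \<open>Deleting the root of the first tree of a forest puts its children in front of the
  remaining trees. This is the step of a left-to-right depth-first exploration, and all sums
  over forests below are computed by recursion along it.\<close>

lemma bij_betw_forests_Suc:
  "bij_betw (\<lambda>(k, us). Node (take k us) # drop k us)
     (SIGMA k:{..n}. forests (r + k) n) (forests (Suc r) (Suc n))"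
proof (rule bij_betw_byWitness[where f' = "\<lambda>f. (case hd f of Node ts \<Rightarrow> (length ts, ts @ tl f))"])
  have aux: "sum_list (map nodes (take k us)) + sum_list (map nodes (drop k us)) = sum_list (map nodes us)" for k us
    by (metis append_take_drop_id map_append sum_list_append)
  show "(\<lambda>(k, us). Node (take k us) # drop k us) ` (SIGMA k:{..n}. forests (r + k) n) \<subseteq> forests (Suc r) (Suc n)"
    using aux by (auto simp: forests_def)
  show "(\<lambda>f. (case hd f of Node ts \<Rightarrow> (length ts, ts @ tl f))) ` forests (Suc r) (Suc n) \<subseteq> (SIGMA k:{..n}. forests (r + k) n)"
  proof
    fix y assume "y \<in> (\<lambda>f. (case hd f of Node ts \<Rightarrow> (length ts, ts @ tl f))) ` forests (Suc r) (Suc n)"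
    then obtain f where f: "f \<in> forests (Suc r) (Suc n)" and y: "y = (case hd f of Node ts \<Rightarrow> (length ts, ts @ tl f))"
      by blast
    obtain ts us where "f = Node ts # us" using f
      by (cases f; cases "hd f") (auto simp: forests_def)
    thus "y \<in> (SIGMA k:{..n}. forests (r + k) n)"
      using f y length_le_nodes[of ts] by (auto simp: forests_def)
  qed
qed (auto simp: forests_def length_Suc_conv split: planted_tree.splits)

lemma sum_forests_Suc:
  "(\<Sum>f\<in>forests (Suc r) (Suc n). g f)
     = (\<Sum>k\<le>n. \<Sum>us\<in>forests (r + k) n. g (Node (take k us) # drop k us))"
  if fin: "\<And>k. k \<le> n \<Longrightarrow> finite (forests (r + k) n)"
proof -
  have "(\<Sum>f\<in>forests (Suc r) (Suc n). g f)
      = (\<Sum>(k, us)\<in>(SIGMA k:{..n}. forests (r + k) n). g (Node (take k us) # drop k us))"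
    by (subst sum.reindex_bij_betw[OF bij_betw_forests_Suc, symmetric]) (simp add: case_prod_beta)
  thus ?thesis using fin by (simp add: sum.Sigma)
qed

lemma finite_forests [simp]: "finite (forests r n)"
proof (induction n arbitrary: r)
  case 0 show ?case by (cases r) (auto simp: forests_0 forests_empty)
next
  case (Suc n)
  show ?case
  proof (cases r)
    case 0 thus ?thesis by (simp add: forests_0)
  next
    case (Suc r')
    have "finite (SIGMA k:{..n}. forests (r' + k) n)" using Suc.IH by auto
    thus ?thesis using bij_betw_finite[OF bij_betw_forests_Suc] Suc by auto
  qed
qed

lemma forest_weight_Node:
  assumes "us \<in> forests (r + k) n"
  shows "forest_weight a (Node (take k us) # drop k us) = a k * forest_weight a us"
proof -
  have "forest_weight a us = forest_weight a (take k us) * forest_weight a (drop k us)"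
    by (metis append_take_drop_id forest_weight_def map_append prod_list.append)
  moreover have "length (take k us) = k" using assms by (auto simp: forests_def)
  ultimately show ?thesis by (simp add: forest_weight_def ac_simps)
qed

subsection \<open>Lagrange inversion\<close>

text \<open>By symmetry the first of \<open>n + 1\<close> exchangeable steps carries the fraction \<open>1 / (n + 1)\<close> of
  their sum. For formal power series this is the product rule for the derivative of a power.\<close>

lemma fps_power_weighted_coeff:
  fixes a :: "nat \<Rightarrow> 'a::field_char_0"
  shows "of_nat (Suc n) * (\<Sum>k\<le>N. of_nat k * a k * fps_nth (Abs_fps a ^ n) (N - k))
    = of_nat N * fps_nth (Abs_fps a ^ Suc n) N"
proof -
  let ?A = "Abs_fps a"
  have "of_nat N * fps_nth (?A ^ Suc n) N = fps_nth (fps_X * fps_deriv (?A ^ Suc n)) N"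
    by (cases N) (auto simp del: power_Suc)
  also have "fps_deriv (?A ^ Suc n) = fps_const (of_nat (Suc n)) * (fps_deriv ?A * ?A ^ n)"
    by (subst fps_deriv_power) (simp add: mult.assoc)
  also have "fps_nth (fps_X * \<dots>) N = of_nat (Suc n) * fps_nth ((fps_X * fps_deriv ?A) * ?A ^ n) N"
    by (simp only: mult.assoc mult.left_commute[of fps_X] fps_mult_left_const_nth)
  also have "fps_nth ((fps_X * fps_deriv ?A) * ?A ^ n) N
      = (\<Sum>k\<le>N. fps_nth (fps_X * fps_deriv ?A) k * fps_nth (?A ^ n) (N - k))"
    by (simp add: fps_mult_nth atLeast0AtMost)
  also have "\<dots> = (\<Sum>k\<le>N. of_nat k * a k * fps_nth (?A ^ n) (N - k))"
    by (intro sum.cong refl, rename_tac k, case_tac k) auto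
  finally show ?thesis by simp
qed

text \<open>For an offspring law \<open>a\<close> this is the probability that the depth-first walk, which has increments
  \<open>k - 1\<close>, is at \<open>0\<close> after \<open>n\<close> steps when started at \<open>r\<close>, whether or not it has been at \<open>0\<close>
  before. The case distinction is there because subtraction on natural numbers truncates.\<close>

definition walk_coeff :: "(nat \<Rightarrow> 'a::field_char_0) \<Rightarrow> nat \<Rightarrow> nat \<Rightarrow> 'a" where
  "walk_coeff a n r = (if r \<le> n then fps_nth (Abs_fps a ^ n) (n - r) else 0)"

text \<open>Decomposition of the walk at its first step, weighted with the position after this step. The
  upper end of the summation is left open because the summation in the recursion over forests may
  extend further than the support of the coefficients.\<close>

lemma first_step_coeff:
  fixes a :: "nat \<Rightarrow> 'a::field_char_0"
  assumes m: "N \<le> r + m"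
  shows "of_nat (Suc n) * (\<Sum>k\<le>m. a k * (of_nat (r + k) * (if r + k \<le> N then fps_nth (Abs_fps a ^ n) (N - (r + k)) else 0)))
    = (if r \<le> N then (of_nat (Suc n) * of_nat r + of_nat (N - r)) * fps_nth (Abs_fps a ^ Suc n) (N - r) else 0)"
proof (cases "r \<le> N")
  case True
  define L where "L = N - r"
  have NL: "N = r + L" using True by (simp add: L_def)
  let ?c = "fps_nth (Abs_fps a ^ n)"
  have "(\<Sum>k\<le>m. a k * (of_nat (r + k) * (if r + k \<le> N then ?c (N - (r + k)) else 0)))
      = (\<Sum>k\<le>L. a k * (of_nat (r + k) * ?c (L - k)))"
    by (rule sum.mono_neutral_cong_right) (use m in \<open>auto simp: NL\<close>)
  also have "\<dots> = of_nat r * (\<Sum>k\<le>L. a k * ?c (L - k)) + (\<Sum>k\<le>L. of_nat k * a k * ?c (L - k))"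
    by (simp add: sum_distrib_left sum.distrib[symmetric] algebra_simps)
  also have "(\<Sum>k\<le>L. a k * ?c (L - k)) = fps_nth (Abs_fps a ^ Suc n) L"
    by (simp add: fps_mult_nth atLeast0AtMost)
  finally have "of_nat (Suc n) * (\<Sum>k\<le>m. a k * (of_nat (r + k) * (if r + k \<le> N then ?c (N - (r + k)) else 0)))
     = (of_nat (Suc n) * of_nat r + of_nat L) * fps_nth (Abs_fps a ^ Suc n) L"
    using fps_power_weighted_coeff[where n = n and N = L and a = a] by (simp add: distrib_left distrib_right mult.assoc del: of_nat_Suc)
  thus ?thesis using True by (simp add: L_def del: of_nat_Suc)
qed simp

lemma walk_coeff_first_step:
  fixes a :: "nat \<Rightarrow> 'a::field_char_0"
  shows "of_nat (Suc n) * (\<Sum>k\<le>n. a k * (of_nat (r + k) * walk_coeff a n (r + k)))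
    = of_nat n * of_nat (Suc r) * walk_coeff a (Suc n) (Suc r)"
proof (cases "r \<le> n")
  case True
  have "of_nat (Suc n) * of_nat r + of_nat (n - r) = (of_nat n * of_nat (Suc r) :: 'a)"
    using True by (simp add: of_nat_diff algebra_simps)
  thus ?thesis using first_step_coeff[of n r n n a] True by (simp add: walk_coeff_def del: of_nat_Suc of_nat_add)
qed (use first_step_coeff[of n r n n a] in \<open>simp add: walk_coeff_def del: of_nat_Suc of_nat_add\<close>)

definition forest_sum :: "(nat \<Rightarrow> 'a::comm_semiring_1) \<Rightarrow> nat \<Rightarrow> nat \<Rightarrow> 'a" where
  "forest_sum a r n = (\<Sum>f\<in>forests r n. forest_weight a f)"

lemma forest_sum_Suc: "forest_sum a (Suc r) (Suc n) = (\<Sum>k\<le>n. a k * forest_sum a (r + k) n)"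
  unfolding forest_sum_def
  by (subst sum_forests_Suc) (auto simp: sum_distrib_left forest_weight_Node intro!: sum.cong)

text \<open>Both sides satisfy the recursion along the depth-first exploration. The formula is used
  for probabilities and for probabilities multiplied by phases, hence for arbitrary fields of
  characteristic zero.\<close>

theorem forest_sum_lagrange:
  fixes a :: "nat \<Rightarrow> 'a::field_char_0"
  shows "of_nat n * forest_sum a r n = of_nat r * walk_coeff a n r"
proof (induction n arbitrary: r)
  case 0
  show ?case by (cases r) (auto simp: walk_coeff_def)
next
  case (Suc n)
  show ?case
  proof (cases r)
    case 0
    thus ?thesis by (simp add: forest_sum_def forests_0)
  next
    case (Suc r')
    show ?thesis
    proof (cases "n = 0")
      case True
      have "forest_sum a r' 0 = (if r' = 0 then 1 else 0)"
        by (simp add: forest_sum_def forests_0 forests_empty forest_weight_def)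
      thus ?thesis using Suc True by (simp add: forest_sum_Suc walk_coeff_def)
    next
      case False
      have "of_nat n * (of_nat (Suc n) * forest_sum a r (Suc n))
          = of_nat (Suc n) * (\<Sum>k\<le>n. a k * (of_nat n * forest_sum a (r' + k) n))"
        unfolding Suc forest_sum_Suc by (simp add: sum_distrib_left mult.left_commute del: of_nat_Suc of_nat_add)
      also have "\<dots> = of_nat (Suc n) * (\<Sum>k\<le>n. a k * (of_nat (r' + k) * walk_coeff a n (r' + k)))"
        unfolding Suc.IH ..
      also have "\<dots> = of_nat n * of_nat (Suc r') * walk_coeff a (Suc n) (Suc r')"
        by (rule walk_coeff_first_step)
      finally show ?thesis using False Suc by (simp add: mult.assoc del: of_nat_Suc)
    qed
  qed
qed

lemma sum_forests_hd:
  fixes a :: "nat \<Rightarrow> 'a::comm_semiring_1"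
  shows "(\<Sum>f\<in>forests (Suc r) n. if hd f = t then forest_weight a f else 0)
     = (if nodes t \<le> n then tree_weight a t * forest_sum a r (n - nodes t) else 0)"
proof -
  have "(\<Sum>f\<in>forests (Suc r) n. if hd f = t then forest_weight a f else 0)
      = (\<Sum>f\<in>{f\<in>forests (Suc r) n. hd f = t}. forest_weight a f)"
    by (simp add: sum.inter_filter)
  also have "{f\<in>forests (Suc r) n. hd f = t} = (if nodes t \<le> n then (#) t ` forests r (n - nodes t) else {})"
    by (auto simp: forests_def length_Suc_conv image_iff)
  finally show ?thesis
    by (auto simp: sum.reindex forest_weight_def forest_sum_def sum_distrib_left)
qed

text \<open>Occurrences of a fixed tree as a fringe subtree, by the same recursion: either the first
  tree is the given one, or the occurrence survives the deletion of the root.\<close>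

theorem forest_sum_fringe_count:
  fixes a :: "nat \<Rightarrow> 'a::field_char_0"
  shows "(\<Sum>f\<in>forests (Suc r) n. forest_weight a f * of_nat (forest_fringe_count t f))
     = (if nodes t \<le> n then tree_weight a t * of_nat (Suc r) * walk_coeff a (n - nodes t) r else 0)"
proof (induction n arbitrary: r)
  case 0
  thus ?case using nodes_pos[of t] by (simp add: forests_empty)
next
  case (Suc n)
  define H where "H r n = (\<Sum>f\<in>forests r n. forest_weight a f * of_nat (forest_fringe_count t f))" for r n
  define s where "s = nodes t"
  have s0: "s > 0" using nodes_pos by (simp add: s_def)
  have Hn: "H k n = (if s \<le> n then tree_weight a t * (of_nat k * walk_coeff a (n - s) (k - 1)) else 0)" for k
  proof (cases k)
    case 0 thus ?thesis by (simp add: H_def forests_0 forest_fringe_count_def)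
  next
    case (Suc k') thus ?thesis using Suc.IH[of k'] by (simp add: H_def s_def mult.assoc)
  qed
  have "H (Suc r) (Suc n) = (\<Sum>k\<le>n. \<Sum>us\<in>forests (r + k) n. a k * (forest_weight a us * of_nat (forest_fringe_count t us))
      + (if Node (take k us) = t then forest_weight a (Node (take k us) # drop k us) else 0))"
    unfolding H_def
  proof (subst sum_forests_Suc, simp, intro sum.cong refl)
    fix k us assume us: "us \<in> forests (r + k) n"
    have "forest_fringe_count t us = forest_fringe_count t (take k us) + forest_fringe_count t (drop k us)"
      unfolding forest_fringe_count_def by (metis append_take_drop_id map_append sum_list_append)
    hence "forest_fringe_count t (Node (take k us) # drop k us)
        = forest_fringe_count t us + (if Node (take k us) = t then 1 else 0)"
      by (simp add: forest_fringe_count_def)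
    thus "forest_weight a (Node (take k us) # drop k us) * of_nat (forest_fringe_count t (Node (take k us) # drop k us))
      = a k * (forest_weight a us * of_nat (forest_fringe_count t us))
      + (if Node (take k us) = t then forest_weight a (Node (take k us) # drop k us) else 0)"
      using us by (auto simp: forest_weight_Node algebra_simps)
  qed
  also have "\<dots> = (\<Sum>k\<le>n. a k * H (r + k) n)
      + (\<Sum>f\<in>forests (Suc r) (Suc n). if hd f = t then forest_weight a f else 0)"
    by (subst sum_forests_Suc) (simp_all add: sum.distrib sum_distrib_left H_def)
  also have "(\<Sum>f\<in>forests (Suc r) (Suc n). if hd f = t then forest_weight a f else 0)
     = (if s \<le> Suc n then tree_weight a t * forest_sum a r (Suc n - s) else 0)"
    by (simp add: sum_forests_hd s_def)
  finally have eq: "H (Suc r) (Suc n) = (\<Sum>k\<le>n. a k * H (r + k) n)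
      + (if s \<le> Suc n then tree_weight a t * forest_sum a r (Suc n - s) else 0)" .
  have "H (Suc r) (Suc n) = (if s \<le> Suc n then tree_weight a t * of_nat (Suc r) * walk_coeff a (Suc n - s) r else 0)"
  proof (cases "s \<le> n")
    case False
    hence "H (Suc r) (Suc n) = (if s = Suc n then tree_weight a t * forest_sum a r 0 else 0)"
      unfolding eq by (auto simp: Hn)
    thus ?thesis using False
      by (auto simp: forest_sum_def forests_0 forests_empty forest_weight_def walk_coeff_def)
  next
    case True
    define M where "M = n - s"
    have M: "Suc n - s = Suc M" "n - s = M" "M \<le> n" using True by (auto simp: M_def)
    have Hk: "a k * H (r + k) n = tree_weight a t * (a k * (of_nat (r + k) * (if r + k \<le> Suc M then fps_nth (Abs_fps a ^ M) (Suc M - (r + k)) else 0)))" for k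
      unfolding Hn M using True by (cases "r + k") (auto simp: walk_coeff_def simp del: of_nat_add)
    have sum_eq: "of_nat (Suc M) * (\<Sum>k\<le>n. a k * (of_nat (r + k) * (if r + k \<le> Suc M then fps_nth (Abs_fps a ^ M) (Suc M - (r + k)) else 0)))
        + of_nat r * walk_coeff a (Suc M) r
       = of_nat (Suc M) * of_nat (Suc r) * walk_coeff a (Suc M) r"
    proof (cases "r \<le> Suc M")
      case r: True
      have "Suc M \<le> n" using s0 True M_def \<open>s \<le> n\<close> by linarith
      hence "Suc M \<le> r + n" by simp
      moreover have "of_nat (Suc M) * of_nat r + of_nat (Suc M - r) + of_nat r = (of_nat (Suc M) * of_nat (Suc r) :: 'a)"
        using r by (simp add: of_nat_diff algebra_simps)
      ultimately show ?thesis using first_step_coeff[of "Suc M" r n M a] r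
        by (simp add: walk_coeff_def distrib_right[symmetric] del: of_nat_Suc of_nat_add)
    next
      case False
      thus ?thesis by (simp add: walk_coeff_def)
    qed
    have "of_nat (Suc M) * H (Suc r) (Suc n) = tree_weight a t *
       (of_nat (Suc M) * (\<Sum>k\<le>n. a k * (of_nat (r + k) * (if r + k \<le> Suc M then fps_nth (Abs_fps a ^ M) (Suc M - (r + k)) else 0)))
        + of_nat (Suc M) * forest_sum a r (Suc M))"
      unfolding eq Hk using True M by (simp add: sum_distrib_left distrib_left mult.left_commute del: of_nat_Suc of_nat_add)
    also have "\<dots> = tree_weight a t * (of_nat (Suc M) * of_nat (Suc r) * walk_coeff a (Suc M) r)"
      unfolding forest_sum_lagrange sum_eq ..
    finally have "of_nat (Suc M) * H (Suc r) (Suc n) = of_nat (Suc M) * (tree_weight a t * of_nat (Suc r) * walk_coeff a (Suc M) r)"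
      by (simp add: ac_simps)
    hence "H (Suc r) (Suc n) = tree_weight a t * of_nat (Suc r) * walk_coeff a (Suc M) r"
      unfolding mult_cancel_left by (simp del: of_nat_Suc)
    thus ?thesis using True M by simp
  qed
  thus ?case by (simp add: H_def s_def)
qed

section \<open>Plane trees and their planted codes\<close>

definition cyclic_list :: "('a \<Rightarrow> 'a) \<Rightarrow> 'a list \<Rightarrow> bool" where
  "cyclic_list f xs \<longleftrightarrow> distinct xs \<and> (\<forall>i<length xs. f (xs ! i) = xs ! (Suc i mod length xs))"

text \<open>Enumerations of the neighbours in cyclic order turn statements about rotations into equations
  between lists. The starting point is free, and fixing it determines the list.\<close>

definition orders :: "'a plane_tree \<Rightarrow> 'a \<Rightarrow> 'a list \<Rightarrow> bool" where
  "orders P v xs \<longleftrightarrow> cyclic_list (snd P v) xs \<and> set xs = neighbours (fst P) v"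

definition plane_iso_by :: "('a \<Rightarrow> 'b) \<Rightarrow> 'a plane_tree \<Rightarrow> 'b plane_tree \<Rightarrow> bool" where
  "plane_iso_by f P P' \<longleftrightarrow> graph_iso_by f (fst P) (fst P') \<and>
     (\<forall>v\<in>verts (fst P). \<forall>u\<in>neighbours (fst P) v. f (snd P v u) = snd P' (f v) (f u))"

lemma plane_iso_iff: "plane_iso P P' \<longleftrightarrow> (\<exists>f. plane_iso_by f P P')"
  by (auto simp: plane_iso_def plane_iso_by_def split: prod.splits)

lemma cyclic_list_funpow:
  assumes "cyclic_list f xs" "i < length xs"
  shows "(f ^^ n) (xs ! i) = xs ! ((i + n) mod length xs)"
proof (induction n)
  case (Suc n)
  have "(i + n) mod length xs < length xs" using assms(2) by (intro mod_less_divisor) auto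
  thus ?case using Suc assms by (simp add: cyclic_list_def mod_Suc_eq)
qed (use assms in auto)

lemma cyclic_list_eqI:
  assumes "cyclic_list f xs" "cyclic_list f ys" "set xs = set ys" "xs \<noteq> [] \<Longrightarrow> hd xs = hd ys"
  shows "xs = ys"
proof (cases "xs = []")
  case False
  hence ne: "xs \<noteq> []" "ys \<noteq> []" using assms(3) by auto
  have len: "length xs = length ys"
    using assms distinct_card[of xs] distinct_card[of ys] by (simp add: cyclic_list_def)
  have "xs ! i = ys ! i" if "i < length xs" for i
    using cyclic_list_funpow[OF assms(1), of 0 i] cyclic_list_funpow[OF assms(2), of 0 i] ne len that assms(4)
    by (simp add: hd_conv_nth)
  thus ?thesis using len by (intro nth_equalityI) auto
qed (use assms(3) in auto)

lemma cyclic_list_permutes: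
  assumes "cyclic_list f xs" "\<And>u. u \<notin> set xs \<Longrightarrow> f u = u"
  shows "f permutes set xs"
proof (rule bij_imp_permutes)
  have "y \<in> f ` set xs" if y: "y \<in> set xs" for y
  proof -
    obtain j where j: "j < length xs" "y = xs ! j" using y by (auto simp: in_set_conv_nth)
    define i where "i = (if j = 0 then length xs - 1 else j - 1)"
    have "i < length xs" "Suc i mod length xs = j" using j by (auto simp: i_def)
    hence "f (xs ! i) = y" using assms(1) j by (auto simp: cyclic_list_def)
    thus ?thesis using \<open>i < length xs\<close> by force
  qed
  moreover have "f ` set xs \<subseteq> set xs"
  proof
    fix y assume "y \<in> f ` set xs"
    then obtain i where "i < length xs" "y = f (xs ! i)" by (auto simp: in_set_conv_nth)
    moreover have "Suc i mod length xs < length xs"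
      using \<open>i < length xs\<close> by (intro mod_less_divisor) auto
    ultimately show "y \<in> set xs" using assms(1) by (auto simp: cyclic_list_def)
  qed
  ultimately have im: "f ` set xs = set xs" by blast
  hence "inj_on f (set xs)" by (intro eq_card_imp_inj_on) auto
  thus "bij_betw f (set xs) (set xs)" using im by (simp add: bij_betw_def)
qed (use assms(2) in auto)

lemma cyclic_list_cyclic_on:
  assumes "cyclic_list f xs" "xs \<noteq> []"
  shows "cyclic_on f (set xs)"
proof (rule cyclic_on_singleI)
  show "xs ! 0 \<in> set xs" using assms(2) by simp
  show "set xs = orbit f (xs ! 0)"
  proof (intro equalityI subsetI)
    fix y assume "y \<in> set xs"
    then obtain j where j: "j < length xs" "y = xs ! j" by (auto simp: in_set_conv_nth)
    have "(f ^^ (j + length xs)) (xs ! 0) = y"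
      using cyclic_list_funpow[OF assms(1), of 0 "j + length xs"] assms(2) j by simp
    thus "y \<in> orbit f (xs ! 0)" using assms(2) unfolding orbit_altdef by force
  next
    fix y assume "y \<in> orbit f (xs ! 0)"
    then obtain n where "y = (f ^^ n) (xs ! 0)" by (auto simp: orbit_altdef)
    thus "y \<in> set xs" using cyclic_list_funpow[OF assms(1), of 0 n] assms(2) by simp
  qed
qed

lemma cyclic_list_rotate:
  assumes "cyclic_list f xs"
  shows "cyclic_list f (rotate m xs)"
  unfolding cyclic_list_def
proof (intro conjI allI impI)
  show "distinct (rotate m xs)" using assms by (simp add: cyclic_list_def)
  fix i assume i: "i < length (rotate m xs)"
  hence "0 < length xs" by (cases xs) auto
  hence l: "\<And>k. k mod length xs < length xs" by simp
  have "f (rotate m xs ! i) = f (xs ! ((m + i) mod length xs))" using i by (simp add: nth_rotate)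
  also have "\<dots> = xs ! (Suc ((m + i) mod length xs) mod length xs)"
    using assms l unfolding cyclic_list_def by blast
  also have "\<dots> = rotate m xs ! (Suc i mod length (rotate m xs))"
    using l by (simp add: nth_rotate mod_simps)
  finally show "f (rotate m xs ! i) = rotate m xs ! (Suc i mod length (rotate m xs))" .
qed

lemma plane_iso_byI:
  assumes bij: "bij_betw f (verts (fst P)) (verts (fst P'))"
    and simple: "simple_graph (fst P)"
    and ord: "\<And>v. v \<in> verts (fst P) \<Longrightarrow> \<exists>xs. orders P v xs \<and> orders P' (f v) (map f xs)"
  shows "plane_iso_by f P P'"
  unfolding plane_iso_by_def graph_iso_by_def
proof (intro conjI ballI)
  show "bij_betw f (verts (fst P)) (verts (fst P'))" by fact
next
  fix u v assume uv: "u \<in> verts (fst P)" "v \<in> verts (fst P)"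
  obtain xs where xs: "orders P u xs" "orders P' (f u) (map f xs)" using ord uv by blast
  have sub: "set xs \<subseteq> verts (fst P)"
    using xs(1) simple by (auto simp: orders_def simple_graph_def neighbours_def)
  have "(u, v) \<in> edges (fst P) \<longleftrightarrow> v \<in> set xs" using xs(1) by (auto simp: orders_def neighbours_def)
  also have "\<dots> \<longleftrightarrow> f v \<in> f ` set xs"
    using sub uv bij by (metis bij_betw_imp_inj_on inj_on_image_mem_iff)
  also have "\<dots> \<longleftrightarrow> (f u, f v) \<in> edges (fst P')" using xs(2) by (auto simp: orders_def neighbours_def)
  finally show "(u, v) \<in> edges (fst P) \<longleftrightarrow> (f u, f v) \<in> edges (fst P')" .
next
  fix v u assume v: "v \<in> verts (fst P)" and u: "u \<in> neighbours (fst P) v"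
  obtain xs where xs: "orders P v xs" "orders P' (f v) (map f xs)" using ord v by blast
  obtain i where i: "i < length xs" "u = xs ! i"
    using u xs(1) unfolding orders_def by (metis in_set_conv_nth)
  have l: "Suc i mod length xs < length xs" using i by (intro mod_less_divisor) auto
  show "f (snd P v u) = snd P' (f v) (f u)"
    using xs i l by (auto simp: orders_def cyclic_list_def)
qed

lemma plane_iso_by_orders:
  assumes iso: "plane_iso_by f P P'" and simple: "simple_graph (fst P)" "simple_graph (fst P')"
    and v: "v \<in> verts (fst P)" and ord: "orders P v xs"
  shows "orders P' (f v) (map f xs)"
proof -
  have sub: "set xs \<subseteq> verts (fst P)"
    using ord simple by (auto simp: orders_def simple_graph_def neighbours_def)
  have bij: "bij_betw f (verts (fst P)) (verts (fst P'))"
    using iso by (simp add: plane_iso_by_def graph_iso_by_def)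
  have "distinct (map f xs)"
    using ord bij sub by (auto simp: distinct_map orders_def cyclic_list_def bij_betw_def intro: inj_on_subset)
  moreover have "snd P' (f v) (map f xs ! i) = map f xs ! (Suc i mod length (map f xs))"
    if i: "i < length (map f xs)" for i
  proof -
    have l: "Suc i mod length xs < length xs" using i by (intro mod_less_divisor) auto
    have "xs ! i \<in> neighbours (fst P) v"
      using ord i unfolding orders_def by (metis length_map nth_mem)
    hence "snd P' (f v) (f (xs ! i)) = f (snd P v (xs ! i))"
      using iso v unfolding plane_iso_by_def by auto
    thus ?thesis using i l ord by (auto simp: orders_def cyclic_list_def)
  qed
  moreover have "f ` set xs = neighbours (fst P') (f v)"
  proof (intro equalityI subsetI)
    fix y assume "y \<in> f ` set xs"
    then obtain x where x: "x \<in> set xs" "y = f x" by blast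
    hence "(v, x) \<in> edges (fst P)" using ord by (auto simp: orders_def neighbours_def)
    thus "y \<in> neighbours (fst P') (f v)"
      using iso v x sub by (auto simp: plane_iso_by_def graph_iso_by_def neighbours_def)
  next
    fix y assume y: "y \<in> neighbours (fst P') (f v)"
    hence "y \<in> verts (fst P')" using simple by (auto simp: simple_graph_def neighbours_def)
    then obtain x where x: "x \<in> verts (fst P)" "y = f x" using bij by (auto simp: bij_betw_def)
    hence "(v, x) \<in> edges (fst P)"
      using iso v y by (auto simp: plane_iso_by_def graph_iso_by_def neighbours_def)
    thus "y \<in> f ` set xs" using x ord by (auto simp: orders_def neighbours_def)
  qed
  ultimately show ?thesis by (simp add: orders_def cyclic_list_def)
qed

lemma plane_iso_by_comp:
  assumes "plane_iso_by f P P'" "plane_iso_by g P' P''" "simple_graph (fst P)"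
  shows "plane_iso_by (g \<circ> f) P P''"
proof -
  have mem: "f x \<in> verts (fst P')" if "x \<in> verts (fst P)" for x
    using assms(1) that by (auto simp: plane_iso_by_def graph_iso_by_def bij_betw_def)
  have nb: "u \<in> verts (fst P) \<and> f u \<in> neighbours (fst P') (f v)" if "v \<in> verts (fst P)" "u \<in> neighbours (fst P) v" for u v
    using assms(1,3) that by (auto simp: plane_iso_by_def graph_iso_by_def neighbours_def simple_graph_def)
  show ?thesis unfolding plane_iso_by_def graph_iso_by_def
  proof (intro conjI ballI)
    show "bij_betw (g \<circ> f) (verts (fst P)) (verts (fst P''))"
      using assms by (auto simp: plane_iso_by_def graph_iso_by_def intro: bij_betw_trans)
  next
    fix u v assume "u \<in> verts (fst P)" "v \<in> verts (fst P)"
    thus "(u, v) \<in> edges (fst P) \<longleftrightarrow> ((g \<circ> f) u, (g \<circ> f) v) \<in> edges (fst P'')"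
      using assms(1,2) mem by (auto simp: plane_iso_by_def graph_iso_by_def)
  next
    fix v u assume vu: "v \<in> verts (fst P)" "u \<in> neighbours (fst P) v"
    have "f (snd P v u) = snd P' (f v) (f u)" using assms(1) vu by (auto simp: plane_iso_by_def)
    moreover have "g (snd P' (f v) (f u)) = snd P'' (g (f v)) (g (f u))"
      using assms(2) nb[OF vu] mem[OF vu(1)] by (auto simp: plane_iso_by_def)
    ultimately show "(g \<circ> f) (snd P v u) = snd P'' ((g \<circ> f) v) ((g \<circ> f) u)" by simp
  qed
qed

lemma plane_iso_by_inv:
  assumes iso: "plane_iso_by f P P'" and simple: "simple_graph (fst P)" "simple_graph (fst P')"
    and rot: "\<And>v u. v \<in> verts (fst P) \<Longrightarrow> u \<in> neighbours (fst P) v \<Longrightarrow> snd P v u \<in> neighbours (fst P) v"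
  shows "plane_iso_by (inv_into (verts (fst P)) f) P' P"
proof -
  let ?g = "inv_into (verts (fst P)) f"
  have bij: "bij_betw f (verts (fst P)) (verts (fst P'))"
    using iso by (simp add: plane_iso_by_def graph_iso_by_def)
  have gf: "?g (f x) = x" if "x \<in> verts (fst P)" for x using bij that by (simp add: bij_betw_inv_into_left)
  have fg: "f (?g y) = y" "?g y \<in> verts (fst P)" if "y \<in> verts (fst P')" for y
    using bij that by (auto simp: bij_betw_inv_into_right bij_betw_def inv_into_into)
  have ed: "(?g y, ?g z) \<in> edges (fst P) \<longleftrightarrow> (y, z) \<in> edges (fst P')"
    if "y \<in> verts (fst P')" "z \<in> verts (fst P')" for y z
    using iso that fg by (simp add: plane_iso_by_def graph_iso_by_def)
  show ?thesis unfolding plane_iso_by_def graph_iso_by_def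
  proof (intro conjI ballI)
    show "bij_betw ?g (verts (fst P')) (verts (fst P))" using bij by (rule bij_betw_inv_into)
  next
    fix y z assume "y \<in> verts (fst P')" "z \<in> verts (fst P')"
    thus "(y, z) \<in> edges (fst P') \<longleftrightarrow> (?g y, ?g z) \<in> edges (fst P)" using ed by simp
  next
    fix v u assume v: "v \<in> verts (fst P')" and u: "u \<in> neighbours (fst P') v"
    have uV: "u \<in> verts (fst P')" using u simple by (auto simp: neighbours_def simple_graph_def)
    have gu: "?g u \<in> neighbours (fst P) (?g v)" using ed[OF v uV] u by (simp add: neighbours_def)
    hence "snd P (?g v) (?g u) \<in> neighbours (fst P) (?g v)" using rot fg v by blast
    hence "snd P (?g v) (?g u) \<in> verts (fst P)" using simple by (auto simp: neighbours_def simple_graph_def)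
    moreover have "f (snd P (?g v) (?g u)) = snd P' v u"
      using iso gu fg v uV unfolding plane_iso_by_def by metis
    ultimately show "?g (snd P' v u) = snd P (?g v) (?g u)" using gf by metis
  qed
qed

subsection \<open>The plane tree of a planted tree\<close>

text \<open>The parent comes first. The root has no parent; its list begins with its first child, which
  makes the corner before this child the distinguished one.\<close>

definition nbr_list :: "planted_tree \<Rightarrow> nat list \<Rightarrow> nat list list" where
  "nbr_list t v = (if v \<in> positions t
     then (if v = [] then [] else [butlast v]) @ map (\<lambda>i. v @ [i]) [0..<outdegree t v] else [])"

text \<open>Elements outside the list are fixed, as \<open>is_plane_tree\<close> requires of a rotation.\<close>

definition successor_in :: "'a list \<Rightarrow> 'a \<Rightarrow> 'a" where
  "successor_in xs u = (if u \<in> set xs then xs ! (Suc (THE i. i < length xs \<and> xs ! i = u) mod length xs) else u)"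

definition plane_model :: "planted_tree \<Rightarrow> nat list plane_tree" where
  "plane_model t = (planted_graph t, \<lambda>v. successor_in (nbr_list t v))"

lemma cyclic_list_successor_in: "distinct xs \<Longrightarrow> cyclic_list (successor_in xs) xs"
  unfolding cyclic_list_def
proof (intro conjI allI impI)
  fix i assume "distinct xs" "i < length xs"
  moreover from this have "(THE j. j < length xs \<and> xs ! j = xs ! i) = i"
    by (intro the_equality) (auto simp: nth_eq_iff_index_eq)
  ultimately show "successor_in xs (xs ! i) = xs ! (Suc i mod length xs)"
    by (auto simp: successor_in_def)
qed auto

lemma positions_appendD: "v @ x \<in> positions t \<Longrightarrow> v \<in> positions t"
proof (induction v arbitrary: t)
  case (Cons i v) thus ?case by (cases t) auto
qed simp

lemma positions_children: "{i. v @ [i] \<in> positions t} = {..<outdegree t v}" if "v \<in> positions t"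
  using that
proof (induction v arbitrary: t)
  case Nil
  show ?case by (cases t) auto
next
  case (Cons i v)
  thus ?case by (cases t) auto
qed

lemma snoc_in_positions: "v @ [i] \<in> positions t \<longleftrightarrow> v \<in> positions t \<and> i < outdegree t v"
  using positions_children[of v t] positions_appendD[of v "[i]" t] by auto

lemma positions_inj: "positions t = positions t' \<Longrightarrow> t = t'"
proof (induction t arbitrary: t')
  case (Node ts)
  obtain ts' where t': "t' = Node ts'" by (cases t')
  have len: "length ts = length ts'"
    using Node.prems outdegree_Nil[of ts] outdegree_Nil[of ts'] unfolding t' outdegree_def by metis
  have "ts ! i = ts' ! i" if "i < length ts" for i
  proof (rule Node.IH)
    show "ts ! i \<in> set ts" using that by simp
    have "v \<in> positions (ts ! i) \<longleftrightarrow> i # v \<in> positions (Node ts)" for v using that by simp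
    moreover have "v \<in> positions (ts' ! i) \<longleftrightarrow> i # v \<in> positions (Node ts')" for v using that len by simp
    ultimately show "positions (ts ! i) = positions (ts' ! i)" using Node.prems t' by blast
  qed
  thus ?case using len t' by (simp add: nth_equalityI)
qed

lemma verts_planted_graph [simp]: "verts (planted_graph t) = positions t"
  by (simp add: planted_graph_def)

lemma edges_planted_graph:
  "(x, y) \<in> edges (planted_graph t) \<longleftrightarrow> y \<in> set (nbr_list t x)"
proof
  assume "(x, y) \<in> edges (planted_graph t)"
  hence x: "x \<in> positions t" "y \<in> positions t" and "(\<exists>i. y = x @ [i]) \<or> (\<exists>i. x = y @ [i])"
    by (auto simp: planted_graph_def)
  from this(3) show "y \<in> set (nbr_list t x)"
  proof (elim disjE exE)
    fix i assume y: "y = x @ [i]"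
    hence "i < outdegree t x" using x(2) snoc_in_positions by metis
    hence "x @ [i] \<in> (\<lambda>i. x @ [i]) ` {0..<outdegree t x}" by (intro imageI) simp
    thus ?thesis unfolding y nbr_list_def if_P[OF x(1)] set_append set_map set_upt by (rule UnI2)
  next
    fix i assume i: "x = y @ [i]"
    have "y = butlast x" "x \<noteq> []" unfolding i by simp_all
    hence "y \<in> set (if x = [] then [] else [butlast x])" by simp
    thus ?thesis unfolding nbr_list_def if_P[OF x(1)] set_append by (rule UnI1)
  qed
next
  assume y: "y \<in> set (nbr_list t x)"
  hence x: "x \<in> positions t" by (cases "x \<in> positions t") (simp_all add: nbr_list_def)
  from y consider "x \<noteq> []" "y = butlast x" | i where "i < outdegree t x" "y = x @ [i]"
    using x by (cases "x = []") (auto simp: nbr_list_def)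
  thus "(x, y) \<in> edges (planted_graph t)"
  proof cases
    case 1
    hence "x = y @ [last x]" by simp
    thus ?thesis using x positions_appendD[of y "[last x]" t] unfolding planted_graph_def by auto
  next
    case 2
    thus ?thesis using x unfolding planted_graph_def by (auto simp: snoc_in_positions)
  qed
qed

lemma neighbours_planted_graph [simp]: "neighbours (planted_graph t) v = set (nbr_list t v)"
  by (auto simp: neighbours_def edges_planted_graph)

lemma simple_planted_graph [simp]: "simple_graph (planted_graph t)"
  by (auto simp: simple_graph_def planted_graph_def sym_def irrefl_def)

lemma distinct_nbr_list: "distinct (nbr_list t v)"
proof -
  have "butlast v \<noteq> v @ [i]" for i by (metis length_append_singleton length_butlast diff_le_self not_less_eq_eq le_refl)
  hence "butlast v \<notin> (\<lambda>i. v @ [i]) ` A" for A by blast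
  thus ?thesis by (auto simp: nbr_list_def distinct_map inj_on_def)
qed

lemma orders_plane_model: "orders (plane_model t) v (nbr_list t v)"
  by (simp add: orders_def plane_model_def cyclic_list_successor_in distinct_nbr_list)

lemma fst_plane_model [simp]: "fst (plane_model t) = planted_graph t"
  by (simp add: plane_model_def)

lemma degree_planted_graph:
  assumes "v \<in> positions t"
  shows "degree (planted_graph t) v = outdegree t v + (if v = [] then 0 else 1)"
proof -
  have "degree (planted_graph t) v = card (set (nbr_list t v))" by (simp add: degree_def)
  also have "\<dots> = length (nbr_list t v)" using distinct_nbr_list distinct_card by blast
  finally show ?thesis using assms by (simp add: nbr_list_def)
qed

lemma nbr_list_ne: "v \<in> positions t \<Longrightarrow> nodes t \<ge> 2 \<Longrightarrow> nbr_list t v \<noteq> []"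
  by (cases t) (auto simp: nbr_list_def)

lemma planted_graph_connected_root: "x \<in> positions t \<Longrightarrow> ([], x) \<in> (edges (planted_graph t))\<^sup>*"
proof (induction x rule: rev_induct)
  case (snoc i x)
  have "(x, x @ [i]) \<in> edges (planted_graph t)"
    using snoc.prems by (auto simp: planted_graph_def dest: positions_appendD)
  thus ?case using snoc positions_appendD[of x "[i]" t] by (meson rtrancl.rtrancl_into_rtrancl)
qed simp

lemma edge_planted_graph_shorter:
  assumes "(x, y) \<in> edges (planted_graph t)" "length y \<le> length x"
  shows "y = butlast x"
  using assms by (auto simp: planted_graph_def)

text \<open>A vertex of maximal height on a cycle would have its parent as both of its neighbours.\<close>

lemma tree_planted_graph: "tree_graph (planted_graph t)"
  unfolding tree_graph_def
proof (intro conjI notI)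
  have s: "sym (edges (planted_graph t))" using simple_planted_graph by (auto simp: simple_graph_def)
  have "(x, y) \<in> (edges (planted_graph t))\<^sup>*" if "x \<in> positions t" "y \<in> positions t" for x y
    using planted_graph_connected_root[OF that(1)] planted_graph_connected_root[OF that(2)]
      sym_rtrancl[OF s] by (meson rtrancl_trans symD)
  moreover have "positions t \<noteq> {}" by (metis Nil_in_positions empty_iff)
  ultimately show "connected_graph (planted_graph t)" unfolding connected_graph_def by auto
  assume "\<exists>p. cycle_in (planted_graph t) p"
  then obtain p where p: "cycle_in (planted_graph t) p" by blast
  let ?n = "length p"
  have n3: "?n \<ge> 3" and d: "distinct p" and e: "\<And>i. i < ?n \<Longrightarrow> (p ! i, p ! (Suc i mod ?n)) \<in> edges (planted_graph t)"
    using p by (auto simp: cycle_in_def)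
  define m where "m = Max ((\<lambda>i. length (p ! i)) ` {..<?n})"
  have "m \<in> (\<lambda>i. length (p ! i)) ` {..<?n}" unfolding m_def using n3 by (intro Max_in) (auto simp: lessThan_empty_iff)
  then obtain i where i: "i < ?n" "length (p ! i) = m" by auto
  have le: "length (p ! j) \<le> length (p ! i)" if "j < ?n" for j
    unfolding i(2) m_def using that by (intro Max_ge) auto
  define j where "j = (if i = 0 then ?n - 1 else i - 1)"
  have j: "j < ?n" "Suc j mod ?n = i" using i n3 by (auto simp: j_def)
  have k: "Suc i mod ?n < ?n" using n3 by (intro mod_less_divisor) auto
  have "(p ! i, p ! j) \<in> edges (planted_graph t)" using e[OF j(1)] j(2) s by (auto dest: symD)
  hence "p ! j = butlast (p ! i)" using le[OF j(1)] by (rule edge_planted_graph_shorter)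
  moreover have "p ! (Suc i mod ?n) = butlast (p ! i)"
    using e[OF i(1)] le[OF k] by (rule edge_planted_graph_shorter)
  ultimately have "j = Suc i mod ?n" using d j k by (metis nth_eq_iff_index_eq)
  thus False using n3 i by (cases "Suc i = ?n") (auto simp: j_def split: if_splits)
qed simp

lemma plane_tree_plane_model: "is_plane_tree (plane_model t)" if "nodes t \<ge> 2"
proof -
  have cl: "cyclic_list (successor_in (nbr_list t v)) (nbr_list t v)" for v
    by (rule cyclic_list_successor_in) (rule distinct_nbr_list)
  show ?thesis unfolding is_plane_tree_def plane_model_def
    using tree_planted_graph cl nbr_list_ne that
    by (auto intro!: cyclic_list_permutes[OF cl] cyclic_list_cyclic_on[OF cl] simp: successor_in_def)
qed

text \<open>Walking around the tree from the root corner determines all words, so an isomorphism that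
  respects the root corner is the identity.\<close>

lemma plane_model_rigid:
  assumes iso: "plane_iso_by f (plane_model t) (plane_model t')"
    and f: "f [] = []" "f [0] = [0]" and n: "nodes t \<ge> 2"
  shows "t = t'" and "x \<in> positions t \<Longrightarrow> f x = x"
proof -
  have bij: "bij_betw f (positions t) (positions t')"
    using iso by (simp add: plane_iso_by_def graph_iso_by_def)
  have ord: "orders (plane_model t') (f x) (map f (nbr_list t x))" if "x \<in> positions t" for x
    by (rule plane_iso_by_orders[OF iso]) (auto simp: that orders_plane_model)
  have map_nbr: "map f (nbr_list t x) = nbr_list t' x"
    if x: "x \<in> positions t" "f x = x" "x \<noteq> [] \<Longrightarrow> f (butlast x) = butlast x" for x
  proof -
    have x': "x \<in> positions t'" using x bij by (metis bij_betwE)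
    have o: "orders (plane_model t') x (map f (nbr_list t x))" using ord[OF x(1)] x(2) by simp
    show ?thesis
    proof (rule cyclic_list_eqI)
      show "cyclic_list (snd (plane_model t') x) (map f (nbr_list t x))" using o by (simp add: orders_def)
      show "cyclic_list (snd (plane_model t') x) (nbr_list t' x)"
        using orders_plane_model[of t' x] by (simp add: orders_def)
      show eq: "set (map f (nbr_list t x)) = set (nbr_list t' x)" using o by (simp add: orders_def)
      assume "map f (nbr_list t x) \<noteq> []"
      hence ne: "nbr_list t x \<noteq> []" "nbr_list t' x \<noteq> []" using eq by auto
      have "outdegree t [] > 0" using n by (cases t) auto
      thus "hd (map f (nbr_list t x)) = hd (nbr_list t' x)"
        using ne x x' f by (cases "x = []") (auto simp: nbr_list_def hd_map upt_conv_Cons)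
    qed
  qed
  have fx: "f x = x" if "x \<in> positions t" for x
    using that
  proof (induction "length x" arbitrary: x rule: less_induct)
    case less
    show ?case
    proof (cases x rule: rev_cases)
      case Nil thus ?thesis using f by simp
    next
      case (snoc y i)
      have y: "y \<in> positions t" "i < outdegree t y" using less.prems snoc by (auto simp: snoc_in_positions)
      have fy: "f y = y" using less.hyps[of y] y snoc by simp
      have fb: "f (butlast y) = butlast y" if "y \<noteq> []"
        using less.hyps[of "butlast y"] y snoc that positions_appendD[of "butlast y" "[last y]" t] by simp
      have m: "map f (nbr_list t y) = nbr_list t' y" using map_nbr[OF y(1) fy fb] .
      have y': "y \<in> positions t'" using y fy bij by (metis bij_betwE)
      let ?k = "if y = [] then i else Suc i"
      have k: "?k < length (nbr_list t y)" using y by (cases "y = []") (simp_all add: nbr_list_def)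
      have "f (nbr_list t y ! ?k) = nbr_list t' y ! ?k" using m k by (metis nth_map)
      moreover have "nbr_list t y ! ?k = y @ [i]" using y by (cases "y = []") (simp_all add: nbr_list_def)
      moreover have "nbr_list t' y ! ?k = y @ [i]"
        using y' k arg_cong[OF m, of length] by (auto simp: nbr_list_def split: if_splits)
      ultimately show ?thesis using snoc by simp
    qed
  qed
  show "x \<in> positions t \<Longrightarrow> f x = x" by (rule fx)
  have "positions t' = f ` positions t" using bij by (simp add: bij_betw_def)
  also have "\<dots> = positions t" using fx by simp
  finally show "t = t'" using positions_inj by simp
qed

subsection \<open>Exploring a plane tree from a corner\<close>

text \<open>The shortest return of such a walk to a vertex already visited would be a cycle.\<close>

lemma nonbacktracking_inj:
  assumes simple: "simple_graph G" and acyc: "\<nexists>p. cycle_in G p"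
    and adj: "\<And>i. i < L \<Longrightarrow> (s i, s (Suc i)) \<in> edges G"
    and nb: "\<And>i. Suc (Suc i) \<le> L \<Longrightarrow> s i \<noteq> s (Suc (Suc i))"
  shows "inj_on s {..L::nat}"
proof (rule ccontr)
  assume "\<not> inj_on s {..L}"
  then obtain a b where ab: "a \<le> L" "b \<le> L" "a \<noteq> b" "s a = s b" by (auto simp: inj_on_def)
  define P where "P d \<longleftrightarrow> (\<exists>i. d > 0 \<and> i + d \<le> L \<and> s i = s (i + d))" for d
  have "\<exists>d. P d"
  proof (cases "a < b")
    case True thus ?thesis using ab unfolding P_def by (intro exI[of _ "b - a"] exI[of _ a]) auto
  next
    case False thus ?thesis using ab unfolding P_def by (intro exI[of _ "a - b"] exI[of _ b]) auto
  qed
  define d where "d = (LEAST d. P d)"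
  have "P d" unfolding d_def using \<open>\<exists>d. P d\<close> by (rule LeastI_ex)
  then obtain i where i: "d > 0" "i + d \<le> L" "s i = s (i + d)" unfolding P_def by blast
  have least: "\<not> P d'" if "d' < d" for d' using that not_less_Least unfolding d_def by blast
  have "d \<noteq> 1" using adj[of i] i simple by (auto simp: simple_graph_def irrefl_def)
  moreover have "d \<noteq> 2" using nb[of i] i by (auto simp: numeral_2_eq_2)
  ultimately have d3: "d \<ge> 3" using i by linarith
  define p where "p = map (\<lambda>k. s (i + k)) [0..<d]"
  have "distinct p"
  proof -
    have "s (i + k) \<noteq> s (i + k')" if "k < k'" "k' < d" for k k'
    proof
      assume "s (i + k) = s (i + k')"
      hence "P (k' - k)" unfolding P_def using that i by (intro exI[of _ "i + k"]) auto
      thus False using least[of "k' - k"] that by simp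
    qed
    hence "inj_on (\<lambda>k. s (i + k)) {0..<d}" by (intro linorder_inj_onI) auto
    thus ?thesis by (simp add: p_def distinct_map)
  qed
  moreover have "(p ! k, p ! (Suc k mod length p)) \<in> edges G" if "k < length p" for k
  proof (cases "Suc k = d")
    case True
    hence "Suc (i + k) = i + d" by simp
    hence "(s (i + k), s (i + d)) \<in> edges G" using adj[of "i + k"] i by (metis Suc_le_eq)
    thus ?thesis using i True by (simp add: p_def)
  next
    case False
    thus ?thesis using adj[of "i + k"] i that by (simp add: p_def)
  qed
  ultimately have "cycle_in G p" using d3 by (simp add: cycle_in_def p_def)
  thus False using acyc by blast
qed

text \<open>A dart is an edge with a direction. After the dart \<open>(a, b)\<close> the directions at \<open>b\<close> are numbered
  in cyclic order, starting with the successor of \<open>a\<close>.\<close>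

definition dart_step :: "('a \<Rightarrow> 'a \<Rightarrow> 'a) \<Rightarrow> 'a \<times> 'a \<Rightarrow> nat \<Rightarrow> 'a \<times> 'a" where
  "dart_step rot = (\<lambda>(a, b) i. (b, (rot b ^^ Suc i) a))"

text \<open>The depth only serves to make the recursion terminate; a depth of at least the number of
  vertices yields the whole tree. The number of children of the first vertex is a parameter, as
  the root of the exploration uses all of its neighbours and any other vertex all but its parent.\<close>

primrec branch :: "'a plane_tree \<Rightarrow> nat \<Rightarrow> nat \<Rightarrow> 'a \<times> 'a \<Rightarrow> planted_tree" where
  "branch P 0 c d = Node []"
| "branch P (Suc n) c d = Node (map (\<lambda>i. branch P n (degree (fst P) (snd (dart_step (snd P) d i)) - 1)
      (dart_step (snd P) d i)) [0..<c])"

text \<open>The words of \<open>branch\<close> without restriction of the depth.\<close>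

definition valid_word :: "'a plane_tree \<Rightarrow> nat \<Rightarrow> 'a \<times> 'a \<Rightarrow> nat list \<Rightarrow> bool" where
  "valid_word P c d x \<longleftrightarrow> (\<forall>k<length x. x ! k <
     (if k = 0 then c else degree (fst P) (snd (foldl (dart_step (snd P)) d (take k x))) - 1))"

lemma valid_word_Cons:
  "valid_word P c d (i # x) \<longleftrightarrow> i < c \<and>
     valid_word P (degree (fst P) (snd (dart_step (snd P) d i)) - 1) (dart_step (snd P) d i) x"
proof -
  let ?d = "dart_step (snd P) d i"
  have *: "(if k = 0 then degree (fst P) (snd ?d) - 1 else degree (fst P) (snd (foldl (dart_step (snd P)) ?d (take k x))) - 1)
    = degree (fst P) (snd (foldl (dart_step (snd P)) ?d (take k x))) - 1" for k by simp
  show ?thesis unfolding valid_word_def length_Cons All_less_Suc2 * by simp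
qed

lemma valid_word_snoc:
  "valid_word P c d (x @ [i]) \<longleftrightarrow> valid_word P c d x \<and> i <
     (if x = [] then c else degree (fst P) (snd (foldl (dart_step (snd P)) d x)) - 1)"
  unfolding valid_word_def by (auto simp: All_less_Suc nth_append less_Suc_eq)

lemma positions_branch: "positions (branch P n c d) = {x. length x \<le> n \<and> valid_word P c d x}"
proof (induction n arbitrary: c d)
  case 0
  show ?case by (auto simp: positions_Node valid_word_def)
next
  case (Suc n)
  have "x \<in> positions (branch P (Suc n) c d) \<longleftrightarrow> length x \<le> Suc n \<and> valid_word P c d x" for x
  proof (cases x)
    case Nil thus ?thesis by (simp add: valid_word_def)
  next
    case (Cons i y) thus ?thesis by (auto simp: valid_word_Cons Suc.IH)
  qed
  thus ?case by blast
qed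

lemma orders_funpow:
  assumes P: "is_plane_tree P" and v: "v \<in> verts (fst P)" and u: "u \<in> neighbours (fst P) v"
  shows "orders P v (map (\<lambda>i. (snd P v ^^ i) u) [0..<degree (fst P) v])"
    and "(snd P v ^^ degree (fst P) v) u = u"
proof -
  let ?f = "snd P v"
  have cyc: "cyclic_on ?f (neighbours (fst P) v)"
    using P v by (auto simp: is_plane_tree_def split: prod.splits)
  have orb: "orbit ?f u = neighbours (fst P) v" using orbit_cyclic_eq3[OF cyc u] .
  have self: "u \<in> orbit ?f u" using u orb by simp
  define k where "k = funpow_dist1 ?f u u"
  have im: "neighbours (fst P) v = (\<lambda>n. (?f ^^ n) u) ` {0..<k}"
    unfolding orb[symmetric] k_def by (rule orbit_conv_funpow_dist1[OF self])
  have inj: "inj_on (\<lambda>n. (?f ^^ n) u) {0..<k}" unfolding k_def by (rule inj_on_funpow_dist1[OF self])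
  have deg: "degree (fst P) v = k" unfolding degree_def im using card_image[OF inj] by simp
  have per: "(?f ^^ k) u = u" unfolding k_def by (rule funpow_dist1_prop[OF self])
  show "(snd P v ^^ degree (fst P) v) u = u" using per deg by simp
  have "?f ((?f ^^ i) u) = (?f ^^ (Suc i mod k)) u" if "i < k" for i
    using that per by (cases "Suc i = k") auto
  thus "orders P v (map (\<lambda>i. (?f ^^ i) u) [0..<degree (fst P) v])"
    unfolding orders_def cyclic_list_def deg using inj im by (auto simp: distinct_map)
qed

text \<open>A word describes a path in \<open>P\<close> that starts at \<open>u\<close>. The neighbour \<open>a\<close> is only the reference
  point of the cyclic order at \<open>u\<close>: it becomes the last child of the root.\<close>

context
  fixes P :: "'a plane_tree" and a u :: 'a
  assumes P: "is_plane_tree P" and fin: "finite (verts (fst P))" and au: "(a, u) \<in> edges (fst P)"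
begin

private abbreviation "deg \<equiv> degree (fst P)"
private abbreviation "W \<equiv> foldl (dart_step (snd P)) (a, u)"
private abbreviation "endpt x \<equiv> snd (W x)"
private abbreviation "valid \<equiv> valid_word P (deg u) (a, u)"
private abbreviation "bound x \<equiv> (if x = [] then deg u else deg (endpt x) - 1)"

private lemma simpleP: "simple_graph (fst P)" and acycP: "\<nexists>p. cycle_in (fst P) p"
  and connP: "connected_graph (fst P)"
  using P by (auto simp: is_plane_tree_def tree_graph_def split: prod.splits)

private lemma symP: "(x, y) \<in> edges (fst P) \<Longrightarrow> (y, x) \<in> edges (fst P)"
  using simpleP by (auto simp: simple_graph_def dest: symD)

private lemma vertsP: "(x, y) \<in> edges (fst P) \<Longrightarrow> x \<in> verts (fst P) \<and> y \<in> verts (fst P)"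
  using simpleP by (auto simp: simple_graph_def)

private lemma W_snoc: "W (x @ [i]) = (endpt x, (snd P (endpt x) ^^ Suc i) (fst (W x)))"
  by (simp add: dart_step_def case_prod_beta)

private lemma W_edge: "W x \<in> edges (fst P)"
proof (induction x rule: rev_induct)
  case Nil show ?case using au by simp
next
  case (snoc i x)
  have "(endpt x, fst (W x)) \<in> edges (fst P)" using symP snoc by simp
  hence nb: "fst (W x) \<in> neighbours (fst P) (endpt x)" by (simp add: neighbours_def)
  have "cyclic_on (snd P (endpt x)) (neighbours (fst P) (endpt x))"
    using P vertsP snoc by (metis (no_types, lifting) is_plane_tree_def case_prod_beta prod.collapse)
  from cyclic_on_funpow_in[OF this nb, of "Suc i"] show ?case
    unfolding W_snoc by (simp add: neighbours_def)
qed

private lemma endpt_vert: "endpt x \<in> verts (fst P)"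
  using W_edge[of x] vertsP[of "fst (W x)" "endpt x"] by simp

private lemma pred_nbr: "fst (W x) \<in> neighbours (fst P) (endpt x)"
  using W_edge[of x] symP[of "fst (W x)" "endpt x"] by (simp add: neighbours_def)

private lemma fst_W: "x \<noteq> [] \<Longrightarrow> fst (W x) = endpt (butlast x)"
  by (cases x rule: rev_cases) (simp_all add: W_snoc del: foldl_append)

private lemma deg_pos: "deg (endpt x) > 0"
proof -
  have "finite (neighbours (fst P) (endpt x))"
    by (rule finite_subset[OF _ fin]) (auto simp: neighbours_def dest: vertsP)
  thus ?thesis using pred_nbr[of x] by (auto simp: degree_def card_gt_0_iff)
qed

private lemma bound_le: "bound x \<le> deg (endpt x)" by simp

private lemma orders1: "orders P (endpt x) (map (\<lambda>i. (snd P (endpt x) ^^ i) (fst (W x))) [0..<deg (endpt x)])"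
  by (rule orders_funpow[OF P endpt_vert pred_nbr])

private lemma orders2: "orders P (endpt x) (map (\<lambda>i. endpt (x @ [i])) [0..<deg (endpt x)])"
proof -
  have "(endpt x, endpt (x @ [0])) \<in> edges (fst P)" using W_edge[of "x @ [0]"] unfolding W_snoc by simp
  hence "endpt (x @ [0]) \<in> neighbours (fst P) (endpt x)" by (simp add: neighbours_def)
  from orders_funpow(1)[OF P endpt_vert this]
  show ?thesis unfolding W_snoc by (simp add: funpow_swap1)
qed

private lemma child_ne_parent:
  assumes "valid (x @ [i])" "x \<noteq> []" shows "endpt (x @ [i]) \<noteq> endpt (butlast x)"
proof
  assume eq: "endpt (x @ [i]) = endpt (butlast x)"
  have i: "Suc i < deg (endpt x)" using assms by (auto simp: valid_word_snoc)
  let ?xs = "map (\<lambda>i. (snd P (endpt x) ^^ i) (fst (W x))) [0..<deg (endpt x)]"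
  have "?xs ! Suc i = ?xs ! 0" using eq fst_W[OF assms(2)] i deg_pos[of x] by (simp add: W_snoc del: foldl_append)
  moreover have "distinct ?xs" using orders1 by (simp add: orders_def cyclic_list_def)
  ultimately show False using i by (subst (asm) nth_eq_iff_index_eq) auto
qed

private lemma children_ne:
  assumes "valid (x @ [i])" "valid (x @ [j])" "i \<noteq> j" shows "endpt (x @ [i]) \<noteq> endpt (x @ [j])"
proof
  assume eq: "endpt (x @ [i]) = endpt (x @ [j])"
  let ?xs = "map (\<lambda>i. endpt (x @ [i])) [0..<deg (endpt x)]"
  have ij: "i < deg (endpt x)" "j < deg (endpt x)"
    using assms bound_le[of x] by (auto simp: valid_word_snoc split: if_splits)
  hence "?xs ! i = ?xs ! j" using eq by simp
  moreover have "distinct ?xs" using orders2 by (simp add: orders_def cyclic_list_def)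
  ultimately show False using ij assms(3) by (subst (asm) nth_eq_iff_index_eq) auto
qed

private lemma valid_take: "valid x \<Longrightarrow> valid (take k x)"
  unfolding valid_word_def
proof (intro allI impI)
  fix j assume v: "\<forall>k<length x. x ! k < (if k = 0 then deg u else deg (endpt (take k x)) - 1)"
    and j: "j < length (take k x)"
  have "take j (take k x) = take j x" using j by (simp add: min_absorb1)
  thus "take k x ! j < (if j = 0 then deg u else deg (endpt (take j (take k x))) - 1)"
    using v[rule_format, of j] j by (simp split: if_splits)
qed

private lemma prefix_edge: "k < length x \<Longrightarrow> (endpt (take k x), endpt (take (Suc k) x)) \<in> edges (fst P)"
  using W_edge[of "take (Suc k) x"] by (simp add: take_Suc_conv_app_nth W_snoc del: foldl_append)

private lemma prefix_ne:
  assumes "valid x" "Suc k < length x"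
  shows "endpt (take k x) \<noteq> endpt (take (Suc (Suc k)) x)"
proof -
  have "endpt (take (Suc k) x @ [x ! Suc k]) \<noteq> endpt (butlast (take (Suc k) x))"
    by (rule child_ne_parent) (use assms valid_take[of x "Suc (Suc k)"] in \<open>auto simp: take_Suc_conv_app_nth\<close>)
  moreover have "butlast (take (Suc k) x) = take k x" using assms by (simp add: butlast_take)
  ultimately show ?thesis using assms by (metis take_Suc_conv_app_nth)
qed

text \<open>If two words had the same endpoint, the path from this endpoint up to the branching point of the
  words and down again along the other word would return to its start. It does not backtrack:
  a vertex differs from its grandparent, and at the branching point two different children
  are taken.\<close>

private lemma endpt_inj:
  assumes x: "valid x" and y: "valid y" and eq: "endpt x = endpt y"
  shows "x = y"
proof -
  obtain ps x' y' where xy: "x = ps @ x'" "y = ps @ y'" and hd: "x' = [] \<or> y' = [] \<or> hd x' \<noteq> hd y'"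
    using longest_common_prefix by blast
  define A where "A = length x'"
  define B where "B = length y'"
  define m where "m = length ps"
  have lx: "length x = m + A" and ly: "length y = m + B" by (simp_all add: xy A_def B_def m_def)
  define s where "s k = (if k \<le> A then endpt (take (m + A - k) x) else endpt (take (m + k - A) y))" for k
  have s2: "s k = endpt (take (m + k - A) y)" if "k \<ge> A" for k
    using that by (cases "k = A") (auto simp: s_def xy m_def)
  have "inj_on s {..A + B}"
  proof (rule nonbacktracking_inj[OF simpleP acycP])
    fix i assume i: "i < A + B"
    show "(s i, s (Suc i)) \<in> edges (fst P)"
    proof (cases "i < A")
      case True
      hence "m + A - i = Suc (m + A - Suc i)" by simp
      hence "(s (Suc i), s i) \<in> edges (fst P)"
        using prefix_edge[of "m + A - Suc i" x] True lx by (simp add: s_def)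
      thus ?thesis by (rule symP)
    next
      case False
      have "m + Suc i - A = Suc (m + i - A)" using False by simp
      thus ?thesis using prefix_edge[of "m + i - A" y] False i ly by (simp add: s2)
    qed
  next
    fix i assume i: "Suc (Suc i) \<le> A + B"
    consider "Suc (Suc i) \<le> A" | "Suc i = A" | "i \<ge> A" by linarith
    thus "s i \<noteq> s (Suc (Suc i))"
    proof cases
      case 1
      hence "m + A - i = Suc (Suc (m + A - Suc (Suc i)))" by simp
      moreover have "Suc (m + A - Suc (Suc i)) < length x" using 1 lx by simp
      ultimately show ?thesis using prefix_ne[OF x, of "m + A - Suc (Suc i)"] 1 by (auto simp: s_def)
    next
      case 2
      have B: "B > 0" using i 2 by simp
      have A: "A > 0" using 2 by simp
      obtain p x'' where x'': "x' = p # x''" using A unfolding A_def by (cases x') auto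
      obtain q y'' where y'': "y' = q # y''" using B unfolding B_def by (cases y') auto
      have "p \<noteq> q" using hd x'' y'' by simp
      moreover have "take (Suc m) x = ps @ [p]" "take (Suc m) y = ps @ [q]"
        by (simp_all add: xy x'' y'' m_def)
      moreover have "s i = endpt (take (Suc m) x)" "s (Suc (Suc i)) = endpt (take (Suc m) y)"
        using 2 by (auto simp: s_def s2)
      ultimately show ?thesis using children_ne[of ps p q] valid_take[OF x, of "Suc m"] valid_take[OF y, of "Suc m"]
        by (simp del: foldl_append)
    next
      case 3
      hence "m + Suc (Suc i) - A = Suc (Suc (m + i - A))" by simp
      thus ?thesis using prefix_ne[OF y, of "m + i - A"] 3 i ly by (simp add: s2)
    qed
  qed
  moreover have "s 0 = s (A + B)" using eq lx ly s2[of "A + B"] by (simp add: s_def)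
  ultimately have "A + B = 0" by (auto dest: inj_onD)
  thus ?thesis by (simp add: xy A_def B_def)
qed

private lemma valid_length: "valid x \<Longrightarrow> length x < card (verts (fst P))"
proof -
  assume x: "valid x"
  have "inj_on (\<lambda>k. endpt (take k x)) {..length x}"
  proof (rule inj_onI)
    fix i j assume ij: "i \<in> {..length x}" "j \<in> {..length x}" "endpt (take i x) = endpt (take j x)"
    hence "take i x = take j x" using endpt_inj valid_take x by blast
    hence "length (take i x) = length (take j x)" by simp
    thus "i = j" using ij by simp
  qed
  moreover have "(\<lambda>k. endpt (take k x)) ` {..length x} \<subseteq> verts (fst P)" using endpt_vert by auto
  ultimately have "card {..length x} \<le> card (verts (fst P))" using card_inj_on_le fin by blast
  thus ?thesis by simp
qed

text \<open>The neighbours of an endpoint are the endpoints of the words extended by one letter, except that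
  the last of these letters leads back to the parent if there is one.\<close>

private lemma nbr_endpt:
  assumes "valid x" "z \<in> neighbours (fst P) (endpt x)"
  shows "\<exists>y. valid y \<and> z = endpt y"
proof -
  have "z \<in> set (map (\<lambda>i. endpt (x @ [i])) [0..<deg (endpt x)])" using assms(2) orders2[of x] by (simp only: orders_def)
  then obtain i where i: "i < deg (endpt x)" "z = endpt (x @ [i])" by auto
  show ?thesis
  proof (cases "i < bound x")
    case True
    hence "valid (x @ [i])" using assms(1) by (simp add: valid_word_snoc)
    thus ?thesis using i by blast
  next
    case False
    hence ne: "x \<noteq> []" and "Suc i = deg (endpt x)" using i by (auto split: if_splits)
    hence "z = fst (W x)" using orders_funpow(2)[OF P endpt_vert pred_nbr, of x] i by (simp add: W_snoc del: foldl_append)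
    hence "z = endpt (butlast x)" using fst_W ne by simp
    moreover have "valid (butlast x)" using valid_take[OF assms(1), of "length x - 1"] by (simp add: butlast_conv_take)
    ultimately show ?thesis by blast
  qed
qed

private lemma endpt_surj: "w \<in> verts (fst P) \<Longrightarrow> \<exists>x. valid x \<and> w = endpt x"
proof -
  assume w: "w \<in> verts (fst P)"
  have "(u, w) \<in> (edges (fst P))\<^sup>*" using connP w vertsP[OF au] by (auto simp: connected_graph_def)
  thus ?thesis
  proof induction
    case base
    show ?case by (rule exI[of _ "[]"]) (simp add: valid_word_def)
  next
    case (step y z)
    then obtain x where "valid x" "y = endpt x" by blast
    thus ?case using nbr_endpt[of x z] step(2) by (simp add: neighbours_def)
  qed
qed

lemma exploration_iso:
  "\<exists>t f. plane_iso_by f (plane_model t) P \<and> f [] = u \<and> f [0] = snd P u a"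
proof -
  define T where "T = branch P (card (verts (fst P))) (deg u) (a, u)"
  have pos: "positions T = {x. valid x}" unfolding T_def positions_branch using valid_length by fastforce
  have out: "outdegree T x = bound x" if "valid x" for x
  proof -
    have "{i. x @ [i] \<in> positions T} = {..<bound x}" using that by (auto simp: pos valid_word_snoc)
    thus ?thesis by (simp add: outdegree_def)
  qed
  have iso: "plane_iso_by endpt (plane_model T) P"
  proof (rule plane_iso_byI)
    have "endpt ` {x. valid x} = verts (fst P)" using endpt_surj endpt_vert by blast
    moreover have "inj_on endpt {x. valid x}" using endpt_inj by (intro inj_onI) blast
    ultimately show "bij_betw endpt (verts (fst (plane_model T))) (verts (fst P))"
      by (simp add: bij_betw_def pos)
    show "simple_graph (fst (plane_model T))" by simp
    fix x assume "x \<in> verts (fst (plane_model T))"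
    hence x: "valid x" by (simp add: pos)
    have "orders P (endpt x) (map endpt (nbr_list T x))"
    proof (cases "x = []")
      case True
      thus ?thesis using orders2[of "[]"] x by (simp add: nbr_list_def out pos comp_def)
    next
      case False
      obtain d where d: "deg (endpt x) = Suc d" using deg_pos[of x] gr0_implies_Suc by blast
      have "map endpt (nbr_list T x) = endpt (butlast x) # map (\<lambda>i. endpt (x @ [i])) [0..<d]"
        using False x d by (simp add: nbr_list_def out pos comp_def del: foldl_append)
      also have "\<dots> = map (\<lambda>i. (snd P (endpt x) ^^ i) (fst (W x))) [0..<deg (endpt x)]"
        unfolding d by (simp only: upt_conv_Cons[OF zero_less_Suc] list.map map_Suc_upt[symmetric] map_map comp_def
             W_snoc snd_conv fst_W[OF False, symmetric] funpow_0 id_apply)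
      finally show ?thesis using orders1[of x] by (simp only:)
    qed
    thus "\<exists>xs. orders (plane_model T) x xs \<and> orders P (endpt x) (map endpt xs)"
      using orders_plane_model by blast
  qed
  show ?thesis using iso by (intro exI[of _ T] exI[of _ endpt]) (simp add: dart_step_def)
qed

end

text \<open>Every corner can become the root corner. A corner at \<open>u\<close> is given by the neighbour \<open>v\<close> that
  follows it in the cyclic order; this neighbour becomes the first child of the root.\<close>

lemma corner_code_exists:
  assumes P: "is_plane_tree P" "finite (verts (fst P))" and uv: "(u, v) \<in> edges (fst P)"
  shows "\<exists>t f. plane_iso_by f (plane_model t) P \<and> f [] = u \<and> f [0] = v"
proof -
  have simple: "simple_graph (fst P)" and perm: "snd P u permutes neighbours (fst P) u"
    using P(1) by (auto simp: is_plane_tree_def tree_graph_def split: prod.splits)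
  have "v \<in> neighbours (fst P) u" using uv by (simp add: neighbours_def)
  then obtain a where a: "a \<in> neighbours (fst P) u" "snd P u a = v"
    using perm by (metis permutes_image imageE)
  have "(a, u) \<in> edges (fst P)" using a(1) simple by (auto simp: neighbours_def simple_graph_def dest: symD)
  from exploration_iso[OF P this] show ?thesis using a(2) by simp
qed

lemma plane_treeD:
  assumes "is_plane_tree P"
  shows "simple_graph (fst P)" "\<And>v u. v \<in> verts (fst P) \<Longrightarrow> u \<in> neighbours (fst P) v \<Longrightarrow> snd P v u \<in> neighbours (fst P) v"
    "\<And>v. v \<in> verts (fst P) \<Longrightarrow> neighbours (fst P) v \<noteq> {}" "verts (fst P) \<noteq> {}"
proof -
  show "simple_graph (fst P)" "verts (fst P) \<noteq> {}"
    using assms by (auto simp: is_plane_tree_def tree_graph_def connected_graph_def split: prod.splits)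
  show "\<And>v u. v \<in> verts (fst P) \<Longrightarrow> u \<in> neighbours (fst P) v \<Longrightarrow> snd P v u \<in> neighbours (fst P) v"
    using assms by (auto simp: is_plane_tree_def permutes_in_image split: prod.splits)
  show "\<And>v. v \<in> verts (fst P) \<Longrightarrow> neighbours (fst P) v \<noteq> {}"
    using assms by (auto simp: is_plane_tree_def cyclic_on_def split: prod.splits)
qed

lemma plane_model_rot:
  "u \<in> neighbours (fst (plane_model t)) v \<Longrightarrow> snd (plane_model t) v u \<in> neighbours (fst (plane_model t)) v"
proof -
  assume u: "u \<in> neighbours (fst (plane_model t)) v"
  have c: "cyclic_list (snd (plane_model t) v) (nbr_list t v)"
    using orders_plane_model[of t v] by (simp add: orders_def)
  obtain i where i: "i < length (nbr_list t v)" "u = nbr_list t v ! i"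
    using u by (auto simp: in_set_conv_nth)
  have "Suc i mod length (nbr_list t v) < length (nbr_list t v)" using i by (intro mod_less_divisor) auto
  thus ?thesis using c i by (auto simp: cyclic_list_def)
qed

lemma plane_model_iso_inv:
  assumes "plane_iso_by f (plane_model t) P" "simple_graph (fst P)"
  shows "plane_iso_by (inv_into (positions t) f) P (plane_model t)"
  using plane_iso_by_inv[OF assms(1) _ assms(2)] plane_model_rot[of _ t] by simp

lemma labelled_copy_exists:
  assumes n: "nodes t = n" "n \<ge> 2"
  shows "\<exists>P\<in>labelled_plane_trees n. \<exists>f. plane_iso_by f (plane_model t) P"
proof -
  obtain g where g: "bij_betw g (positions t) {..<n}"
    using ex_bij_betw_finite_nat[of "positions t"] n by (auto simp: card_positions atLeast0LessThan)
  define h where "h = inv_into (positions t) g"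
  have hg: "h (g x) = x" if "x \<in> positions t" for x
    using that g by (simp add: h_def bij_betw_inv_into_left)
  have gh: "g (h v) = v" "h v \<in> positions t" if "v < n" for v
    using that g by (auto simp: h_def bij_betw_inv_into_right bij_betw_def inv_into_into)
  have gm: "g x < n" if "x \<in> positions t" for x using that g by (auto simp: bij_betw_def)
  let ?E = "edges (planted_graph t)"
  have EV: "x \<in> positions t \<and> y \<in> positions t" if "(x, y) \<in> ?E" for x y
    using that by (auto simp: planted_graph_def)
  define G where "G = \<lparr>verts = {..<n}, edges = (\<lambda>(x, y). (g x, g y)) ` ?E\<rparr>"
  define rot where "rot v = successor_in (if v < n then map g (nbr_list t (h v)) else [])" for v
  have EG: "(v, w) \<in> edges G \<longleftrightarrow> v < n \<and> w < n \<and> (h v, h w) \<in> ?E" for v w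
  proof
    assume "(v, w) \<in> edges G"
    then obtain x y where xy: "(x, y) \<in> ?E" "v = g x" "w = g y" by (auto simp: G_def)
    thus "v < n \<and> w < n \<and> (h v, h w) \<in> ?E" using EV[OF xy(1)] gm hg by simp
  next
    assume vw: "v < n \<and> w < n \<and> (h v, h w) \<in> ?E"
    hence "(g (h v), g (h w)) \<in> edges G" unfolding G_def by force
    thus "(v, w) \<in> edges G" using vw gh by simp
  qed
  have nbG: "neighbours G v = (if v < n then g ` set (nbr_list t (h v)) else {})" for v
  proof -
    have "w \<in> neighbours G v \<longleftrightarrow> v < n \<and> w \<in> g ` set (nbr_list t (h v))" for w
    proof -
      have "w \<in> neighbours G v \<longleftrightarrow> v < n \<and> w < n \<and> h w \<in> set (nbr_list t (h v))"
        by (simp add: neighbours_def EG edges_planted_graph)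
      also have "\<dots> \<longleftrightarrow> v < n \<and> w \<in> g ` set (nbr_list t (h v))"
      proof (intro conj_cong refl iffI)
        assume "w < n \<and> h w \<in> set (nbr_list t (h v))"
        thus "w \<in> g ` set (nbr_list t (h v))" using gh by (metis imageI)
      next
        assume "w \<in> g ` set (nbr_list t (h v))"
        then obtain y where y: "y \<in> set (nbr_list t (h v))" "w = g y" by blast
        hence "y \<in> positions t" using EV edges_planted_graph by blast
        thus "w < n \<and> h w \<in> set (nbr_list t (h v))" using y gm hg by simp
      qed
      finally show ?thesis .
    qed
    thus ?thesis by auto
  qed
  have simp_t: "sym ?E" "irrefl ?E" using simple_planted_graph[of t] by (auto simp: simple_graph_def)
  have simple: "simple_graph G"
    unfolding simple_graph_def
    using simp_t by (auto simp: sym_def irrefl_def EG) (auto simp: G_def)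
  have conn: "connected_graph G"
    unfolding connected_graph_def
  proof (intro conjI ballI)
    show "verts G \<noteq> {}" using n by (auto simp: G_def lessThan_empty_iff)
    fix u v assume uv: "u \<in> verts G" "v \<in> verts G"
    have "(h u, h v) \<in> ?E\<^sup>*"
      using tree_planted_graph[of t] uv gh by (auto simp: tree_graph_def connected_graph_def G_def)
    hence "(g (h u), g (h v)) \<in> (edges G)\<^sup>*"
    proof induction
      case (step y z)
      have "(g y, g z) \<in> edges G" using step(2) by (force simp: G_def)
      with step.IH show ?case by (rule rtrancl_into_rtrancl)
    qed simp
    thus "(u, v) \<in> (edges G)\<^sup>*" using uv gh by (simp add: G_def)
  qed
  have acyc: "\<not> cycle_in G p" for p
  proof
    assume p: "cycle_in G p"
    have pn: "v < n" if v: "v \<in> set p" for v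
    proof -
      obtain i where "i < length p" "v = p ! i" using v by (auto simp: in_set_conv_nth)
      thus ?thesis using p EG unfolding cycle_in_def by blast
    qed
    have "inj_on h (set p)" using pn gh by (intro inj_onI) metis
    moreover have "Suc i mod length p < length p" if "i < length p" for i
      using that by (intro mod_less_divisor) auto
    ultimately have "cycle_in (planted_graph t) (map h p)"
      using p unfolding cycle_in_def by (auto simp: distinct_map EG)
    thus False using tree_planted_graph[of t] by (auto simp: tree_graph_def)
  qed
  have cl: "cyclic_list (rot v) (if v < n then map g (nbr_list t (h v)) else [])" for v
    unfolding rot_def
  proof (rule cyclic_list_successor_in)
    have "set (nbr_list t (h v)) \<subseteq> positions t" using EV edges_planted_graph by blast
    hence "inj_on g (set (nbr_list t (h v)))" using g by (auto simp: bij_betw_def intro: inj_on_subset)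
    thus "distinct (if v < n then map g (nbr_list t (h v)) else [])"
      using distinct_nbr_list by (simp add: distinct_map)
  qed
  have setl: "set (if v < n then map g (nbr_list t (h v)) else []) = neighbours G v" for v
    by (simp add: nbG)
  have plane: "is_plane_tree (G, rot)"
    unfolding is_plane_tree_def prod.case tree_graph_def
  proof (intro conjI allI ballI)
    show "simple_graph G" "connected_graph G" "\<nexists>p. cycle_in G p" using simple conn acyc by auto
    show "rot v permutes neighbours G v" for v
      unfolding setl[symmetric] by (rule cyclic_list_permutes[OF cl]) (simp only: rot_def successor_in_def if_False)
    show "cyclic_on (rot v) (neighbours G v)" if "v \<in> verts G" for v
      unfolding setl[symmetric]
      by (rule cyclic_list_cyclic_on[OF cl]) (use that nbr_list_ne[of "h v" t] gh n in \<open>simp add: G_def\<close>)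
  qed
  have iso: "plane_iso_by g (plane_model t) (G, rot)"
  proof (rule plane_iso_byI)
    show "bij_betw g (verts (fst (plane_model t))) (verts (fst (G, rot)))" using g by (simp add: G_def)
    show "simple_graph (fst (plane_model t))" by simp
    fix v assume "v \<in> verts (fst (plane_model t))"
    hence v: "v \<in> positions t" by simp
    have "orders (G, rot) (g v) (map g (nbr_list t v))"
      using cl[of "g v"] setl[of "g v"] gm[OF v] hg[OF v] by (simp add: orders_def)
    thus "\<exists>xs. orders (plane_model t) v xs \<and> orders (G, rot) (g v) (map g xs)"
      using orders_plane_model by blast
  qed
  show ?thesis
    by (rule bexI[of _ "(G, rot)"], rule exI[of _ g]) (use iso plane in \<open>auto simp: labelled_plane_trees_def G_def\<close>)
qed

subsection \<open>The codes of an unrooted plane tree\<close>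

text \<open>The planted trees that arise from \<open>U\<close> by choosing a root corner, one for each orbit of corners
  under the automorphisms of \<open>U\<close>.\<close>

definition codes :: "nat plane_tree set \<Rightarrow> planted_tree set" where
  "codes U = {t. \<exists>P\<in>U. \<exists>f. plane_iso_by f (plane_model t) P}"

lemma labelled_plane_treesD:
  assumes "P \<in> labelled_plane_trees n"
  shows "is_plane_tree P" "verts (fst P) = {..<n}" "finite (verts (fst P))" "n \<ge> 2"
proof -
  show P: "is_plane_tree P" "verts (fst P) = {..<n}" "finite (verts (fst P))"
    using assms by (auto simp: labelled_plane_trees_def)
  obtain v where v: "v \<in> verts (fst P)" using plane_treeD(4)[OF P(1)] by blast
  obtain u where u: "u \<in> neighbours (fst P) v" using plane_treeD(3)[OF P(1) v] by blast
  have "u \<noteq> v" "u \<in> verts (fst P)"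
    using u plane_treeD(1)[OF P(1)] by (auto simp: neighbours_def simple_graph_def irrefl_def)
  hence "card {u, v} \<le> card (verts (fst P))" using v P(3) by (intro card_mono) auto
  thus "n \<ge> 2" using \<open>u \<noteq> v\<close> P(2) by simp
qed

lemma equiv_plane_iso_rel: "equiv (labelled_plane_trees n) (plane_iso_rel n)"
proof (rule equivI)
  show "plane_iso_rel n \<subseteq> labelled_plane_trees n \<times> labelled_plane_trees n"
    by (auto simp: plane_iso_rel_def)
  have "plane_iso_by (\<lambda>x. x) P P" for P :: "nat plane_tree"
    by (simp add: plane_iso_by_def graph_iso_by_def bij_betw_def)
  thus "refl_on (labelled_plane_trees n) (plane_iso_rel n)"
    by (auto simp: refl_on_def plane_iso_rel_def plane_iso_iff)
  show "sym (plane_iso_rel n)"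
  proof (rule symI)
    fix P P' assume a: "(P, P') \<in> plane_iso_rel n"
    then obtain f where f: "plane_iso_by f P P'" and l: "P \<in> labelled_plane_trees n" "P' \<in> labelled_plane_trees n"
      by (auto simp: plane_iso_rel_def plane_iso_iff)
    note p = labelled_plane_treesD(1)[OF l(1)] labelled_plane_treesD(1)[OF l(2)]
    have "plane_iso_by (inv_into (verts (fst P)) f) P' P"
      by (rule plane_iso_by_inv[OF f plane_treeD(1)[OF p(1)] plane_treeD(1)[OF p(2)] plane_treeD(2)[OF p(1)]])
    thus "(P', P) \<in> plane_iso_rel n" using l by (auto simp: plane_iso_rel_def plane_iso_iff)
  qed
  show "trans (plane_iso_rel n)"
  proof (rule transI)
    fix P P' P'' assume a: "(P, P') \<in> plane_iso_rel n" "(P', P'') \<in> plane_iso_rel n"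
    then obtain f g where fg: "plane_iso_by f P P'" "plane_iso_by g P' P''"
      and l: "P \<in> labelled_plane_trees n" "P'' \<in> labelled_plane_trees n"
      by (auto simp: plane_iso_rel_def plane_iso_iff)
    have "plane_iso_by (g \<circ> f) P P''"
      by (rule plane_iso_by_comp[OF fg plane_treeD(1)[OF labelled_plane_treesD(1)[OF l(1)]]])
    thus "(P, P'') \<in> plane_iso_rel n" using l by (auto simp: plane_iso_rel_def plane_iso_iff)
  qed
qed

lemma unrooted_class:
  assumes "U \<in> unrooted_plane_trees n"
  shows "\<exists>P. P \<in> U" "P \<in> U \<Longrightarrow> P \<in> labelled_plane_trees n"
    "P \<in> U \<Longrightarrow> U = plane_iso_rel n `` {P}" "P \<in> U \<Longrightarrow> P' \<in> U \<Longrightarrow> \<exists>f. plane_iso_by f P P'"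
proof -
  note eq = equiv_plane_iso_rel[of n]
  have U: "U \<in> labelled_plane_trees n // plane_iso_rel n" using assms by (simp add: unrooted_plane_trees_def)
  show "\<exists>P. P \<in> U" using in_quotient_imp_non_empty[OF eq U] by blast
  show "P \<in> U \<Longrightarrow> P \<in> labelled_plane_trees n" using in_quotient_imp_subset[OF eq U] by blast
  show "P \<in> U \<Longrightarrow> U = plane_iso_rel n `` {P}"
  proof -
    assume P: "P \<in> U"
    obtain P0 where P0: "U = plane_iso_rel n `` {P0}" using U by (rule quotientE)
    hence "(P0, P) \<in> plane_iso_rel n" using P by blast
    thus "U = plane_iso_rel n `` {P}" unfolding P0 by (rule equiv_class_eq[OF eq])
  qed
  show "P \<in> U \<Longrightarrow> P' \<in> U \<Longrightarrow> \<exists>f. plane_iso_by f P P'"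
    using in_quotient_imp_in_rel[OF eq U, of P P'] by (auto simp: plane_iso_rel_def plane_iso_iff)
qed

lemma plane_iso_by_card_verts:
  "plane_iso_by f P P' \<Longrightarrow> card (verts (fst P)) = card (verts (fst P'))"
  by (auto simp: plane_iso_by_def graph_iso_by_def dest: bij_betw_same_card)

lemma codes_nodes:
  assumes U: "U \<in> unrooted_plane_trees n" and t: "t \<in> codes U"
  shows "nodes t = n" "n \<ge> 2"
proof -
  obtain P f where P: "P \<in> U" "plane_iso_by f (plane_model t) P" using t by (auto simp: codes_def)
  note l = labelled_plane_treesD[OF unrooted_class(2)[OF U P(1)]]
  show "nodes t = n" using plane_iso_by_card_verts[OF P(2)] l by (simp add: card_positions)
  show "n \<ge> 2" by (rule l)
qed

lemma codes_iso_all: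
  assumes U: "U \<in> unrooted_plane_trees n" and t: "t \<in> codes U" and P: "P \<in> U"
  shows "\<exists>f. plane_iso_by f (plane_model t) P"
proof -
  obtain P' f where P': "P' \<in> U" "plane_iso_by f (plane_model t) P'" using t by (auto simp: codes_def)
  obtain g where "plane_iso_by g P' P" using unrooted_class(4)[OF U P'(1) P] by blast
  from plane_iso_by_comp[OF P'(2) this] show ?thesis by auto
qed

lemma codes_iso:
  assumes U: "U \<in> unrooted_plane_trees n" and t: "t \<in> codes U" "t' \<in> codes U"
  shows "\<exists>f. plane_iso_by f (plane_model t) (plane_model t')"
proof -
  obtain P where P: "P \<in> U" using unrooted_class(1)[OF U] by blast
  note s = plane_treeD(1)[OF labelled_plane_treesD(1)[OF unrooted_class(2)[OF U P]]]
  obtain f g where "plane_iso_by f (plane_model t) P" "plane_iso_by g (plane_model t') P"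
    using codes_iso_all[OF U] t P by blast
  from plane_iso_by_comp[OF this(1) plane_model_iso_inv[OF this(2) s]] show ?thesis by auto
qed

lemma codes_closed:
  assumes t: "t \<in> codes U" and iso: "plane_iso_by f (plane_model t') (plane_model t)"
  shows "t' \<in> codes U"
  using t plane_iso_by_comp[OF iso] unfolding codes_def by fastforce

lemma codes_graph_iso:
  assumes U: "U \<in> unrooted_plane_trees n" and t: "t \<in> codes U"
  shows "\<exists>f. graph_iso_by f (planted_graph t) (underlying U)"
proof -
  have "(SOME P. P \<in> U) \<in> U" using unrooted_class(1)[OF U] by (rule someI_ex)
  from codes_iso_all[OF U t this] show ?thesis
    unfolding underlying_def plane_iso_by_def by auto
qed

lemma codes_ne:
  assumes U: "U \<in> unrooted_plane_trees n"
  shows "codes U \<noteq> {}"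
proof -
  obtain P where P: "P \<in> U" using unrooted_class(1)[OF U] by blast
  note l = labelled_plane_treesD[OF unrooted_class(2)[OF U P]]
  obtain v where v: "v \<in> verts (fst P)" using plane_treeD(4)[OF l(1)] by blast
  then obtain u where "u \<in> neighbours (fst P) v" using plane_treeD(3)[OF l(1)] by blast
  hence "(v, u) \<in> edges (fst P)" by (simp add: neighbours_def)
  from corner_code_exists[OF l(1,3) this] show ?thesis using P by (auto simp: codes_def)
qed

lemma codes_ex1:
  assumes n: "nodes t = n" "n \<ge> 2"
  shows "\<exists>!U. U \<in> unrooted_plane_trees n \<and> t \<in> codes U"
proof -
  obtain P f where P: "P \<in> labelled_plane_trees n" "plane_iso_by f (plane_model t) P"
    using labelled_copy_exists[OF n] by blast
  let ?U = "plane_iso_rel n `` {P}"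
  have "?U \<in> unrooted_plane_trees n" using P(1) by (simp add: unrooted_plane_trees_def quotientI)
  moreover have "P \<in> ?U" using equiv_class_self[OF equiv_plane_iso_rel P(1)] .
  ultimately have 1: "?U \<in> unrooted_plane_trees n \<and> t \<in> codes ?U" using P(2) by (auto simp: codes_def)
  moreover have "U = ?U" if U: "U \<in> unrooted_plane_trees n \<and> t \<in> codes U" for U
  proof -
    obtain P' where P': "P' \<in> U" using unrooted_class(1) U by blast
    hence l: "P' \<in> labelled_plane_trees n" using unrooted_class(2) U by blast
    obtain g where g: "plane_iso_by g (plane_model t) P'" using codes_iso_all U P' by blast
    have "plane_iso_by (g \<circ> inv_into (positions t) f) P P'"
      using plane_iso_by_comp[OF plane_model_iso_inv[OF P(2)] g] plane_treeD(1)[OF labelled_plane_treesD(1)[OF P(1)]] by simp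
    hence "(P, P') \<in> plane_iso_rel n" using P(1) l by (auto simp: plane_iso_rel_def plane_iso_iff)
    hence "plane_iso_rel n `` {P} = plane_iso_rel n `` {P'}" using equiv_class_eq[OF equiv_plane_iso_rel] by blast
    thus ?thesis using unrooted_class(3)[of U n P'] U P' by simp
  qed
  ultimately show ?thesis by (intro ex1I) auto
qed

lemma finite_nodes [simp]: "finite {t. nodes t = n}"
proof (rule finite_imageD[of "\<lambda>t. [t]"])
  have "(\<lambda>t. [t]) ` {t. nodes t = n} \<subseteq> forests 1 n" by (auto simp: forests_def)
  thus "finite ((\<lambda>t. [t]) ` {t. nodes t = n})" using finite_forests finite_subset by blast
qed (auto simp: inj_on_def)

lemma finite_codes: "U \<in> unrooted_plane_trees n \<Longrightarrow> finite (codes U)"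
  by (rule finite_subset[OF _ finite_nodes[of n]]) (auto dest: codes_nodes)

lemma finite_unrooted_plane_trees [simp]: "finite (unrooted_plane_trees n)"
proof (rule finite_imageD[of "\<lambda>U. SOME t. t \<in> codes U"])
  have some: "(SOME t. t \<in> codes U) \<in> codes U" if "U \<in> unrooted_plane_trees n" for U
    using codes_ne[OF that] by (simp add: some_in_eq)
  have "(\<lambda>U. SOME t. t \<in> codes U) ` unrooted_plane_trees n \<subseteq> {t. nodes t = n}"
    using some codes_nodes(1) by blast
  thus "finite ((\<lambda>U. SOME t. t \<in> codes U) ` unrooted_plane_trees n)" by (rule finite_subset) simp
  show "inj_on (\<lambda>U. SOME t. t \<in> codes U) (unrooted_plane_trees n)"
  proof (rule inj_onI)
    fix U V assume UV: "U \<in> unrooted_plane_trees n" "V \<in> unrooted_plane_trees n"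
      "(SOME t. t \<in> codes U) = (SOME t. t \<in> codes V)"
    hence "(SOME t. t \<in> codes U) \<in> codes U" "(SOME t. t \<in> codes U) \<in> codes V" using some by metis+
    thus "U = V" using UV codes_ex1 codes_nodes by metis
  qed
qed

lemma sum_codes:
  assumes "n \<ge> 2"
  shows "(\<Sum>U\<in>unrooted_plane_trees n. \<Sum>t\<in>codes U. F t) = (\<Sum>t | nodes t = n. F t)"
proof -
  have "(\<Sum>U\<in>unrooted_plane_trees n. \<Sum>t\<in>codes U. F t) = sum F (\<Union>U\<in>unrooted_plane_trees n. codes U)"
  proof (rule sum.UNION_disjoint[symmetric])
    show "\<forall>U\<in>unrooted_plane_trees n. \<forall>V\<in>unrooted_plane_trees n. U \<noteq> V \<longrightarrow> codes U \<inter> codes V = {}"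
    proof (intro ballI impI equals0I)
      fix U V t assume UV: "U \<in> unrooted_plane_trees n" "V \<in> unrooted_plane_trees n" "U \<noteq> V" "t \<in> codes U \<inter> codes V"
      hence "nodes t = n" using codes_nodes(1)[of U n t] by blast
      from codes_ex1[OF this assms] show False using UV by blast
    qed
  qed (auto simp: finite_codes)
  also have "(\<Union>U\<in>unrooted_plane_trees n. codes U) = {t. nodes t = n}"
  proof (intro equalityI subsetI)
    fix t assume "t \<in> (\<Union>U\<in>unrooted_plane_trees n. codes U)"
    thus "t \<in> {t. nodes t = n}" using codes_nodes(1) by auto
  next
    fix t assume "t \<in> {t. nodes t = n}"
    hence "nodes t = n" by simp
    from codes_ex1[OF this assms] show "t \<in> (\<Union>U\<in>unrooted_plane_trees n. codes U)" by blast
  qed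
  finally show ?thesis .
qed

lemma card_edges_planted_graph: "card (edges (planted_graph t)) = 2 * (nodes t - 1)"
proof -
  let ?V = "positions t - {[]}"
  let ?A = "(\<lambda>x. (butlast x, x)) ` ?V" and ?B = "(\<lambda>x. (x, butlast x)) ` ?V"
  have "edges (planted_graph t) = ?A \<union> ?B"
  proof (intro equalityI subsetI)
    fix e assume "e \<in> edges (planted_graph t)"
    thus "e \<in> ?A \<union> ?B" by (auto simp: planted_graph_def image_iff)
  next
    fix e assume "e \<in> ?A \<union> ?B"
    then obtain x where x: "x \<in> positions t" "x \<noteq> []" "e = (butlast x, x) \<or> e = (x, butlast x)" by blast
    moreover have "butlast x \<in> positions t" using positions_appendD[of "butlast x" "[last x]" t] x by simp
    moreover have "\<exists>i. x = butlast x @ [i]" using x(2) append_butlast_last_id by metis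
    ultimately show "e \<in> edges (planted_graph t)" by (auto simp: planted_graph_def)
  qed
  moreover have "?A \<inter> ?B = {}"
  proof -
    have "\<not> (x \<noteq> [] \<and> y \<noteq> [] \<and> butlast x = y \<and> x = butlast y)" for x y :: "nat list"
      by (metis append_butlast_last_id length_append_singleton length_butlast less_not_refl3 lessI Suc_lessD)
    thus ?thesis by auto
  qed
  moreover have "card ?A = card ?V" "card ?B = card ?V" by (rule card_image, simp add: inj_on_def)+
  moreover have "card ?V = nodes t - 1" by (simp add: card_positions)
  ultimately show ?thesis by (simp add: card_Un_disjoint)
qed

lemma finite_edges_planted_graph [simp]: "finite (edges (planted_graph t))"
  by (rule finite_subset[of _ "positions t \<times> positions t"]) (auto simp: planted_graph_def)

definition corner_code :: "planted_tree \<Rightarrow> nat list \<times> nat list \<Rightarrow> planted_tree" where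
  "corner_code t e = (SOME t'. \<exists>f. plane_iso_by f (plane_model t') (plane_model t) \<and> f [] = fst e \<and> f [0] = snd e)"

lemma corner_code:
  assumes "nodes t \<ge> 2" "e \<in> edges (planted_graph t)"
  shows "\<exists>f. plane_iso_by f (plane_model (corner_code t e)) (plane_model t) \<and> f [] = fst e \<and> f [0] = snd e"
  unfolding corner_code_def
  by (rule someI_ex) (use corner_code_exists[OF plane_tree_plane_model[OF assms(1)], of "fst e" "snd e"] assms in auto)

lemma iso_nodes: "plane_iso_by f (plane_model t) (plane_model t') \<Longrightarrow> nodes t = nodes t'"
  by (drule plane_iso_by_card_verts) (simp add: card_positions)

lemma plane_iso_by_inj:
  "plane_iso_by f (plane_model t) P \<Longrightarrow> x \<in> positions t \<Longrightarrow> y \<in> positions t \<Longrightarrow> f x = f y \<longleftrightarrow> x = y"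
  unfolding plane_iso_by_def graph_iso_by_def bij_betw_def by (auto dest: inj_onD)

lemma zero_in_positions: "nodes t \<ge> 2 \<Longrightarrow> [0] \<in> positions t"
  by (cases t) auto

lemma inv_into_iso [simp]:
  "plane_iso_by f (plane_model t) P \<Longrightarrow> x \<in> positions t \<Longrightarrow> inv_into (positions t) f (f x) = x"
  unfolding plane_iso_by_def graph_iso_by_def bij_betw_def by simp

text \<open>By rigidity, a code is determined by the corner of a fixed code \<open>t\<close> to which an isomorphism takes
  its root corner.\<close>

lemma corner_code_image:
  assumes U: "U \<in> unrooted_plane_trees n" and t: "t \<in> codes U"
  shows "codes U = corner_code t ` edges (planted_graph t)"
proof (intro equalityI subsetI)
  have n: "nodes t \<ge> 2" using codes_nodes[OF U t] by simp
  fix s assume s: "s \<in> codes U"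
  hence ns: "nodes s \<ge> 2" using codes_nodes[OF U] by simp
  obtain f where f: "plane_iso_by f (plane_model s) (plane_model t)" using codes_iso[OF U s t] by blast
  let ?e = "(f [], f [0])"
  have "([], [0]) \<in> edges (planted_graph s)"
    using zero_in_positions[OF ns] by (auto simp: planted_graph_def)
  hence e: "?e \<in> edges (planted_graph t)"
    using f zero_in_positions[OF ns] by (auto simp: plane_iso_by_def graph_iso_by_def)
  obtain g where g: "plane_iso_by g (plane_model (corner_code t ?e)) (plane_model t)" "g [] = f []" "g [0] = f [0]"
    using corner_code[OF n e] by auto
  have nc: "nodes (corner_code t ?e) \<ge> 2" using iso_nodes[OF g(1)] n by simp
  let ?h = "inv_into (positions s) f \<circ> g"
  have "plane_iso_by ?h (plane_model (corner_code t ?e)) (plane_model s)"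
    by (rule plane_iso_by_comp[OF g(1) plane_model_iso_inv[OF f]]) auto
  moreover have "?h [] = []" "?h [0] = [0]"
    using f zero_in_positions[OF ns] by (auto simp: g(2,3))
  ultimately have "corner_code t ?e = s" using plane_model_rigid(1) nc by blast
  thus "s \<in> corner_code t ` edges (planted_graph t)" using e by blast
next
  have n: "nodes t \<ge> 2" using codes_nodes[OF U t] by simp
  fix s assume "s \<in> corner_code t ` edges (planted_graph t)"
  then obtain e where "e \<in> edges (planted_graph t)" "s = corner_code t e" by blast
  thus "s \<in> codes U" using corner_code[OF n] codes_closed[OF t] by blast
qed

lemma card_codes_le:
  assumes U: "U \<in> unrooted_plane_trees n"
  shows "card (codes U) \<le> 2 * (n - 1)"
proof -
  obtain t where t: "t \<in> codes U" using codes_ne[OF U] by blast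
  have "card (codes U) \<le> card (edges (planted_graph t))"
    unfolding corner_code_image[OF U t] by (rule card_image_le) simp
  thus ?thesis using codes_nodes[OF U t] by (simp add: card_edges_planted_graph)
qed

text \<open>If there are fewer codes than corners, two corners have the same code, and the two isomorphisms
  with this code compose to an automorphism that takes one corner to the other.\<close>

lemma nontrivial_automorphism:
  assumes U: "U \<in> unrooted_plane_trees n" and less: "card (codes U) < 2 * (n - 1)"
  shows "\<exists>t\<in>codes U. \<exists>h. plane_iso_by h (plane_model t) (plane_model t) \<and> (h [], h [0]) \<noteq> ([], [0])"
proof -
  obtain t where t: "t \<in> codes U" using codes_ne[OF U] by blast
  have n: "nodes t = n" "nodes t \<ge> 2" using codes_nodes[OF U t] by auto
  have "\<not> inj_on (corner_code t) (edges (planted_graph t))"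
  proof
    assume "inj_on (corner_code t) (edges (planted_graph t))"
    hence "card (codes U) = 2 * (n - 1)"
      unfolding corner_code_image[OF U t] by (simp add: card_image card_edges_planted_graph n)
    thus False using less by simp
  qed
  then obtain e e' where e: "e \<in> edges (planted_graph t)" "e' \<in> edges (planted_graph t)" "e \<noteq> e'"
    "corner_code t e = corner_code t e'" by (auto simp: inj_on_def)
  define s where "s = corner_code t e"
  obtain f f' where f: "plane_iso_by f (plane_model s) (plane_model t)" "f [] = fst e" "f [0] = snd e"
    and f': "plane_iso_by f' (plane_model s) (plane_model t)" "f' [] = fst e'" "f' [0] = snd e'"
    using corner_code[OF n(2) e(1)] corner_code[OF n(2) e(2)] e(4) unfolding s_def by auto
  let ?h = "inv_into (positions s) f \<circ> f'"
  have ns: "nodes s \<ge> 2" using iso_nodes[OF f(1)] n by simp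
  have "plane_iso_by ?h (plane_model s) (plane_model s)"
    by (rule plane_iso_by_comp[OF f'(1) plane_model_iso_inv[OF f(1)]]) auto
  moreover have "(?h [], ?h [0]) \<noteq> ([], [0])"
  proof
    assume a: "(?h [], ?h [0]) = ([], [0])"
    have surj: "f ` positions s = positions t" "f' ` positions s = positions t"
      using f(1) f'(1) by (auto simp: plane_iso_by_def graph_iso_by_def bij_betw_def)
    have "f (?h x) = f' x" if "x \<in> positions s" for x
      using that surj by (auto intro!: f_inv_into_f)
    from this[of "[]"] this[of "[0]"] have "f' [] = f []" "f' [0] = f [0]"
      using a zero_in_positions[OF ns] by auto
    thus False using e(3) f f' by (simp add: prod_eq_iff)
  qed
  moreover have "s \<in> codes U" using codes_closed[OF t f(1)] .
  ultimately show ?thesis by blast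
qed

subsection \<open>Symmetric plane trees\<close>

text \<open>If no vertex is fixed, the root is mapped to a proper extension of itself. Let \<open>v\<close> be a longest
  word with this property, and \<open>c\<close> its child in the direction of \<open>h v\<close>. By maximality \<open>h c\<close> is not
  in the subtree of \<open>c\<close>, but it is adjacent to \<open>h v\<close>, which is. Hence \<open>h v = c\<close> and \<open>h c = v\<close>.\<close>

lemma automorphism_centre:
  assumes h: "graph_iso_by h (planted_graph t) (planted_graph t)"
  shows "(\<exists>v\<in>positions t. h v = v) \<or> (\<exists>v\<in>positions t. \<exists>c\<in>positions t. (v, c) \<in> edges (planted_graph t) \<and> h v = c \<and> h c = v)"
proof (rule disjCI)
  assume "\<not> (\<exists>v\<in>positions t. \<exists>c\<in>positions t. (v, c) \<in> edges (planted_graph t) \<and> h v = c \<and> h c = v)"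
  hence noflip: "\<And>v c. v \<in> positions t \<Longrightarrow> c \<in> positions t \<Longrightarrow> (v, c) \<in> edges (planted_graph t) \<Longrightarrow> h v = c \<Longrightarrow> h c \<noteq> v" by blast
  show "\<exists>v\<in>positions t. h v = v"
  proof (rule ccontr)
    assume "\<not> (\<exists>v\<in>positions t. h v = v)"
    hence nofix: "\<And>v. v \<in> positions t \<Longrightarrow> h v \<noteq> v" by blast
    have hV: "h v \<in> positions t" if "v \<in> positions t" for v
      using h that by (auto simp: graph_iso_by_def bij_betw_def)
    let ?S = "{v \<in> positions t. \<exists>y. y \<noteq> [] \<and> h v = v @ y}"
    have "[] \<in> ?S" using nofix[of "[]"] by simp
    moreover have "finite ?S" by simp
    ultimately have "Max (length ` ?S) \<in> length ` ?S" by (metis (no_types, lifting) Max_in finite_imageI image_is_empty empty_iff)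
    then obtain v0 where v0: "v0 \<in> ?S" "length v0 = Max (length ` ?S)" by (metis (no_types, lifting) imageE)
    hence "\<exists>v\<in>?S. \<forall>w\<in>?S. length w \<le> length v" using \<open>finite ?S\<close> by (intro bexI[of _ v0]) auto
    then obtain v where v: "v \<in> ?S" and max: "\<And>w. w \<in> ?S \<Longrightarrow> length w \<le> length v" by blast
    then obtain i y where hv: "h v = v @ i # y" by (auto simp: neq_Nil_conv)
    define c where "c = v @ [i]"
    have vp: "v \<in> positions t" using v by simp
    have cp: "c \<in> positions t" using hV[OF vp] positions_appendD[of c y t] by (simp add: hv c_def)
    have "c \<notin> ?S" using max[of c] by (auto simp: c_def)
    hence npre: "h c \<noteq> c @ z" for z using cp nofix[OF cp] by (cases "z = []") auto
    have "(v, c) \<in> edges (planted_graph t)" using vp cp by (auto simp: planted_graph_def c_def)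
    hence e: "(h v, h c) \<in> edges (planted_graph t)" using h vp cp by (auto simp: graph_iso_by_def)
    hence "(\<exists>j. h c = h v @ [j]) \<or> (\<exists>j. h v = h c @ [j])" by (auto simp: planted_graph_def)
    moreover have "h c \<noteq> h v @ [j]" for j using npre[of "y @ [j]"] by (simp add: hv c_def)
    ultimately obtain j where j: "h v = h c @ [j]" by blast
    have "y = []"
    proof (rule ccontr)
      assume "y \<noteq> []"
      hence "h c = c @ butlast y" using j unfolding hv c_def
        by (metis append.assoc append_Cons append_Nil butlast.simps(2) butlast_append butlast_snoc list.distinct(1))
      thus False using npre by blast
    qed
    hence hvc: "h v = c" by (simp add: hv c_def)
    hence "h c = v" using j by (simp add: c_def)
    with hvc show False using noflip[OF vp cp \<open>(v, c) \<in> edges (planted_graph t)\<close>] by blast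
  qed
qed

fun rotate_word :: "nat \<Rightarrow> nat \<Rightarrow> nat list \<Rightarrow> nat list" where
  "rotate_word a k [] = []"
| "rotate_word a k (i # x) = ((a + i) mod k) # x"

lemma rotate_iso:
  "plane_iso_by (rotate_word a (length ts)) (plane_model (Node (rotate a ts))) (plane_model (Node ts))"
proof (rule plane_iso_byI)
  let ?k = "length ts" and ?f = "rotate_word a (length ts)"
  have inj: "inj_on (\<lambda>i. (a + i) mod ?k) {..<?k}"
  proof (rule inj_onI)
    fix i j assume ij: "i \<in> {..<?k}" "j \<in> {..<?k}" "(a + i) mod ?k = (a + j) mod ?k"
    have "distinct (rotate a [0..<?k])" by simp
    moreover have "rotate a [0..<?k] ! i = (a + i) mod ?k" if "i < ?k" for i
      using that by (subst nth_rotate) (auto intro!: nth_upt[THEN trans] mod_less_divisor)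
    ultimately show "i = j" using ij by (metis length_rotate length_upt diff_zero lessThan_iff nth_eq_iff_index_eq)
  qed
  have lt: "(a + i) mod ?k < ?k" if "i < ?k" for i using that by (intro mod_less_divisor) auto
  have into: "?f v \<in> positions (Node ts)" if "v \<in> positions (Node (rotate a ts))" for v
    using that lt by (cases v) (auto simp: nth_rotate)
  have "inj_on ?f (positions (Node (rotate a ts)))"
  proof (rule inj_onI)
    fix v w assume "v \<in> positions (Node (rotate a ts))" "w \<in> positions (Node (rotate a ts))" "?f v = ?f w"
    thus "v = w" using inj by (cases v; cases w) (auto dest: inj_onD)
  qed
  moreover have "card (positions (Node (rotate a ts))) = card (positions (Node ts))"
    unfolding card_positions by (simp add: rotate_map[symmetric] rotate_drop_take add.commute
        flip: sum_list_append) (metis append_take_drop_id sum_list_append add.commute map_append)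
  ultimately have "bij_betw ?f (positions (Node (rotate a ts))) (positions (Node ts))"
    unfolding bij_betw_def using into card_image card_subset_eq[OF finite_positions, of _ "Node ts"]
    by (metis image_subsetI)
  thus "bij_betw ?f (verts (fst (plane_model (Node (rotate a ts))))) (verts (fst (plane_model (Node ts))))"
    by simp
  show "simple_graph (fst (plane_model (Node (rotate a ts))))" by simp
  fix v assume "v \<in> verts (fst (plane_model (Node (rotate a ts))))"
  hence v: "v \<in> positions (Node (rotate a ts))" by simp
  have "orders (plane_model (Node ts)) (?f v) (map ?f (nbr_list (Node (rotate a ts)) v))"
  proof (cases v)
    case Nil
    have "map ?f (nbr_list (Node (rotate a ts)) []) = rotate a (nbr_list (Node ts) [])"
      by (rule nth_equalityI) (auto simp: nbr_list_def nth_rotate lt)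
    thus ?thesis using orders_plane_model[of "Node ts" "[]"] Nil
      by (simp add: orders_def cyclic_list_rotate)
  next
    case (Cons i x)
    have out: "outdegree (Node ts) (?f v) = outdegree (Node (rotate a ts)) v"
      using v Cons lt by (simp add: nth_rotate)
    have "map ?f (nbr_list (Node (rotate a ts)) v) = nbr_list (Node ts) (?f v)"
      using v into[OF v] unfolding nbr_list_def out by (simp add: Cons)
    thus ?thesis using orders_plane_model by metis
  qed
  thus "\<exists>xs. orders (plane_model (Node (rotate a ts))) v xs \<and> orders (plane_model (Node ts)) (?f v) (map ?f xs)"
    using orders_plane_model by blast
qed

text \<open>Moving the root to the other end of the root edge exchanges the two trees that remain when this
  edge is deleted.\<close>

fun flip_word :: "nat list \<Rightarrow> nat list" where
  "flip_word [] = [0]"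
| "flip_word [0] = []"
| "flip_word (0 # j # x) = Suc j # x"
| "flip_word (Suc i # x) = 0 # i # x"

lemma flip_flip [simp]: "flip_word (flip_word v) = v"
  by (induction v rule: flip_word.induct) auto

lemma flip_in_positions:
  "v \<in> positions (Node (Node ts # us)) \<Longrightarrow> flip_word v \<in> positions (Node (Node us # ts))"
  by (induction v rule: flip_word.induct) auto

lemma flip_iso:
  "plane_iso_by flip_word (plane_model (Node (Node ts # us))) (plane_model (Node (Node us # ts)))"
proof (rule plane_iso_byI)
  show "bij_betw flip_word (verts (fst (plane_model (Node (Node ts # us))))) (verts (fst (plane_model (Node (Node us # ts)))))"
    by (rule bij_betw_byWitness[where f' = flip_word]) (auto intro: flip_in_positions)
  show "simple_graph (fst (plane_model (Node (Node ts # us))))" by simp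
  fix v assume "v \<in> verts (fst (plane_model (Node (Node ts # us))))"
  hence v: "v \<in> positions (Node (Node ts # us))" by simp
  have "map flip_word (nbr_list (Node (Node ts # us)) v) = nbr_list (Node (Node us # ts)) (flip_word v)"
  proof (cases v rule: flip_word.cases)
    case 1
    thus ?thesis by (simp add: nbr_list_def upt_conv_Cons map_Suc_upt[symmetric] comp_def del: upt_Suc)
  next
    case 2
    thus ?thesis by (simp add: nbr_list_def upt_conv_Cons map_Suc_upt[symmetric] comp_def del: upt_Suc)
  next
    case (3 j x)
    thus ?thesis using v flip_in_positions[OF v] by (cases "x = []") (simp_all add: nbr_list_def)
  next
    case (4 i x)
    thus ?thesis using v flip_in_positions[OF v] by (cases "x = []") (simp_all add: nbr_list_def)
  qed
  thus "\<exists>xs. orders (plane_model (Node (Node ts # us))) v xs \<and> orders (plane_model (Node (Node us # ts))) (flip_word v) (map flip_word xs)"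
    using orders_plane_model by metis
qed

text \<open>Codes in which a symmetry is visible at the root: flipping the root edge or rotating the children
  of the root does not change the tree.\<close>

definition symmetric_code :: "planted_tree \<Rightarrow> bool" where
  "symmetric_code t \<longleftrightarrow> (\<exists>ts. t = Node (Node ts # ts)) \<or>
     (\<exists>ts a. t = Node ts \<and> 0 < a \<and> a < length ts \<and> rotate a ts = ts)"

text \<open>The root is moved to the flipped edge or to the fixed vertex of the automorphism. By rigidity the
  automorphism then becomes an equation between a planted tree and its flipped or rotated version.\<close>

lemma symmetric_code_exists:
  assumes n: "nodes t \<ge> 2" and h: "plane_iso_by h (plane_model t) (plane_model t)"
    and nontriv: "(h [], h [0]) \<noteq> ([], [0])"
  shows "\<exists>s f. plane_iso_by f (plane_model s) (plane_model t) \<and> symmetric_code s"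
proof -
  have hV: "h x \<in> positions t" if "x \<in> positions t" for x
    using h that by (auto simp: plane_iso_by_def graph_iso_by_def bij_betw_def)
  have move: "\<exists>s f k. plane_iso_by f (plane_model s) (plane_model t) \<and> f [] = u \<and> f [0] = v \<and>
     plane_iso_by k (plane_model s) (plane_model s) \<and> (\<forall>x\<in>positions s. f (k x) = h (f x))"
    if uv: "(u, v) \<in> edges (planted_graph t)" for u v
  proof -
    have "\<exists>s f. plane_iso_by f (plane_model s) (plane_model t) \<and> f [] = u \<and> f [0] = v"
      by (rule corner_code_exists[OF plane_tree_plane_model[OF n]]) (simp_all add: uv)
    then obtain s f where f: "plane_iso_by f (plane_model s) (plane_model t)" "f [] = u" "f [0] = v"
      by blast
    let ?k = "(inv_into (positions s) f \<circ> h) \<circ> f"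
    have "plane_iso_by ?k (plane_model s) (plane_model s)"
      by (rule plane_iso_by_comp[OF f(1) plane_iso_by_comp[OF h plane_model_iso_inv[OF f(1)]]]) auto
    moreover have "f (?k x) = h (f x)" if "x \<in> positions s" for x
    proof -
      have "f ` positions s = positions t" using f(1) by (auto simp: plane_iso_by_def graph_iso_by_def bij_betw_def)
      hence "h (f x) \<in> f ` positions s" using that hV by auto
      thus ?thesis by (simp add: f_inv_into_f)
    qed
    ultimately show ?thesis using f by blast
  qed
  have "graph_iso_by h (planted_graph t) (planted_graph t)" using h by (simp add: plane_iso_by_def)
  from automorphism_centre[OF this] show ?thesis
  proof (elim disjE bexE conjE)
    fix v assume v: "v \<in> positions t" "h v = v"
    obtain u where "u \<in> set (nbr_list t v)" using nbr_list_ne[OF v(1) n] by (meson hd_in_set)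
    hence "(v, u) \<in> edges (planted_graph t)" by (simp add: edges_planted_graph)
    from move[OF this] obtain s f k where f: "plane_iso_by f (plane_model s) (plane_model t)" "f [] = v"
      and k: "plane_iso_by k (plane_model s) (plane_model s)" and fk: "\<And>x. x \<in> positions s \<Longrightarrow> f (k x) = h (f x)"
      by blast
    have ns: "nodes s \<ge> 2" using iso_nodes[OF f(1)] n by simp
    have z: "[0] \<in> positions s" using zero_in_positions[OF ns] .
    have kV: "k x \<in> positions s" if "x \<in> positions s" for x
      using k that by (auto simp: plane_iso_by_def graph_iso_by_def bij_betw_def)
    have "f (k []) = f []" using fk[of "[]"] f(2) v(2) by simp
    hence k0: "k [] = []" using plane_iso_by_inj[OF f(1)] kV by simp
    have "([], [0]) \<in> edges (planted_graph s)" using z by (auto simp: planted_graph_def)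
    hence "(k [], k [0]) \<in> edges (planted_graph s)" using k z by (auto simp: plane_iso_by_def graph_iso_by_def)
    then obtain a where a: "k [0] = [a]" by (auto simp: k0 planted_graph_def)
    obtain ts where s: "s = Node ts" by (cases s)
    have al: "a < length ts" using kV[OF z] a s by simp
    \<comment> \<open>an automorphism that fixes the root corner is trivial\<close>
    have "a \<noteq> 0"
    proof
      assume "a = 0"
      hence id: "k x = x" if "x \<in> positions s" for x
        using plane_model_rigid(2)[OF k k0 _ ns that] a by simp
      have "h y = y" if y: "y \<in> positions t" for y
      proof -
        have "positions t = f ` positions s" using f(1) by (auto simp: plane_iso_by_def graph_iso_by_def bij_betw_def)
        with y obtain x where "x \<in> positions s" "y = f x" by blast
        thus ?thesis using fk[of x] id by simp
      qed
      thus False using nontriv zero_in_positions[OF n] by simp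
    qed
    let ?R = "rotate_word a (length ts)"
    let ?r = "Node (rotate a ts)"
    have nr: "[] \<in> positions ?r" "[0] \<in> positions ?r" using al by auto
    have Ri: "plane_iso_by (inv_into (positions ?r) ?R) (plane_model s) (plane_model ?r)"
      unfolding s by (rule plane_model_iso_inv[OF rotate_iso]) simp
    have "plane_iso_by (inv_into (positions ?r) ?R \<circ> k) (plane_model s) (plane_model ?r)"
      by (rule plane_iso_by_comp[OF k Ri]) simp
    moreover have "inv_into (positions ?r) ?R [] = []"
      using inv_into_iso[OF rotate_iso[of a ts] nr(1)] by simp
    moreover have "inv_into (positions ?r) ?R [a] = [0]"
      using inv_into_iso[OF rotate_iso[of a ts] nr(2)] al by simp
    ultimately have "s = ?r" using plane_model_rigid(1)[of _ s ?r] ns k0 a by simp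
    hence "rotate a ts = ts" using s by simp
    hence "symmetric_code s" using al \<open>a \<noteq> 0\<close> s unfolding symmetric_code_def by blast
    thus ?thesis using f(1) by blast
  next
    fix v c assume v: "v \<in> positions t" "c \<in> positions t" "(v, c) \<in> edges (planted_graph t)" "h v = c" "h c = v"
    from move[OF v(3)] obtain s f k where f: "plane_iso_by f (plane_model s) (plane_model t)" "f [] = v" "f [0] = c"
      and k: "plane_iso_by k (plane_model s) (plane_model s)" and fk: "\<And>x. x \<in> positions s \<Longrightarrow> f (k x) = h (f x)"
      by blast
    have ns: "nodes s \<ge> 2" using iso_nodes[OF f(1)] n by simp
    have z: "[0] \<in> positions s" using zero_in_positions[OF ns] .
    have kV: "k x \<in> positions s" if "x \<in> positions s" for x
      using k that by (auto simp: plane_iso_by_def graph_iso_by_def bij_betw_def)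
    have "f (k []) = f [0]" "f (k [0]) = f []" using fk[of "[]"] fk[OF z] f v by auto
    hence k01: "k [] = [0]" "k [0] = []" using plane_iso_by_inj[OF f(1)] kV z by auto
    obtain ts us where s: "s = Node (Node ts # us)"
    proof -
      obtain r where "s = Node r" by (cases s)
      moreover from this z have "r \<noteq> []" by auto
      ultimately obtain t1 us where "s = Node (t1 # us)" by (cases r) auto
      with that show ?thesis by (cases t1) blast
    qed
    let ?r = "Node (Node us # ts)"
    have "plane_iso_by flip_word (plane_model s) (plane_model ?r)" unfolding s by (rule flip_iso)
    from plane_iso_by_comp[OF k this]
    have "plane_iso_by (flip_word \<circ> k) (plane_model s) (plane_model ?r)" by simp
    note rigid = plane_model_rigid(1)[OF this _ _ ns]
    have "s = ?r" by (rule rigid) (simp_all add: k01)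
    hence "us = ts" using s by (metis list.inject planted_tree.inject)
    hence "s = Node (Node ts # ts)" using s by simp
    hence "symmetric_code s" unfolding symmetric_code_def by blast
    thus ?thesis using f(1) by blast
  qed
qed

theorem card_codes_asymmetric:
  assumes U: "U \<in> unrooted_plane_trees n" and less: "card (codes U) < 2 * (n - 1)"
  shows "\<exists>t\<in>codes U. symmetric_code t"
proof -
  obtain t h where t: "t \<in> codes U" and h: "plane_iso_by h (plane_model t) (plane_model t)" "(h [], h [0]) \<noteq> ([], [0])"
    using nontrivial_automorphism[OF assms] by blast
  have "nodes t \<ge> 2" using codes_nodes[OF U t] by simp
  from symmetric_code_exists[OF this h] obtain s f
    where "plane_iso_by f (plane_model s) (plane_model t)" "symmetric_code s" by blast
  with codes_closed[OF t this(1)] show ?thesis by (intro bexI[of _ s])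
qed

section \<open>A local limit theorem by Fourier inversion\<close>

lemma pmf_nat_sums:
  fixes f :: "nat \<Rightarrow> 'a::{banach, second_countable_topology}"
  assumes "integrable (measure_pmf p) f"
  shows "(\<lambda>k. pmf p k *\<^sub>R f k) sums measure_pmf.expectation p f"
proof -
  have "integrable (count_space UNIV) (\<lambda>k. pmf p k *\<^sub>R f k)"
    using assms unfolding measure_pmf_eq_density by (subst (asm) integrable_density) auto
  moreover have "measure_pmf.expectation p f = integral\<^sup>L (count_space UNIV) (\<lambda>k. pmf p k *\<^sub>R f k)"
    unfolding measure_pmf_eq_density by (subst integral_density) auto
  ultimately show ?thesis using sums_integral_count_space_nat by metis
qed

lemma integrable_cis [simp]: "integrable (measure_pmf p) (\<lambda>k. cis (f k))"
  by (rule measure_pmf.integrable_const_bound[where B = 1]) auto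

lemma fps_power_sums:
  fixes a :: "nat \<Rightarrow> complex"
  assumes a: "summable (\<lambda>k. norm (a k))"
  shows "summable (\<lambda>N. norm (fps_nth (Abs_fps a ^ n) N))"
    and "norm z \<le> 1 \<Longrightarrow> (\<lambda>N. fps_nth (Abs_fps a ^ n) N * z ^ N) sums (\<Sum>k. a k * z ^ k) ^ n"
proof -
  have *: "summable (\<lambda>N. norm (fps_nth (Abs_fps a ^ n) N)) \<and>
    (\<forall>z. norm z \<le> 1 \<longrightarrow> (\<lambda>N. fps_nth (Abs_fps a ^ n) N * z ^ N) sums (\<Sum>k. a k * z ^ k) ^ n)"
  proof (induction n)
    case 0
    have "(\<lambda>N. fps_nth (Abs_fps a ^ 0) N * z ^ N) sums (\<Sum>N\<in>{0}. fps_nth (Abs_fps a ^ 0) N * z ^ N)" for z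
      by (rule sums_finite) auto
    moreover have "(\<lambda>N. norm (fps_nth (Abs_fps a ^ 0) N)) sums (\<Sum>N\<in>{0}. norm (fps_nth (Abs_fps a ^ 0) N))"
      by (rule sums_finite) auto
    ultimately show ?case by (auto simp: sums_iff)
  next
    case (Suc n)
    define c where "c = fps_nth (Abs_fps a ^ n)"
    have c: "summable (\<lambda>N. norm (c N))" using Suc by (simp add: c_def)
    have mult: "fps_nth (Abs_fps a ^ Suc n) N = (\<Sum>i\<le>N. a i * c (N - i))" for N
      by (simp add: fps_mult_nth c_def atLeast0AtMost)
    have "summable (\<lambda>N. norm (fps_nth (Abs_fps a ^ Suc n) N))"
    proof (rule summable_comparison_test', rule summable_Cauchy_product)
      show "summable (\<lambda>k. norm (norm (a k)))" "summable (\<lambda>k. norm (norm (c k)))" using a c by auto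
      show "norm (norm (fps_nth (Abs_fps a ^ Suc n) N)) \<le> (\<Sum>i\<le>N. norm (a i) * norm (c (N - i)))" if "N \<ge> 0" for N
        unfolding mult by (auto intro!: order.trans[OF norm_sum] sum_mono simp: norm_mult)
    qed
    moreover have "(\<lambda>N. fps_nth (Abs_fps a ^ Suc n) N * z ^ N) sums (\<Sum>k. a k * z ^ k) ^ Suc n"
      if z: "norm z \<le> 1" for z
    proof -
      have b: "norm (x * z ^ k) \<le> norm x" for x k
        using z by (simp add: norm_mult norm_power mult_left_le power_le_one)
      have 1: "summable (\<lambda>k. norm (a k * z ^ k))" "summable (\<lambda>k. norm (c k * z ^ k))"
        by (rule summable_comparison_test'[OF a], use b in simp, rule summable_comparison_test'[OF c], use b in simp)
      have "(\<Sum>i\<le>N. (a i * z ^ i) * (c (N - i) * z ^ (N - i))) = fps_nth (Abs_fps a ^ Suc n) N * z ^ N" for N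
        unfolding mult sum_distrib_right
        by (intro sum.cong refl) (simp add: mult.assoc mult.left_commute power_add[symmetric])
      moreover have "(\<Sum>k. c k * z ^ k) = (\<Sum>k. a k * z ^ k) ^ n"
        using Suc z by (simp add: c_def sums_iff)
      ultimately show ?thesis using Cauchy_product_sums[OF 1] by simp
    qed
    ultimately show ?case by blast
  qed
  show "summable (\<lambda>N. norm (fps_nth (Abs_fps a ^ n) N))" using * by blast
  show "norm z \<le> 1 \<Longrightarrow> (\<lambda>N. fps_nth (Abs_fps a ^ n) N * z ^ N) sums (\<Sum>k. a k * z ^ k) ^ n" using * by blast
qed

lemma fps_power_support:
  fixes a :: "nat \<Rightarrow> 'a::field_char_0"
  assumes "\<And>k. a k \<noteq> 0 \<Longrightarrow> d dvd k" "fps_nth (Abs_fps a ^ n) N \<noteq> 0"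
  shows "d dvd N"
  using assms(2)
proof (induction n arbitrary: N)
  case 0 thus ?case by (auto split: if_splits)
next
  case (Suc n)
  have "(\<Sum>i=0..N. a i * fps_nth (Abs_fps a ^ n) (N - i)) \<noteq> 0"
    using Suc.prems by (simp add: fps_mult_nth)
  then obtain i where i: "i \<le> N" "a i \<noteq> 0" "fps_nth (Abs_fps a ^ n) (N - i) \<noteq> 0"
    by (metis (no_types, lifting) mult_eq_0_iff sum.neutral atLeastAtMost_iff)
  have "d dvd i + (N - i)" using assms(1)[OF i(2)] Suc.IH[OF i(3)] by (rule dvd_add)
  thus ?case using i by simp
qed

lemma integral_cis_period:
  fixes d :: real and m :: int
  assumes "d > 0"
  shows "(LINT s|lborel. indicator {-pi/d..pi/d} s *\<^sub>R cis (d * m * s)) = (if m = 0 then of_real (2 * pi / d) else 0)"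
proof (cases "m = 0")
  case True
  have "(LINT s|lborel. indicator {-pi/d..pi/d} s *\<^sub>R (1::complex)) = of_real (pi / d) - of_real (- pi / d)"
    by (rule integral_FTC_atLeastAtMost) (use assms in \<open>auto intro!: derivative_eq_intros simp: field_simps\<close>)
  thus ?thesis using True by simp
next
  case False
  define c where "c = d * m"
  have c: "c \<noteq> 0" using assms False by (simp add: c_def)
  have "(LINT s|lborel. indicator {-pi/d..pi/d} s *\<^sub>R cis (c * s))
      = exp (\<i> * c * of_real (pi / d)) / (\<i> * c) - exp (\<i> * c * of_real (- pi / d)) / (\<i> * c)"
  proof (rule integral_FTC_atLeastAtMost)
    show "- pi / d \<le> pi / d" using assms by simp
    show "continuous_on {- pi / d..pi / d} (\<lambda>s. cis (c * s))"
      unfolding cis_conv_exp by (intro continuous_intros)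
    fix s
    have 1: "((\<lambda>z. exp (\<i> * c * z) / (\<i> * c)) has_field_derivative cis (c * s)) (at (of_real s))"
      using c by (auto intro!: derivative_eq_intros simp: cis_conv_exp mult.assoc)
    show "((\<lambda>s. exp (\<i> * c * of_real s) / (\<i> * c)) has_vector_derivative cis (c * s)) (at s within {- pi / d..pi / d})"
      by (rule has_vector_derivative_real_field[OF 1])
  qed
  also have "exp (\<i> * c * of_real (pi / d)) = cis (pi * m)"
    using assms by (simp add: cis_conv_exp c_def field_simps)
  also have "exp (\<i> * c * of_real (- pi / d)) = cis (- (pi * m))"
    using assms by (simp add: cis_conv_exp c_def field_simps)
  also have "cis (pi * m) = cis (- (pi * m))"
    by (rule complex_eqI) (simp_all add: sin_npi_int)
  finally show ?thesis using False by (simp add: c_def)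
qed

text \<open>Fourier inversion. If \<open>d\<close> divides all exponents, the generating function on the unit circle has
  period \<open>2 \<pi> / d\<close>. Integrating over one period only is essential later on, since at its
  multiples the modulus of a characteristic function is one again.\<close>

lemma fps_power_coeff_integral:
  fixes a :: "nat \<Rightarrow> complex"
  assumes a: "summable (\<lambda>k. norm (a k))" and supp: "\<And>k. a k \<noteq> 0 \<Longrightarrow> d dvd k" and d: "d > 0" "d dvd M"
  shows "of_real (2 * pi / d) * fps_nth (Abs_fps a ^ n) M
    = (LINT s|lborel. indicator {-pi/d..pi/d} s *\<^sub>R ((\<Sum>k. a k * cis (s * k)) ^ n * cis (- s * M)))"
proof -
  define c where "c = fps_nth (Abs_fps a ^ n)"
  define B where "B = {-pi/d..pi/d}"
  have c: "summable (\<lambda>N. norm (c N))" unfolding c_def by (rule fps_power_sums(1)[OF a])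
  have int1: "integrable lborel (\<lambda>s. indicator B s *\<^sub>R (cis (x * s)))" for x
    unfolding B_def cis_conv_exp set_integrable_def[symmetric]
    by (rule borel_integrable_atLeastAtMost') (intro continuous_intros)
  have coeff: "(LINT s|lborel. indicator B s *\<^sub>R (c N * cis ((real N - real M) * s)))
      = (if N = M then of_real (2 * pi / d) * c M else 0)" for N
  proof (cases "c N = 0")
    case False
    hence "d dvd N" using fps_power_support[of a d n N] supp unfolding c_def by blast
    then obtain x y where xy: "N = d * x" "M = d * y" using d by blast
    have "(LINT s|lborel. indicator B s *\<^sub>R (c N * cis ((real N - real M) * s)))
        = c N * (LINT s|lborel. indicator B s *\<^sub>R (cis (real d * (int x - int y) * s)))"
      by (subst integral_mult_right_zero[symmetric]) (simp add: xy algebra_simps)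
    also have "\<dots> = c N * (if int x - int y = 0 then of_real (2 * pi / d) else 0)"
      unfolding B_def using integral_cis_period[of "real d" "int x - int y"] d by simp
    finally show ?thesis using d by (auto simp: xy)
  qed auto
  have "(\<lambda>N. LINT s|lborel. indicator B s *\<^sub>R (c N * cis ((real N - real M) * s)))
     sums (LINT s|lborel. (\<Sum>N. indicator B s *\<^sub>R (c N * cis ((real N - real M) * s))))"
  proof (rule sums_integral)
    show "integrable lborel (\<lambda>s. indicator B s *\<^sub>R (c N * cis ((real N - real M) * s)))" for N
      using integrable_mult_right[OF int1[of "real N - real M"], of "c N"] by (simp add: mult_ac)
    show "AE s in lborel. summable (\<lambda>N. norm (indicator B s *\<^sub>R (c N * cis ((real N - real M) * s))))"
      using c by (auto intro!: summable_mult simp: norm_mult)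
    have "(LINT s|lborel. norm (indicator B s *\<^sub>R (c N * cis ((real N - real M) * s)))) = norm (c N) * measure lborel B" for N
      by (simp add: norm_mult B_def)
    thus "summable (\<lambda>N. LINT s|lborel. norm (indicator B s *\<^sub>R (c N * cis ((real N - real M) * s))))"
      using c by (auto intro: summable_mult2)
  qed
  also have "(\<lambda>s. (\<Sum>N. indicator B s *\<^sub>R (c N * cis ((real N - real M) * s))))
      = (\<lambda>s. indicator B s *\<^sub>R ((\<Sum>k. a k * cis (s * k)) ^ n * cis (- s * M)))"
  proof
    fix s
    have "(\<lambda>N. c N * cis s ^ N) sums (\<Sum>k. a k * cis s ^ k) ^ n"
      unfolding c_def by (rule fps_power_sums(2)[OF a]) simp
    moreover have "cis s ^ k = cis (s * real k)" for k by (simp add: Complex.DeMoivre mult.commute)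
    ultimately have "(\<lambda>N. c N * cis (s * N)) sums (\<Sum>k. a k * cis (s * k)) ^ n"
      by (simp only:)
    from sums_scaleR_right[OF sums_mult2[OF this, of "cis (- s * M)"], of "indicator B s"]
    have "(\<lambda>N. indicator B s *\<^sub>R (c N * cis ((real N - real M) * s)))
        sums (indicator B s *\<^sub>R ((\<Sum>k. a k * cis (s * k)) ^ n * cis (- s * M)))"
      by (simp add: mult.assoc cis_mult algebra_simps)
    thus "(\<Sum>N. indicator B s *\<^sub>R (c N * cis ((real N - real M) * s)))
        = indicator B s *\<^sub>R ((\<Sum>k. a k * cis (s * k)) ^ n * cis (- s * M))" by (simp add: sums_iff)
  qed
  finally have "(\<lambda>N. if N = M then of_real (2 * pi / d) * c M else 0) sums
     (LINT s|lborel. indicator B s *\<^sub>R ((\<Sum>k. a k * cis (s * k)) ^ n * cis (- s * M)))"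
    unfolding coeff .
  moreover have "(\<lambda>N. if N = M then of_real (2 * pi / d) * c M else 0) sums (of_real (2 * pi / d) * c M)"
    using sums_single[of M "\<lambda>_. of_real (2 * pi / d) * c M"] by simp
  ultimately show ?thesis using sums_unique2 unfolding c_def B_def by blast
qed

text \<open>The central limit theorem for characteristic functions, here the pointwise limit of the
  integrand. As only second moments are assumed, the Taylor remainder is bounded by a minimum of
  a quadratic and a cubic term, to which dominated convergence applies.\<close>

lemma characteristic_power_tendsto:
  fixes Z :: "nat \<Rightarrow> real"
  assumes sq: "integrable (measure_pmf p) (\<lambda>k. (Z k)\<^sup>2)" and mean: "measure_pmf.expectation p Z = 0"
  shows "(\<lambda>n. (measure_pmf.expectation p (\<lambda>k. cis (Z k / sqrt n))) ^ n)
    \<longlonglongrightarrow> of_real (exp (- measure_pmf.expectation p (\<lambda>k. (Z k)\<^sup>2) / 2))"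
proof -
  define v where "v = measure_pmf.expectation p (\<lambda>k. (Z k)\<^sup>2)"
  define \<psi> where "\<psi> n = measure_pmf.expectation p (\<lambda>k. cis (Z k / sqrt (real n)))" for n
  define \<mu> where "\<mu> = distr (measure_pmf p) borel Z"
  have v0: "v \<ge> 0" unfolding v_def by simp
  have intZ: "integrable (measure_pmf p) Z"
    by (rule measure_pmf.square_integrable_imp_integrable[OF _ sq]) simp
  have \<psi>_char: "\<psi> n = char \<mu> (1 / sqrt (real n))" for n
    unfolding \<psi>_def \<mu>_def char_def by (subst integral_distr) (auto simp: cis_conv_exp)
  have \<psi>1: "norm (\<psi> n) \<le> 1" for n
    unfolding \<psi>_def by (rule order.trans[OF integral_norm_bound]) simp
  have main: "\<forall>\<^sub>F n in sequentially. norm (\<psi> n ^ n - of_real ((1 + (- v / 2) / n) ^ n))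
      \<le> 1 / 6 * measure_pmf.expectation p (\<lambda>k. min (6 * (Z k)\<^sup>2) (\<bar>1 / sqrt (real n)\<bar> * \<bar>Z k\<bar> ^ 3))"
  proof (rule eventually_sequentiallyI)
    fix n assume "n \<ge> nat (ceiling v) + 1"
    hence n: "n > 0" "real n \<ge> v" by linarith+
    have "norm (\<psi> n - (1 - (1 / sqrt (real n))\<^sup>2 * v / 2))
        \<le> (1 / sqrt (real n))\<^sup>2 / 6 * measure_pmf.expectation p (\<lambda>k. min (6 * (Z k)\<^sup>2) (\<bar>1 / sqrt (real n)\<bar> * \<bar>Z k\<bar> ^ 3))"
      unfolding \<psi>_char by (rule prob_space.char_approx3'[OF measure_pmf.prob_space_axioms _ intZ sq mean _ \<mu>_def]) (auto simp: mean v_def)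
    also have "(1 / sqrt (real n))\<^sup>2 = 1 / n" using n by (simp add: power_divide)
    finally have *: "norm (\<psi> n - of_real (1 + (- v / 2) / n))
       \<le> 1 / n / 6 * measure_pmf.expectation p (\<lambda>k. min (6 * (Z k)\<^sup>2) (\<bar>1 / sqrt (real n)\<bar> * \<bar>Z k\<bar> ^ 3))"
      by (simp add: mult.commute)
    have "norm (\<psi> n ^ n - of_real (1 + (- v / 2) / n) ^ n) \<le> n * norm (\<psi> n - of_real (1 + (- v / 2) / n))"
    proof (rule norm_power_diff[OF \<psi>1])
      have "v / n \<le> 1" "v / n \<ge> 0" using n v0 by auto
      hence "\<bar>1 + (- v / 2) / n\<bar> \<le> 1" by (simp add: abs_le_iff)
      thus "norm (complex_of_real (1 + (- v / 2) / n)) \<le> 1" by (simp only: norm_of_real)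
    qed
    also have "\<dots> \<le> n * (1 / n / 6 * measure_pmf.expectation p (\<lambda>k. min (6 * (Z k)\<^sup>2) (\<bar>1 / sqrt (real n)\<bar> * \<bar>Z k\<bar> ^ 3)))"
      by (rule mult_left_mono[OF *]) simp
    finally show "norm (\<psi> n ^ n - of_real ((1 + (- v / 2) / n) ^ n))
      \<le> 1 / 6 * measure_pmf.expectation p (\<lambda>k. min (6 * (Z k)\<^sup>2) (\<bar>1 / sqrt (real n)\<bar> * \<bar>Z k\<bar> ^ 3))"
      using n by simp
  qed
  have "(\<lambda>n. min (6 * x\<^sup>2) (\<bar>1 / sqrt (real n)\<bar> * \<bar>x\<bar> ^ 3)) \<longlonglongrightarrow> 0" for x :: real
  proof (rule tendsto_sandwich[OF _ _ tendsto_const])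
    have "(\<lambda>n. 1 / sqrt (real n)) \<longlonglongrightarrow> 0" by real_asymp
    from tendsto_mult_left_zero[OF tendsto_rabs_zero[OF this]]
    show "(\<lambda>n. \<bar>1 / sqrt (real n)\<bar> * \<bar>x\<bar> ^ 3) \<longlonglongrightarrow> 0" .
  qed auto
  hence "(\<lambda>n. measure_pmf.expectation p (\<lambda>k. min (6 * (Z k)\<^sup>2) (\<bar>1 / sqrt (real n)\<bar> * \<bar>Z k\<bar> ^ 3)))
      \<longlonglongrightarrow> measure_pmf.expectation p (\<lambda>k. 0)"
    by (intro integral_dominated_convergence[where w = "\<lambda>k. 6 * (Z k)\<^sup>2"]) (use sq in auto)
  hence "(\<lambda>n. 1 / 6 * measure_pmf.expectation p (\<lambda>k. min (6 * (Z k)\<^sup>2) (\<bar>1 / sqrt (real n)\<bar> * \<bar>Z k\<bar> ^ 3))) \<longlonglongrightarrow> 0"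
    by (simp only: integral_zero tendsto_mult_right_zero)
  from Lim_null_comparison[OF main this]
  have "(\<lambda>n. \<psi> n ^ n - of_real ((1 + (- v / 2) / n) ^ n)) \<longlonglongrightarrow> 0" .
  moreover have "(\<lambda>n. complex_of_real ((1 + (- v / 2) / n) ^ n)) \<longlonglongrightarrow> of_real (exp (- v / 2))"
    by (intro tendsto_of_real tendsto_exp_limit_sequentially)
  ultimately have "(\<lambda>n. \<psi> n ^ n) \<longlonglongrightarrow> of_real (exp (- v / 2))" by (rule Lim_transform[rotated])
  thus ?thesis by (simp add: \<psi>_def v_def)
qed

subsection \<open>Decay of the characteristic function\<close>

text \<open>Two atoms with different phases keep the modulus of a characteristic function away from one.\<close>

lemma norm_two_atoms_le:
  assumes "a \<ge> 0" "b \<ge> 0" "a + b \<le> 1"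
  shows "norm (of_real a * cis x + of_real b * cis y) \<le> a + b - a * b * (1 - cos (y - x))"
proof (rule power2_le_imp_le)
  define w where "w = a * b * (1 - cos (y - x))"
  have w0: "w \<ge> 0" using assms by (simp add: w_def)
  have "1 - cos (y - x) \<le> 2" using cos_ge_minus_one[of "y - x"] by linarith
  hence "w \<le> a * b * 2" unfolding w_def using assms by (intro mult_left_mono) auto
  also have "a * b * 2 \<le> (a + b)\<^sup>2" by (simp add: power2_eq_square algebra_simps)
  also have "\<dots> \<le> a + b" using assms by (simp add: power2_eq_square mult_left_le)
  finally show "0 \<le> a + b - a * b * (1 - cos (y - x))" by (simp add: w_def)
  have "(norm (of_real a * cis x + of_real b * cis y))\<^sup>2
      = (a * cos x + b * cos y)\<^sup>2 + (a * sin x + b * sin y)\<^sup>2"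
    by (simp add: cmod_power2)
  also have "\<dots> = a\<^sup>2 * ((sin x)\<^sup>2 + (cos x)\<^sup>2) + b\<^sup>2 * ((sin y)\<^sup>2 + (cos y)\<^sup>2) + 2 * a * b * cos (y - x)"
    unfolding cos_diff by algebra
  also have "\<dots> = (a + b)\<^sup>2 - 2 * w" by (simp add: w_def power2_eq_square algebra_simps)
  also have "\<dots> \<le> (a + b)\<^sup>2 - 2 * (a + b) * w"
    using mult_right_mono[OF assms(3) w0] by (simp add: algebra_simps)
  also have "\<dots> \<le> (a + b - w)\<^sup>2" by (simp add: power2_eq_square algebra_simps)
  finally show "(norm (of_real a * cis x + of_real b * cis y))\<^sup>2 \<le> (a + b - a * b * (1 - cos (y - x)))\<^sup>2"
    by (simp add: w_def)
qed

lemma norm_characteristic_le: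
  assumes "k \<noteq> (0::nat)"
  shows "norm (measure_pmf.expectation p (\<lambda>i. cis (f i))) \<le> 1 - pmf p 0 * pmf p k * (1 - cos (f k - f 0))"
proof -
  let ?A = "{0, k}"
  have i1: "integrable (measure_pmf p) (\<lambda>i. indicator ?A i *\<^sub>R cis (f i))"
    and i2: "integrable (measure_pmf p) (\<lambda>i. indicator (- ?A) i *\<^sub>R cis (f i))"
    by (rule measure_pmf.integrable_const_bound[where B = 1]; auto simp: indicator_def)+
  have "measure_pmf.expectation p (\<lambda>i. cis (f i))
      = measure_pmf.expectation p (\<lambda>i. indicator ?A i *\<^sub>R cis (f i) + indicator (- ?A) i *\<^sub>R cis (f i))"
    by (intro Bochner_Integration.integral_cong) (auto simp: indicator_def)
  also have "\<dots> = measure_pmf.expectation p (\<lambda>i. indicator ?A i *\<^sub>R cis (f i))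
      + measure_pmf.expectation p (\<lambda>i. indicator (- ?A) i *\<^sub>R cis (f i))"
    by (rule Bochner_Integration.integral_add[OF i1 i2])
  also have "measure_pmf.expectation p (\<lambda>i. indicator ?A i *\<^sub>R cis (f i))
      = (\<Sum>i\<in>?A. pmf p i *\<^sub>R (indicator ?A i *\<^sub>R cis (f i)))"
    by (rule integral_measure_pmf) (auto simp: indicator_def split: if_splits)
  also have "\<dots> = of_real (pmf p 0) * cis (f 0) + of_real (pmf p k) * cis (f k)"
    using assms by (simp add: scaleR_conv_of_real)
  finally have "norm (measure_pmf.expectation p (\<lambda>i. cis (f i)))
      \<le> norm (of_real (pmf p 0) * cis (f 0) + of_real (pmf p k) * cis (f k))
        + norm (measure_pmf.expectation p (\<lambda>i. indicator (- ?A) i *\<^sub>R cis (f i)))"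
    by (metis norm_triangle_ineq)
  also have "norm (measure_pmf.expectation p (\<lambda>i. indicator (- ?A) i *\<^sub>R cis (f i)))
      \<le> measure_pmf.expectation p (\<lambda>i. norm (indicator (- ?A) i *\<^sub>R cis (f i)))"
    by (rule integral_norm_bound)
  also have "(\<lambda>i. norm (indicator (- ?A) i *\<^sub>R cis (f i))) = (\<lambda>i. indicator (- ?A) i)"
    by (auto simp: indicator_def)
  also have "measure_pmf.expectation p (indicator (- ?A)) = 1 - measure_pmf.prob p ?A"
    using measure_pmf.prob_compl[of ?A p] by (simp add: Compl_eq_Diff_UNIV)
  also have pA: "measure_pmf.prob p ?A = pmf p 0 + pmf p k"
    using assms by (simp add: measure_measure_pmf_finite)
  also have "norm (of_real (pmf p 0) * cis (f 0) + of_real (pmf p k) * cis (f k))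
      \<le> pmf p 0 + pmf p k - pmf p 0 * pmf p k * (1 - cos (f k - f 0))"
    by (rule norm_two_atoms_le) (use pA measure_pmf.prob_le_1[of p ?A] in auto)
  finally show ?thesis by simp
qed

text \<open>The chord from \<open>1\<close> to \<open>cis u\<close> has squared length \<open>2 (1 - cos u)\<close>, so this is a triangle
  inequality. It shows that a small perturbation of the phase preserves the lower bound.\<close>

lemma one_minus_cos_add_ge: "1 - cos (u + e) \<ge> (1 - cos u) / 2 - e\<^sup>2 / 2" for u e :: real
proof -
  have n: "norm (cis x - 1) ^ 2 = 2 * (1 - cos x)" for x
  proof -
    have "norm (cis x - 1) ^ 2 = (cos x - 1)\<^sup>2 + (sin x)\<^sup>2" by (simp add: cmod_power2)
    also have "\<dots> = ((sin x)\<^sup>2 + (cos x)\<^sup>2) + 1 - 2 * cos x" by (simp only: power2_eq_square) (simp add: algebra_simps)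
    finally show ?thesis by simp
  qed
  have "cis u - 1 = cis (- e) * (cis (u + e) - 1) + (cis (- e) - 1)"
    by (simp add: algebra_simps cis_mult)
  hence "norm (cis u - 1) \<le> norm (cis (- e) * (cis (u + e) - 1)) + norm (cis (- e) - 1)"
    by (metis norm_triangle_ineq)
  hence "norm (cis u - 1) \<le> norm (cis (u + e) - 1) + norm (cis (- e) - 1)" by (simp add: norm_mult)
  hence "(norm (cis u - 1))\<^sup>2 \<le> (norm (cis (u + e) - 1) + norm (cis (- e) - 1))\<^sup>2"
    by (rule power_mono) simp
  also have "\<dots> \<le> 2 * (norm (cis (u + e) - 1))\<^sup>2 + 2 * (norm (cis (- e) - 1))\<^sup>2"
    using sum_squares_bound[of "norm (cis (u + e) - 1)" "norm (cis (- e) - 1)"]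
    by (simp add: power2_eq_square algebra_simps)
  finally have "2 * (1 - cos u) \<le> 4 * (1 - cos (u + e)) + 4 * (1 - cos e)" unfolding n by simp
  moreover have "1 - cos e \<le> e\<^sup>2 / 2"
  proof -
    have "1 - cos e = 2 * (sin (e / 2))\<^sup>2" using cos_double_sin[of "e / 2"] by simp
    also have "(sin (e / 2))\<^sup>2 \<le> (e / 2)\<^sup>2" using abs_sin_x_le_abs_x[of "e / 2"] by (simp only: abs_le_square_iff)
    finally show ?thesis by (simp add: power2_eq_square)
  qed
  moreover have "(1 - cos u) / 2 - E \<le> 1 - C" if "2 * (1 - cos u) \<le> 4 * (1 - C) + 4 * (1 - D)" "1 - D \<le> E" for C D E :: real
    using that by (simp add: field_simps)
  ultimately show ?thesis by blast
qed

lemma finite_subset_Gcd: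
  fixes S :: "nat set"
  assumes k: "k \<in> S" "k > 0"
  shows "\<exists>K\<subseteq>S. finite K \<and> K \<noteq> {} \<and> k \<in> K \<and> Gcd K = Gcd S"
proof -
  define P where "P g \<longleftrightarrow> (\<exists>K\<subseteq>S. finite K \<and> k \<in> K \<and> g = Gcd K)" for g
  have "P (Gcd {k})" unfolding P_def using k by (intro exI[of _ "{k}"]) auto
  hence "P (LEAST g. P g)" by (rule LeastI)
  then obtain K where K: "K \<subseteq> S" "finite K" "k \<in> K" "(LEAST g. P g) = Gcd K" unfolding P_def by blast
  have "Gcd K dvd x" if "x \<in> S" for x
  proof -
    have "P (Gcd (insert x K))" unfolding P_def using that K k by (intro exI[of _ "insert x K"]) auto
    hence "Gcd K \<le> Gcd (insert x K)" using K(4) Least_le[of P] by metis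
    moreover have "Gcd (insert x K) dvd Gcd K" by simp
    moreover have "Gcd K > 0" using K(3) k(2) by (metis Gcd_0_iff gr0I singletonD subset_singletonD empty_iff insertE subsetD)
    ultimately have "Gcd (insert x K) = Gcd K" by (meson dvd_imp_le le_antisym)
    thus ?thesis by (metis Gcd_dvd insertI1)
  qed
  hence "Gcd K dvd Gcd S" by (rule Gcd_greatest)
  moreover have "Gcd S dvd Gcd K" using K(1) by (meson Gcd_greatest Gcd_dvd subsetD)
  ultimately have "Gcd K = Gcd S" by (rule dvd_antisym)
  thus ?thesis using K by blast
qed

lemma Gcd_multiple_Ints:
  assumes "finite K" "\<And>k. k \<in> K \<Longrightarrow> x * real k \<in> \<int>"
  shows "x * real (Gcd K) \<in> \<int>"
  using assms
proof (induction K)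
  case (insert k K)
  have 1: "x * real k \<in> \<int>" "x * real (Gcd K) \<in> \<int>" using insert by auto
  obtain u v where uv: "u * int k + v * int (Gcd K) = gcd (int k) (int (Gcd K))" using bezout_int by blast
  have "real (Gcd (insert k K)) = real_of_int (gcd (int k) (int (Gcd K)))" by (simp add: gcd_int_int_eq)
  also have "\<dots> = of_int u * real k + of_int v * real (Gcd K)" unfolding uv[symmetric] by simp
  finally have "x * real (Gcd (insert k K)) = of_int u * (x * real k) + of_int v * (x * real (Gcd K))"
    by (simp add: algebra_simps)
  thus ?case using 1 by (simp add: Ints_add Ints_mult)
qed simp

text \<open>Near zero the sum is quadratic in \<open>s\<close>. Elsewhere it is bounded below by compactness, because at a
  common zero of all terms \<open>s d\<close> is a multiple of \<open>2 \<pi>\<close>.\<close>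

lemma sum_one_minus_cos_ge:
  fixes K :: "nat set"
  assumes K: "finite K" "k0 \<in> K" "k0 > 0" and d: "d = Gcd K"
  shows "\<exists>c>0. \<forall>s. \<bar>s\<bar> \<le> pi / d \<longrightarrow> (\<Sum>k\<in>K. 1 - cos (s * real k)) \<ge> c * s\<^sup>2"
proof -
  define h where "h s = (\<Sum>k\<in>K. 1 - cos (s * real k))" for s :: real
  have dpos: "d > 0" using K d by (metis Gcd_0_iff gr0I singletonD subset_singletonD empty_iff insertE subsetD)
  have hk: "1 - cos (s * real k) \<le> h s" if "k \<in> K" for s k
    unfolding h_def by (rule member_le_sum[OF that]) (use K in auto)
  have h0: "h s \<ge> 0" for s unfolding h_def by (intro sum_nonneg) simp
  have pos: "h s > 0" if s: "\<bar>s\<bar> \<le> pi / d" "s \<noteq> 0" for s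
  proof (rule ccontr)
    assume "\<not> h s > 0"
    hence "h s = 0" using h0[of s] by simp
    hence "cos (s * real k) = 1" if "k \<in> K" for k using hk[OF that, of s] cos_le_one[of "s * real k"] by linarith
    hence "s / (2 * pi) * real k \<in> \<int>" if "k \<in> K" for k
      using that cos_one_2pi_int[of "s * real k"] by (fastforce simp: field_simps Ints_def)
    hence "s / (2 * pi) * real d \<in> \<int>" unfolding d using K by (intro Gcd_multiple_Ints) auto
    then obtain m where m: "s / (2 * pi) * real d = of_int m" by (auto elim: Ints_cases)
    have "m \<noteq> 0" using m s dpos by auto
    hence "\<bar>s / (2 * pi) * real d\<bar> \<ge> 1" unfolding m by linarith
    moreover have "\<bar>s / (2 * pi) * real d\<bar> = \<bar>s\<bar> * d / (2 * pi)" by (simp add: abs_mult)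
    moreover have "\<bar>s\<bar> * d \<le> pi" using s dpos by (simp add: field_simps)
    ultimately show False using pi_gt_zero by (simp add: field_simps)
  qed
  have "((\<lambda>u::real. (1 - cos u) / u\<^sup>2) \<longlongrightarrow> 1 / 2) (at 0)" by real_asymp
  hence "eventually (\<lambda>u::real. (1 - cos u) / u\<^sup>2 > 1 / 4) (at 0)" by (rule order_tendstoD) simp
  then obtain \<delta> where \<delta>: "\<delta> > 0" "\<And>u::real. u \<noteq> 0 \<Longrightarrow> \<bar>u\<bar> < \<delta> \<Longrightarrow> (1 - cos u) / u\<^sup>2 > 1 / 4"
    unfolding eventually_at by (auto simp: dist_real_def)
  define e where "e = \<delta> / (2 * k0)"
  have e: "e > 0" using \<delta> K by (simp add: e_def)
  have near: "h s \<ge> real k0 ^ 2 / 4 * s\<^sup>2" if "\<bar>s\<bar> \<le> e" for s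
  proof (cases "s = 0")
    case False
    have "\<bar>s * real k0\<bar> \<le> e * real k0" using that by (simp add: abs_mult mult_right_mono)
    also have "\<dots> < \<delta>" using \<delta> K by (simp add: e_def)
    finally have "(1 - cos (s * real k0)) / (s * real k0)\<^sup>2 > 1 / 4" using False K by (intro \<delta>) auto
    hence "1 - cos (s * real k0) > 1 / 4 * (s * real k0)\<^sup>2" using False K by (simp add: field_simps)
    thus ?thesis using hk[OF K(2), of s] by (simp add: power_mult_distrib mult.commute)
  qed (simp add: h0)
  define A where "A = {s. e \<le> \<bar>s\<bar> \<and> \<bar>s\<bar> \<le> pi / d}"
  have "\<exists>m>0. \<forall>s\<in>A. h s \<ge> m"
  proof (cases "A = {}")
    case False
    have "A = {- pi / d..- e} \<union> {e..pi / d}" using e by (auto simp: A_def abs_if)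
    hence "compact A" by (simp add: compact_Un)
    moreover have "continuous_on A h" unfolding h_def by (intro continuous_intros)
    ultimately obtain x where x: "x \<in> A" "\<forall>s\<in>A. h x \<le> h s" using continuous_attains_inf[OF _ False] by blast
    have "h x > 0" using x(1) e by (intro pos) (auto simp: A_def)
    thus ?thesis using x by blast
  qed (auto intro: exI[of _ 1])
  then obtain m where m: "m > 0" "\<And>s. s \<in> A \<Longrightarrow> h s \<ge> m" by blast
  define c where "c = min (real k0 ^ 2 / 4) (m * d\<^sup>2 / pi\<^sup>2)"
  have "c > 0" using K m dpos by (simp add: c_def)
  moreover have "h s \<ge> c * s\<^sup>2" if s: "\<bar>s\<bar> \<le> pi / d" for s
  proof (cases "\<bar>s\<bar> \<le> e")
    case True
    have "c * s\<^sup>2 \<le> real k0 ^ 2 / 4 * s\<^sup>2" unfolding c_def by (rule mult_right_mono[OF min.cobounded1]) simp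
    thus ?thesis using near[OF True] by simp
  next
    case False
    have "s\<^sup>2 \<le> (pi / d)\<^sup>2" using s by (metis abs_ge_zero power2_abs power_mono)
    hence "c * s\<^sup>2 \<le> m * d\<^sup>2 / pi\<^sup>2 * (pi / d)\<^sup>2"
      by (intro mult_mono) (use m in \<open>auto simp: c_def\<close>)
    also have "\<dots> = m" using dpos by (simp add: field_simps)
    also have "m \<le> h s" using False s by (intro m(2)) (auto simp: A_def)
    finally show ?thesis .
  qed
  ultimately show ?thesis unfolding h_def by blast
qed

lemma integrable_gaussian: "c > 0 \<Longrightarrow> integrable lborel (\<lambda>x::real. exp (- c * x\<^sup>2))"
proof -
  assume c: "c > 0"
  define \<sigma> where "\<sigma> = 1 / sqrt (2 * c)"
  have s: "\<sigma> > 0" "\<sigma>\<^sup>2 = 1 / (2 * c)" using c by (auto simp: \<sigma>_def power_divide)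
  have "integrable lborel (\<lambda>x. sqrt (2 * pi * \<sigma>\<^sup>2) * normal_density 0 \<sigma> x)" using s by simp
  also have "(\<lambda>x. sqrt (2 * pi * \<sigma>\<^sup>2) * normal_density 0 \<sigma> x) = (\<lambda>x. exp (- c * x\<^sup>2))"
    using s c by (auto simp: normal_density_def fun_eq_iff field_simps)
  finally show ?thesis .
qed

locale critical_offspring =
  fixes p :: "nat pmf"
  assumes mean_one: "measure_pmf.expectation p real = 1"
    and square_integrable: "integrable (measure_pmf p) (\<lambda>k. (real k - 1)\<^sup>2)"
    and pmf_0_pos: "pmf p 0 > 0"
    and pmf_ge_2_pos: "\<exists>k\<ge>2. pmf p k > 0"
begin

definition span :: nat where "span = Gcd {k. pmf p k > 0}"

definition var :: real where "var = measure_pmf.expectation p (\<lambda>k. (real k - 1)\<^sup>2)"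

text \<open>The residual variance of the indicator of \<open>\<xi> = j\<close> after linear regression on \<open>\<xi>\<close>.\<close>

definition count_var :: "nat \<Rightarrow> real" where
  "count_var j = pmf p j * (1 - pmf p j) - (pmf p j * (real j - 1))\<^sup>2 / var"

text \<open>Marking the vertices with \<open>j\<close> children by a phase turns weights of trees into characteristic
  functions of the number of these vertices.\<close>

definition tilt :: "nat \<Rightarrow> real \<Rightarrow> nat \<Rightarrow> complex" where
  "tilt j \<theta> k = of_real (pmf p k) * (if k = j then cis \<theta> else 1)"

text \<open>The centred exponent in the joint characteristic function of the marker \<open>\<xi> = j\<close> and the step
  \<open>\<xi> - 1\<close> of the depth-first walk.\<close>

definition centred :: "nat \<Rightarrow> real \<Rightarrow> real \<Rightarrow> nat \<Rightarrow> real" where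
  "centred j \<theta> x k = \<theta> * (of_bool (k = j) - pmf p j) + x * (real k - 1)"

lemma integrable_step [simp]: "integrable (measure_pmf p) (\<lambda>k. real k - 1)"
  by (rule measure_pmf.square_integrable_imp_integrable[OF _ square_integrable]) simp

lemma mean_zero: "measure_pmf.expectation p (\<lambda>k. real k - 1) = 0"
proof -
  have "integrable (measure_pmf p) (\<lambda>k. (real k - 1) + 1)" by (intro Bochner_Integration.integrable_add) auto
  hence "integrable (measure_pmf p) real" by simp
  thus ?thesis by (subst Bochner_Integration.integral_diff) (auto simp: mean_one)
qed

lemma expectation_at:
  fixes g :: "nat \<Rightarrow> real"
  shows "integrable (measure_pmf p) (\<lambda>k. of_bool (k = j) * g k)"
    "measure_pmf.expectation p (\<lambda>k. of_bool (k = j) * g k) = pmf p j * g j"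
proof -
  show "integrable (measure_pmf p) (\<lambda>k. of_bool (k = j) * g k)"
    by (rule measure_pmf.integrable_const_bound[where B = "\<bar>g j\<bar>"]) auto
  have "measure_pmf.expectation p (\<lambda>k. of_bool (k = j) * g k) = (\<Sum>k\<in>{j}. pmf p k *\<^sub>R (of_bool (k = j) * g k))"
    by (rule integral_measure_pmf) (auto split: if_splits)
  thus "measure_pmf.expectation p (\<lambda>k. of_bool (k = j) * g k) = pmf p j * g j" by simp
qed

lemma var_pos: "var > 0"
proof -
  have "pmf p 0 = measure_pmf.expectation p (\<lambda>k. of_bool (k = 0) * 1)" by (subst expectation_at(2)) simp
  also have "\<dots> \<le> var" unfolding var_def
    by (rule integral_mono[OF expectation_at(1) square_integrable]) (auto simp: power2_eq_square)
  finally show ?thesis using pmf_0_pos by simp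
qed

lemma span_dvd: "pmf p k > 0 \<Longrightarrow> span dvd k"
  unfolding span_def by (rule Gcd_dvd) simp

lemma span_pos: "span > 0"
proof -
  obtain k where k: "k \<ge> 2" "pmf p k > 0" using pmf_ge_2_pos by blast
  thus ?thesis using span_dvd[OF k(2)] by (auto intro: Nat.gr0I)
qed

lemma centred_moments:
  "integrable (measure_pmf p) (\<lambda>k. (centred j \<theta> x k)\<^sup>2)"
  "measure_pmf.expectation p (centred j \<theta> x) = 0"
  "measure_pmf.expectation p (\<lambda>k. (centred j \<theta> x k)\<^sup>2)
     = \<theta>\<^sup>2 * (pmf p j * (1 - pmf p j)) + 2 * \<theta> * x * (pmf p j * (real j - 1)) + x\<^sup>2 * var"
proof -
  let ?q = "pmf p j"
  have eq: "(centred j \<theta> x k)\<^sup>2 = of_bool (k = j) * (\<theta>\<^sup>2 - 2 * \<theta>\<^sup>2 * ?q + 2 * \<theta> * x * (real k - 1))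
      + (x\<^sup>2 * (real k - 1)\<^sup>2 + (\<theta>\<^sup>2 * ?q\<^sup>2 - 2 * \<theta> * ?q * x * (real k - 1)))" for k
    by (simp add: centred_def power2_eq_square algebra_simps)
  have i: "integrable (measure_pmf p) (\<lambda>k. x\<^sup>2 * (real k - 1)\<^sup>2)"
    "integrable (measure_pmf p) (\<lambda>k. \<theta>\<^sup>2 * ?q\<^sup>2 - 2 * \<theta> * ?q * x * (real k - 1))"
    using square_integrable by auto
  note i' = Bochner_Integration.integrable_add[OF i]
  show "integrable (measure_pmf p) (\<lambda>k. (centred j \<theta> x k)\<^sup>2)"
    unfolding eq by (rule Bochner_Integration.integrable_add[OF expectation_at(1) i'])
  have "measure_pmf.expectation p (\<lambda>k. (centred j \<theta> x k)\<^sup>2)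
     = ?q * (\<theta>\<^sup>2 - 2 * \<theta>\<^sup>2 * ?q + 2 * \<theta> * x * (real j - 1))
      + (measure_pmf.expectation p (\<lambda>k. x\<^sup>2 * (real k - 1)\<^sup>2)
        + measure_pmf.expectation p (\<lambda>k. \<theta>\<^sup>2 * ?q\<^sup>2 - 2 * \<theta> * ?q * x * (real k - 1)))"
    unfolding eq Bochner_Integration.integral_add[OF expectation_at(1) i'] Bochner_Integration.integral_add[OF i]
      expectation_at(2) ..
  also have "measure_pmf.expectation p (\<lambda>k. \<theta>\<^sup>2 * ?q\<^sup>2 - 2 * \<theta> * ?q * x * (real k - 1)) = \<theta>\<^sup>2 * ?q\<^sup>2"
    by (subst Bochner_Integration.integral_diff) (auto simp: mean_zero)
  also have "measure_pmf.expectation p (\<lambda>k. x\<^sup>2 * (real k - 1)\<^sup>2) = x\<^sup>2 * var" by (simp add: var_def)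
  finally show "measure_pmf.expectation p (\<lambda>k. (centred j \<theta> x k)\<^sup>2)
     = \<theta>\<^sup>2 * (pmf p j * (1 - pmf p j)) + 2 * \<theta> * x * (pmf p j * (real j - 1)) + x\<^sup>2 * var"
    by (simp add: power2_eq_square algebra_simps)
  have "measure_pmf.expectation p (centred j \<theta> x)
      = measure_pmf.expectation p (\<lambda>k. of_bool (k = j) * \<theta> + (x * (real k - 1) - \<theta> * ?q))"
    by (intro Bochner_Integration.integral_cong) (auto simp: centred_def algebra_simps)
  also have "\<dots> = ?q * \<theta> + measure_pmf.expectation p (\<lambda>k. x * (real k - 1) - \<theta> * ?q)"
  proof -
    have "integrable (measure_pmf p) (\<lambda>k. x * (real k - 1) - \<theta> * ?q)" by simp
    from Bochner_Integration.integral_add[OF expectation_at(1) this] show ?thesis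
      unfolding expectation_at(2) .
  qed
  also have "measure_pmf.expectation p (\<lambda>k. x * (real k - 1) - \<theta> * ?q) = - (\<theta> * ?q)"
    by (subst Bochner_Integration.integral_diff) (auto simp: mean_zero)
  finally show "measure_pmf.expectation p (centred j \<theta> x) = 0" by simp
qed

text \<open>This dominates the Fourier integrand. The bounds by two atoms, averaged over finitely many atoms
  that generate the span, give a factor of at most \<open>1 - c s\<^sup>2\<close> on a whole period. The marker
  perturbs the phases by \<open>O(1 / sqrt n)\<close>, which costs only a constant factor after \<open>n\<close> steps.\<close>

lemma characteristic_decay:
  "\<exists>c>0. \<forall>n x. n > 0 \<and> \<bar>x\<bar> \<le> pi * sqrt n / span \<longrightarrow>
     norm (measure_pmf.expectation p (\<lambda>k. cis (centred j \<theta> x k / sqrt n)) ^ n) \<le> exp (\<theta>\<^sup>2) * exp (- c * x\<^sup>2)"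
proof -
  define S where "S = {k. pmf p k > 0}"
  obtain k0 where k0: "k0 \<in> S" "k0 > 0" using pmf_ge_2_pos by (force simp: S_def)
  obtain K where K: "K \<subseteq> S" "finite K" "k0 \<in> K" "Gcd K = Gcd S"
    using finite_subset_Gcd[OF k0] by blast
  obtain c where c: "c > 0" "\<And>s. \<bar>s\<bar> \<le> pi / span \<Longrightarrow> (\<Sum>k\<in>K. 1 - cos (s * real k)) \<ge> c * s\<^sup>2"
    using sum_one_minus_cos_ge[OF K(2,3) k0(2), of span] K(4) unfolding span_def S_def by auto
  define K' where "K' = K - {0}"
  have K': "finite K'" "K' \<noteq> {}" "\<And>k. k \<in> K' \<Longrightarrow> k \<noteq> 0 \<and> pmf p k > 0"
    using K k0 by (auto simp: K'_def S_def)
  have sumK': "(\<Sum>k\<in>K. 1 - cos (s * real k)) = (\<Sum>k\<in>K'. 1 - cos (s * real k))" for s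
    unfolding K'_def by (rule sum.mono_neutral_right) (use K in auto)
  define b where "b = Min ((\<lambda>k. pmf p 0 * pmf p k) ` K')"
  have b: "b > 0" "\<And>k. k \<in> K' \<Longrightarrow> b \<le> pmf p 0 * pmf p k"
    unfolding b_def using K' pmf_0_pos by (auto intro!: Min_le)
  have b1: "b \<le> 1"
  proof -
    obtain k where "k \<in> K'" using K' by blast
    thus ?thesis using b(2)[of k] mult_le_one[of "pmf p 0" "pmf p k"] by (simp add: pmf_le_1)
  qed
  define m where "m = real (card K')"
  have m: "m > 0" using K' by (simp add: m_def card_gt_0_iff)
  define c' where "c' = b * c / (2 * m)"
  have "c' > 0" using b c m by (simp add: c'_def)
  moreover have "norm (measure_pmf.expectation p (\<lambda>k. cis (centred j \<theta> x k / sqrt n)) ^ n) \<le> exp (\<theta>\<^sup>2) * exp (- c' * x\<^sup>2)"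
    if n: "n > 0" and x: "\<bar>x\<bar> \<le> pi * sqrt n / span" for n :: nat and x
  proof -
    define s where "s = x / sqrt n"
    define e where "e k = \<theta> * (of_bool (k = j) - of_bool (0 = j)) / sqrt n" for k :: nat
    define N where "N = norm (measure_pmf.expectation p (\<lambda>k. cis (centred j \<theta> x k / sqrt n)))"
    have s: "\<bar>s\<bar> \<le> pi / span" using x n by (simp add: s_def field_simps)
    have x2: "x\<^sup>2 = n * s\<^sup>2" using n by (simp add: s_def power_divide)
    have e2: "(e k)\<^sup>2 \<le> \<theta>\<^sup>2 / n" for k
      using n by (auto simp: e_def power_mult_distrib power_divide of_bool_def)
    have bound: "N \<le> 1 - b * ((1 - cos (s * real k)) / 2 - \<theta>\<^sup>2 / n / 2)" if k: "k \<in> K'" for k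
    proof -
      have diff: "centred j \<theta> x k / sqrt n - centred j \<theta> x 0 / sqrt n = s * real k + e k"
        by (simp add: centred_def s_def e_def diff_divide_distrib add_divide_distrib algebra_simps)
      have "N \<le> 1 - pmf p 0 * pmf p k * (1 - cos (s * real k + e k))"
        unfolding N_def diff[symmetric] by (rule norm_characteristic_le) (use K'(3)[OF k] in simp)
      also have "b * (1 - cos (s * real k + e k)) \<le> pmf p 0 * pmf p k * (1 - cos (s * real k + e k))"
        by (rule mult_right_mono[OF b(2)[OF k]]) simp
      hence "1 - pmf p 0 * pmf p k * (1 - cos (s * real k + e k)) \<le> 1 - b * (1 - cos (s * real k + e k))" by simp
      also have "b * ((1 - cos (s * real k)) / 2 - \<theta>\<^sup>2 / n / 2) \<le> b * (1 - cos (s * real k + e k))"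
        using one_minus_cos_add_ge[of "s * real k" "e k"] e2[of k] b(1) by (intro mult_left_mono) auto
      hence "1 - b * (1 - cos (s * real k + e k)) \<le> 1 - b * ((1 - cos (s * real k)) / 2 - \<theta>\<^sup>2 / n / 2)" by simp
      finally show ?thesis .
    qed
    have "m * N = (\<Sum>k\<in>K'. N)" by (simp add: m_def)
    also have "\<dots> \<le> (\<Sum>k\<in>K'. 1 - b * ((1 - cos (s * real k)) / 2 - \<theta>\<^sup>2 / n / 2))" by (rule sum_mono[OF bound])
    also have "\<dots> = m + m * b * \<theta>\<^sup>2 / n / 2 - b / 2 * (\<Sum>k\<in>K'. 1 - cos (s * real k))"
      by (simp add: sum_subtractf sum.distrib sum_distrib_left[symmetric] sum_divide_distrib[symmetric] m_def algebra_simps diff_divide_distrib)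
    also have "\<dots> \<le> m + m * b * \<theta>\<^sup>2 / n / 2 - b / 2 * (c * s\<^sup>2)"
      using mult_left_mono[OF c(2)[OF s], of "b / 2"] b(1) unfolding sumK' by simp
    also have "\<dots> = m * (1 + (b * \<theta>\<^sup>2 / n / 2 - c' * s\<^sup>2))" using m by (simp add: c'_def field_simps)
    finally have "N \<le> 1 + (b * \<theta>\<^sup>2 / n / 2 - c' * s\<^sup>2)" using m by simp
    also have "\<dots> \<le> exp (b * \<theta>\<^sup>2 / n / 2 - c' * s\<^sup>2)" by (rule exp_ge_add_one_self)
    finally have "N ^ n \<le> exp (b * \<theta>\<^sup>2 / n / 2 - c' * s\<^sup>2) ^ n" by (intro power_mono) (simp_all add: N_def)
    also have "\<dots> = exp (n * (b * \<theta>\<^sup>2 / n / 2 - c' * s\<^sup>2))" by (rule exp_of_nat_mult[symmetric])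
    also have "n * (b * \<theta>\<^sup>2 / n / 2 - c' * s\<^sup>2) = b / 2 * \<theta>\<^sup>2 + - c' * x\<^sup>2" using n by (simp add: x2 field_simps)
    also have "exp (b / 2 * \<theta>\<^sup>2 + - c' * x\<^sup>2) \<le> exp (\<theta>\<^sup>2 + - c' * x\<^sup>2)"
      using mult_right_mono[of "b / 2" 1 "\<theta>\<^sup>2"] b1 by simp
    also have "\<dots> = exp (\<theta>\<^sup>2) * exp (- c' * x\<^sup>2)" by (rule exp_add)
    finally show ?thesis by (simp add: N_def norm_power)
  qed
  ultimately show ?thesis by blast
qed

text \<open>Integrating the characteristic function of a bivariate normal law over the second argument
  conditions the second coordinate to be zero, and the conditional variance of the first one is its
  residual variance.\<close>

lemma gaussian_integral:
  fixes v c :: real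
  shows "has_bochner_integral lborel (\<lambda>x. exp (- (\<theta>\<^sup>2 * v + 2 * \<theta> * x * c + x\<^sup>2 * var) / 2))
    (sqrt (2 * pi / var) * exp (- \<theta>\<^sup>2 / 2 * (v - c\<^sup>2 / var)))"
proof -
  define \<sigma> where "\<sigma> = 1 / sqrt var"
  have s: "\<sigma> > 0" "\<sigma>\<^sup>2 = 1 / var" using var_pos by (auto simp: \<sigma>_def power_divide)
  let ?C = "sqrt (2 * pi / var) * exp (- \<theta>\<^sup>2 / 2 * (v - c\<^sup>2 / var))"
  have "has_bochner_integral lborel (\<lambda>x. ?C * normal_density (- \<theta> * c / var) \<sigma> x) (?C * 1)"
    using s by (intro has_bochner_integral_mult_right) (simp add: has_bochner_integral_iff)
  also have "(\<lambda>x. ?C * normal_density (- \<theta> * c / var) \<sigma> x)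
      = (\<lambda>x. exp (- (\<theta>\<^sup>2 * v + 2 * \<theta> * x * c + x\<^sup>2 * var) / 2))"
  proof
    fix x
    have "?C * normal_density (- \<theta> * c / var) \<sigma> x
        = exp (- \<theta>\<^sup>2 / 2 * (v - c\<^sup>2 / var)) * exp (- (x - - \<theta> * c / var)\<^sup>2 / (2 * \<sigma>\<^sup>2))"
      using s var_pos by (simp add: normal_density_def real_sqrt_divide)
    also have "\<dots> = exp (- \<theta>\<^sup>2 / 2 * (v - c\<^sup>2 / var) + - (x - - \<theta> * c / var)\<^sup>2 / (2 * \<sigma>\<^sup>2))"
      by (rule exp_add[symmetric])
    also have "- \<theta>\<^sup>2 / 2 * (v - c\<^sup>2 / var) + - (x - - \<theta> * c / var)\<^sup>2 / (2 * \<sigma>\<^sup>2)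
        = - (\<theta>\<^sup>2 * v + 2 * \<theta> * x * c + x\<^sup>2 * var) / 2"
      unfolding s(2) using var_pos by (simp add: field_simps power2_eq_square)
    finally show "?C * normal_density (- \<theta> * c / var) \<sigma> x = exp (- (\<theta>\<^sup>2 * v + 2 * \<theta> * x * c + x\<^sup>2 * var) / 2)" .
  qed
  finally show ?thesis by simp
qed

text \<open>The Fourier integral for \<open>walk_coeff\<close> in the variable \<open>x = s * sqrt n\<close> and with centred exponents.\<close>

definition fourier_coeff :: "nat \<Rightarrow> real \<Rightarrow> nat \<Rightarrow> nat \<Rightarrow> complex" where
  "fourier_coeff j \<theta> r n = of_real (span / (2 * pi)) *
     (LINT x|lborel. indicator {- pi * sqrt n / span..pi * sqrt n / span} x *\<^sub>R
        (measure_pmf.expectation p (\<lambda>k. cis (centred j \<theta> x k / sqrt n)) ^ n * cis (x * r / sqrt n)))"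

lemma fourier_coeff_tendsto:
  "fourier_coeff j \<theta> r \<longlonglongrightarrow> of_real (span / sqrt (2 * pi * var) * exp (- \<theta>\<^sup>2 / 2 * count_var j))"
proof -
  define g where "g n x = measure_pmf.expectation p (\<lambda>k. cis (centred j \<theta> x k / sqrt (real n))) ^ n" for n x
  define B where "B n = {- pi * sqrt (real n) / span..pi * sqrt (real n) / span}" for n
  define V where "V x = \<theta>\<^sup>2 * (pmf p j * (1 - pmf p j)) + 2 * \<theta> * x * (pmf p j * (real j - 1)) + x\<^sup>2 * var" for x
  obtain c where c: "c > 0" "\<And>n x. n > 0 \<Longrightarrow> \<bar>x\<bar> \<le> pi * sqrt (real n) / span \<Longrightarrow> norm (g n x) \<le> exp (\<theta>\<^sup>2) * exp (- c * x\<^sup>2)"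
    using characteristic_decay[of j \<theta>] unfolding g_def by blast
  have meas: "(\<lambda>x. measure_pmf.expectation p (\<lambda>k. cis (centred j \<theta> x k / sqrt (real n)))) \<in> borel_measurable borel" for n
  proof (rule borel_measurable_LIMSEQ_metric)
    show "(\<lambda>x. \<Sum>k<m. pmf p k *\<^sub>R cis (centred j \<theta> x k / sqrt (real n))) \<in> borel_measurable borel" for m
      unfolding centred_def cis_conv_exp by measurable
    show "(\<lambda>m. \<Sum>k<m. pmf p k *\<^sub>R cis (centred j \<theta> x k / sqrt (real n)))
        \<longlonglongrightarrow> measure_pmf.expectation p (\<lambda>k. cis (centred j \<theta> x k / sqrt (real n)))" for x
      using pmf_nat_sums[OF integrable_cis] unfolding sums_def .
  qed
  have meas_cis: "(\<lambda>x. cis (f x)) \<in> borel_measurable borel" if "f \<in> borel_measurable borel" for f :: "real \<Rightarrow> real"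
    unfolding cis_conv_exp using that by measurable
  have "(\<lambda>n. LINT x|lborel. indicator (B n) x *\<^sub>R (g n x * cis (x * r / sqrt (real n))))
      \<longlonglongrightarrow> (LINT x|lborel. of_real (exp (- V x / 2)))"
  proof (rule LIMSEQ_offset[where k = 1], rule integral_dominated_convergence)
    show "integrable lborel (\<lambda>x. exp (\<theta>\<^sup>2) * exp (- c * x\<^sup>2))" using integrable_gaussian[OF c(1)] by simp
    show "(\<lambda>x. complex_of_real (exp (- V x / 2))) \<in> borel_measurable lborel" unfolding V_def by measurable
    show "(\<lambda>x. indicator (B (n + 1)) x *\<^sub>R (g (n + 1) x * cis (x * r / sqrt (real (n + 1))))) \<in> borel_measurable lborel" for n
    proof -
      have [measurable]: "g m \<in> borel_measurable borel" for m
        unfolding g_def using meas[of m] by measurable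
      have [measurable]: "(\<lambda>x::real. cis (x * r / sqrt (real m))) \<in> borel_measurable borel" for m
        by (rule meas_cis) measurable
      show ?thesis unfolding B_def by measurable
    qed
    show "AE x in lborel. norm (indicator (B (n + 1)) x *\<^sub>R (g (n + 1) x * cis (x * r / sqrt (real (n + 1))))) \<le> exp (\<theta>\<^sup>2) * exp (- c * x\<^sup>2)" for n
    proof (rule AE_I2)
      fix x
      show "norm (indicator (B (n + 1)) x *\<^sub>R (g (n + 1) x * cis (x * r / sqrt (real (n + 1))))) \<le> exp (\<theta>\<^sup>2) * exp (- c * x\<^sup>2)"
      proof (cases "x \<in> B (n + 1)")
        case True
        hence "\<bar>x\<bar> \<le> pi * sqrt (real (n + 1)) / span" by (auto simp: B_def abs_le_iff)
        thus ?thesis using c(2)[of "n + 1" x] True by (simp add: norm_mult)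
      qed simp
    qed
    show "AE x in lborel. (\<lambda>n. indicator (B (n + 1)) x *\<^sub>R (g (n + 1) x * cis (x * r / sqrt (real (n + 1))))) \<longlonglongrightarrow> of_real (exp (- V x / 2))"
    proof (rule AE_I2)
      fix x
      have "(\<lambda>n. g n x) \<longlonglongrightarrow> of_real (exp (- V x / 2))"
        unfolding g_def V_def centred_moments(3)[symmetric]
        by (rule characteristic_power_tendsto[OF centred_moments(1,2)])
      moreover have "(\<lambda>n. cis (x * r / sqrt (real n))) \<longlonglongrightarrow> cis 0"
        unfolding cis_conv_exp by (intro tendsto_intros) real_asymp
      moreover have "(\<lambda>n. indicator (B n) x :: real) \<longlonglongrightarrow> 1"
      proof (rule tendsto_eventually)
        have "filterlim (\<lambda>n. pi * sqrt (real n) / span) at_top sequentially"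
          using span_pos by real_asymp
        hence "eventually (\<lambda>n. pi * sqrt (real n) / span \<ge> \<bar>x\<bar>) sequentially" by (simp add: filterlim_at_top)
        thus "eventually (\<lambda>n. indicator (B n) x = (1::real)) sequentially"
          by eventually_elim (auto simp: B_def indicator_def abs_le_iff)
      qed
      ultimately have "(\<lambda>n. indicator (B n) x *\<^sub>R (g n x * cis (x * r / sqrt (real n)))) \<longlonglongrightarrow> 1 *\<^sub>R (of_real (exp (- V x / 2)) * cis 0)"
        by (intro tendsto_scaleR tendsto_mult)
      from LIMSEQ_ignore_initial_segment[OF this, of 1]
      show "(\<lambda>n. indicator (B (n + 1)) x *\<^sub>R (g (n + 1) x * cis (x * r / sqrt (real (n + 1))))) \<longlonglongrightarrow> of_real (exp (- V x / 2))"
        by simp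
    qed
  qed
  also have "(LINT x|lborel. complex_of_real (exp (- V x / 2))) = of_real (sqrt (2 * pi / var) * exp (- \<theta>\<^sup>2 / 2 * count_var j))"
    using has_bochner_integral_integral_eq[OF gaussian_integral[of \<theta> "pmf p j * (1 - pmf p j)" "pmf p j * (real j - 1)"]]
    unfolding V_def count_var_def by (simp only: integral_complex_of_real)
  finally have "fourier_coeff j \<theta> r \<longlonglongrightarrow> of_real (span / (2 * pi)) * of_real (sqrt (2 * pi / var) * exp (- \<theta>\<^sup>2 / 2 * count_var j))"
    unfolding fourier_coeff_def g_def B_def by (rule tendsto_mult_left)
  also have "span / (2 * pi) * (sqrt (2 * pi / var) * exp (- \<theta>\<^sup>2 / 2 * count_var j))
      = span / sqrt (2 * pi * var) * exp (- \<theta>\<^sup>2 / 2 * count_var j)"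
  proof -
    have "sqrt (2 * pi / var) * sqrt (2 * pi * var) = 2 * pi"
    proof -
      have "sqrt (2 * pi / var) * sqrt (2 * pi * var) = sqrt ((2 * pi)\<^sup>2)"
        using var_pos by (simp only: real_sqrt_mult[symmetric] power2_eq_square) simp
      thus ?thesis by (simp only: real_sqrt_abs) simp
    qed
    hence "sqrt (2 * pi / var) = 2 * pi / sqrt (2 * pi * var)" using var_pos by (simp add: field_simps)
    thus ?thesis by simp
  qed
  hence "complex_of_real (span / (2 * pi)) * of_real (sqrt (2 * pi / var) * exp (- \<theta>\<^sup>2 / 2 * count_var j))
      = of_real (span / sqrt (2 * pi * var) * exp (- \<theta>\<^sup>2 / 2 * count_var j))"
    by (simp only: of_real_mult[symmetric])
  finally show ?thesis .
qed

lemma summable_tilt: "summable (\<lambda>k. norm (tilt j \<theta> k))"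
proof -
  have "(\<lambda>k. pmf p k *\<^sub>R (1::real)) sums measure_pmf.expectation p (\<lambda>k. 1)" by (rule pmf_nat_sums) simp
  hence "summable (pmf p)" by (simp add: sums_iff)
  moreover have "norm (tilt j \<theta> k) = pmf p k" for k by (simp add: tilt_def norm_mult)
  ultimately show ?thesis by simp
qed

text \<open>Rescaled Fourier inversion. Centring multiplies the integrand by two phases: the one of the steps
  nearly cancels the phase of the coefficient of index \<open>n - r\<close>, as \<open>n\<close> is the mean of the sum of
  \<open>n\<close> offspring numbers, and leaves \<open>cis (x * r / sqrt n)\<close>; the one of the marker is the last factor
  on the left.\<close>

lemma walk_coeff_eq_fourier_coeff:
  assumes n: "n > 0" "r \<le> n" "span dvd n - r"
  shows "of_real (sqrt n) * walk_coeff (tilt j (\<theta> / sqrt n)) n r * cis (- \<theta> * pmf p j * sqrt n) = fourier_coeff j \<theta> r n"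
proof -
  let ?a = "tilt j (\<theta> / sqrt n)"
  define B where "B = {- pi / span..pi / span}"
  define F where "F s = (\<Sum>k. ?a k * cis (s * k)) ^ n * cis (- s * real (n - r))" for s :: real
  have sq: "sqrt n > 0" "sqrt n * sqrt n = n" using n by auto
  have supp: "span dvd k" if "?a k \<noteq> 0" for k
    using that span_dvd[of k] pmf_nonneg[of p k] by (auto simp: tilt_def less_le)
  have "of_real (2 * pi / span) * walk_coeff ?a n r = (LINT s|lborel. indicator B s *\<^sub>R F s)"
    using fps_power_coeff_integral[where a = ?a and d = span and M = "n - r" and n = n, OF summable_tilt supp span_pos n(3)] n(2)
    unfolding walk_coeff_def B_def F_def by simp
  also have "\<dots> = \<bar>1 / sqrt n\<bar> *\<^sub>R (LINT x|lborel. indicator B (0 + 1 / sqrt n * x) *\<^sub>R F (0 + 1 / sqrt n * x))"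
    by (rule lborel_integral_real_affine) (use sq in auto)
  finally have "of_real (sqrt n) * (of_real (2 * pi / span) * walk_coeff ?a n r)
      = (LINT x|lborel. indicator B (1 / sqrt n * x) *\<^sub>R F (1 / sqrt n * x))"
    using sq by (simp add: scaleR_conv_of_real)
  hence "of_real (sqrt n) * (of_real (2 * pi / span) * walk_coeff ?a n r) * cis (- \<theta> * pmf p j * sqrt n)
      = (LINT x|lborel. (indicator B (1 / sqrt n * x) *\<^sub>R F (1 / sqrt n * x)) * cis (- \<theta> * pmf p j * sqrt n))"
    by (simp only: integral_mult_left_zero)
  also have "(\<lambda>x. (indicator B (1 / sqrt n * x) *\<^sub>R F (1 / sqrt n * x)) * cis (- \<theta> * pmf p j * sqrt n))
    = (\<lambda>x. indicator {- pi * sqrt n / span..pi * sqrt n / span} x *\<^sub>R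
        (measure_pmf.expectation p (\<lambda>k. cis (centred j \<theta> x k / sqrt n)) ^ n * cis (x * r / sqrt n)))"
  proof
    fix x
    have ind: "(indicator B (1 / sqrt n * x) :: real) = indicator {- pi * sqrt n / span..pi * sqrt n / span} x"
      using sq(1) span_pos by (auto simp: B_def indicator_def field_simps)
    define s where "s = 1 / sqrt n * x"
    have "(\<lambda>k. pmf p k *\<^sub>R cis (\<theta> / sqrt n * of_bool (k = j) + s * k))
        sums measure_pmf.expectation p (\<lambda>k. cis (\<theta> / sqrt n * of_bool (k = j) + s * k))"
      by (rule pmf_nat_sums) simp
    also have "(\<lambda>k. pmf p k *\<^sub>R cis (\<theta> / sqrt n * of_bool (k = j) + s * k)) = (\<lambda>k. ?a k * cis (s * k))"
      by (auto simp: tilt_def fun_eq_iff scaleR_conv_of_real cis_mult)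
    finally have S: "(\<Sum>k. ?a k * cis (s * k)) = measure_pmf.expectation p (\<lambda>k. cis (\<theta> / sqrt n * of_bool (k = j) + s * k))"
      by (simp add: sums_iff)
    have "measure_pmf.expectation p (\<lambda>k. cis (centred j \<theta> x k / sqrt n))
        = measure_pmf.expectation p (\<lambda>k. cis (\<theta> / sqrt n * of_bool (k = j) + s * k) * cis (- (\<theta> * pmf p j / sqrt n + s)))"
      by (intro Bochner_Integration.integral_cong refl) (auto simp: cis_mult centred_def s_def diff_divide_distrib add_divide_distrib algebra_simps)
    also have "\<dots> = (\<Sum>k. ?a k * cis (s * k)) * cis (- (\<theta> * pmf p j / sqrt n + s))"
      unfolding S by (rule integral_mult_left_zero)
    finally have E: "measure_pmf.expectation p (\<lambda>k. cis (centred j \<theta> x k / sqrt n)) ^ n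
        = (\<Sum>k. ?a k * cis (s * k)) ^ n * cis (real n * - (\<theta> * pmf p j / sqrt n + s))"
      by (simp only: power_mult_distrib Complex.DeMoivre)
    have arg: "real n * - (\<theta> * pmf p j / sqrt n + s) + x * r / sqrt n = - s * real (n - r) + - \<theta> * pmf p j * sqrt n"
    proof -
      have "real n / sqrt n = sqrt n" using sq by (simp add: field_simps)
      hence 1: "real n * (\<theta> * pmf p j / sqrt n) = \<theta> * pmf p j * sqrt n"
        by (metis (no_types, opaque_lifting) mult.commute mult.left_commute times_divide_eq_right)
      have 2: "x * r / sqrt n = s * r" by (simp add: s_def)
      have 3: "real (n - r) = real n - real r" using n by simp
      show ?thesis unfolding 2 3 using 1 by (simp add: algebra_simps)
    qed
    have "measure_pmf.expectation p (\<lambda>k. cis (centred j \<theta> x k / sqrt n)) ^ n * cis (x * r / sqrt n)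
        = (\<Sum>k. ?a k * cis (s * k)) ^ n * cis (- s * real (n - r) + - \<theta> * pmf p j * sqrt n)"
      unfolding E mult.assoc cis_mult arg ..
    also have "\<dots> = F s * cis (- \<theta> * pmf p j * sqrt n)"
      unfolding F_def mult.assoc cis_mult ..
    finally show "(indicator B (1 / sqrt n * x) *\<^sub>R F (1 / sqrt n * x)) * cis (- \<theta> * pmf p j * sqrt n)
      = indicator {- pi * sqrt n / span..pi * sqrt n / span} x *\<^sub>R
        (measure_pmf.expectation p (\<lambda>k. cis (centred j \<theta> x k / sqrt n)) ^ n * cis (x * r / sqrt n))"
      unfolding ind unfolding s_def[symmetric] by (simp only: scaleR_conv_of_real mult.assoc)
  qed
  finally have "of_real (sqrt n) * (of_real (2 * pi / span) * walk_coeff ?a n r) * cis (- \<theta> * pmf p j * sqrt n)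
    = of_real (2 * pi / span) * fourier_coeff j \<theta> r n"
    using span_pos unfolding fourier_coeff_def by (simp flip: of_real_mult)
  hence "of_real (2 * pi / span) * (of_real (sqrt n) * walk_coeff ?a n r * cis (- \<theta> * pmf p j * sqrt n))
    = of_real (2 * pi / span) * fourier_coeff j \<theta> r n" by (simp only: mult_ac)
  thus ?thesis unfolding mult_cancel_left using span_pos by auto
qed

text \<open>The residual variance is the second moment of the indicator minus its regression on the step;
  \<open>x\<close> below is the coefficient of this regression.\<close>

lemma count_var_nonneg: "count_var j \<ge> 0"
proof -
  define x where "x = - pmf p j * (real j - 1) / var"
  have "0 \<le> measure_pmf.expectation p (\<lambda>k. (centred j 1 x k)\<^sup>2)" by simp
  also have "\<dots> = count_var j"
    unfolding centred_moments(3) count_var_def x_def using var_pos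
    by (simp add: field_simps power2_eq_square)
  finally show ?thesis .
qed

text \<open>If the residual variance vanished, the indicator of \<open>j\<close> would be an affine function on the support
  of \<open>p\<close>, which contains the three points \<open>0 < i < i'\<close>. But a non-constant affine function takes
  three values there, and a constant one is excluded since \<open>j\<close> is an atom.\<close>

lemma count_var_pos:
  assumes j: "pmf p j > 0" and i: "0 < i" "i < i'" "pmf p i > 0" "pmf p i' > 0"
  shows "count_var j > 0"
proof (rule ccontr)
  assume "\<not> count_var j > 0"
  hence c0: "count_var j = 0" using count_var_nonneg[of j] by simp
  define x where "x = - pmf p j * (real j - 1) / var"
  have "measure_pmf.expectation p (\<lambda>k. (centred j 1 x k)\<^sup>2) = count_var j"
    unfolding centred_moments(3) count_var_def x_def using var_pos
    by (simp add: field_simps power2_eq_square)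
  hence "AE k in measure_pmf p. (centred j 1 x k)\<^sup>2 = 0"
    using c0 integral_nonneg_eq_0_iff_AE[OF centred_moments(1)[of j 1 x]] by simp
  hence z: "of_bool (k = j) - pmf p j + x * (real k - 1) = 0" if "pmf p k > 0" for k
    using that by (auto simp: AE_measure_pmf_iff set_pmf_iff centred_def)
  have 1: "of_bool (0 = j) - of_bool (i = j) = x * real i"
    "of_bool (0 = j) - of_bool (i' = j) = x * real i'"
    using z[OF pmf_0_pos] z[OF i(3)] z[OF i(4)] by (simp_all add: algebra_simps)
  have "x \<noteq> 0"
  proof
    assume x0: "x = 0"
    hence "j \<noteq> 0" using 1 i by (auto simp: of_bool_def split: if_splits)
    hence "pmf p j = 0" using z[OF pmf_0_pos] x0 by simp
    thus False using j by simp
  qed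
  hence "x * real i \<noteq> 0" "x * real i' \<noteq> 0" "x * real i \<noteq> x * real i'" using i by auto
  thus False using 1 by (auto simp: of_bool_def split: if_splits)
qed

end

section \<open>Neighbourhoods and fringe subtrees\<close>

lemma rooted_iso_sym:
  assumes "G \<simeq>\<^sub>r H" "snd G \<in> verts (fst G)"
  shows "H \<simeq>\<^sub>r G"
proof -
  obtain f where f: "bij_betw f (verts (fst G)) (verts (fst H))" "f (snd G) = snd H"
    "\<And>u v. u \<in> verts (fst G) \<Longrightarrow> v \<in> verts (fst G) \<Longrightarrow> (u, v) \<in> edges (fst G) \<longleftrightarrow> (f u, f v) \<in> edges (fst H)"
    using assms(1) unfolding rooted_iso_def graph_iso_by_def by blast
  let ?g = "inv_into (verts (fst G)) f"
  have g: "f (?g y) = y" "?g y \<in> verts (fst G)" if "y \<in> verts (fst H)" for y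
    using f(1) that by (auto simp: bij_betw_inv_into_right bij_betw_def inv_into_into)
  have "?g (snd H) = snd G" using f(1,2) assms(2) by (metis bij_betw_inv_into_left)
  moreover have "bij_betw ?g (verts (fst H)) (verts (fst G))" using f(1) by (rule bij_betw_inv_into)
  ultimately show ?thesis unfolding rooted_iso_def graph_iso_by_def using f(3) g by (metis (no_types, lifting))
qed

lemma rooted_iso_trans:
  assumes "G \<simeq>\<^sub>r H" "H \<simeq>\<^sub>r K"
  shows "G \<simeq>\<^sub>r K"
proof -
  obtain f where f: "bij_betw f (verts (fst G)) (verts (fst H))" "f (snd G) = snd H"
    "\<And>u v. u \<in> verts (fst G) \<Longrightarrow> v \<in> verts (fst G) \<Longrightarrow> (u, v) \<in> edges (fst G) \<longleftrightarrow> (f u, f v) \<in> edges (fst H)"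
    using assms(1) unfolding rooted_iso_def graph_iso_by_def by blast
  obtain g where g: "bij_betw g (verts (fst H)) (verts (fst K))" "g (snd H) = snd K"
    "\<And>u v. u \<in> verts (fst H) \<Longrightarrow> v \<in> verts (fst H) \<Longrightarrow> (u, v) \<in> edges (fst H) \<longleftrightarrow> (g u, g v) \<in> edges (fst K)"
    using assms(2) unfolding rooted_iso_def graph_iso_by_def by blast
  have mem: "f u \<in> verts (fst H)" if "u \<in> verts (fst G)" for u using f(1) that by (auto simp: bij_betw_def)
  show ?thesis unfolding rooted_iso_def graph_iso_by_def
    by (rule exI[of _ "g \<circ> f"]) (use f g mem bij_betw_trans[OF f(1) g(1)] in auto)
qed

lemma rooted_iso_cong:
  assumes "G \<simeq>\<^sub>r H" "snd G \<in> verts (fst G)"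
  shows "G \<simeq>\<^sub>r Q \<longleftrightarrow> H \<simeq>\<^sub>r Q"
  using rooted_iso_trans[OF rooted_iso_sym[OF assms]] rooted_iso_trans[OF assms(1)] by blast

lemma snd_nbhd [simp]: "snd (nbhd l G) = snd G"
  by (simp add: nbhd_def Let_def)

lemma root_in_nbhd: "snd G \<in> verts (fst G) \<Longrightarrow> snd (nbhd l G) \<in> verts (fst (nbhd l G))"
  by (auto simp: nbhd_def Let_def intro: exI[of _ 0])

text \<open>The vertices of \<open>H\<close> are joined to the rest of \<open>G\<close> only at \<open>z\<close>, which no walk of length less than
  \<open>l\<close> from \<open>v\<close> reaches.\<close>

lemma nbhd_embedding:
  assumes H: "simple_graph H" "v \<in> verts H"
    and f: "inj_on f (verts H)" "f ` verts H \<subseteq> verts G"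
    and ed: "\<And>x y. x \<in> verts H \<Longrightarrow> y \<in> verts H \<Longrightarrow> (x, y) \<in> edges H \<longleftrightarrow> (f x, f y) \<in> edges G"
    and out: "\<And>y w. y \<in> verts H \<Longrightarrow> y \<noteq> z \<Longrightarrow> (f y, w) \<in> edges G \<Longrightarrow> w \<in> f ` verts H"
    and far: "\<And>k. k < l \<Longrightarrow> (v, z) \<notin> edges H ^^ k"
  shows "nbhd l (H, v) \<simeq>\<^sub>r nbhd l (G, f v)"
proof -
  have HV: "(x, y) \<in> edges H \<Longrightarrow> x \<in> verts H \<and> y \<in> verts H" for x y
    using H(1) by (auto simp: simple_graph_def)
  have walk: "(f v, w) \<in> edges G ^^ k \<longleftrightarrow> (\<exists>y\<in>verts H. w = f y \<and> (v, y) \<in> edges H ^^ k)" if "k \<le> l" for k w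
    using that
  proof (induction k arbitrary: w)
    case 0
    thus ?case using H by auto
  next
    case (Suc k)
    show ?case
    proof
      assume "(f v, w) \<in> edges G ^^ Suc k"
      then obtain w' where w': "(f v, w') \<in> edges G ^^ k" "(w', w) \<in> edges G" by auto
      then obtain y where y: "y \<in> verts H" "w' = f y" "(v, y) \<in> edges H ^^ k" using Suc by auto
      have "y \<noteq> z" using far[of k] y(3) Suc.prems by auto
      then obtain y' where y': "y' \<in> verts H" "w = f y'" using out[OF y(1)] w'(2) y(2) by blast
      hence "(y, y') \<in> edges H" using ed[OF y(1) y'(1)] w'(2) y(2) by simp
      thus "\<exists>y\<in>verts H. w = f y \<and> (v, y) \<in> edges H ^^ Suc k" using y y' by auto
    next
      assume "\<exists>y\<in>verts H. w = f y \<and> (v, y) \<in> edges H ^^ Suc k"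
      then obtain y y' where y: "y \<in> verts H" "w = f y" "(v, y') \<in> edges H ^^ k" "(y', y) \<in> edges H" by auto
      hence y': "y' \<in> verts H" using HV by blast
      hence "(f v, f y') \<in> edges G ^^ k" using Suc y by auto
      moreover have "(f y', f y) \<in> edges G" using ed[OF y' y(1)] y(4) by simp
      ultimately show "(f v, w) \<in> edges G ^^ Suc k" using y(2) by auto
    qed
  qed
  define A where "A = {y \<in> verts H. \<exists>k\<le>l. (v, y) \<in> edges H ^^ k}"
  have B: "{w \<in> verts G. \<exists>k\<le>l. (f v, w) \<in> edges G ^^ k} = f ` A"
  proof (intro equalityI subsetI)
    fix w assume "w \<in> {w \<in> verts G. \<exists>k\<le>l. (f v, w) \<in> edges G ^^ k}"
    then obtain k where k: "k \<le> l" "(f v, w) \<in> edges G ^^ k" by blast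
    then obtain y where "y \<in> verts H" "w = f y" "(v, y) \<in> edges H ^^ k" using walk by blast
    thus "w \<in> f ` A" using k(1) unfolding A_def by blast
  next
    fix w assume "w \<in> f ` A"
    thus "w \<in> {w \<in> verts G. \<exists>k\<le>l. (f v, w) \<in> edges G ^^ k}" using walk f(2) by (auto simp: A_def)
  qed
  have inj: "inj_on f A" using f(1) by (rule inj_on_subset) (auto simp: A_def)
  have "graph_iso_by f (fst (nbhd l (H, v))) (fst (nbhd l (G, f v)))"
    unfolding graph_iso_by_def nbhd_def Let_def fst_conv snd_conv B A_def[symmetric] graph.simps
    using inj ed by (auto simp: bij_betw_def A_def)
  thus ?thesis unfolding rooted_iso_def by (intro exI[of _ f]) simp
qed

fun subtree_at :: "planted_tree \<Rightarrow> nat list \<Rightarrow> planted_tree" where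
  "subtree_at t [] = t"
| "subtree_at (Node ts) (i # u) = subtree_at (ts ! i) u"

lemma append_in_positions: "u \<in> positions t \<Longrightarrow> u @ y \<in> positions t \<longleftrightarrow> y \<in> positions (subtree_at t u)"
  by (induction t u rule: subtree_at.induct) auto

lemma fringe_count_eq_card: "fringe_count t s = card {u \<in> positions s. subtree_at s u = t}"
proof (induction s)
  case (Node ts)
  have *: "card {u \<in> positions s. subtree_at s u = t} = (\<Sum>u\<in>positions s. if subtree_at s u = t then 1 else 0)" for s
    by (simp add: sum.If_cases Int_def)
  have "card {u \<in> positions (Node ts). subtree_at (Node ts) u = t} =
     (if Node ts = t then 1 else 0) + (\<Sum>i<length ts. card {u \<in> positions (ts ! i). subtree_at (ts ! i) u = t})"
    unfolding * by (subst sum_positions_Node) simp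
  thus ?case using Node by (simp add: sum_list_conv_index)
qed

lemma planted_walk_length:
  "(x, y) \<in> edges (planted_graph t) ^^ k \<Longrightarrow> length x \<le> length y + k"
proof (induction k arbitrary: y)
  case (Suc k)
  then obtain y' where y': "(x, y') \<in> edges (planted_graph t) ^^ k" "(y', y) \<in> edges (planted_graph t)" by auto
  have "length y' \<le> length y + 1" using y'(2) by (auto simp: planted_graph_def)
  thus ?case using Suc.IH[OF y'(1)] by simp
qed auto

lemma planted_edgeD: "(x, y) \<in> edges (planted_graph t) \<Longrightarrow>
    x \<in> positions t \<and> y \<in> positions t \<and> ((\<exists>i. y = x @ [i]) \<or> (\<exists>i. x = y @ [i]))"
  by (simp add: planted_graph_def)

lemma nbhd_subtree:
  assumes u: "u \<in> positions s" "subtree_at s u = t" and x: "x \<in> positions t" "length x = l"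
  shows "nbhd l (planted_graph t, x) \<simeq>\<^sub>r nbhd l (planted_graph s, u @ x)"
proof (rule nbhd_embedding[where z = "[]" and f = "\<lambda>y. u @ y"])
  have m: "u @ y \<in> positions s \<longleftrightarrow> y \<in> positions t" for y using append_in_positions[OF u(1)] u(2) by simp
  show "simple_graph (planted_graph t)" "x \<in> verts (planted_graph t)" using x by simp_all
  show "inj_on (\<lambda>y. u @ y) (verts (planted_graph t))" by (simp add: inj_on_def)
  show "(\<lambda>y. u @ y) ` verts (planted_graph t) \<subseteq> verts (planted_graph s)" using m by auto
  show "(y, y') \<in> edges (planted_graph t) \<longleftrightarrow> (u @ y, u @ y') \<in> edges (planted_graph s)" for y y'
    unfolding planted_graph_def using m by simp
  show "w \<in> (\<lambda>y. u @ y) ` verts (planted_graph t)"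
    if y: "y \<in> verts (planted_graph t)" "y \<noteq> []" and e: "(u @ y, w) \<in> edges (planted_graph s)" for y w
  proof -
    from planted_edgeD[OF e] have w: "w \<in> positions s" "(\<exists>i. w = (u @ y) @ [i]) \<or> (\<exists>i. u @ y = w @ [i])" by auto
    from w(2) have "\<exists>y'. w = u @ y'"
    proof (elim disjE exE)
      fix i assume "u @ y = w @ [i]"
      hence "w = butlast (u @ y)" by simp
      thus ?thesis using y(2) by (simp add: butlast_append)
    qed auto
    thus ?thesis using w(1) m by auto
  qed
  show "(x, []) \<notin> edges (planted_graph t) ^^ k" if "k < l" for k
    using planted_walk_length[of x "[]" k t] that x by auto
qed

text \<open>Vertices of height at least \<open>l\<close> are classified by the fringe subtree at their \<open>l\<close>-th
  ancestor, together with their own position in it.\<close>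

definition pointed_trees :: "nat \<Rightarrow> (planted_tree \<times> nat list) set" where
  "pointed_trees l = {(t, x). x \<in> positions t \<and> length x = l}"

text \<open>Different pointed trees account for different vertices: as \<open>x\<close> has length \<open>l\<close>, it can be read off
  \<open>u @ x\<close>.\<close>

lemma sum_fringe_count_le_card:
  assumes B: "finite B" "B \<subseteq> pointed_trees l"
    and P: "\<And>t x u. (t, x) \<in> B \<Longrightarrow> u \<in> positions s \<Longrightarrow> subtree_at s u = t \<Longrightarrow> P (u @ x)"
  shows "(\<Sum>(t, x)\<in>B. fringe_count t s) \<le> card {v \<in> positions s. P v}"
proof -
  let ?V = "\<lambda>(t, x). (\<lambda>u. u @ x) ` {u \<in> positions s. subtree_at s u = t}"
  have "(\<Sum>(t, x)\<in>B. fringe_count t s) = (\<Sum>b\<in>B. card (?V b))"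
    by (intro sum.cong refl) (auto simp: fringe_count_eq_card card_image inj_on_def)
  also have "\<dots> = card (\<Union>b\<in>B. ?V b)"
  proof (rule card_UN_disjoint[symmetric])
    show "finite B" by fact
    show "\<forall>b\<in>B. finite (?V b)" by auto
    show "\<forall>b\<in>B. \<forall>b'\<in>B. b \<noteq> b' \<longrightarrow> ?V b \<inter> ?V b' = {}"
    proof (intro ballI impI)
      fix b b' assume b: "b \<in> B" "b' \<in> B" "b \<noteq> b'"
      have "length (snd b) = length (snd b')"
        by (cases b; cases b') (use b B(2) in \<open>auto simp: pointed_trees_def\<close>)
      thus "?V b \<inter> ?V b' = {}" using b(3) by (auto simp: prod_eq_iff split: prod.splits)
    qed
  qed
  also have "\<dots> \<le> card {v \<in> positions s. P v}"
  proof (rule card_mono)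
    show "(\<Union>b\<in>B. ?V b) \<subseteq> {v \<in> positions s. P v}"
    proof
      fix v assume "v \<in> (\<Union>b\<in>B. ?V b)"
      then obtain t x u where *: "(t, x) \<in> B" "u \<in> positions s" "subtree_at s u = t" "v = u @ x" by auto
      have "x \<in> positions t" using *(1) B(2) by (auto simp: pointed_trees_def)
      thus "v \<in> {v \<in> positions s. P v}" using append_in_positions[OF *(2), of x] P * by auto
    qed
  qed simp
  finally show ?thesis .
qed

definition nbhd_count :: "nat \<Rightarrow> nat rooted_graph \<Rightarrow> planted_tree \<Rightarrow> nat" where
  "nbhd_count l Q s = card {v \<in> positions s. nbhd l (planted_graph s, v) \<simeq>\<^sub>r Q}"

text \<open>The vertices with a given neighbourhood and those without it are both bounded below. The gap
  between the two bounds consists of the vertices of height less than \<open>l\<close> and of those whose pointed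
  tree is not listed.\<close>

lemma nbhd_count_bounds:
  assumes B: "finite B" "B \<subseteq> pointed_trees l" "\<And>t x. (t, x) \<in> B \<Longrightarrow> nbhd l (planted_graph t, x) \<simeq>\<^sub>r Q"
    and C: "finite C" "C \<subseteq> pointed_trees l" "\<And>t x. (t, x) \<in> C \<Longrightarrow> \<not> nbhd l (planted_graph t, x) \<simeq>\<^sub>r Q"
  shows "(\<Sum>(t, x)\<in>B. fringe_count t s) \<le> nbhd_count l Q s"
    and "nbhd_count l Q s + (\<Sum>(t, x)\<in>C. fringe_count t s) \<le> nodes s"
proof -
  have iso: "nbhd l (planted_graph t, x) \<simeq>\<^sub>r Q \<longleftrightarrow> nbhd l (planted_graph s, u @ x) \<simeq>\<^sub>r Q"
    if "(t, x) \<in> pointed_trees l" "u \<in> positions s" "subtree_at s u = t" for t x u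
    by (rule rooted_iso_cong[OF nbhd_subtree]) (use that root_in_nbhd[of "(planted_graph t, x)" l] in \<open>auto simp: pointed_trees_def\<close>)
  show "(\<Sum>(t, x)\<in>B. fringe_count t s) \<le> nbhd_count l Q s"
    unfolding nbhd_count_def by (rule sum_fringe_count_le_card[OF B(1,2)]) (use B iso in blast)
  have "(\<Sum>(t, x)\<in>C. fringe_count t s) \<le> card {v \<in> positions s. \<not> nbhd l (planted_graph s, v) \<simeq>\<^sub>r Q}"
    by (rule sum_fringe_count_le_card[OF C(1,2)]) (use C iso in blast)
  moreover have "card {v \<in> positions s. nbhd l (planted_graph s, v) \<simeq>\<^sub>r Q}
      + card {v \<in> positions s. \<not> nbhd l (planted_graph s, v) \<simeq>\<^sub>r Q} = card (positions s)"
    by (subst card_Un_disjoint[symmetric]) (auto intro!: arg_cong[where f = card])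
  ultimately show "nbhd_count l Q s + (\<Sum>(t, x)\<in>C. fringe_count t s) \<le> nodes s"
    by (simp add: nbhd_count_def card_positions)
qed

section \<open>The limit tree\<close>

fun common_prefix_length :: "'a list \<Rightarrow> 'a list \<Rightarrow> nat" where
  "common_prefix_length (a # x) (b # y) = (if a = b then Suc (common_prefix_length x y) else 0)"
| "common_prefix_length _ _ = 0"

text \<open>The vertex of the limit tree that corresponds to the position \<open>y\<close>, when the distinguished
  position \<open>x\<close> is placed at the start of the spine and the root at the spine vertex of index
  \<open>length x\<close>.\<close>

definition spine_embed :: "nat list \<Rightarrow> nat list \<Rightarrow> spine_vertex" where
  "spine_embed x y = (length x - common_prefix_length x y, drop (common_prefix_length x y) y)"

lemma common_prefix_length_le:
  "common_prefix_length x y \<le> length x" "common_prefix_length x y \<le> length y"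
  by (induction x y rule: common_prefix_length.induct) auto

lemma take_common_prefix: "take (common_prefix_length x y) x = take (common_prefix_length x y) y"
  by (induction x y rule: common_prefix_length.induct) auto

lemma common_prefix_length_snoc:
  "common_prefix_length x (y @ [j]) =
     (if length y < length x \<and> y = take (length y) x \<and> j = x ! length y then Suc (length y) else common_prefix_length x y)"
proof (induction x arbitrary: y)
  case (Cons a x)
  show ?case
  proof (cases y)
    case (Cons b z)
    define P where "P \<longleftrightarrow> length z < length x \<and> z = take (length z) x \<and> j = x ! length z"
    have c: "(length y < length (a # x) \<and> y = take (length y) (a # x) \<and> j = (a # x) ! length y) \<longleftrightarrow> a = b \<and> P"
      unfolding Cons P_def by auto
    have IH: "common_prefix_length x (z @ [j]) = (if P then Suc (length z) else common_prefix_length x z)"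
      unfolding P_def by (rule Cons.IH)
    show ?thesis unfolding c unfolding Cons using IH by simp
  qed simp
qed simp

lemma common_prefix_length_take [simp]: "k \<le> length x \<Longrightarrow> common_prefix_length x (take k x) = k"
proof (induction x arbitrary: k)
  case (Cons a x) thus ?case by (cases k) auto
qed auto

lemma spine_embed_inverse:
  "take (length x - fst (spine_embed x y)) x @ snd (spine_embed x y) = y"
proof -
  let ?m = "common_prefix_length x y"
  have "length x - (length x - ?m) = ?m" using common_prefix_length_le(1)[of x y] by simp
  thus ?thesis unfolding spine_embed_def fst_conv snd_conv by (metis take_common_prefix append_take_drop_id)
qed

lemma inj_spine_embed: "inj_on (spine_embed x) A"
  by (rule inj_onI) (metis spine_embed_inverse)

lemma spine_embed_take: "k \<le> length x \<Longrightarrow> spine_embed x (take k x) = (length x - k, [])"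
  by (simp add: spine_embed_def)

lemma fst_spine_embed_le: "fst (spine_embed x y) \<le> length x"
  by (simp add: spine_embed_def)

text \<open>Appending a letter moves down the spine if it leads to the next prefix of \<open>x\<close>, and
  appends to the word otherwise.\<close>

lemma spine_embed_snoc:
  "spine_embed x (y @ [j]) =
     (if length y < length x \<and> y = take (length y) x \<and> j = x ! length y
      then (length x - Suc (length y), []) else (fst (spine_embed x y), snd (spine_embed x y) @ [j]))"
  using common_prefix_length_le(2)[of x y] by (auto simp: spine_embed_def common_prefix_length_snoc)

text \<open>The part of the limit tree below its spine vertex of index \<open>length x\<close> is \<open>t\<close>, with the root of the
  limit tree at position \<open>x\<close>. The spine vertex of index \<open>i\<close> is the \<open>i\<close>-th ancestor of \<open>x\<close>.\<close>

definition spine_event :: "planted_tree \<Rightarrow> nat list \<Rightarrow> spine_sample set" where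
  "spine_event t x = {(X, S).
     (\<forall>i\<in>{1..length x}. S i = (outdegree t (take (length x - i) x), x ! (length x - i))) \<and>
     (\<forall>y\<in>positions t - (\<lambda>k. take k x) ` {..<length x}. X (spine_embed x y) = outdegree t y)}"

lemma strict_prefix_iff: "y \<in> (\<lambda>k. take k x) ` {..<length x} \<longleftrightarrow> length y < length x \<and> y = take (length y) x"
  by (auto simp: image_iff)

lemma spine_embed_strict_prefix:
  "y \<in> (\<lambda>k. take k x) ` {..<length x} \<longleftrightarrow> fst (spine_embed x y) \<ge> 1 \<and> snd (spine_embed x y) = []"
proof
  assume "y \<in> (\<lambda>k. take k x) ` {..<length x}"
  thus "fst (spine_embed x y) \<ge> 1 \<and> snd (spine_embed x y) = []" by (auto simp: spine_embed_take)
next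
  assume a: "fst (spine_embed x y) \<ge> 1 \<and> snd (spine_embed x y) = []"
  hence "y = take (length x - fst (spine_embed x y)) x" using spine_embed_inverse[of x y] by simp
  moreover have "length x - fst (spine_embed x y) < length x"
    using a fst_spine_embed_le[of x y] by linarith
  ultimately show "y \<in> (\<lambda>k. take k x) ` {..<length x}" by blast
qed

lemma child_positions_spine_embed:
  assumes s: "s \<in> spine_event t x" and y: "y \<in> positions t"
  shows "child_positions s (spine_embed x y) =
     {j. j < outdegree t y \<and> \<not> (length y < length x \<and> y = take (length y) x \<and> j = x ! length y)}"
proof -
  obtain X S where sXS: "s = (X, S)" by (cases s)
  obtain i v where iv: "spine_embed x y = (i, v)" by (cases "spine_embed x y")
  show ?thesis
  proof (cases "y \<in> (\<lambda>k. take k x) ` {..<length x}")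
    case True
    hence y': "length y < length x" "y = take (length y) x" by (auto simp: strict_prefix_iff)
    hence e: "spine_embed x y = (length x - length y, [])" using spine_embed_take[of "length y" x] by simp
    hence "S (length x - length y) = (outdegree t y, x ! length y)"
      using s y' unfolding spine_event_def sXS by (auto dest!: bspec[of _ _ "length x - length y"])
    thus ?thesis using y' e by (auto simp: child_positions_def sXS)
  next
    case False
    hence "X (spine_embed x y) = outdegree t y" using s y unfolding spine_event_def sXS by auto
    thus ?thesis using False iv spine_embed_strict_prefix[of y x]
      by (auto simp: child_positions_def sXS strict_prefix_iff)
  qed
qed

lemma limit_verts_snoc: "(i, v @ [j]) \<in> limit_verts s \<longleftrightarrow> (i, v) \<in> limit_verts s \<and> j \<in> child_positions s (i, v)"
proof
  assume "(i, v @ [j]) \<in> limit_verts s"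
  thus "(i, v) \<in> limit_verts s \<and> j \<in> child_positions s (i, v)"
    by (cases rule: limit_verts.cases) auto
qed (auto intro: limit_verts.child)

lemma limit_verts_embed:
  assumes s: "s \<in> spine_event t x" and x: "x \<in> positions t"
  shows "spine_embed x ` positions t = {(i, v) \<in> limit_verts s. i \<le> length x}"
proof (intro equalityI subsetI)
  fix w assume "w \<in> spine_embed x ` positions t"
  then obtain y where y: "y \<in> positions t" "w = spine_embed x y" by blast
  have "spine_embed x y \<in> limit_verts s" using y(1)
  proof (induction y rule: rev_induct)
    case Nil
    show ?case using spine_embed_take[of 0 x] by (simp add: limit_verts.spine)
  next
    case (snoc j y)
    have yp: "y \<in> positions t" "j < outdegree t y" using snoc.prems by (auto simp: snoc_in_positions)
    show ?case
    proof (cases "length y < length x \<and> y = take (length y) x \<and> j = x ! length y")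
      case True
      thus ?thesis by (simp add: spine_embed_snoc limit_verts.spine)
    next
      case False
      hence "j \<in> child_positions s (spine_embed x y)" unfolding child_positions_spine_embed[OF s yp(1)] using yp by simp
      moreover have "spine_embed x (y @ [j]) = (fst (spine_embed x y), snd (spine_embed x y) @ [j])"
        using False by (subst spine_embed_snoc) (simp only: if_False)
      ultimately show ?thesis using snoc.IH[OF yp(1)] by (simp add: limit_verts_snoc)
    qed
  qed
  thus "w \<in> {(i, v) \<in> limit_verts s. i \<le> length x}" using y(2) fst_spine_embed_le[of x y] by auto
next
  fix w assume "w \<in> {(i, v) \<in> limit_verts s. i \<le> length x}"
  then obtain i v where w: "w = (i, v)" "(i, v) \<in> limit_verts s" "i \<le> length x" by auto
  have "(i, v) \<in> spine_embed x ` positions t" using w(2,3)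
  proof (induction v rule: rev_induct)
    case Nil
    have "take (length x - i) x \<in> positions t"
      using x positions_appendD[of "take (length x - i) x" "drop (length x - i) x" t] by simp
    moreover have "spine_embed x (take (length x - i) x) = (i, [])" using Nil by (subst spine_embed_take) auto
    ultimately show ?case by (metis imageI)
  next
    case (snoc j v)
    hence v: "(i, v) \<in> limit_verts s" "j \<in> child_positions s (i, v)" by (auto simp: limit_verts_snoc)
    then obtain y where y: "y \<in> positions t" "(i, v) = spine_embed x y" using snoc by blast
    have j: "j < outdegree t y" "\<not> (length y < length x \<and> y = take (length y) x \<and> j = x ! length y)"
      using v(2) unfolding y(2) child_positions_spine_embed[OF s y(1)] by auto
    have "y @ [j] \<in> positions t" using y j by (simp add: snoc_in_positions)
    moreover have "spine_embed x (y @ [j]) = (i, v @ [j])"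
      using j(2) y(2)[symmetric] by (subst spine_embed_snoc) (simp only: if_False fst_conv snd_conv)
    ultimately show ?case by (metis imageI)
  qed
  thus "w \<in> spine_embed x ` positions t" using w by simp
qed

lemma limit_parent_embed:
  "limit_parent (spine_embed x y) (spine_embed x y') \<longleftrightarrow> (\<exists>j. y' = y @ [j])"
proof
  assume "\<exists>j. y' = y @ [j]"
  then obtain j where y': "y' = y @ [j]" by blast
  show "limit_parent (spine_embed x y) (spine_embed x y')"
  proof (cases "length y < length x \<and> y = take (length y) x \<and> j = x ! length y")
    case True
    have "spine_embed x y = (length x - length y, [])" using True spine_embed_take[of "length y" x] by simp
    moreover have "spine_embed x y' = (length x - Suc (length y), [])" unfolding y' spine_embed_snoc using True by simp
    moreover have "length x - length y = Suc (length x - Suc (length y))" using conjunct1[OF True] by simp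
    ultimately show ?thesis by (simp add: limit_parent.intros)
  next
    case False
    have "spine_embed x y' = (fst (spine_embed x y), snd (spine_embed x y) @ [j])"
      unfolding y' using False by (subst spine_embed_snoc) (simp only: if_False)
    thus ?thesis using limit_parent.intros(2)[of "fst (spine_embed x y)" "snd (spine_embed x y)" j] by simp
  qed
next
  assume "limit_parent (spine_embed x y) (spine_embed x y')"
  thus "\<exists>j. y' = y @ [j]"
  proof (cases rule: limit_parent.cases)
    case (1 i)
    have i: "Suc i \<le> length x" using 1 fst_spine_embed_le[of x y] by simp
    have "y = take (length x - Suc i) x" "y' = take (length x - i) x"
      using 1 spine_embed_inverse[of x y] spine_embed_inverse[of x y'] by simp_all
    moreover have "length x - i = Suc (length x - Suc i)" using i by simp
    ultimately show ?thesis using i by (auto simp: take_Suc_conv_app_nth)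
  next
    case (2 i v j)
    have "y = take (length x - i) x @ v" "y' = take (length x - i) x @ v @ [j]"
      using 2 spine_embed_inverse[of x y] spine_embed_inverse[of x y'] by simp_all
    thus ?thesis by simp
  qed
qed

text \<open>A walk of length less than \<open>length x\<close> from the root does not reach the spine vertex of that index,
  the only one through which the rest of the limit tree can be entered.\<close>

lemma nbhd_limit_tree:
  assumes s: "s \<in> spine_event t x" and x: "x \<in> positions t"
  shows "nbhd (length x) (planted_graph t, x) \<simeq>\<^sub>r nbhd (length x) (limit_tree s)"
proof -
  have root: "spine_embed x x = (0, [])" using spine_embed_take[of "length x" x] by simp
  have im: "spine_embed x ` positions t = {(i, v) \<in> limit_verts s. i \<le> length x}"
    by (rule limit_verts_embed[OF s x])
  have fst_lt: "fst (spine_embed x y) < length x \<or> snd (spine_embed x y) \<noteq> []" if "y \<noteq> []" for y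
    using that spine_embed_inverse[of x y] fst_spine_embed_le[of x y] by (cases "fst (spine_embed x y) < length x") auto
  have "nbhd (length x) (planted_graph t, x) \<simeq>\<^sub>r nbhd (length x) (fst (limit_tree s), spine_embed x x)"
  proof (rule nbhd_embedding[where z = "[]" and f = "spine_embed x"])
    show "simple_graph (planted_graph t)" "x \<in> verts (planted_graph t)" using x by simp_all
    show "inj_on (spine_embed x) (verts (planted_graph t))" by (rule inj_spine_embed)
    show sub: "spine_embed x ` verts (planted_graph t) \<subseteq> verts (fst (limit_tree s))"
      using im by (auto simp: limit_tree_def)
    show "(y, y') \<in> edges (planted_graph t) \<longleftrightarrow> (spine_embed x y, spine_embed x y') \<in> edges (fst (limit_tree s))"
      if "y \<in> verts (planted_graph t)" "y' \<in> verts (planted_graph t)" for y y'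
      using that sub by (auto simp: planted_graph_def limit_tree_def limit_parent_embed)
    show "w \<in> spine_embed x ` verts (planted_graph t)"
      if y: "y \<in> verts (planted_graph t)" "y \<noteq> []" and e: "(spine_embed x y, w) \<in> edges (fst (limit_tree s))" for y w
    proof -
      obtain i v where iv: "spine_embed x y = (i, v)" by (cases "spine_embed x y")
      have w: "w \<in> limit_verts s" "limit_parent (i, v) w \<or> limit_parent w (i, v)"
        using e by (auto simp: limit_tree_def iv)
      have i: "i < length x \<or> v \<noteq> []" "i \<le> length x" using fst_lt[OF y(2)] fst_spine_embed_le[of x y] by (auto simp: iv)
      have "fst w \<le> length x" using w(2) i by (auto elim: limit_parent.cases)
      thus ?thesis using w(1) im by (cases w) auto
    qed
    show "(x, []) \<notin> edges (planted_graph t) ^^ k" if "k < length x" for k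
      using planted_walk_length[of x "[]" k t] that by auto
  qed
  thus ?thesis unfolding root by (simp add: limit_tree_def)
qed

text \<open>The spine samples determine \<open>x\<close>, and the vertices below the spine vertex determine \<open>t\<close>.\<close>

lemma spine_event_disjoint:
  assumes s: "s \<in> spine_event t x" "s \<in> spine_event t' x'"
    and x: "x \<in> positions t" "x' \<in> positions t'" "length x = length x'"
  shows "t = t' \<and> x = x'"
proof -
  obtain X S where sXS: "s = (X, S)" by (cases s)
  have "x ! k = x' ! k" if k: "k < length x" for k
  proof -
    define i where "i = length x - k"
    have i: "i \<in> {1..length x}" "length x - i = k" using k by (auto simp: i_def)
    have 1: "S i = (outdegree t (take (length x - i) x), x ! (length x - i))"
      using s(1) i(1) unfolding spine_event_def sXS by auto
    have 2: "S i = (outdegree t' (take (length x' - i) x'), x' ! (length x' - i))"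
      using s(2) i(1) x(3) unfolding spine_event_def sXS by auto
    show ?thesis using 1 2 i(2) x(3) by simp
  qed
  hence xx: "x = x'" using x(3) by (intro nth_equalityI) auto
  have "spine_embed x ` positions t = spine_embed x ` positions t'"
    using limit_verts_embed[OF s(1) x(1)] limit_verts_embed[OF s(2) x(2)] xx by simp
  hence "positions t = positions t'" using inj_spine_embed[of x UNIV] by (simp add: inj_image_eq_iff)
  thus ?thesis using xx positions_inj by blast
qed

subsection \<open>Measurability of neighbourhoods in the limit tree\<close>

text \<open>Measurability does not depend on the offspring law, so it is stated for the common
  \<open>\<sigma>\<close>-algebra of all laws \<open>limit_measure p\<close>.\<close>

definition sample_algebra :: "spine_sample measure" where
  "sample_algebra = (\<Pi>\<^sub>M x\<in>UNIV. count_space UNIV) \<Otimes>\<^sub>M (\<Pi>\<^sub>M i\<in>UNIV. count_space UNIV)"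

lemma sets_limit_measure: "sets (limit_measure p) = sets sample_algebra"
  unfolding limit_measure_def sample_algebra_def
  by (intro sets_pair_measure_cong sets_PiM_cong refl) auto

lemma space_limit_measure [simp]: "space (limit_measure p) = UNIV"
  by (simp add: limit_measure_def space_pair_measure space_PiM)

lemma space_sample_algebra [simp]: "space sample_algebra = UNIV"
  by (simp add: sample_algebra_def space_pair_measure space_PiM)

lemma pred_offspring: "Measurable.pred sample_algebra (\<lambda>s. P (fst s c))"
proof -
  have "(\<lambda>s. fst s c) \<in> measurable sample_algebra (count_space UNIV)"
    unfolding sample_algebra_def by measurable
  thus ?thesis by (rule measurable_compose) simp
qed

lemma pred_spine: "Measurable.pred sample_algebra (\<lambda>s. P (snd s i))"
proof -
  have "(\<lambda>s. snd s i) \<in> measurable sample_algebra (count_space UNIV)"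
    unfolding sample_algebra_def by measurable
  thus ?thesis by (rule measurable_compose) simp
qed

lemma pred_limit_verts [measurable]: "Measurable.pred sample_algebra (\<lambda>s. x \<in> limit_verts s)"
proof -
  have "Measurable.pred sample_algebra (\<lambda>s. (i, v) \<in> limit_verts s)" for i v
  proof (induction v rule: rev_induct)
    case Nil
    show ?case by (simp add: limit_verts.spine)
  next
    case (snoc j v)
    have "j \<in> child_positions s (i, v) \<longleftrightarrow> (if i \<ge> 1 \<and> v = [] then j < fst (snd s i) \<and> j \<noteq> snd (snd s i) else j < fst s (i, v))" for s
      by (cases s) (auto simp: child_positions_def)
    hence "Measurable.pred sample_algebra (\<lambda>s. j \<in> child_positions s (i, v))"
      using pred_spine[of "\<lambda>y. j < fst y \<and> j \<noteq> snd y" i] pred_offspring[of "\<lambda>y. j < y" "(i, v)"] by simp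
    with snoc.IH show ?case unfolding limit_verts_snoc by measurable
  qed
  thus ?thesis by (cases x) simp
qed

lemma pred_limit_edges [measurable]:
  "Measurable.pred sample_algebra (\<lambda>s. (x, y) \<in> edges (fst (limit_tree s)))"
proof -
  have "(x, y) \<in> edges (fst (limit_tree s)) \<longleftrightarrow> x \<in> limit_verts s \<and> y \<in> limit_verts s \<and> (limit_parent x y \<or> limit_parent y x)" for s
    by (simp add: limit_tree_def)
  thus ?thesis by simp
qed

lemma pred_limit_walks [measurable]:
  "Measurable.pred sample_algebra (\<lambda>s. (x, y) \<in> edges (fst (limit_tree s)) ^^ k)"
proof (induction k arbitrary: y)
  case (Suc k)
  have "(x, y) \<in> edges (fst (limit_tree s)) ^^ Suc k \<longleftrightarrow>
     (\<exists>z. (x, z) \<in> edges (fst (limit_tree s)) ^^ k \<and> (z, y) \<in> edges (fst (limit_tree s)))" for s by auto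
  thus ?case using Suc by simp
qed simp

lemma finite_limit_neighbours: "finite {y. (x, y) \<in> edges (fst (limit_tree s))}"
proof -
  obtain i v where x: "x = (i, v)" by (cases x)
  have fin: "finite (child_positions s (i, v))"
    by (cases s) (auto simp: child_positions_def)
  have "{y. (x, y) \<in> edges (fst (limit_tree s))} \<subseteq>
     {(Suc i, []), (i - 1, []), (i, butlast v)} \<union> (\<lambda>j. (i, v @ [j])) ` child_positions s (i, v)"
  proof
    fix y assume "y \<in> {y. (x, y) \<in> edges (fst (limit_tree s))}"
    hence y: "y \<in> limit_verts s" "limit_parent x y \<or> limit_parent y x" by (auto simp: limit_tree_def)
    from y(2) show "y \<in> {(Suc i, []), (i - 1, []), (i, butlast v)} \<union> (\<lambda>j. (i, v @ [j])) ` child_positions s (i, v)"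
      using y(1) unfolding x by (auto elim!: limit_parent.cases simp: limit_verts_snoc)
  qed
  thus ?thesis by (rule finite_subset) (use fin in auto)
qed

lemma finite_limit_ball: "finite {y. \<exists>k\<le>l. (x, y) \<in> edges (fst (limit_tree s)) ^^ k}"
proof -
  have "finite {y. (x, y) \<in> edges (fst (limit_tree s)) ^^ k}" for k
  proof (induction k)
    case (Suc k)
    have "{y. (x, y) \<in> edges (fst (limit_tree s)) ^^ Suc k}
        = (\<Union>z\<in>{z. (x, z) \<in> edges (fst (limit_tree s)) ^^ k}. {y. (z, y) \<in> edges (fst (limit_tree s))})" by auto
    thus ?case using Suc finite_limit_neighbours by simp
  qed simp
  moreover have "{y. \<exists>k\<le>l. (x, y) \<in> edges (fst (limit_tree s)) ^^ k} = (\<Union>k\<in>{..l}. {y. (x, y) \<in> edges (fst (limit_tree s)) ^^ k})" by auto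
  ultimately show ?thesis by simp
qed

text \<open>A ball is a finite graph on a countable vertex set, so the event is a countable union over the
  values of the ball.\<close>

lemma nbhd_limit_tree_measurable:
  "{s. nbhd l (limit_tree s) \<simeq>\<^sub>r Q} \<in> sets sample_algebra"
proof -
  define R where "R = {(\<lparr>verts = V, edges = E\<rparr>, r) | V E (r::spine_vertex). finite V \<and> finite (E :: (spine_vertex \<times> spine_vertex) set)}"
  have "R = (\<lambda>((V, E), r). (\<lparr>verts = V, edges = E\<rparr>, r)) ` (({V. finite V} \<times> {E. finite E}) \<times> UNIV)"
    by (auto simp: R_def image_iff)
  hence "countable R" by (auto intro!: countable_image countable_SIGMA countable_Collect_finite)
  have inR: "nbhd l (limit_tree s) \<in> R" for s
  proof -
    let ?B = "{v \<in> verts (fst (limit_tree s)). \<exists>k\<le>l. (snd (limit_tree s), v) \<in> edges (fst (limit_tree s)) ^^ k}"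
    have B: "finite ?B" by (rule finite_subset[OF _ finite_limit_ball[of l "snd (limit_tree s)" s]]) auto
    hence "finite (edges (fst (limit_tree s)) \<inter> ?B \<times> ?B)" by blast
    thus ?thesis using B unfolding nbhd_def Let_def R_def by blast
  qed
  have meas: "{s. nbhd l (limit_tree s) = H} \<in> sets sample_algebra" for H
  proof -
    have root: "snd (limit_tree s) = (0, [])" for s by (simp add: limit_tree_def)
    have vs: "verts (fst (limit_tree s)) = limit_verts s" for s by (simp add: limit_tree_def)
    have "nbhd l (limit_tree s) = H \<longleftrightarrow> snd H = (0, []) \<and>
       (\<forall>v. v \<in> verts (fst H) \<longleftrightarrow> v \<in> limit_verts s \<and> (\<exists>k\<in>{..l}. ((0, []), v) \<in> edges (fst (limit_tree s)) ^^ k)) \<and>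
       (\<forall>e. e \<in> edges (fst H) \<longleftrightarrow> (fst e, snd e) \<in> edges (fst (limit_tree s)) \<and> fst e \<in> verts (fst H) \<and> snd e \<in> verts (fst H))" (is "_ \<longleftrightarrow> ?R s") for s
    proof -
      define B where "B = {v \<in> limit_verts s. \<exists>k\<le>l. ((0, []), v) \<in> edges (fst (limit_tree s)) ^^ k}"
      have n: "nbhd l (limit_tree s) = (\<lparr>verts = B, edges = edges (fst (limit_tree s)) \<inter> B \<times> B\<rparr>, (0, []))"
        unfolding nbhd_def Let_def root vs B_def ..
      have "nbhd l (limit_tree s) = H \<longleftrightarrow> snd H = (0, []) \<and> verts (fst H) = B \<and> edges (fst H) = edges (fst (limit_tree s)) \<inter> B \<times> B"
        unfolding n by (cases H; cases "fst H") auto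
      also have "\<dots> \<longleftrightarrow> ?R s" by (auto simp: B_def set_eq_iff)
      finally show ?thesis .
    qed
    hence eq: "{s. nbhd l (limit_tree s) = H} = {s \<in> space sample_algebra. ?R s}" by simp
    have "Measurable.pred sample_algebra ?R" by measurable
    thus ?thesis unfolding eq by measurable
  qed
  have "{s. nbhd l (limit_tree s) \<simeq>\<^sub>r Q} = (\<Union>H\<in>{H \<in> R. H \<simeq>\<^sub>r Q}. {s. nbhd l (limit_tree s) = H})"
    using inR by auto
  moreover have "countable {H \<in> R. H \<simeq>\<^sub>r Q}" using \<open>countable R\<close> by (rule countable_subset[rotated]) auto
  ultimately show ?thesis using meas by (auto intro!: sets.countable_UN')
qed

subsection \<open>Probabilities of spine events\<close>

lemma tree_weight_nonneg: "(\<And>k. a k \<ge> 0) \<Longrightarrow> tree_weight a t \<ge> (0::real)"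
proof (induction t)
  case (Node ts)
  have "prod_list (map (tree_weight a) ts) \<ge> 0" using Node by (induction ts) auto
  thus ?case using Node.prems by simp
qed

lemma measure_PiM_pmf_cylinder:
  fixes q :: "'b pmf" and J :: "'a set"
  assumes "finite J"
  shows "{X. \<forall>c\<in>J. X c = f c} \<in> sets (\<Pi>\<^sub>M x\<in>UNIV. measure_pmf q)"
    and "emeasure (\<Pi>\<^sub>M x\<in>UNIV. measure_pmf q) {X. \<forall>c\<in>J. X c = f c} = ennreal (\<Prod>c\<in>J. pmf q (f c))"
proof -
  interpret P: product_prob_space "\<lambda>_::'a. measure_pmf q" UNIV
    by (intro product_prob_spaceI) (rule measure_pmf.prob_space_axioms)
  have sp: "space (\<Pi>\<^sub>M x\<in>UNIV. measure_pmf q) = (UNIV :: ('a \<Rightarrow> 'b) set)" by (simp add: space_PiM)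
  have eq: "{X. \<forall>c\<in>J. X c = f c} = {X \<in> space (\<Pi>\<^sub>M x\<in>UNIV. measure_pmf q). \<forall>c\<in>J. X c \<in> {f c}}" by (simp add: sp)
  show "{X. \<forall>c\<in>J. X c = f c} \<in> sets (\<Pi>\<^sub>M x\<in>UNIV. measure_pmf q)"
    unfolding eq
  proof (rule sets.sets_Collect_finite_All[OF _ assms])
    fix c assume "c \<in> J"
    have "(\<lambda>X. X c) -` {f c} \<inter> space (\<Pi>\<^sub>M x\<in>UNIV. measure_pmf q) \<in> sets (\<Pi>\<^sub>M x\<in>UNIV. measure_pmf q)"
      by (rule measurable_sets[OF measurable_component_singleton]) auto
    thus "{X \<in> space (\<Pi>\<^sub>M x\<in>UNIV. measure_pmf q). X c \<in> {f c}} \<in> sets (\<Pi>\<^sub>M x\<in>UNIV. measure_pmf q)"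
      by (simp add: sp vimage_def)
  qed
  have "emeasure (\<Pi>\<^sub>M x\<in>UNIV. measure_pmf q) {X. \<forall>c\<in>J. X c = f c} = (\<Prod>c\<in>J. emeasure (measure_pmf q) {f c})"
    unfolding eq by (rule P.emeasure_PiM_Collect) (use assms in auto)
  also have "\<dots> = ennreal (\<Prod>c\<in>J. pmf q (f c))"
    by (simp add: emeasure_pmf_single prod_ennreal)
  finally show "emeasure (\<Pi>\<^sub>M x\<in>UNIV. measure_pmf q) {X. \<forall>c\<in>J. X c = f c} = ennreal (\<Prod>c\<in>J. pmf q (f c))" .
qed

context critical_offspring
begin

lemma mean_sums: "(\<lambda>k. real k * pmf p k) sums 1"
proof -
  have "integrable (measure_pmf p) (\<lambda>k. (real k - 1) + 1)" by (intro Bochner_Integration.integrable_add) auto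
  hence "integrable (measure_pmf p) real" by simp
  from pmf_nat_sums[OF this] show ?thesis by (simp add: mean_one mult.commute)
qed

lemma pmf_sums: "(\<lambda>k. pmf p k) sums 1"
  using pmf_nat_sums[of p "\<lambda>_. 1::real"] by simp

text \<open>The factor \<open>k\<close> of the size-biased law cancels against the uniform choice among \<open>k\<close> children.\<close>

lemma pmf_spine: "j < k \<Longrightarrow> pmf (spine_pmf p) (k, j) = pmf p k"
proof -
  assume j: "j < k"
  have "(\<integral>\<^sup>+k. ennreal (real k * pmf p k) \<partial>count_space UNIV) = (\<Sum>k. ennreal (real k * pmf p k))"
    by (rule nn_integral_count_space_nat)
  also have "\<dots> = ennreal 1" by (rule suminf_ennreal_eq) (use mean_sums in auto)
  finally have emb: "pmf (embed_pmf (\<lambda>k. real k * pmf p k)) i = real i * pmf p i" for i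
    by (intro pmf_embed_pmf) auto
  have "pmf (spine_pmf p) (k, j)
     = measure_pmf.expectation (embed_pmf (\<lambda>k. real k * pmf p k)) (\<lambda>i. pmf (map_pmf (Pair i) (pmf_of_set {..<i})) (k, j))"
    unfolding spine_pmf_def by (rule pmf_bind)
  also have "\<dots> = (\<Sum>i\<in>{k}. pmf (embed_pmf (\<lambda>k. real k * pmf p k)) i *\<^sub>R pmf (map_pmf (Pair i) (pmf_of_set {..<i})) (k, j))"
    by (rule integral_measure_pmf) (auto simp: pmf_eq_0_set_pmf)
  also have "\<dots> = pmf (embed_pmf (\<lambda>k. real k * pmf p k)) k * pmf (map_pmf (Pair k) (pmf_of_set {..<k})) (k, j)" by simp
  also have "pmf (map_pmf (Pair k) (pmf_of_set {..<k})) (k, j) = pmf (pmf_of_set {..<k}) j"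
    by (rule pmf_map_inj') (simp add: inj_on_def)
  also have "\<dots> = 1 / k" using j by (subst pmf_of_set) (auto simp: lessThan_empty_iff)
  finally show ?thesis using j by (simp add: emb)
qed

interpretation limit: prob_space "limit_measure p"
proof -
  interpret P: product_prob_space "\<lambda>_::spine_vertex. measure_pmf p" UNIV
    by (intro product_prob_spaceI) (rule measure_pmf.prob_space_axioms)
  interpret Q: product_prob_space "\<lambda>_::nat. measure_pmf (spine_pmf p)" UNIV
    by (intro product_prob_spaceI) (rule measure_pmf.prob_space_axioms)
  interpret PQ: pair_prob_space "\<Pi>\<^sub>M x\<in>(UNIV :: spine_vertex set). measure_pmf p" "\<Pi>\<^sub>M i\<in>(UNIV :: nat set). measure_pmf (spine_pmf p)" ..
  show "prob_space (limit_measure p)" unfolding limit_measure_def by (rule PQ.prob_space_axioms)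
qed

lemma prob_space_limit_measure: "prob_space (limit_measure p)"
  by (rule limit.prob_space_axioms)

text \<open>Because of this cancellation the spine vertices contribute the same factors as all the others,
  and the product is the Galton--Watson weight of \<open>t\<close>.\<close>

lemma spine_event_prob:
  assumes x: "x \<in> positions t"
  shows "spine_event t x \<in> sets (limit_measure p)"
    and "measure (limit_measure p) (spine_event t x) = tree_weight (pmf p) t"
proof -
  define pre where "pre = (\<lambda>k. take k x) ` {..<length x}"
  define J where "J = spine_embed x ` (positions t - pre)"
  define f where "f c = outdegree t (take (length x - fst c) x @ snd c)" for c
  define g where "g i = (outdegree t (take (length x - i) x), x ! (length x - i))" for i
  define A where "A = {X. \<forall>c\<in>J. X c = f c}"
  define B where "B = {S. \<forall>i\<in>{1..length x}. S i = g i}"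
  have finJ: "finite J" by (simp add: J_def)
  have ev: "spine_event t x = A \<times> B"
    by (auto simp: spine_event_def A_def B_def J_def f_def g_def pre_def spine_embed_inverse)
  interpret P: product_prob_space "\<lambda>_::spine_vertex. measure_pmf p" UNIV
    by (intro product_prob_spaceI) (rule measure_pmf.prob_space_axioms)
  interpret Q: product_prob_space "\<lambda>_::nat. measure_pmf (spine_pmf p)" UNIV
    by (intro product_prob_spaceI) (rule measure_pmf.prob_space_axioms)
  have sA: "A \<in> sets (\<Pi>\<^sub>M x\<in>UNIV. measure_pmf p)" and eA: "emeasure (\<Pi>\<^sub>M x\<in>UNIV. measure_pmf p) A = ennreal (\<Prod>c\<in>J. pmf p (f c))"
    unfolding A_def by (rule measure_PiM_pmf_cylinder[OF finJ])+
  have sB: "B \<in> sets (\<Pi>\<^sub>M i\<in>UNIV. measure_pmf (spine_pmf p))"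
    and eB: "emeasure (\<Pi>\<^sub>M i\<in>UNIV. measure_pmf (spine_pmf p)) B = ennreal (\<Prod>i\<in>{1..length x}. pmf (spine_pmf p) (g i))"
    unfolding B_def by (rule measure_PiM_pmf_cylinder; simp)+
  show "spine_event t x \<in> sets (limit_measure p)" unfolding ev limit_measure_def using sA sB by (rule pair_measureI)
  have pre_pos: "take k x \<in> positions t" for k using x positions_appendD[of "take k x" "drop k x" t] by simp
  have "(\<Prod>c\<in>J. pmf p (f c)) = (\<Prod>y\<in>positions t - pre. pmf p (outdegree t y))"
    unfolding J_def by (subst prod.reindex[OF inj_spine_embed]) (simp add: f_def spine_embed_inverse)
  moreover have "(\<Prod>i\<in>{1..length x}. pmf (spine_pmf p) (g i)) = (\<Prod>y\<in>pre. pmf p (outdegree t y))"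
  proof -
    have "(\<Prod>i\<in>{1..length x}. pmf (spine_pmf p) (g i)) = (\<Prod>i\<in>{1..length x}. pmf p (outdegree t (take (length x - i) x)))"
    proof (intro prod.cong refl)
      fix i assume i: "i \<in> {1..length x}"
      have "take (length x - i) x @ [x ! (length x - i)] \<in> positions t"
      proof -
        have "length x - i < length x" using i by auto
        thus ?thesis using pre_pos[of "Suc (length x - i)"] by (simp add: take_Suc_conv_app_nth)
      qed
      hence "x ! (length x - i) < outdegree t (take (length x - i) x)" by (simp add: snoc_in_positions)
      thus "pmf (spine_pmf p) (g i) = pmf p (outdegree t (take (length x - i) x))" unfolding g_def by (rule pmf_spine)
    qed
    also have "\<dots> = (\<Prod>k\<in>{..<length x}. pmf p (outdegree t (take k x)))"
      by (rule prod.reindex_bij_witness[where i = "\<lambda>k. length x - k" and j = "\<lambda>i. length x - i"]) auto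
    also have "\<dots> = (\<Prod>y\<in>pre. pmf p (outdegree t y))"
      unfolding pre_def
    proof (subst prod.reindex)
      show "inj_on (\<lambda>k. take k x) {..<length x}"
        by (rule inj_onI) (metis length_take lessThan_iff min.absorb4)
    qed simp
    finally show ?thesis .
  qed
  moreover have "(\<Prod>y\<in>positions t - pre. pmf p (outdegree t y)) * (\<Prod>y\<in>pre. pmf p (outdegree t y)) = tree_weight (pmf p) t"
    unfolding planted_weight_eq[symmetric] planted_weight_def
    by (rule prod.subset_diff[symmetric]) (auto simp: pre_def pre_pos)
  moreover have "emeasure (limit_measure p) (spine_event t x)
     = ennreal (\<Prod>c\<in>J. pmf p (f c)) * ennreal (\<Prod>i\<in>{1..length x}. pmf (spine_pmf p) (g i))"
    unfolding ev limit_measure_def eA[symmetric] eB[symmetric]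
    by (rule Q.emeasure_pair_measure_Times[OF sA sB])
  ultimately have "emeasure (limit_measure p) (spine_event t x) = ennreal (tree_weight (pmf p) t)"
    by (simp add: ennreal_mult[symmetric] prod_nonneg)
  thus "measure (limit_measure p) (spine_event t x) = tree_weight (pmf p) t"
    by (simp add: measure_def tree_weight_nonneg)
qed

lemma spine_events_le:
  assumes B: "finite B" "B \<subseteq> pointed_trees l" and E: "E \<in> sets (limit_measure p)"
    and sub: "\<And>t x. (t, x) \<in> B \<Longrightarrow> spine_event t x \<subseteq> E"
  shows "(\<Sum>(t, x)\<in>B. tree_weight (pmf p) t) \<le> measure (limit_measure p) E"
proof -
  have "(\<Sum>(t, x)\<in>B. tree_weight (pmf p) t) = (\<Sum>b\<in>B. measure (limit_measure p) (spine_event (fst b) (snd b)))"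
    by (intro sum.cong refl) (use B in \<open>auto simp: pointed_trees_def spine_event_prob\<close>)
  also have "\<dots> = measure (limit_measure p) (\<Union>b\<in>B. spine_event (fst b) (snd b))"
  proof (rule limit.finite_measure_finite_Union[symmetric, OF B(1)])
    show "(\<lambda>b. spine_event (fst b) (snd b)) ` B \<subseteq> sets (limit_measure p)"
      using B by (auto simp: pointed_trees_def spine_event_prob)
    show "disjoint_family_on (\<lambda>b. spine_event (fst b) (snd b)) B"
      unfolding disjoint_family_on_def
    proof (intro ballI impI equals0I)
      fix b b' s assume b: "b \<in> B" "b' \<in> B" "b \<noteq> b'" and s: "s \<in> spine_event (fst b) (snd b) \<inter> spine_event (fst b') (snd b')"
      have "fst b = fst b' \<and> snd b = snd b'"
        by (rule spine_event_disjoint; cases b; cases b') (use b s B(2) in \<open>auto simp: pointed_trees_def\<close>)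
      thus False using b(3) by (simp add: prod_eq_iff)
    qed
  qed
  also have "\<dots> \<le> measure (limit_measure p) E"
  proof (rule limit.finite_measure_mono[OF _ E])
    have "spine_event (fst b) (snd b) \<subseteq> E" if "b \<in> B" for b by (rule sub) (use that in simp)
    thus "(\<Union>b\<in>B. spine_event (fst b) (snd b)) \<subseteq> E" by blast
  qed
  finally show ?thesis .
qed

lemma limit_prob_bounds:
  defines "L \<equiv> \<lambda>l Q. \<P>(s in limit_measure p. nbhd l (limit_tree s) \<simeq>\<^sub>r Q)"
  assumes B: "finite B" "B \<subseteq> pointed_trees l" "\<And>t x. (t, x) \<in> B \<Longrightarrow> nbhd l (planted_graph t, x) \<simeq>\<^sub>r Q"
    and C: "finite C" "C \<subseteq> pointed_trees l" "\<And>t x. (t, x) \<in> C \<Longrightarrow> \<not> nbhd l (planted_graph t, x) \<simeq>\<^sub>r Q"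
  shows "(\<Sum>(t, x)\<in>B. tree_weight (pmf p) t) \<le> L l Q"
    and "L l Q + (\<Sum>(t, x)\<in>C. tree_weight (pmf p) t) \<le> 1"
proof -
  let ?E = "{s. nbhd l (limit_tree s) \<simeq>\<^sub>r Q}"
  have E: "?E \<in> sets (limit_measure p)" unfolding sets_limit_measure by (rule nbhd_limit_tree_measurable)
  have L: "L l Q = measure (limit_measure p) ?E" by (simp add: L_def)
  have iso: "nbhd l (planted_graph t, x) \<simeq>\<^sub>r Q \<longleftrightarrow> nbhd l (limit_tree s) \<simeq>\<^sub>r Q"
    if tx: "(t, x) \<in> pointed_trees l" and s: "s \<in> spine_event t x" for t x s
  proof -
    have x: "x \<in> positions t" "length x = l" using tx by (auto simp: pointed_trees_def)
    have "nbhd l (planted_graph t, x) \<simeq>\<^sub>r nbhd l (limit_tree s)" using nbhd_limit_tree[OF s x(1)] x(2) by simp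
    thus ?thesis by (rule rooted_iso_cong) (use root_in_nbhd[of "(planted_graph t, x)" l] x in simp)
  qed
  show "(\<Sum>(t, x)\<in>B. tree_weight (pmf p) t) \<le> L l Q"
    unfolding L by (rule spine_events_le[OF B(1,2) E]) (use B iso in blast)
  have "(\<Sum>(t, x)\<in>C. tree_weight (pmf p) t) \<le> measure (limit_measure p) (- ?E)"
  proof (rule spine_events_le[OF C(1,2)])
    show "- ?E \<in> sets (limit_measure p)" using sets.compl_sets[OF E] by (simp add: Compl_eq_Diff_UNIV)
  qed (use C iso in blast)
  also have "\<dots> = 1 - measure (limit_measure p) ?E"
    using limit.prob_compl[OF E] by (simp add: Compl_eq_Diff_UNIV)
  finally show "L l Q + (\<Sum>(t, x)\<in>C. tree_weight (pmf p) t) \<le> 1" unfolding L by simp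
qed

end

subsection \<open>The pointed trees carry the whole mass\<close>

instance planted_tree :: countable by countable_datatype

lemma nn_integral_count_space_le:
  fixes f :: "'a::countable \<Rightarrow> ennreal"
  assumes "\<And>F. finite F \<Longrightarrow> sum f F \<le> C"
  shows "(\<integral>\<^sup>+x. f x \<partial>count_space UNIV) \<le> C"
proof -
  define g where "g n = (if n \<in> range (to_nat :: 'a \<Rightarrow> nat) then f (from_nat n) else 0)" for n
  have "bij_betw (to_nat :: 'a \<Rightarrow> nat) UNIV (range (to_nat :: 'a \<Rightarrow> nat))" by (simp add: bij_betw_def)
  from nn_integral_bij_count_space[OF this, of g]
  have "(\<integral>\<^sup>+x. f x \<partial>count_space UNIV) = (\<integral>\<^sup>+n. g n \<partial>count_space (range (to_nat :: 'a \<Rightarrow> nat)))"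
    by (simp add: g_def)
  also have "\<dots> = (\<integral>\<^sup>+n. g n \<partial>count_space UNIV)"
    by (rule nn_integral_count_space_eq) (auto simp: g_def)
  also have "\<dots> = (\<Sum>n. g n)" by (rule nn_integral_count_space_nat)
  also have "\<dots> \<le> C"
  proof (rule suminf_le_const)
    fix n
    have "(\<Sum>i<n. g i) = (\<Sum>i\<in>{..<n} \<inter> range (to_nat :: 'a \<Rightarrow> nat). f (from_nat i))"
      unfolding g_def by (simp add: sum.If_cases)
    also have "\<dots> = sum f (from_nat ` ({..<n} \<inter> range (to_nat :: 'a \<Rightarrow> nat)))"
      by (subst sum.reindex) (auto simp: inj_on_def)
    also have "\<dots> \<le> C" by (rule assms) simp
    finally show "(\<Sum>i<n. g i) \<le> C" .
  qed simp
  finally show ?thesis .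
qed

lemma nn_integral_Node:
  "(\<integral>\<^sup>+t. G t \<partial>count_space UNIV) = (\<integral>\<^sup>+ts. G (Node ts) \<partial>count_space UNIV)"
proof -
  have "bij_betw Node UNIV UNIV"
    by (rule bij_betw_byWitness[where f' = "\<lambda>t. case t of Node ts \<Rightarrow> ts"]) (auto split: planted_tree.splits)
  from nn_integral_bij_count_space[OF this] show ?thesis by metis
qed

lemma nn_integral_lists_Cons:
  fixes f :: "'a list \<Rightarrow> ennreal"
  assumes "f [] = 0"
  shows "(\<integral>\<^sup>+ts. f ts \<partial>count_space UNIV) = (\<integral>\<^sup>+t. \<integral>\<^sup>+ts. f (t # ts) \<partial>count_space UNIV \<partial>count_space UNIV)"
proof -
  have "bij_betw (\<lambda>(t, ts). t # ts) (UNIV :: ('a \<times> 'a list) set) (UNIV - {[]})"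
    by (rule bij_betw_byWitness[where f' = "\<lambda>ts. (hd ts, tl ts)"]) auto
  from nn_integral_bij_count_space[OF this, of f]
  have "(\<integral>\<^sup>+x. f (fst x # snd x) \<partial>count_space UNIV) = (\<integral>\<^sup>+ts. f ts \<partial>count_space (UNIV - {[]}))"
    by (simp add: case_prod_beta)
  also have "\<dots> = (\<integral>\<^sup>+ts. f ts \<partial>count_space UNIV)"
    by (rule nn_integral_count_space_eq) (use assms in auto)
  finally show ?thesis using nn_integral_fst_count_space[of "\<lambda>x. f (fst x # snd x)"] by simp
qed

primrec generation :: "nat \<Rightarrow> planted_tree \<Rightarrow> nat" where
  "generation 0 t = 1"
| "generation (Suc l) t = (case t of Node ts \<Rightarrow> sum_list (map (generation l) ts))"

lemma card_generation: "card {x \<in> positions t. length x = l} = generation l t"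
proof (induction l arbitrary: t)
  case 0
  have "{x \<in> positions t. length x = 0} = {[]}" by auto
  thus ?case by simp
next
  case (Suc l)
  obtain ts where t: "t = Node ts" by (cases t)
  have *: "card {x \<in> positions s. length x = k} = (\<Sum>x\<in>positions s. if length x = k then 1 else 0)" for s k
    by (simp add: sum.If_cases Int_def)
  have "card {x \<in> positions t. length x = Suc l} = (\<Sum>i<length ts. card {x \<in> positions (ts ! i). length x = l})"
    unfolding t * by (subst sum_positions_Node) simp
  thus ?case by (simp add: t Suc sum_list_conv_index)
qed

context critical_offspring
begin

definition wt :: "planted_tree \<Rightarrow> ennreal" where "wt t = ennreal (tree_weight (pmf p) t)"

definition list_wt :: "planted_tree list \<Rightarrow> ennreal" where "list_wt ts = prod_list (map wt ts)"

lemma wt_Node: "wt (Node ts) = ennreal (pmf p (length ts)) * list_wt ts"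
proof -
  have "list_wt ts = ennreal (prod_list (map (tree_weight (pmf p)) ts)) \<and> 0 \<le> prod_list (map (tree_weight (pmf p)) ts)"
    unfolding list_wt_def by (induction ts) (auto simp: wt_def ennreal_mult tree_weight_nonneg)
  thus ?thesis by (simp add: wt_def ennreal_mult)
qed

text \<open>The mean size of generation \<open>l\<close> of a Galton--Watson tree, restricted to finite trees.\<close>

definition mass :: "nat \<Rightarrow> ennreal" where
  "mass l = (\<integral>\<^sup>+t. wt t * of_nat (generation l t) \<partial>count_space UNIV)"

definition list_mass :: "nat \<Rightarrow> ennreal" where
  "list_mass k = (\<integral>\<^sup>+ts. list_wt ts * indicator {ts. length ts = k} ts \<partial>count_space UNIV)"

definition list_generation_mass :: "nat \<Rightarrow> nat \<Rightarrow> ennreal" where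
  "list_generation_mass l k = (\<integral>\<^sup>+ts. list_wt ts * of_nat (sum_list (map (generation l) ts)) * indicator {ts. length ts = k} ts \<partial>count_space UNIV)"

lemma nn_integral_by_length:
  fixes f :: "planted_tree list \<Rightarrow> ennreal"
  shows "(\<integral>\<^sup>+ts. ennreal (pmf p (length ts)) * f ts \<partial>count_space UNIV)
    = (\<Sum>k. ennreal (pmf p k) * (\<integral>\<^sup>+ts. f ts * indicator {ts. length ts = k} ts \<partial>count_space UNIV))"
proof -
  have "ennreal (pmf p (length ts)) * f ts = (\<Sum>k. ennreal (pmf p k) * (f ts * indicator {ts. length ts = k} ts))" for ts
  proof -
    have "(\<lambda>k. ennreal (pmf p k) * (f ts * indicator {ts. length ts = k} ts)) sums
        (\<Sum>k\<in>{length ts}. ennreal (pmf p k) * (f ts * indicator {ts. length ts = k} ts))"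
      by (rule sums_finite) auto
    thus ?thesis by (simp add: sums_iff)
  qed
  thus ?thesis by (simp add: nn_integral_suminf nn_integral_cmult)
qed

lemma mass_0_eq: "mass 0 = (\<Sum>k. ennreal (pmf p k) * list_mass k)"
  unfolding mass_def list_mass_def nn_integral_Node[of "\<lambda>t. wt t * _ t"] wt_Node
  using nn_integral_by_length[of list_wt] by simp

lemma mass_Suc_eq: "mass (Suc l) = (\<Sum>k. ennreal (pmf p k) * list_generation_mass l k)"
  unfolding mass_def list_generation_mass_def nn_integral_Node[of "\<lambda>t. wt t * _ t"] wt_Node
  using nn_integral_by_length[of "\<lambda>ts. list_wt ts * of_nat (sum_list (map (generation l) ts))"]
  by (simp add: mult.assoc)

lemma list_mass_eq: "list_mass k = mass 0 ^ k"
proof (induction k)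
  case 0
  have "list_mass 0 = (\<integral>\<^sup>+ts. indicator {[]} (ts :: planted_tree list) \<partial>count_space UNIV)"
    unfolding list_mass_def by (intro nn_integral_cong) (auto simp: list_wt_def indicator_def)
  thus ?case by simp
next
  case (Suc k)
  have "list_mass (Suc k) = (\<integral>\<^sup>+t. \<integral>\<^sup>+ts. wt t * (list_wt ts * indicator {ts. length ts = k} ts) \<partial>count_space UNIV \<partial>count_space UNIV)"
    unfolding list_mass_def
    by (subst nn_integral_lists_Cons) (auto simp: list_wt_def indicator_def mult.assoc intro!: nn_integral_cong)
  also have "\<dots> = (\<integral>\<^sup>+t. wt t * list_mass k \<partial>count_space UNIV)"
    unfolding list_mass_def by (intro nn_integral_cong nn_integral_cmult) simp
  also have "\<dots> = mass 0 * list_mass k"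
    unfolding mass_def by (simp add: nn_integral_multc)
  finally show ?case using Suc by simp
qed

lemma list_generation_mass_Suc:
  "list_generation_mass l (Suc k) = mass l * list_mass k + mass 0 * list_generation_mass l k"
proof -
  let ?i = "\<lambda>ts. indicator {ts. length ts = k} (ts :: planted_tree list) :: ennreal"
  have "list_generation_mass l (Suc k) = (\<integral>\<^sup>+t. \<integral>\<^sup>+ts. (wt t * of_nat (generation l t)) * (list_wt ts * ?i ts)
      + wt t * (list_wt ts * of_nat (sum_list (map (generation l) ts)) * ?i ts) \<partial>count_space UNIV \<partial>count_space UNIV)"
    unfolding list_generation_mass_def
    by (subst nn_integral_lists_Cons) (auto simp: list_wt_def indicator_def algebra_simps intro!: nn_integral_cong)
  also have "\<dots> = (\<integral>\<^sup>+t. (wt t * of_nat (generation l t)) * list_mass k + wt t * list_generation_mass l k \<partial>count_space UNIV)"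
  proof (intro nn_integral_cong)
    fix t
    show "(\<integral>\<^sup>+ts. (wt t * of_nat (generation l t)) * (list_wt ts * ?i ts)
      + wt t * (list_wt ts * of_nat (sum_list (map (generation l) ts)) * ?i ts) \<partial>count_space UNIV)
      = (wt t * of_nat (generation l t)) * list_mass k + wt t * list_generation_mass l k"
      unfolding list_mass_def list_generation_mass_def
      by (subst nn_integral_add) (simp_all add: nn_integral_cmult)
  qed
  also have "\<dots> = mass l * list_mass k + mass 0 * list_generation_mass l k"
    by (subst nn_integral_add) (simp_all add: nn_integral_multc mass_def)
  finally show ?thesis .
qed

text \<open>The fringe subtree at the root of the limit tree is a Galton--Watson tree, so the weights are
  probabilities of disjoint events.\<close>

lemma mass_0_le: "mass 0 \<le> 1"
  unfolding mass_def
proof (rule nn_integral_count_space_le)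
  fix F :: "planted_tree set" assume F: "finite F"
  let ?B = "(\<lambda>t. (t, [] :: nat list)) ` F"
  have "(\<Sum>(t, x)\<in>?B. tree_weight (pmf p) t) \<le> measure (limit_measure p) UNIV"
    by (rule spine_events_le[where l = 0]) (use F sets.top[of sample_algebra] in \<open>auto simp: pointed_trees_def sets_limit_measure\<close>)
  also have "\<dots> = 1" using prob_space.prob_space[OF prob_space_limit_measure] by simp
  also have "(\<Sum>(t, x)\<in>?B. tree_weight (pmf p) t) = (\<Sum>t\<in>F. tree_weight (pmf p) t)"
    by (subst sum.reindex) (auto simp: inj_on_def)
  finally have "ennreal (\<Sum>t\<in>F. tree_weight (pmf p) t) \<le> 1" by simp
  thus "(\<Sum>t\<in>F. wt t * of_nat (generation 0 t)) \<le> 1"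
    by (simp add: wt_def sum_ennreal tree_weight_nonneg)
qed

text \<open>Extinction: the total mass is a fixed point of the generating function of \<open>p\<close>, and as the
  mean is one the only fixed point in the unit interval is one.\<close>

lemma mass_0: "mass 0 = 1"
proof (rule ccontr)
  assume ne: "mass 0 \<noteq> 1"
  obtain q where q: "mass 0 = ennreal q" "q \<ge> 0"
    using mass_0_le by (cases "mass 0") (auto simp: top_unique)
  have q1: "q < 1" using mass_0_le ne unfolding q(1) by (cases "q = 1") (auto simp: less_le)
  have sq: "summable (\<lambda>k. pmf p k * q ^ k)"
  proof (rule summable_comparison_test')
    show "summable (pmf p)" using pmf_sums by (simp add: sums_iff)
    show "norm (pmf p k * q ^ k) \<le> pmf p k" if "k \<ge> 0" for k
      using q q1 by (simp add: abs_mult mult_left_le power_le_one)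
  qed
  have "mass 0 = (\<Sum>k. ennreal (pmf p k) * mass 0 ^ k)"
    using mass_0_eq unfolding list_mass_eq .
  hence "ennreal q = (\<Sum>k. ennreal (pmf p k) * ennreal q ^ k)" unfolding q(1) .
  also have "\<dots> = (\<Sum>k. ennreal (pmf p k * q ^ k))" using q by (simp add: ennreal_mult ennreal_power)
  also have "\<dots> = ennreal (\<Sum>k. pmf p k * q ^ k)"
    by (rule suminf_ennreal2) (use sq q in auto)
  finally have "(\<lambda>k. pmf p k * q ^ k) sums q"
    using sq q by (subst (asm) ennreal_inj) (auto simp: sums_iff intro!: suminf_nonneg)
  from sums_diff[OF sums_mult2[OF mean_sums, of "1 - q"] sums_diff[OF pmf_sums this]]
  have s: "(\<lambda>k. pmf p k * (q ^ k - 1 - real k * (q - 1))) sums 0" by (simp add: algebra_simps)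
  \<comment> \<open>Bernoulli's inequality, which is strict at the atom \<open>k \<ge> 2\<close>\<close>
  have bern: "q ^ k - 1 - real k * (q - 1) \<ge> 0" for k
    using Bernoulli_inequality[of "q - 1" k] q by simp
  obtain k where k: "k \<ge> 2" "pmf p k > 0" using pmf_ge_2_pos by blast
  obtain m where m: "k = Suc m" "m \<ge> 1" using k by (cases k) auto
  have "q * (1 + real m * (q - 1)) \<le> q * q ^ m"
    using Bernoulli_inequality[of "q - 1" m] q by (intro mult_left_mono) auto
  moreover have "q * (1 + real m * (q - 1)) - 1 - real k * (q - 1) = real m * (q - 1)\<^sup>2"
    unfolding m by (simp add: power2_eq_square algebra_simps)
  moreover have "real m * (q - 1)\<^sup>2 > 0" using m q1 by simp
  ultimately have "q ^ k - 1 - real k * (q - 1) > 0" unfolding m by simp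
  hence pos: "pmf p k * (q ^ k - 1 - real k * (q - 1)) > 0" using k by simp
  have "(\<Sum>k. pmf p k * (q ^ k - 1 - real k * (q - 1))) > 0"
    by (rule suminf_pos2[where i = k]) (use s bern pos in \<open>auto simp: sums_iff\<close>)
  thus False using s by (simp add: sums_iff)
qed

text \<open>As almost every tree is finite, the mean generation size is multiplied by the mean of the offspring
  law, which is one, from each generation to the next.\<close>

lemma mass_eq_1: "mass l = 1"
proof (induction l)
  case (Suc l)
  have "list_generation_mass l k = of_nat k" for k
  proof (induction k)
    case 0
    have "list_generation_mass l 0 = (\<integral>\<^sup>+(ts :: planted_tree list). 0 \<partial>count_space UNIV)"
      unfolding list_generation_mass_def by (intro nn_integral_cong) (auto simp: indicator_def)
    thus ?case by simp
  next
    case (Suc k)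
    thus ?case by (simp add: list_generation_mass_Suc list_mass_eq mass_0 \<open>mass l = 1\<close>)
  qed
  hence "mass (Suc l) = (\<Sum>k. ennreal (real k * pmf p k))"
    unfolding mass_Suc_eq by (simp add: ennreal_mult ennreal_of_nat_eq_real_of_nat mult.commute)
  also have "\<dots> = ennreal 1" by (rule suminf_ennreal_eq) (use mean_sums in auto)
  finally show ?case by simp
qed (rule mass_0)

lemma pointed_trees_mass:
  assumes "e > 0"
  shows "\<exists>A. finite A \<and> A \<subseteq> pointed_trees l \<and> (\<Sum>(t, x)\<in>A. tree_weight (pmf p) t) > 1 - e"
proof (rule ccontr)
  assume no: "\<not> ?thesis"
  have "mass l \<le> ennreal (1 - min e 1)"
    unfolding mass_def
  proof (rule nn_integral_count_space_le)
    fix F :: "planted_tree set" assume F: "finite F"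
    let ?A = "SIGMA t:F. {x \<in> positions t. length x = l}"
    have "finite ?A" "?A \<subseteq> pointed_trees l" using F by (auto simp: pointed_trees_def)
    hence "(\<Sum>(t, x)\<in>?A. tree_weight (pmf p) t) \<le> 1 - e" using no by (meson not_le)
    moreover have "(\<Sum>(t, x)\<in>?A. tree_weight (pmf p) t) = (\<Sum>t\<in>F. tree_weight (pmf p) t * real (generation l t))"
      using F by (subst sum.Sigma[symmetric]) (auto simp: card_generation mult.commute)
    moreover have "(\<Sum>t\<in>F. tree_weight (pmf p) t * real (generation l t)) \<ge> 0"
      by (intro sum_nonneg mult_nonneg_nonneg tree_weight_nonneg) auto
    ultimately have "(\<Sum>t\<in>F. tree_weight (pmf p) t * real (generation l t)) \<le> 1 - min e 1" by auto
    hence "ennreal (\<Sum>t\<in>F. tree_weight (pmf p) t * real (generation l t)) \<le> ennreal (1 - min e 1)" by (rule ennreal_leI)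
    thus "(\<Sum>t\<in>F. wt t * of_nat (generation l t)) \<le> ennreal (1 - min e 1)"
      by (simp add: wt_def sum_ennreal[symmetric] tree_weight_nonneg ennreal_mult ennreal_of_nat_eq_real_of_nat)
  qed
  hence "ennreal 1 \<le> ennreal (1 - min e 1)" by (simp add: mass_eq_1)
  thus False using assms by (subst (asm) ennreal_le_iff) auto
qed

text \<open>As the limit has no mass left over, lower bounds for an event and for its complement
  together force convergence.\<close>

theorem nbhd_fraction_tendsto:
  assumes conv: "\<And>t. (\<lambda>n. a n t) \<longlonglongrightarrow> tree_weight (pmf p) t"
    and low: "\<And>n B. finite B \<Longrightarrow> B \<subseteq> pointed_trees l \<Longrightarrow>
       (\<And>t x. (t, x) \<in> B \<Longrightarrow> nbhd l (planted_graph t, x) \<simeq>\<^sub>r Q) \<Longrightarrow> (\<Sum>(t, x)\<in>B. a n t) \<le> \<alpha> n"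
    and high: "\<And>n C. finite C \<Longrightarrow> C \<subseteq> pointed_trees l \<Longrightarrow>
       (\<And>t x. (t, x) \<in> C \<Longrightarrow> \<not> nbhd l (planted_graph t, x) \<simeq>\<^sub>r Q) \<Longrightarrow> \<alpha> n + (\<Sum>(t, x)\<in>C. a n t) \<le> 1"
  shows "\<alpha> \<longlonglongrightarrow> \<P>(s in limit_measure p. nbhd l (limit_tree s) \<simeq>\<^sub>r Q)"
proof (rule LIMSEQ_I)
  fix e :: real assume e: "e > 0"
  define L where "L = \<P>(s in limit_measure p. nbhd l (limit_tree s) \<simeq>\<^sub>r Q)"
  obtain A where A: "finite A" "A \<subseteq> pointed_trees l" "(\<Sum>(t, x)\<in>A. tree_weight (pmf p) t) > 1 - e"
    using pointed_trees_mass[OF e] by blast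
  define B where "B = {b \<in> A. nbhd l (planted_graph (fst b), snd b) \<simeq>\<^sub>r Q}"
  define C where "C = A - B"
  have BC: "finite B" "finite C" "B \<subseteq> pointed_trees l" "C \<subseteq> pointed_trees l" using A by (auto simp: B_def C_def)
  have Bq: "nbhd l (planted_graph t, x) \<simeq>\<^sub>r Q" if "(t, x) \<in> B" for t x using that by (simp add: B_def)
  have Cq: "\<not> nbhd l (planted_graph t, x) \<simeq>\<^sub>r Q" if "(t, x) \<in> C" for t x using that by (simp add: B_def C_def)
  define \<beta> where "\<beta> = (\<Sum>(t, x)\<in>B. tree_weight (pmf p) t)"
  define \<gamma> where "\<gamma> = (\<Sum>(t, x)\<in>C. tree_weight (pmf p) t)"
  have bg: "\<beta> + \<gamma> > 1 - e"
    using A(3) sum.subset_diff[OF _ A(1), of B "\<lambda>(t, x). tree_weight (pmf p) t"] by (auto simp: \<beta>_def \<gamma>_def C_def B_def)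
  have L: "\<beta> \<le> L" "L + \<gamma> \<le> 1"
    unfolding L_def \<beta>_def \<gamma>_def using limit_prob_bounds[OF BC(1,3) Bq BC(2,4) Cq] by auto
  have ta: "(\<lambda>n. \<Sum>(t, x)\<in>B. a n t) \<longlonglongrightarrow> \<beta>" "(\<lambda>n. \<Sum>(t, x)\<in>C. a n t) \<longlonglongrightarrow> \<gamma>"
    unfolding \<beta>_def \<gamma>_def case_prod_beta by (intro tendsto_sum conv)+
  have "eventually (\<lambda>n. (\<Sum>(t, x)\<in>B. a n t) > \<beta> - (\<beta> + \<gamma> - (1 - e))) sequentially"
    by (rule order_tendstoD[OF ta(1)]) (use bg in simp)
  moreover have "eventually (\<lambda>n. (\<Sum>(t, x)\<in>C. a n t) > \<gamma> - (\<beta> + \<gamma> - (1 - e))) sequentially"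
    by (rule order_tendstoD[OF ta(2)]) (use bg in simp)
  ultimately have "eventually (\<lambda>n. norm (\<alpha> n - L) < e) sequentially"
  proof eventually_elim
    case (elim n)
    have "(\<Sum>(t, x)\<in>B. a n t) \<le> \<alpha> n" "\<alpha> n + (\<Sum>(t, x)\<in>C. a n t) \<le> 1"
      using low[OF BC(1,3) Bq] high[OF BC(2,4) Cq] by auto
    thus ?case using elim L by (auto simp: abs_less_iff)
  qed
  thus "\<exists>N. \<forall>n\<ge>N. norm (\<alpha> n - \<P>(s in limit_measure p. nbhd l (limit_tree s) \<simeq>\<^sub>r Q)) < e"
    unfolding L_def eventually_sequentially .
qed

end

lemma prob_uniformly_rooted:
  assumes fin: "\<And>G. G \<in> set_pmf g \<Longrightarrow> finite (verts G) \<and> verts G \<noteq> {}"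
  shows "\<P>(x in measure_pmf (uniformly_rooted g). P x)
    = measure_pmf.expectation g (\<lambda>G. real (card {v \<in> verts G. P (G, v)}) / real (card (verts G)))"
proof -
  have inner: "pmf (map_pmf P (map_pmf (Pair G) (pmf_of_set (verts G)))) True = real (card {v \<in> verts G. P (G, v)}) / real (card (verts G))"
    if "G \<in> set_pmf g" for G
  proof -
    have "pmf (map_pmf P (map_pmf (Pair G) (pmf_of_set (verts G)))) True = measure (pmf_of_set (verts G)) {v. P (G, v)}"
      unfolding pmf.map_comp pmf_map by (simp add: vimage_def comp_def)
    also have "\<dots> = real (card (verts G \<inter> {v. P (G, v)})) / real (card (verts G))"
      using fin[OF that] by (intro measure_pmf_of_set) auto
    finally show ?thesis by (simp add: Int_def)
  qed
  have "\<P>(x in measure_pmf (uniformly_rooted g). P x) = pmf (map_pmf P (uniformly_rooted g)) True"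
    by (simp add: pmf_map vimage_def)
  also have "\<dots> = measure_pmf.expectation g (\<lambda>G. pmf (map_pmf P (map_pmf (Pair G) (pmf_of_set (verts G)))) True)"
    unfolding uniformly_rooted_def map_bind_pmf by (rule pmf_bind)
  also have "\<dots> = measure_pmf.expectation g (\<lambda>G. real (card {v \<in> verts G. P (G, v)}) / real (card (verts G)))"
    by (rule integral_cong_AE) (auto simp: AE_measure_pmf_iff inner)
  finally show ?thesis .
qed

section \<open>The canonical tilt\<close>

context
  fixes w :: "nat \<Rightarrow> real"
  assumes w_nonneg: "\<And>k. w k \<ge> 0" and w0: "w 0 > 0" and w2: "\<exists>k\<ge>2. w k > 0"
begin

private abbreviation "diffs_summable t \<equiv> summable (\<lambda>k. diffs w k * t ^ k)"

lemma mean_series: "diffs_summable t \<Longrightarrow> (\<lambda>k. real k * w k * t ^ k) sums (t * (\<Sum>k. diffs w k * t ^ k))"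
proof -
  assume "diffs_summable t"
  hence "(\<lambda>k. t * (diffs w k * t ^ k)) sums (t * (\<Sum>k. diffs w k * t ^ k))"
    by (intro sums_mult summable_sums)
  hence "(\<lambda>k. real (Suc k) * w (Suc k) * t ^ Suc k) sums (t * (\<Sum>k. diffs w k * t ^ k))"
    by (simp add: diffs_def mult_ac)
  thus ?thesis by (subst (asm) sums_Suc_iff) simp
qed

lemma mean_series_converse:
  assumes "t > 0" "summable (\<lambda>k. real k * w k * t ^ k)"
  shows "diffs_summable t"
proof -
  have "summable (\<lambda>k. real (Suc k) * w (Suc k) * t ^ Suc k)"
    using assms(2) by (subst summable_Suc_iff)
  hence "summable (\<lambda>k. (1 / t) * (real (Suc k) * w (Suc k) * t ^ Suc k))" by (rule summable_mult)
  moreover have "(1 / t) * (real (Suc k) * w (Suc k) * t ^ Suc k) = diffs w k * t ^ k" for k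
    using assms(1) by (simp add: diffs_def del: of_nat_Suc)
  ultimately show ?thesis by (simp only:)
qed

lemma summable_weights:
  assumes "diffs_summable t" "t \<ge> 0" shows "summable (\<lambda>k. w k * t ^ k)"
proof -
  have "summable (\<lambda>k. real k * w k * t ^ k)" using mean_series[OF assms(1)] by (simp add: sums_iff)
  hence "summable (\<lambda>k. w k * t ^ k)"
  proof (rule summable_comparison_test'[where N = 1])
    fix k :: nat assume "k \<ge> 1"
    hence "1 * (w k * t ^ k) \<le> real k * (w k * t ^ k)"
      using w_nonneg assms(2) by (intro mult_right_mono) auto
    thus "norm (w k * t ^ k) \<le> real k * w k * t ^ k" using w_nonneg assms(2) by (simp add: mult.assoc)
  qed
  thus ?thesis .
qed

lemma Phi_pos: "summable (\<lambda>k. w k * t ^ k) \<Longrightarrow> t \<ge> 0 \<Longrightarrow> Phi w t > 0"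
  unfolding Phi_def by (rule suminf_pos2[where i = 0]) (use w_nonneg w0 in auto)

lemma centred_series:
  assumes "diffs_summable t" "t \<ge> 0"
  shows "(\<lambda>k. (real k - \<mu>) * (w k * t ^ k)) sums ((Psi w t - \<mu>) * Phi w t)"
proof -
  have "(\<lambda>k. w k * t ^ k) sums Phi w t" unfolding Phi_def using summable_weights[OF assms] by (rule summable_sums)
  from sums_diff[OF mean_series[OF assms(1)] sums_mult[OF this, of \<mu>]]
  have "(\<lambda>k. (real k - \<mu>) * (w k * t ^ k)) sums (t * (\<Sum>k. diffs w k * t ^ k) - \<mu> * Phi w t)"
    by (simp add: algebra_simps)
  moreover have "t * (\<Sum>k. diffs w k * t ^ k) = Psi w t * Phi w t"
    using Phi_pos[OF summable_weights[OF assms] assms(2)] by (simp add: Psi_def)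
  ultimately show ?thesis by (simp add: algebra_simps)
qed

text \<open>The mean of the tilted law increases with the parameter, because the change of measure from
  \<open>s\<close> to \<open>t\<close> has the increasing density \<open>(t / s) ^ k\<close>, up to normalisation.\<close>

lemma Psi_strict_mono:
  assumes s: "diffs_summable s" "0 \<le> s" and t: "diffs_summable t" "s < t"
  shows "Psi w s < Psi w t"
proof -
  have t0: "t \<ge> 0" using s t by simp
  obtain k2 where k2: "k2 \<ge> 2" "w k2 > 0" using w2 by blast
  define \<mu> where "\<mu> = Psi w s"
  have Pt: "Phi w t > 0" by (rule Phi_pos[OF summable_weights[OF t(1) t0] t0])
  have mu0: "\<mu> \<ge> 0"
  proof -
    have "0 \<le> (\<Sum>k. real k * w k * s ^ k)"
      by (rule suminf_nonneg) (use mean_series[OF s(1)] w_nonneg s(2) in \<open>auto simp: sums_iff\<close>)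
    also have "\<dots> = s * (\<Sum>k. diffs w k * s ^ k)" using mean_series[OF s(1)] by (simp add: sums_iff)
    finally show ?thesis unfolding \<mu>_def Psi_def
      using Phi_pos[OF summable_weights[OF s] s(2)] by simp
  qed
  have "(Psi w t - \<mu>) * Phi w t > 0"
  proof (cases "s = 0")
    case True
    have "\<mu> = 0" by (simp add: \<mu>_def Psi_def True)
    have "(Psi w t - \<mu>) * Phi w t = (\<Sum>k. (real k - \<mu>) * (w k * t ^ k))"
      using centred_series[OF t(1) t0, of \<mu>] by (simp add: sums_iff)
    also have "\<dots> > 0"
      by (rule suminf_pos2[where i = k2])
        (use centred_series[OF t(1) t0, of \<mu>] \<open>\<mu> = 0\<close> k2 t True w_nonneg in \<open>auto simp: sums_iff\<close>)
    finally show ?thesis .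
  next
    case False
    hence sp: "s > 0" using s by simp
    \<comment> \<open>with \<open>x ^ m\<close> subtracted, the density changes its sign where \<open>k - \<mu>\<close> does\<close>
    define m where "m = nat \<lfloor>\<mu>\<rfloor>"
    have m: "real m \<le> \<mu>" "\<mu> < real m + 1" using mu0 by (simp_all add: m_def)
    define x where "x = t / s"
    have x: "x > 1" "t = x * s" using sp t by (auto simp: x_def)
    have "(\<lambda>k. (real k - \<mu>) * (w k * t ^ k) - x ^ m * ((real k - \<mu>) * (w k * s ^ k)))
        sums ((Psi w t - \<mu>) * Phi w t - x ^ m * ((Psi w s - \<mu>) * Phi w s))"
      by (intro sums_diff sums_mult centred_series s t t0)
    hence S: "(\<lambda>k. (real k - \<mu>) * (x ^ k - x ^ m) * (w k * s ^ k)) sums ((Psi w t - \<mu>) * Phi w t)"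
      by (simp add: \<mu>_def x(2) power_mult_distrib algebra_simps)
    have sgn: "(real k - \<mu>) * (x ^ k - x ^ m) \<ge> 0" for k
    proof (cases "k \<le> m")
      case True
      hence "x ^ k \<le> x ^ m" using x by (intro power_increasing) auto
      moreover have "real k \<le> \<mu>" using True m(1) by linarith
      ultimately show ?thesis by (intro mult_nonpos_nonpos) auto
    next
      case False
      hence "x ^ m \<le> x ^ k" using x by (intro power_increasing) auto
      moreover have "real k \<ge> \<mu>" using False m(2) by linarith
      ultimately show ?thesis by (intro mult_nonneg_nonneg) auto
    qed
    have "\<exists>i. (real i - \<mu>) * (x ^ i - x ^ m) * (w i * s ^ i) > 0"
    proof (cases "m = 0")
      case True
      have "x ^ k2 > 1" using x k2 by (intro one_less_power) auto
      thus ?thesis using True m k2 sp by (intro exI[of _ k2] mult_pos_pos) auto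
    next
      case False
      have "x ^ m > 1" using x False by (intro one_less_power) auto
      moreover have "\<mu> > 0" using m False by linarith
      ultimately have "(- \<mu>) * (1 - x ^ m) > 0" by (intro mult_neg_neg) auto
      hence "(- \<mu>) * (1 - x ^ m) * w 0 > 0" using w0 by (rule mult_pos_pos)
      thus ?thesis by (intro exI[of _ 0]) simp
    qed
    then obtain i where i: "(real i - \<mu>) * (x ^ i - x ^ m) * (w i * s ^ i) > 0" by blast
    have "0 < (\<Sum>k. (real k - \<mu>) * (x ^ k - x ^ m) * (w k * s ^ k))"
      by (rule suminf_pos2[where i = i]) (use S sgn w_nonneg sp i in \<open>auto simp: sums_iff\<close>)
    thus ?thesis using S by (simp add: sums_iff)
  qed
  hence "Psi w t - \<mu> > 0" using Pt by (simp add: zero_less_mult_iff)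
  thus ?thesis by (simp add: \<mu>_def)
qed

lemma diffs_summable_inside: "ereal \<bar>t\<bar> < conv_radius w \<Longrightarrow> diffs_summable t"
proof -
  assume "ereal \<bar>t\<bar> < conv_radius w"
  then obtain K where K: "ereal \<bar>t\<bar> < ereal K" "ereal K < conv_radius w" using ereal_dense2 by blast
  hence "0 < K" by simp
  show ?thesis
  proof (rule termdiff_converges[where K = K])
    show "norm t < K" using K(1) by simp
    fix x :: real assume "norm x < K"
    hence "ereal (norm x) < conv_radius w" using K(2) by (metis less_ereal.simps(1) order.strict_trans)
    thus "summable (\<lambda>n. w n * x ^ n)" by (rule summable_in_conv_radius)
  qed
qed

lemma continuous_on_Psi:
  assumes "0 \<le> T" "ereal T < conv_radius w"
  shows "continuous_on {0..T} (Psi w)"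
proof -
  obtain K where K: "ereal T < ereal K" "ereal K < conv_radius w" using ereal_dense2[OF assms(2)] by auto
  have K': "summable (\<lambda>k. w k * K ^ k)" "diffs_summable K"
    using K assms summable_weights[of K] diffs_summable_inside[of K] by auto
  have "isCont (Phi w) t" "isCont (\<lambda>t. \<Sum>k. diffs w k * t ^ k) t" if "t \<in> {0..T}" for t
    unfolding Phi_def by (rule isCont_powser[OF K'(1)], use that K in simp, rule isCont_powser[OF K'(2)], use that K in simp)
  moreover have "Phi w t \<noteq> 0" if "t \<in> {0..T}" for t
  proof -
    have "ereal \<bar>t\<bar> < conv_radius w" using that assms by (simp add: order.strict_trans1[rotated])
    thus ?thesis using Phi_pos[OF summable_weights[OF diffs_summable_inside]] that by force
  qed
  ultimately show ?thesis unfolding Psi_def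
    by (intro continuous_intros continuous_at_imp_continuous_on ballI) auto
qed

text \<open>If the mean stays below one inside the disc of convergence, the terms with \<open>k \<ge> 2\<close> are
  controlled by the term \<open>k = 0\<close>, so the series converge on the boundary.\<close>

lemma subcritical_boundary:
  assumes le: "\<And>t. 0 < t \<Longrightarrow> ereal t < conv_radius w \<Longrightarrow> Psi w t \<le> 1" and pos: "conv_radius w > 0"
  shows "conv_radius w < \<infinity>" "diffs_summable (real_of_ereal (conv_radius w))" "Psi w (real_of_ereal (conv_radius w)) \<le> 1"
proof -
  obtain k2 where k2: "k2 \<ge> 2" "w k2 > 0" using w2 by blast
  have part: "(\<Sum>k<N. (real k - 1) * (w k * t ^ k)) \<le> 0" if t: "0 < t" "ereal t < conv_radius w" for t N
  proof (cases "N = 0")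
    case False
    have d: "diffs_summable t" using diffs_summable_inside[of t] t by simp
    have c: "(\<lambda>k. (real k - 1) * (w k * t ^ k)) sums ((Psi w t - 1) * Phi w t)"
      using centred_series[OF d, of 1] t by simp
    have "(\<Sum>k<N. (real k - 1) * (w k * t ^ k)) \<le> (\<Sum>k. (real k - 1) * (w k * t ^ k))"
    proof (rule sum_le_suminf)
      show "summable (\<lambda>k. (real k - 1) * (w k * t ^ k))" using c by (simp add: sums_iff)
      show "0 \<le> (real k - 1) * (w k * t ^ k)" if "k \<in> - {..<N}" for k
        using that False w_nonneg t by (intro mult_nonneg_nonneg) auto
    qed simp
    also have "\<dots> = (Psi w t - 1) * Phi w t" using c by (simp add: sums_iff)
    also have "\<dots> \<le> 0" using le[OF t] Phi_pos[OF summable_weights[OF d]] t by (simp add: mult_nonpos_nonneg)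
    finally show ?thesis .
  qed simp
  have fin: "conv_radius w \<noteq> \<infinity>"
  proof
    assume inf: "conv_radius w = \<infinity>"
    define t where "t = max 1 ((w 0 + 1) / w k2)"
    have t: "t \<ge> 1" "t * w k2 \<ge> w 0 + 1" using k2 by (auto simp: t_def field_simps max_def)
    have "(\<Sum>k\<in>{0, k2}. (real k - 1) * (w k * t ^ k)) \<le> (\<Sum>k<Suc k2. (real k - 1) * (w k * t ^ k))"
      by (rule sum_mono2) (use w_nonneg t in \<open>auto intro!: mult_nonneg_nonneg\<close>)
    also have "\<dots> \<le> 0" using t inf by (intro part) auto
    finally have "(real k2 - 1) * (w k2 * t ^ k2) \<le> w 0" using k2 by simp
    moreover have "1 * (w k2 * t) \<le> (real k2 - 1) * (w k2 * t ^ k2)"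
      using k2 t self_le_power[of t k2] by (intro mult_mono) auto
    ultimately show False using t by (simp add: mult.commute)
  qed
  then obtain \<rho> where rho: "conv_radius w = ereal \<rho>" "\<rho> > 0" using pos by (cases "conv_radius w") auto
  have part': "(\<Sum>k<N. (real k - 1) * (w k * \<rho> ^ k)) \<le> 0" for N
  proof (rule tendsto_upperbound)
    show "((\<lambda>t. \<Sum>k<N. (real k - 1) * (w k * t ^ k)) \<longlongrightarrow> (\<Sum>k<N. (real k - 1) * (w k * \<rho> ^ k))) (at_left \<rho>)"
      by (intro tendsto_intros)
    show "eventually (\<lambda>t. (\<Sum>k<N. (real k - 1) * (w k * t ^ k)) \<le> 0) (at_left \<rho>)"
      unfolding eventually_at_left[OF rho(2)] using part rho(1) by (intro exI[of _ 0]) (auto simp: rho(2))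
  qed simp
  have shift: "(\<Sum>k<N. (real (Suc k) - 1) * (w (Suc k) * \<rho> ^ Suc k)) \<le> w 0" for N
    using part'[of "Suc N"] unfolding sum.lessThan_Suc_shift by simp
  have s1: "summable (\<lambda>k. (real (Suc k) - 1) * (w (Suc k) * \<rho> ^ Suc k))"
    by (rule bounded_imp_summable[where B = "w 0"])
      (use shift w_nonneg rho in \<open>auto simp: lessThan_Suc_atMost[symmetric] simp del: sum.lessThan_Suc intro!: mult_nonneg_nonneg\<close>)
  hence s2: "summable (\<lambda>k. (real k - 1) * (w k * \<rho> ^ k))" by (subst (asm) summable_Suc_iff)
  have "summable (\<lambda>k. real k * w k * \<rho> ^ k)"
  proof (rule summable_comparison_test'[where N = 2])
    show "summable (\<lambda>k. 2 * ((real k - 1) * (w k * \<rho> ^ k)))" using s2 by (rule summable_mult)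
    fix k :: nat assume "k \<ge> 2"
    hence "real k * (w k * \<rho> ^ k) \<le> (2 * (real k - 1)) * (w k * \<rho> ^ k)"
      using w_nonneg rho by (intro mult_right_mono) auto
    thus "norm (real k * w k * \<rho> ^ k) \<le> 2 * ((real k - 1) * (w k * \<rho> ^ k))"
      using w_nonneg rho by (simp add: algebra_simps)
  qed
  hence d: "diffs_summable \<rho>" by (rule mean_series_converse[OF rho(2)])
  have c: "(\<lambda>k. (real k - 1) * (w k * \<rho> ^ k)) sums ((Psi w \<rho> - 1) * Phi w \<rho>)"
    using centred_series[OF d, of 1] rho by simp
  have "(Psi w \<rho> - 1) * Phi w \<rho> \<le> 0"
    using suminf_le_const[OF s2 part'] c by (simp add: sums_iff)
  moreover have "Phi w \<rho> > 0" using Phi_pos[OF summable_weights[OF d]] rho by simp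
  ultimately have "Psi w \<rho> \<le> 1" by (simp add: mult_le_0_iff)
  thus "conv_radius w < \<infinity>" "diffs_summable (real_of_ereal (conv_radius w))" "Psi w (real_of_ereal (conv_radius w)) \<le> 1"
    using d rho by auto
qed

lemma nu_eq_SUP:
  assumes pos: "conv_radius w > 0"
  shows "nu w = (SUP t\<in>{t. 0 < t \<and> ereal t < conv_radius w}. ereal (Psi w t))"
proof -
  let ?I = "{t. 0 < t \<and> ereal t < conv_radius w}"
  define S where "S = (SUP t\<in>?I. ereal (Psi w t))"
  have ev: "eventually P (at_left (conv_radius w)) \<longleftrightarrow> (\<exists>b<conv_radius w. \<forall>y>b. y < conv_radius w \<longrightarrow> P y)" for P
    by (rule eventually_at_left[OF pos])
  have real: "real_of_ereal y \<in> ?I \<and> ereal (real_of_ereal y) = y" if "0 < y" "y < conv_radius w" for y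
    using that by (cases y) auto
  have "((\<lambda>t. ereal (Psi w (real_of_ereal t))) \<longlongrightarrow> S) (at_left (conv_radius w))"
  proof (rule order_tendstoI)
    fix a assume "a < S"
    then obtain t0 where t0: "t0 \<in> ?I" "a < ereal (Psi w t0)" unfolding S_def less_SUP_iff by blast
    show "eventually (\<lambda>t. a < ereal (Psi w (real_of_ereal t))) (at_left (conv_radius w))"
      unfolding ev
    proof (intro exI[of _ "ereal t0"] conjI allI impI)
      show "ereal t0 < conv_radius w" using t0 by simp
      fix y assume y: "ereal t0 < y" "y < conv_radius w"
      have "0 < ereal t0" using t0(1) by simp
      hence "0 < y" using y(1) by (rule order.strict_trans)
      hence yI: "real_of_ereal y \<in> ?I" "ereal (real_of_ereal y) = y" using real[of y] y by auto
      have "t0 < real_of_ereal y" using y(1) yI(2) by (metis ereal_less_eq(3) not_le)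
      hence "Psi w t0 < Psi w (real_of_ereal y)"
        using t0(1) yI(1) by (intro Psi_strict_mono diffs_summable_inside[of t0] diffs_summable_inside[of "real_of_ereal y"])
          (auto simp del: abs_real_of_ereal simp: abs_of_pos)
      thus "a < ereal (Psi w (real_of_ereal y))" using t0(2) by (meson less_ereal.simps(1) order.strict_trans)
    qed
  next
    fix a assume a: "S < a"
    show "eventually (\<lambda>t. ereal (Psi w (real_of_ereal t)) < a) (at_left (conv_radius w))"
      unfolding ev
    proof (intro exI[of _ 0] conjI allI impI)
      fix y assume y: "0 < y" "y < conv_radius w"
      have "ereal (Psi w (real_of_ereal y)) \<le> S" unfolding S_def using real[OF y] by (intro SUP_upper) auto
      thus "ereal (Psi w (real_of_ereal y)) < a" using a by (rule order.strict_trans1)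
    qed (rule pos)
  qed
  moreover have "at_left (conv_radius w) \<noteq> bot"
  proof
    assume "at_left (conv_radius w) = bot"
    hence "eventually (\<lambda>_. False) (at_left (conv_radius w))" by simp
    then obtain b where "b < conv_radius w" "\<forall>y>b. \<not> y < conv_radius w" unfolding ev by blast
    thus False using dense by blast
  qed
  ultimately show ?thesis unfolding nu_def S_def[symmetric] by (intro tendsto_Lim)
qed

text \<open>If \<open>nu w \<ge> 1\<close>, the value one is attained inside the disc of convergence by continuity, or else at
  the boundary point. If \<open>nu w < 1\<close>, the parameter is the boundary point by definition. At the
  boundary point the series converge by \<open>subcritical_boundary\<close>.\<close>

lemma tau_summable:
  assumes pos: "conv_radius w > 0"
  shows "tau w \<ge> 0" "summable (\<lambda>k. w k * tau w ^ k)"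
proof -
  let ?\<rho> = "real_of_ereal (conv_radius w)"
  let ?I = "{t. 0 < t \<and> ereal t < conv_radius w}"
  have "tau w \<ge> 0 \<and> summable (\<lambda>k. w k * tau w ^ k)"
  proof (cases "nu w \<ge> 1")
    case True
    have ex: "\<exists>t. t \<ge> 0 \<and> diffs_summable t \<and> Psi w t = 1"
    proof (cases "\<exists>t\<in>?I. Psi w t \<ge> 1")
      case True
      then obtain T where T: "0 < T" "ereal T < conv_radius w" "Psi w T \<ge> 1" by auto
      have "Psi w 0 = 0" by (simp add: Psi_def)
      hence "\<exists>t\<ge>0. t \<le> T \<and> Psi w t = 1"
        using T continuous_on_Psi[of T] by (intro IVT') auto
      then obtain t where t: "0 \<le> t" "t \<le> T" "Psi w t = 1" by blast
      have "ereal \<bar>t\<bar> < conv_radius w" using t T(2) by (simp add: order.strict_trans1[rotated])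
      thus ?thesis using t diffs_summable_inside by blast
    next
      case False
      hence lt: "Psi w t \<le> 1" if "0 < t" "ereal t < conv_radius w" for t using that by force
      note b = subcritical_boundary[OF lt pos]
      have r: "ereal ?\<rho> = conv_radius w" "?\<rho> > 0" using b(1) pos by (cases "conv_radius w"; simp)+
      have "nu w \<le> ereal (Psi w ?\<rho>)"
        unfolding nu_eq_SUP[OF pos]
      proof (rule SUP_least)
        fix t assume t: "t \<in> ?I"
        hence "t < ?\<rho>" using r(1) by (metis less_ereal.simps(1) mem_Collect_eq)
        thus "ereal (Psi w t) \<le> ereal (Psi w ?\<rho>)"
          using Psi_strict_mono[OF diffs_summable_inside[of t] _ b(2)] t by auto
      qed
      hence "ereal 1 \<le> ereal (Psi w ?\<rho>)" using True unfolding one_ereal_def by (rule order.trans[rotated])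
      hence "Psi w ?\<rho> = 1" using b(3) by simp
      thus ?thesis using b(2) r by (intro exI[of _ ?\<rho>]) auto
    qed
    moreover have "t = t'" if "t \<ge> 0 \<and> diffs_summable t \<and> Psi w t = 1" "t' \<ge> 0 \<and> diffs_summable t' \<and> Psi w t' = 1" for t t'
      using Psi_strict_mono[of t t'] Psi_strict_mono[of t' t] that by (cases t t' rule: linorder_cases) auto
    ultimately have "\<exists>!t. t \<ge> 0 \<and> diffs_summable t \<and> Psi w t = 1" by blast
    from theI'[OF this] have "tau w \<ge> 0 \<and> diffs_summable (tau w)" using True by (simp add: tau_def)
    thus ?thesis using summable_weights by blast
  next
    case False
    have lt: "Psi w t \<le> 1" if t: "0 < t" "ereal t < conv_radius w" for t
    proof -
      have "ereal (Psi w t) \<le> nu w" unfolding nu_eq_SUP[OF pos] using t by (intro SUP_upper) auto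
      also have "nu w \<le> 1" using False by simp
      finally have "ereal (Psi w t) \<le> ereal 1" unfolding one_ereal_def .
      thus ?thesis by simp
    qed
    have "tau w = ?\<rho>" using False by (simp add: tau_def)
    moreover have "?\<rho> \<ge> 0" using pos by (cases "conv_radius w") auto
    ultimately show ?thesis using summable_weights[OF subcritical_boundary(2)[OF lt pos]] by simp
  qed
  thus "tau w \<ge> 0" "summable (\<lambda>k. w k * tau w ^ k)" by auto
qed

lemma pmf_offspring:
  assumes pos: "conv_radius w > 0"
  shows "pmf (offspring_pmf w) k = w k * tau w ^ k / Phi w (tau w)"
proof -
  note t = tau_summable[OF pos]
  have P: "Phi w (tau w) > 0" by (rule Phi_pos[OF t(2,1)])
  have "(\<integral>\<^sup>+k. ennreal (w k * tau w ^ k / Phi w (tau w)) \<partial>count_space UNIV) = (\<Sum>k. ennreal (w k * tau w ^ k / Phi w (tau w)))"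
    by (rule nn_integral_count_space_nat)
  also have "\<dots> = ennreal 1"
  proof (rule suminf_ennreal_eq)
    have "(\<lambda>k. w k * tau w ^ k) sums Phi w (tau w)" unfolding Phi_def using t(2) by (rule summable_sums)
    from sums_divide[OF this, of "Phi w (tau w)"] show "(\<lambda>k. w k * tau w ^ k / Phi w (tau w)) sums 1" using P by simp
  qed (use w_nonneg t P in auto)
  finally show ?thesis unfolding offspring_pmf_def
    using w_nonneg t P by (intro pmf_embed_pmf) auto
qed

lemma critical_offspring_canonical:
  assumes pos: "conv_radius w > 0"
    and mean: "measure_pmf.expectation (offspring_pmf w) real = 1"
    and sq: "integrable (measure_pmf (offspring_pmf w)) (\<lambda>k. (real k - 1)\<^sup>2)"
  shows "critical_offspring (offspring_pmf w)" "tau w > 0" "Phi w (tau w) > 0"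
proof -
  note t = tau_summable[OF pos] and p = pmf_offspring[OF pos]
  show P: "Phi w (tau w) > 0" by (rule Phi_pos[OF t(2,1)])
  have "tau w \<noteq> 0"
  proof
    assume 0: "tau w = 0"
    have "measure_pmf.expectation (offspring_pmf w) real = (\<Sum>k\<in>{0}. pmf (offspring_pmf w) k *\<^sub>R real k)"
      by (rule integral_measure_pmf) (auto simp: set_pmf_iff p 0 power_0_left split: if_splits)
    thus False using mean by simp
  qed
  thus tp: "tau w > 0" using t by simp
  show "critical_offspring (offspring_pmf w)"
  proof
    show "0 < pmf (offspring_pmf w) 0" using p w0 P by simp
    show "\<exists>k\<ge>2. 0 < pmf (offspring_pmf w) k" using p w2 P tp by auto
  qed (fact mean sq)+
qed

end

section \<open>Sampling with weights\<close>

lemma weighted_pmf_scale: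
  assumes "c \<noteq> 0" "\<And>x. x \<in> A \<Longrightarrow> g x = c * f x"
  shows "weighted_pmf A g = weighted_pmf A f"
proof -
  have "sum g A = c * sum f A" using assms(2) by (simp add: sum_distrib_left)
  hence "(\<lambda>x. if x \<in> A then g x / sum g A else 0) = (\<lambda>x. if x \<in> A then f x / sum f A else 0)"
    using assms by (auto simp: fun_eq_iff)
  thus ?thesis by (simp add: weighted_pmf_def)
qed

lemma
  fixes h :: "'a \<Rightarrow> 'c::{banach, second_countable_topology}"
  assumes A: "finite A" "\<And>x. x \<in> A \<Longrightarrow> f x \<ge> 0" "sum f A > 0"
  shows pmf_weighted_pmf: "pmf (weighted_pmf A f) x = (if x \<in> A then f x / sum f A else 0)"
    and set_weighted_pmf: "set_pmf (weighted_pmf A f) \<subseteq> A"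
    and expectation_weighted_pmf: "measure_pmf.expectation (weighted_pmf A f) h
          = (\<Sum>x\<in>A. f x *\<^sub>R h x) /\<^sub>R sum f A"
proof -
  have "(\<integral>\<^sup>+x. ennreal (if x \<in> A then f x / sum f A else 0) \<partial>count_space UNIV)
      = (\<Sum>x\<in>A. ennreal (if x \<in> A then f x / sum f A else 0))"
    by (rule nn_integral_count_space') (use A in auto)
  also have "\<dots> = ennreal (\<Sum>x\<in>A. f x / sum f A)" using A by (subst sum_ennreal[symmetric]) auto
  also have "(\<Sum>x\<in>A. f x / sum f A) = 1" using A by (simp add: sum_divide_distrib[symmetric])
  finally have p: "pmf (weighted_pmf A f) x = (if x \<in> A then f x / sum f A else 0)" for x
    unfolding weighted_pmf_def using A by (intro pmf_embed_pmf) auto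
  show "pmf (weighted_pmf A f) x = (if x \<in> A then f x / sum f A else 0)" by (rule p)
  show sub: "set_pmf (weighted_pmf A f) \<subseteq> A" by (auto simp: set_pmf_iff p split: if_splits)
  have "measure_pmf.expectation (weighted_pmf A f) h = (\<Sum>x\<in>A. pmf (weighted_pmf A f) x *\<^sub>R h x)"
    by (rule integral_measure_pmf) (use A sub in auto)
  also have "\<dots> = (\<Sum>x\<in>A. f x *\<^sub>R h x) /\<^sub>R sum f A"
    by (simp add: p scaleR_sum_right divide_inverse mult.commute)
  finally show "measure_pmf.expectation (weighted_pmf A f) h = (\<Sum>x\<in>A. f x *\<^sub>R h x) /\<^sub>R sum f A" .
qed

section \<open>Asymptotics of conditioned forests\<close>

definition forest_outdegree_count :: "nat \<Rightarrow> planted_tree list \<Rightarrow> nat" where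
  "forest_outdegree_count j ts = sum_list (map (outdegree_count j) ts)"

lemma eventually_seq_gt:
  assumes "filterlim (N :: nat \<Rightarrow> nat) at_top sequentially"
  shows "eventually (\<lambda>k. N k > C) sequentially"
proof -
  have "eventually (\<lambda>k. Suc C \<le> N k) sequentially" using assms by (simp add: filterlim_at_top)
  thus ?thesis by eventually_elim simp
qed

lemma tree_weight_of_real: "tree_weight (\<lambda>k. complex_of_real (a k)) t = of_real (tree_weight a t)"
proof (induction t)
  case (Node ts)
  have "prod_list (map (tree_weight (\<lambda>k. complex_of_real (a k))) ts) = of_real (prod_list (map (tree_weight a) ts))"
    using Node by (induction ts) auto
  thus ?case by simp
qed

lemma forest_weight_nonneg: "(\<And>k. a k \<ge> (0::real)) \<Longrightarrow> forest_weight a ts \<ge> 0"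
  unfolding forest_weight_def by (induction ts) (auto simp: tree_weight_nonneg)

context critical_offspring
begin

lemma forest_weight_tilt:
  "forest_weight (tilt j \<theta>) ts = of_real (forest_weight (pmf p) ts) * cis (\<theta> * forest_outdegree_count j ts)"
proof (induction ts)
  case Nil thus ?case by (simp add: forest_weight_def forest_outdegree_count_def)
next
  case (Cons t ts)
  have "tree_weight (tilt j \<theta>) t = of_real (tree_weight (pmf p) t) * cis \<theta> ^ outdegree_count j t"
    unfolding tilt_def tree_weight_indicator[of "\<lambda>k. complex_of_real (pmf p k)"] tree_weight_of_real ..
  also have "cis \<theta> ^ outdegree_count j t = cis (\<theta> * outdegree_count j t)"
    by (simp add: Complex.DeMoivre mult.commute)
  finally show ?case using Cons
    by (simp add: forest_weight_def forest_outdegree_count_def cis_mult distrib_left mult_ac)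
qed

lemma forest_sum_tilt_0: "forest_sum (tilt j 0) r n = of_real (forest_sum (pmf p) r n)"
  unfolding forest_sum_def by (simp add: forest_weight_tilt)

lemma tree_weight_tilt_0: "tree_weight (tilt j 0) t = of_real (tree_weight (pmf p) t)"
  using forest_weight_tilt[of j 0 "[t]"] by (simp add: forest_weight_def)

lemma nodes_mod_span:
  "tree_weight (pmf p) t \<noteq> 0 \<Longrightarrow> \<exists>e. nodes t = Suc (span * e)"
proof (induction t)
  case (Node ts)
  have "\<exists>e. sum_list (map nodes ts) = length ts + span * e"
    if "prod_list (map (tree_weight (pmf p)) ts) \<noteq> 0"
    using that Node.IH
  proof (induction ts)
    case (Cons t ts)
    obtain e where "nodes t = Suc (span * e)" using Cons by auto
    moreover obtain e' where "sum_list (map nodes ts) = length ts + span * e'" using Cons by auto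
    ultimately show ?case by (intro exI[of _ "e + e'"]) (simp add: algebra_simps)
  qed simp
  then obtain e where e: "sum_list (map nodes ts) = length ts + span * e" using Node.prems by auto
  have "pmf p (length ts) > 0" using Node.prems pmf_nonneg[of p "length ts"] by (auto simp: less_le)
  then obtain e' where "length ts = span * e'" using span_dvd by blast
  thus ?case using e by (intro exI[of _ "e' + e"]) (simp add: algebra_simps)
qed

lemma forest_nodes_mod_span:
  "forest_weight (pmf p) ts \<noteq> 0 \<Longrightarrow> \<exists>e. sum_list (map nodes ts) = length ts + span * e"
proof (induction ts)
  case (Cons t ts)
  obtain e where "nodes t = Suc (span * e)" using Cons.prems nodes_mod_span[of t] by (auto simp: forest_weight_def)
  moreover obtain e' where "sum_list (map nodes ts) = length ts + span * e'" using Cons by (auto simp: forest_weight_def)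
  ultimately show ?case by (intro exI[of _ "e + e'"]) (simp add: algebra_simps)
qed simp

text \<open>A necessary condition for a forest of \<open>r\<close> trees with \<open>n\<close> vertices to have positive weight, which
  for \<open>r > 0\<close> is sufficient if \<open>n\<close> is large.\<close>

definition admissible :: "nat \<Rightarrow> nat \<Rightarrow> bool" where
  "admissible r n \<longleftrightarrow> r \<le> n \<and> span dvd n - r"

lemma forest_sum_pos_imp_admissible:
  assumes "forest_sum (pmf p) r n > 0" shows "admissible r n"
proof -
  have "(\<Sum>f\<in>forests r n. forest_weight (pmf p) f) \<noteq> 0" using assms by (simp add: forest_sum_def)
  then obtain f where f: "f \<in> forests r n" "forest_weight (pmf p) f \<noteq> 0" by (meson sum.neutral)
  thus ?thesis using forest_nodes_mod_span[OF f(2)] by (auto simp: forests_def admissible_def)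
qed

definition llt_const :: real where "llt_const = span / sqrt (2 * pi * var)"

lemma llt_const_pos: "llt_const > 0"
  using var_pos span_pos by (simp add: llt_const_def)

lemma walk_coeff_tendsto:
  assumes N: "filterlim N at_top sequentially" and adm: "\<And>k. admissible r (N k)"
  shows "(\<lambda>k. of_real (sqrt (N k)) * walk_coeff (tilt j (\<theta> / sqrt (N k))) (N k) r * cis (- \<theta> * pmf p j * sqrt (N k)))
    \<longlonglongrightarrow> of_real (llt_const * exp (- \<theta>\<^sup>2 / 2 * count_var j))"
proof (rule Lim_transform_eventually)
  show "(\<lambda>k. fourier_coeff j \<theta> r (N k)) \<longlonglongrightarrow> of_real (llt_const * exp (- \<theta>\<^sup>2 / 2 * count_var j))"
    unfolding llt_const_def by (rule filterlim_compose[OF fourier_coeff_tendsto N])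
  have "eventually (\<lambda>k. N k > 0) sequentially" using eventually_seq_gt[OF N] .
  thus "eventually (\<lambda>k. fourier_coeff j \<theta> r (N k) = of_real (sqrt (N k)) * walk_coeff (tilt j (\<theta> / sqrt (N k))) (N k) r * cis (- \<theta> * pmf p j * sqrt (N k))) sequentially"
  proof eventually_elim
    case (elim k)
    show ?case
      by (rule walk_coeff_eq_fourier_coeff[symmetric]) (use elim adm[of k] in \<open>auto simp: admissible_def\<close>)
  qed
qed

lemma forest_sum_tilt_tendsto:
  assumes N: "filterlim N at_top sequentially" and adm: "\<And>k. admissible r (N k)"
  shows "(\<lambda>k. of_real (sqrt (N k)) * (of_nat (N k) * forest_sum (tilt j (\<theta> / sqrt (N k))) r (N k)) * cis (- \<theta> * pmf p j * sqrt (N k)))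
    \<longlonglongrightarrow> of_nat r * of_real (llt_const * exp (- \<theta>\<^sup>2 / 2 * count_var j))"
proof -
  from tendsto_mult_left[OF walk_coeff_tendsto[OF assms], of "of_nat r"]
  show ?thesis unfolding forest_sum_lagrange by (simp add: mult_ac)
qed

lemma forest_sum_tendsto:
  assumes N: "filterlim N at_top sequentially" and adm: "\<And>k. admissible r (N k)"
  shows "(\<lambda>k. sqrt (N k) * (real (N k) * forest_sum (pmf p) r (N k))) \<longlonglongrightarrow> real r * llt_const"
proof -
  have "(\<lambda>k. complex_of_real (sqrt (N k) * (real (N k) * forest_sum (pmf p) r (N k)))) \<longlonglongrightarrow> of_real (real r * llt_const)"
    using forest_sum_tilt_tendsto[OF assms, of 0 0] by (simp add: forest_sum_tilt_0)
  thus ?thesis unfolding tendsto_of_real_iff .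
qed

lemma eventually_forest_sum_pos:
  assumes N: "filterlim N at_top sequentially" and adm: "\<And>k. admissible r (N k)" and r: "r > 0"
  shows "eventually (\<lambda>k. N k > 0 \<and> forest_sum (pmf p) r (N k) > 0) sequentially"
proof -
  have "real r * llt_const > 0" using r llt_const_pos by simp
  from order_tendstoD(1)[OF forest_sum_tendsto[OF N adm] this]
  have "eventually (\<lambda>k. sqrt (N k) * (real (N k) * forest_sum (pmf p) r (N k)) > 0) sequentially" .
  moreover have "eventually (\<lambda>k. N k > 0) sequentially" using eventually_seq_gt[OF N] .
  ultimately show ?thesis by eventually_elim (auto simp: zero_less_mult_iff)
qed

lemma forest_sum_set:
  assumes r: "r > 0"
  shows "infinite {n. forest_sum (pmf p) r n > 0}"
proof
  assume fin: "finite {n. forest_sum (pmf p) r n > 0}"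
  define N where "N k = r + span * k" for k
  have N: "filterlim N at_top sequentially"
    using span_pos unfolding N_def by (intro filterlim_at_top_mono[OF filterlim_ident]) (auto intro!: always_eventually trans_le_add2)
  have adm: "admissible r (N k)" for k by (simp add: admissible_def N_def)
  have "eventually (\<lambda>k. N k > Max (insert 0 {n. forest_sum (pmf p) r n > 0})) sequentially"
    using eventually_seq_gt[OF N] .
  with eventually_forest_sum_pos[OF N adm r] have "eventually (\<lambda>k. False) sequentially"
  proof eventually_elim
    case (elim k)
    have "N k \<le> Max (insert 0 {n. forest_sum (pmf p) r n > 0})" using elim fin by (intro Max_ge) auto
    thus False using elim by simp
  qed
  thus False by simp
qed

text \<open>A quotient of two local limits, those of the marked and of the unmarked weights of the same
  forests.\<close>

theorem forest_outdegree_count_char: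
  assumes N: "filterlim N at_top sequentially" and adm: "\<And>k. admissible r (N k)" and r: "r > 0"
  shows "(\<lambda>k. (\<Sum>f\<in>forests r (N k). of_real (forest_weight (pmf p) f) *
        cis (\<theta> * ((real (forest_outdegree_count j f) - pmf p j * real (N k)) / sqrt (N k)))) / of_real (forest_sum (pmf p) r (N k)))
     \<longlonglongrightarrow> of_real (exp (- \<theta>\<^sup>2 / 2 * count_var j))"
proof -
  let ?A = "\<lambda>k. of_real (sqrt (N k)) * (of_nat (N k) * forest_sum (tilt j (\<theta> / sqrt (N k))) r (N k)) * cis (- \<theta> * pmf p j * sqrt (N k))"
  let ?B = "\<lambda>k. complex_of_real (sqrt (N k) * (real (N k) * forest_sum (pmf p) r (N k)))"
  have nz: "complex_of_real (real r * llt_const) \<noteq> 0" using r llt_const_pos by simp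
  have "(\<lambda>k. ?A k / ?B k) \<longlonglongrightarrow> (of_nat r * of_real (llt_const * exp (- \<theta>\<^sup>2 / 2 * count_var j))) / of_real (real r * llt_const)"
    by (rule tendsto_divide[OF forest_sum_tilt_tendsto[OF N adm] tendsto_of_real[OF forest_sum_tendsto[OF N adm]] nz])
  also have "(of_nat r * of_real (llt_const * exp (- \<theta>\<^sup>2 / 2 * count_var j))) / of_real (real r * llt_const)
      = complex_of_real (exp (- \<theta>\<^sup>2 / 2 * count_var j))"
    using r llt_const_pos by simp
  finally show ?thesis
  proof (rule Lim_transform_eventually)
    show "eventually (\<lambda>k. ?A k / ?B k = (\<Sum>f\<in>forests r (N k). of_real (forest_weight (pmf p) f) *
        cis (\<theta> * ((real (forest_outdegree_count j f) - pmf p j * real (N k)) / sqrt (N k)))) / of_real (forest_sum (pmf p) r (N k))) sequentially"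
      using eventually_forest_sum_pos[OF N adm r]
    proof eventually_elim
      case (elim k)
      have sq: "real (N k) / sqrt (N k) = sqrt (N k)" using elim by (simp add: real_div_sqrt)
      have "forest_sum (tilt j (\<theta> / sqrt (N k))) r (N k) * cis (- \<theta> * pmf p j * sqrt (N k))
          = (\<Sum>f\<in>forests r (N k). of_real (forest_weight (pmf p) f) *
              (cis (\<theta> / sqrt (N k) * real (forest_outdegree_count j f)) * cis (- \<theta> * pmf p j * sqrt (N k))))"
        unfolding forest_sum_def forest_weight_tilt sum_distrib_right by (simp add: mult.assoc)
      also have "\<dots> = (\<Sum>f\<in>forests r (N k). of_real (forest_weight (pmf p) f) *
              cis (\<theta> * ((real (forest_outdegree_count j f) - pmf p j * real (N k)) / sqrt (N k))))"
      proof (intro sum.cong refl arg_cong2[where f = "(*)"])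
        fix f
        have "\<theta> * ((real (forest_outdegree_count j f) - pmf p j * real (N k)) / sqrt (N k))
            = \<theta> / sqrt (N k) * real (forest_outdegree_count j f) - \<theta> * pmf p j * (real (N k) / sqrt (N k))"
          by (simp add: diff_divide_distrib right_diff_distrib)
        thus "cis (\<theta> / sqrt (N k) * real (forest_outdegree_count j f)) * cis (- \<theta> * pmf p j * sqrt (N k))
            = cis (\<theta> * ((real (forest_outdegree_count j f) - pmf p j * real (N k)) / sqrt (N k)))"
          unfolding sq by (simp add: cis_mult)
      qed
      finally have S: "forest_sum (tilt j (\<theta> / sqrt (N k))) r (N k) * cis (- \<theta> * pmf p j * sqrt (N k)) = \<dots>" .
      have "?A k / ?B k = (forest_sum (tilt j (\<theta> / sqrt (N k))) r (N k) * cis (- \<theta> * pmf p j * sqrt (N k))) / of_real (forest_sum (pmf p) r (N k))"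
        using elim by (simp add: field_simps)
      thus ?case unfolding S .
    qed
  qed
qed

text \<open>The numerator and the total weight times the size are multiples of walk coefficients whose
  numbers of steps differ by \<open>nodes t\<close> only; by the local limit theorem these coefficients are
  asymptotically equal.\<close>

theorem forest_fringe_fraction:
  assumes N: "filterlim N at_top sequentially" and adm: "\<And>k. admissible (Suc r) (N k)"
  shows "(\<lambda>k. (\<Sum>f\<in>forests (Suc r) (N k). forest_weight (pmf p) f * real (forest_fringe_count t f))
      / forest_sum (pmf p) (Suc r) (N k) / real (N k)) \<longlonglongrightarrow> tree_weight (pmf p) t"
proof (cases "tree_weight (pmf p) t = 0")
  case zero: True
  have "(\<Sum>f\<in>forests (Suc r) (N k). forest_weight (pmf p) f * real (forest_fringe_count t f)) = 0" for k
    unfolding forest_sum_fringe_count zero by simp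
  thus ?thesis by (simp add: zero)
next
  case False
  then obtain e where e: "nodes t = Suc (span * e)" using nodes_mod_span by blast
  define s where "s = nodes t"
  define x where "x = tree_weight (pmf p) t"
  \<comment> \<open>eventually \<open>N k - s\<close>; the other value keeps all terms admissible\<close>
  define M where "M k = (if N k \<ge> s + r then N k - s else r)" for k
  have evN: "eventually (\<lambda>k. N k \<ge> C) sequentially" for C using N by (simp add: filterlim_at_top)
  have admM: "admissible r (M k)" for k
  proof (cases "N k \<ge> s + r")
    case True
    obtain y where y: "N k - Suc r = span * y" using adm[of k] by (auto simp: admissible_def)
    have "N k - s - r = (N k - Suc r) - span * e" using True e by (simp add: s_def)
    hence "span dvd M k - r" using y True by (simp add: M_def diff_mult_distrib2[symmetric])
    thus ?thesis using True by (simp add: admissible_def M_def)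
  qed (simp add: M_def admissible_def)
  have M: "filterlim M at_top sequentially"
    unfolding filterlim_at_top
  proof
    fix C
    show "eventually (\<lambda>k. C \<le> M k) sequentially"
      using evN[of "C + s + r"] by eventually_elim (auto simp: M_def)
  qed
  have num: "(\<lambda>k. complex_of_real (sqrt (M k)) * walk_coeff (tilt 0 0) (M k) r) \<longlonglongrightarrow> of_real llt_const"
    using walk_coeff_tendsto[OF M admM, of 0 0] by simp
  have den: "(\<lambda>k. complex_of_real (sqrt (N k) * (real (N k) * forest_sum (pmf p) (Suc r) (N k)))) \<longlonglongrightarrow> of_real (real (Suc r) * llt_const)"
    by (rule tendsto_of_real[OF forest_sum_tendsto[OF N adm]])
  have rat: "(\<lambda>k. complex_of_real (sqrt (N k) / sqrt (M k))) \<longlonglongrightarrow> of_real 1"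
  proof (rule tendsto_of_real, rule Lim_transform_eventually)
    have "((\<lambda>x::real. sqrt x / sqrt (x - real s)) \<longlongrightarrow> 1) at_top" by real_asymp
    from filterlim_compose[OF this filterlim_compose[OF filterlim_real_sequentially N]]
    show "(\<lambda>k. sqrt (real (N k)) / sqrt (real (N k) - real s)) \<longlonglongrightarrow> 1" .
    show "eventually (\<lambda>k. sqrt (real (N k)) / sqrt (real (N k) - real s) = sqrt (N k) / sqrt (M k)) sequentially"
      using evN[of "s + r"] by eventually_elim (simp add: M_def of_nat_diff)
  qed
  have nz: "complex_of_real (real (Suc r) * llt_const) \<noteq> 0"
    using llt_const_pos by (simp only: of_real_eq_0_iff mult_eq_0_iff of_nat_eq_0_iff) simp
  have "(\<lambda>k. of_real x * of_nat (Suc r) * (complex_of_real (sqrt (M k)) * walk_coeff (tilt 0 0) (M k) r) * of_real (sqrt (N k) / sqrt (M k))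
        / complex_of_real (sqrt (N k) * (real (N k) * forest_sum (pmf p) (Suc r) (N k))))
      \<longlonglongrightarrow> of_real x * of_nat (Suc r) * of_real llt_const * of_real 1 / of_real (real (Suc r) * llt_const)"
    by (intro tendsto_divide tendsto_mult tendsto_const num rat den nz)
  also have "of_real x * of_nat (Suc r) * of_real llt_const * of_real 1 / of_real (real (Suc r) * llt_const) = complex_of_real x"
  proof -
    have "X * R * L * of_real 1 / (R * L) = X" if "R \<noteq> 0" "L \<noteq> 0" for X R L :: complex using that by simp
    moreover have "complex_of_nat (Suc r) \<noteq> 0" by (metis of_nat_eq_0_iff nat.distinct(1))
    moreover have "complex_of_real llt_const \<noteq> 0" using llt_const_pos by simp
    ultimately show ?thesis unfolding of_real_mult of_real_of_nat_eq by blast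
  qed
  finally have "(\<lambda>k. complex_of_real ((\<Sum>f\<in>forests (Suc r) (N k). forest_weight (pmf p) f * real (forest_fringe_count t f))
      / forest_sum (pmf p) (Suc r) (N k) / real (N k))) \<longlonglongrightarrow> of_real x"
  proof (rule Lim_transform_eventually)
    have Mpos: "eventually (\<lambda>k. M k > 0) sequentially" using eventually_seq_gt[OF M] .
    show "eventually (\<lambda>k. of_real x * of_nat (Suc r) * (complex_of_real (sqrt (M k)) * walk_coeff (tilt 0 0) (M k) r) * of_real (sqrt (N k) / sqrt (M k))
        / complex_of_real (sqrt (N k) * (real (N k) * forest_sum (pmf p) (Suc r) (N k)))
      = complex_of_real ((\<Sum>f\<in>forests (Suc r) (N k). forest_weight (pmf p) f * real (forest_fringe_count t f))
      / forest_sum (pmf p) (Suc r) (N k) / real (N k))) sequentially"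
      using eventually_forest_sum_pos[OF N adm zero_less_Suc] evN[of "s + r"] Mpos
    proof eventually_elim
      case (elim k)
      have "complex_of_real (\<Sum>f\<in>forests (Suc r) (N k). forest_weight (pmf p) f * real (forest_fringe_count t f))
          = (\<Sum>f\<in>forests (Suc r) (N k). forest_weight (tilt 0 0) f * of_nat (forest_fringe_count t f))"
        by (simp add: forest_weight_tilt)
      also have "\<dots> = of_real x * of_nat (Suc r) * walk_coeff (tilt 0 0) (M k) r"
        unfolding forest_sum_fringe_count using elim by (simp add: M_def s_def x_def tree_weight_tilt_0)
      finally have S: "complex_of_real (\<Sum>f\<in>forests (Suc r) (N k). forest_weight (pmf p) f * real (forest_fringe_count t f)) = \<dots>" .
      have "of_real x * of_nat (Suc r) * (complex_of_real (sqrt (M k)) * W) * of_real (sqrt (N k) / sqrt (M k))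
        / complex_of_real (sqrt (N k) * (real (N k) * forest_sum (pmf p) (Suc r) (N k)))
        = of_real x * of_nat (Suc r) * W / of_real (forest_sum (pmf p) (Suc r) (N k)) / of_nat (N k)" for W
        using elim by (simp add: field_simps del: of_nat_Suc)
      thus ?case unfolding of_real_divide S by simp
    qed
  qed
  thus ?thesis unfolding tendsto_of_real_iff x_def .
qed

text \<open>The bounds of \<open>nbhd_count_bounds\<close> hold for every tree and are linear in the fringe counts, so
  they pass to expectations.\<close>

theorem nbhd_count_tendsto:
  assumes \<mu>: "\<And>k. set_pmf (\<mu> k) \<subseteq> {s. nodes s = N k}"
    and fringe: "\<And>t. (\<lambda>k. measure_pmf.expectation (\<mu> k) (\<lambda>s. real (fringe_count t s)) / real (N k)) \<longlonglongrightarrow> tree_weight (pmf p) t"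
  shows "(\<lambda>k. measure_pmf.expectation (\<mu> k) (\<lambda>s. real (nbhd_count l Q s) / real (N k)))
     \<longlonglongrightarrow> \<P>(s in limit_measure p. nbhd l (limit_tree s) \<simeq>\<^sub>r Q)"
proof (rule nbhd_fraction_tendsto[where a = "\<lambda>k t. measure_pmf.expectation (\<mu> k) (\<lambda>s. real (fringe_count t s)) / real (N k)"])
  have int [simp]: "integrable (measure_pmf (\<mu> k)) f" for k and f :: "planted_tree \<Rightarrow> real"
    by (rule integrable_measure_pmf_finite) (rule finite_subset[OF \<mu>], simp)
  have Npos: "N k > 0" for k
  proof -
    obtain s where "s \<in> set_pmf (\<mu> k)" using set_pmf_not_empty by fast
    thus ?thesis using \<mu>[of k] nodes_pos[of s] by auto
  qed
  have lin: "(\<Sum>(t, x)\<in>B. measure_pmf.expectation (\<mu> k) (\<lambda>s. real (fringe_count t s)) / real (N k))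
      = measure_pmf.expectation (\<mu> k) (\<lambda>s. real (\<Sum>(t, x)\<in>B. fringe_count t s) / real (N k))" for B k
    by (simp add: case_prod_beta sum_divide_distrib Bochner_Integration.integral_sum)
  show "(\<Sum>(t, x)\<in>B. measure_pmf.expectation (\<mu> k) (\<lambda>s. real (fringe_count t s)) / real (N k))
      \<le> measure_pmf.expectation (\<mu> k) (\<lambda>s. real (nbhd_count l Q s) / real (N k))"
    if "finite B" "B \<subseteq> pointed_trees l" "\<And>t x. (t, x) \<in> B \<Longrightarrow> nbhd l (planted_graph t, x) \<simeq>\<^sub>r Q" for k B
  proof -
    have le: "(\<Sum>(t, x)\<in>B. fringe_count t s) \<le> nbhd_count l Q s" for s
      by (rule nbhd_count_bounds(1)[OF that, where C = "{}"]) auto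
    show ?thesis unfolding lin
      by (intro integral_mono int divide_right_mono) (simp_all only: of_nat_le_iff le of_nat_0_le_iff)
  qed
  show "measure_pmf.expectation (\<mu> k) (\<lambda>s. real (nbhd_count l Q s) / real (N k))
      + (\<Sum>(t, x)\<in>C. measure_pmf.expectation (\<mu> k) (\<lambda>s. real (fringe_count t s)) / real (N k)) \<le> 1"
    if C: "finite C" "C \<subseteq> pointed_trees l" "\<And>t x. (t, x) \<in> C \<Longrightarrow> \<not> nbhd l (planted_graph t, x) \<simeq>\<^sub>r Q" for k C
  proof -
    have "measure_pmf.expectation (\<mu> k) (\<lambda>s. real (nbhd_count l Q s) / real (N k))
      + (\<Sum>(t, x)\<in>C. measure_pmf.expectation (\<mu> k) (\<lambda>s. real (fringe_count t s)) / real (N k))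
      = measure_pmf.expectation (\<mu> k) (\<lambda>s. real (nbhd_count l Q s) / real (N k) + real (\<Sum>(t, x)\<in>C. fringe_count t s) / real (N k))"
      unfolding lin by (rule Bochner_Integration.integral_add[symmetric]) (rule int)+
    also have "\<dots> \<le> measure_pmf.expectation (\<mu> k) (\<lambda>s. 1)"
    proof (rule integral_mono_AE)
      show "AE s in measure_pmf (\<mu> k). real (nbhd_count l Q s) / real (N k) + real (\<Sum>(t, x)\<in>C. fringe_count t s) / real (N k) \<le> 1"
        unfolding AE_measure_pmf_iff
      proof
        fix s assume "s \<in> set_pmf (\<mu> k)"
        hence "nodes s = N k" using \<mu> by blast
        hence "nbhd_count l Q s + (\<Sum>(t, x)\<in>C. fringe_count t s) \<le> N k"
          using nbhd_count_bounds(2)[OF finite.emptyI _ _ C, of s] by simp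
        hence "real (nbhd_count l Q s + (\<Sum>(t, x)\<in>C. fringe_count t s)) / real (N k) \<le> real (N k) / real (N k)"
          by (intro divide_right_mono) (simp_all only: of_nat_le_iff of_nat_0_le_iff)
        thus "real (nbhd_count l Q s) / real (N k) + real (\<Sum>(t, x)\<in>C. fringe_count t s) / real (N k) \<le> 1"
          using Npos[of k] by (simp only: of_nat_add add_divide_distrib) simp
      qed
    qed auto
    finally show ?thesis by simp
  qed
qed (rule fringe)

end

section \<open>Unrooted trees and corner-rooted trees\<close>

text \<open>The root of a tree rooted at a corner has as many neighbours as children, any other vertex has one
  more; with this correction at the root, the weight becomes that of the unrooted tree.\<close>

definition corner_weight :: "(nat \<Rightarrow> real) \<Rightarrow> planted_tree \<Rightarrow> real" where
  "corner_weight a t = (case t of Node ts \<Rightarrow> a (length ts - 1) * forest_weight a ts)"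

text \<open>Deleting the root edge leaves two planted trees in which the out-degree of every vertex is its
  degree in the whole tree minus one.\<close>

definition corner_forest :: "planted_tree \<Rightarrow> planted_tree list" where
  "corner_forest t = (case t of Node ts \<Rightarrow> [Node (tl ts), hd ts])"

lemma graph_iso_degree:
  assumes f: "graph_iso_by f G H" and s: "simple_graph G" "simple_graph H" and v: "v \<in> verts G"
  shows "degree H (f v) = degree G v"
proof -
  have bij: "bij_betw f (verts G) (verts H)" and
    e: "\<And>u v. u \<in> verts G \<Longrightarrow> v \<in> verts G \<Longrightarrow> (u, v) \<in> edges G \<longleftrightarrow> (f u, f v) \<in> edges H"
    using f by (auto simp: graph_iso_by_def)
  have sub: "neighbours G v \<subseteq> verts G" "neighbours H (f v) \<subseteq> verts H"
    using s by (auto simp: neighbours_def simple_graph_def)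
  have "f ` neighbours G v = neighbours H (f v)"
  proof (intro equalityI subsetI)
    fix y assume "y \<in> f ` neighbours G v"
    then obtain u where u: "u \<in> neighbours G v" "y = f u" by blast
    thus "y \<in> neighbours H (f v)" using e[OF v, of u] sub(1) by (auto simp: neighbours_def)
  next
    fix y assume y: "y \<in> neighbours H (f v)"
    hence "y \<in> f ` verts G" using sub(2) bij by (auto simp: bij_betw_def)
    then obtain u where u: "u \<in> verts G" "y = f u" by blast
    thus "y \<in> f ` neighbours G v" using e[OF v u(1)] y by (auto simp: neighbours_def)
  qed
  moreover have "inj_on f (neighbours G v)" using bij sub(1) by (auto simp: bij_betw_def intro: inj_on_subset)
  ultimately show ?thesis unfolding degree_def using card_image by metis
qed

lemma simple_underlying: "U \<in> unrooted_plane_trees n \<Longrightarrow> simple_graph (underlying U)"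
proof -
  assume U: "U \<in> unrooted_plane_trees n"
  have "(SOME P. P \<in> U) \<in> U" using unrooted_class(1)[OF U] by (rule someI_ex)
  from plane_treeD(1)[OF labelled_plane_treesD(1)[OF unrooted_class(2)[OF U this]]]
  show ?thesis by (simp add: underlying_def)
qed

lemma corner_weight_eq_prod: "corner_weight a t = (\<Prod>v\<in>positions t. a (degree (planted_graph t) v - 1))"
proof -
  obtain ts where t: "t = Node ts" by (cases t)
  have "(\<Prod>v\<in>positions t. a (degree (planted_graph t) v - 1))
      = a (length ts - 1) * (\<Prod>i<length ts. \<Prod>v\<in>positions (ts ! i). a (degree (planted_graph t) (i # v) - 1))"
    unfolding t by (subst prod_positions_Node) (simp add: degree_planted_graph)
  also have "(\<Prod>i<length ts. \<Prod>v\<in>positions (ts ! i). a (degree (planted_graph t) (i # v) - 1))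
      = (\<Prod>i<length ts. planted_weight a (ts ! i))"
    unfolding planted_weight_def t by (intro prod.cong refl) (simp add: degree_planted_graph)
  finally show ?thesis
    by (simp add: t corner_weight_def forest_weight_def planted_weight_eq prod_list_conv_index)
qed

lemma unrooted_weight_code:
  assumes U: "U \<in> unrooted_plane_trees n" and t: "t \<in> codes U"
  shows "unrooted_weight a U = corner_weight a t"
proof -
  obtain f where f: "graph_iso_by f (planted_graph t) (underlying U)" using codes_graph_iso[OF assms] by blast
  hence bij: "bij_betw f (positions t) (verts (underlying U))" by (simp add: graph_iso_by_def)
  have "unrooted_weight a U = (\<Prod>v\<in>positions t. a (degree (underlying U) (f v) - 1))"
    unfolding unrooted_weight_def by (rule prod.reindex_bij_betw[OF bij, symmetric])
  also have "\<dots> = corner_weight a t"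
    unfolding corner_weight_eq_prod
    by (intro prod.cong refl) (simp add: graph_iso_degree[OF f _ simple_underlying[OF U]])
  finally show ?thesis .
qed

lemma card_degree_corner:
  assumes "d \<ge> 1" "nodes t \<ge> 2"
  shows "card {v \<in> positions t. degree (planted_graph t) v = d} = forest_outdegree_count (d - 1) (corner_forest t)"
proof -
  obtain u us where t: "t = Node (u # us)"
  proof -
    obtain ts where "t = Node ts" by (cases t)
    with that show ?thesis using assms(2) by (cases ts) auto
  qed
  have c: "card {v \<in> positions s. P v} = (\<Sum>v\<in>positions s. if P v then 1 else 0)" for s P
    by (simp add: sum.If_cases Int_def)
  have "card {v \<in> positions t. degree (planted_graph t) v = d} =
      (if length us = d - 1 then 1 else 0) + (\<Sum>i<length (u # us). \<Sum>v\<in>positions ((u # us) ! i). if degree (planted_graph t) (i # v) = d then 1 else 0)"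
    unfolding c t using assms(1) by (subst sum_positions_Node) (auto simp: degree_planted_graph)
  also have "(\<Sum>i<length (u # us). \<Sum>v\<in>positions ((u # us) ! i). if degree (planted_graph t) (i # v) = d then 1 else 0)
      = (\<Sum>i<length (u # us). card {v \<in> positions ((u # us) ! i). outdegree ((u # us) ! i) v = d - 1})"
    unfolding c t using assms(1) by (intro sum.cong refl) (auto simp: degree_planted_graph simp del: nth_Cons_0)
  also have "\<dots> = sum_list (map (outdegree_count (d - 1)) (u # us))"
    unfolding card_outdegree sum_list_conv_index ..
  finally show ?thesis by (simp add: t corner_forest_def forest_outdegree_count_def)
qed

lemma count_degree_code:
  assumes U: "U \<in> unrooted_plane_trees n" and t: "t \<in> codes U" and d: "d \<ge> 1"
  shows "count_degree d U = forest_outdegree_count (d - 1) (corner_forest t)"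
proof -
  obtain f where f: "graph_iso_by f (planted_graph t) (underlying U)" using codes_graph_iso[OF U t] by blast
  hence bij: "bij_betw f (positions t) (verts (underlying U))" by (simp add: graph_iso_by_def)
  have deg: "degree (underlying U) (f v) = degree (planted_graph t) v" if "v \<in> positions t" for v
    using graph_iso_degree[OF f _ simple_underlying[OF U]] that by simp
  have vs: "verts (underlying U) = f ` positions t" using bij by (simp add: bij_betw_def)
  have "{v \<in> verts (underlying U). degree (underlying U) v = d} = f ` {v \<in> positions t. degree (underlying U) (f v) = d}"
    unfolding vs by blast
  also have "{v \<in> positions t. degree (underlying U) (f v) = d} = {v \<in> positions t. degree (planted_graph t) v = d}"
    using deg by auto
  finally have "{v \<in> verts (underlying U). degree (underlying U) v = d} = f ` {v \<in> positions t. degree (planted_graph t) v = d}" .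
  moreover have "inj_on f {v \<in> positions t. degree (planted_graph t) v = d}"
    using bij by (auto simp: bij_betw_def intro: inj_on_subset)
  ultimately have "count_degree d U = card {v \<in> positions t. degree (planted_graph t) v = d}"
    unfolding count_degree_def by (simp add: card_image)
  thus ?thesis using card_degree_corner d codes_nodes[OF U t] by simp
qed

lemma nbhd_count_code:
  assumes U: "U \<in> unrooted_plane_trees n" and t: "t \<in> codes U"
  shows "card {v \<in> verts (underlying U). nbhd l (underlying U, v) \<simeq>\<^sub>r Q} = nbhd_count l Q t"
proof -
  obtain f where f: "graph_iso_by f (planted_graph t) (underlying U)" using codes_graph_iso[OF U t] by blast
  hence bij: "bij_betw f (positions t) (verts (underlying U))" by (simp add: graph_iso_by_def)
  obtain z where z: "z \<notin> positions t" using ex_new_if_finite[OF infinite_UNIV_listI finite_positions] by blast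
  have iso: "nbhd l (planted_graph t, v) \<simeq>\<^sub>r nbhd l (underlying U, f v)" if v: "v \<in> positions t" for v
  proof (rule nbhd_embedding[where z = z])
    show "simple_graph (planted_graph t)" "v \<in> verts (planted_graph t)" using v by simp_all
    show "inj_on f (verts (planted_graph t))" "f ` verts (planted_graph t) \<subseteq> verts (underlying U)"
      using bij by (auto simp: bij_betw_def)
    show "(x, y) \<in> edges (planted_graph t) \<longleftrightarrow> (f x, f y) \<in> edges (underlying U)"
      if "x \<in> verts (planted_graph t)" "y \<in> verts (planted_graph t)" for x y
      using f that by (auto simp: graph_iso_by_def)
    show "w \<in> f ` verts (planted_graph t)" if "(f y, w) \<in> edges (underlying U)" for y w
      using that simple_underlying[OF U] bij by (auto simp: simple_graph_def bij_betw_def)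
    show "(v, z) \<notin> edges (planted_graph t) ^^ k" for k
    proof (cases k)
      case 0 thus ?thesis using v z by auto
    next
      case (Suc k') thus ?thesis using z by (auto dest: planted_edgeD)
    qed
  qed
  have eq: "nbhd l (underlying U, f v) \<simeq>\<^sub>r Q \<longleftrightarrow> nbhd l (planted_graph t, v) \<simeq>\<^sub>r Q" if v: "v \<in> positions t" for v
  proof -
    have "snd (nbhd l (planted_graph t, v)) \<in> verts (fst (nbhd l (planted_graph t, v)))"
      by (rule root_in_nbhd) (simp add: v)
    from rooted_iso_cong[OF iso[OF v] this, of Q] show ?thesis by (rule sym)
  qed
  have vs: "verts (underlying U) = f ` positions t" using bij by (simp add: bij_betw_def)
  have "{v \<in> verts (underlying U). nbhd l (underlying U, v) \<simeq>\<^sub>r Q} = f ` {v \<in> positions t. nbhd l (underlying U, f v) \<simeq>\<^sub>r Q}"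
    unfolding vs by blast
  also have "{v \<in> positions t. nbhd l (underlying U, f v) \<simeq>\<^sub>r Q} = {v \<in> positions t. nbhd l (planted_graph t, v) \<simeq>\<^sub>r Q}"
    using eq by blast
  finally have "{v \<in> verts (underlying U). nbhd l (underlying U, v) \<simeq>\<^sub>r Q} = f ` {v \<in> positions t. nbhd l (planted_graph t, v) \<simeq>\<^sub>r Q}" .
  moreover have "inj_on f {v \<in> positions t. nbhd l (planted_graph t, v) \<simeq>\<^sub>r Q}"
    using bij by (auto simp: bij_betw_def intro: inj_on_subset)
  ultimately show ?thesis unfolding nbhd_count_def by (simp add: card_image)
qed

lemma bij_betw_corner_forest:
  assumes "n \<ge> 2"
  shows "bij_betw corner_forest {t. nodes t = n} (forests 2 n)"
proof (rule bij_betw_byWitness[where f' = "\<lambda>f. case hd f of Node ts \<Rightarrow> Node (f ! 1 # ts)"])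
  show "\<forall>t\<in>{t. nodes t = n}. (case hd (corner_forest t) of Node ts \<Rightarrow> Node (corner_forest t ! 1 # ts)) = t"
  proof
    fix t assume t: "t \<in> {t. nodes t = n}"
    obtain ts where ts: "t = Node ts" by (cases t)
    hence "ts \<noteq> []" using t assms by auto
    thus "(case hd (corner_forest t) of Node ts \<Rightarrow> Node (corner_forest t ! 1 # ts)) = t"
      by (simp add: corner_forest_def ts)
  qed
  have len2: "\<exists>ts u. f = [Node ts, u]" if f: "f \<in> forests 2 n" for f
  proof -
    obtain s u where "f = [s, u]" using f by (auto simp: forests_def numeral_2_eq_2 length_Suc_conv)
    thus ?thesis by (cases s) auto
  qed
  show "\<forall>f\<in>forests 2 n. corner_forest (case hd f of Node ts \<Rightarrow> Node (f ! 1 # ts)) = f"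
    using len2 by (force simp: corner_forest_def)
  show "corner_forest ` {t. nodes t = n} \<subseteq> forests 2 n"
  proof
    fix f assume "f \<in> corner_forest ` {t. nodes t = n}"
    then obtain ts where ts: "nodes (Node ts) = n" "f = [Node (tl ts), hd ts]"
      by (metis (mono_tags, lifting) corner_forest_def imageE mem_Collect_eq planted_tree.case planted_tree.exhaust)
    have "ts \<noteq> []" using ts(1) assms by auto
    thus "f \<in> forests 2 n" using ts by (cases ts) (auto simp: forests_def)
  qed
  show "(\<lambda>f. case hd f of Node ts \<Rightarrow> Node (f ! 1 # ts)) ` forests 2 n \<subseteq> {t. nodes t = n}"
  proof
    fix t assume "t \<in> (\<lambda>f. case hd f of Node ts \<Rightarrow> Node (f ! 1 # ts)) ` forests 2 n"
    then obtain f where f: "f \<in> forests 2 n" "t = (case hd f of Node ts \<Rightarrow> Node (f ! 1 # ts))" by blast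
    then obtain ts u where "f = [Node ts, u]" using len2 by blast
    thus "t \<in> {t. nodes t = n}" using f by (auto simp: forests_def)
  qed
qed

lemma forest_weight_corner:
  assumes "nodes t \<ge> 2" shows "forest_weight a (corner_forest t) = corner_weight a t"
proof -
  obtain ts where ts: "t = Node ts" by (cases t)
  obtain u us where us: "ts = u # us" using assms ts by (cases ts) auto
  show ?thesis by (cases u) (simp add: ts us corner_forest_def corner_weight_def forest_weight_def mult_ac)
qed

lemma sum_corner_forest:
  assumes "n \<ge> 2"
  shows "(\<Sum>t | nodes t = n. h (corner_forest t)) = (\<Sum>f\<in>forests 2 n. h f)"
  by (rule sum.reindex_bij_betw[OF bij_betw_corner_forest[OF assms]])

lemma sum_corner_weight:
  assumes "n \<ge> 2"
  shows "(\<Sum>t | nodes t = n. corner_weight a t) = forest_sum a 2 n"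
  unfolding forest_sum_def sum_corner_forest[OF assms, symmetric]
  by (intro sum.cong refl) (use assms in \<open>auto simp: forest_weight_corner\<close>)

lemma corner_weight_nonneg: "(\<And>k. a k \<ge> 0) \<Longrightarrow> corner_weight a t \<ge> 0"
  by (cases t) (simp add: corner_weight_def forest_weight_nonneg)

lemma sum_unrooted_weight:
  assumes "n \<ge> 2"
  shows "(\<Sum>U\<in>unrooted_plane_trees n. (real (card (codes U)) * unrooted_weight a U) *\<^sub>R (f U :: complex))
    = (\<Sum>t | nodes t = n. corner_weight a t *\<^sub>R f (THE U. U \<in> unrooted_plane_trees n \<and> t \<in> codes U))"
  unfolding sum_codes[OF assms, symmetric]
proof (intro sum.cong refl)
  fix U assume U: "U \<in> unrooted_plane_trees n"
  have "(THE V. V \<in> unrooted_plane_trees n \<and> t \<in> codes V) = U" if t: "t \<in> codes U" for t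
    using codes_ex1[OF codes_nodes(1)[OF U t] assms] U t by (intro the1_equality) auto
  hence "(\<Sum>t\<in>codes U. corner_weight a t *\<^sub>R f (THE U. U \<in> unrooted_plane_trees n \<and> t \<in> codes U))
      = (\<Sum>t\<in>codes U. unrooted_weight a U *\<^sub>R f U)"
    using unrooted_weight_code[OF U] by (intro sum.cong refl) auto
  thus "(real (card (codes U)) * unrooted_weight a U) *\<^sub>R f U
      = (\<Sum>t\<in>codes U. corner_weight a t *\<^sub>R f (THE U. U \<in> unrooted_plane_trees n \<and> t \<in> codes U))"
    by (simp add: scaleR_conv_of_real mult.assoc)
qed

text \<open>Corner-rooted trees count each unrooted tree once per orbit of corners. As only symmetric
  trees have fewer orbits than corners, the two laws differ by at most a linear factor times the
  relative weight of these trees.\<close>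

lemma unrooted_corner_compare:
  fixes a :: "nat \<Rightarrow> real" and f :: "nat plane_tree set \<Rightarrow> complex"
  assumes a: "\<And>k. a k \<ge> 0" and n: "n \<ge> 2" and pos: "forest_sum a 2 n > 0"
    and f: "\<And>U. norm (f U) \<le> 1"
    and g: "\<And>U t. U \<in> unrooted_plane_trees n \<Longrightarrow> t \<in> codes U \<Longrightarrow> g t = f U"
  shows "(\<Sum>U\<in>unrooted_plane_trees n. unrooted_weight a U) > 0"
    and "norm ((\<Sum>U\<in>unrooted_plane_trees n. unrooted_weight a U *\<^sub>R f U) /\<^sub>R (\<Sum>U\<in>unrooted_plane_trees n. unrooted_weight a U)
        - (\<Sum>t | nodes t = n. corner_weight a t *\<^sub>R g t) /\<^sub>R forest_sum a 2 n)
      \<le> 2 * (2 * real n * (\<Sum>t | nodes t = n \<and> symmetric_code t. corner_weight a t)) / forest_sum a 2 n"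
proof -
  let ?UU = "unrooted_plane_trees n"
  let ?W = "unrooted_weight a"
  \<comment> \<open>the number of corners; \<open>R\<close> below is the total weight of the trees, each multiplied by the number of
    its corners in excess of its codes\<close>
  define D where "D = real (2 * (n - 1))"
  define c where "c U = real (card (codes U))" for U
  have Dpos: "D > 0" using n by (simp add: D_def)
  have W0: "?W U \<ge> 0" if "U \<in> ?UU" for U
    using unrooted_weight_code[OF that] codes_ne[OF that] corner_weight_nonneg[of a, OF a] by force
  have cD: "c U \<le> D" if "U \<in> ?UU" for U using card_codes_le[OF that] by (simp only: c_def D_def of_nat_le_iff)
  define Z where "Z = forest_sum a 2 n"
  define Z' where "Z' = D * (\<Sum>U\<in>?UU. ?W U)"
  define A where "A = (\<Sum>t | nodes t = n. corner_weight a t *\<^sub>R g t)"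
  define A' where "A' = D *\<^sub>R (\<Sum>U\<in>?UU. ?W U *\<^sub>R f U)"
  define R where "R = (\<Sum>U\<in>?UU. (D - c U) * ?W U)"
  have A: "A = (\<Sum>U\<in>?UU. (c U * ?W U) *\<^sub>R f U)"
    unfolding A_def c_def sum_unrooted_weight[OF n]
  proof (intro sum.cong refl)
    fix t assume "t \<in> {t. nodes t = n}"
    hence t: "nodes t = n" by simp
    from theI'[OF codes_ex1[OF t n]] show "corner_weight a t *\<^sub>R g t = corner_weight a t *\<^sub>R f (THE U. U \<in> ?UU \<and> t \<in> codes U)"
      using g by simp
  qed
  have "complex_of_real Z = (\<Sum>t | nodes t = n. corner_weight a t *\<^sub>R 1)"
    unfolding Z_def sum_corner_weight[OF n, symmetric] by (simp add: scaleR_conv_of_real)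
  also have "\<dots> = complex_of_real (\<Sum>U\<in>?UU. c U * ?W U)"
    unfolding sum_unrooted_weight[OF n, of a "\<lambda>_. 1", symmetric] c_def by (simp add: scaleR_conv_of_real)
  finally have Z: "Z = (\<Sum>U\<in>?UU. c U * ?W U)" by (simp only: of_real_eq_iff)
  have ZR: "Z' = Z + R" unfolding Z Z'_def R_def sum_distrib_left sum.distrib[symmetric] by (simp add: algebra_simps)
  have R0: "R \<ge> 0" unfolding R_def using cD W0 by (intro sum_nonneg mult_nonneg_nonneg) auto
  have Zpos: "Z > 0" using pos by (simp add: Z_def)
  have Z'pos: "Z' > 0" using ZR R0 Zpos by simp
  show Wpos: "(\<Sum>U\<in>?UU. ?W U) > 0" using Z'pos Dpos unfolding Z'_def by (simp add: zero_less_mult_iff)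
  have AA: "norm (A' - A) \<le> R"
  proof -
    have "A' - A = (\<Sum>U\<in>?UU. ((D - c U) * ?W U) *\<^sub>R f U)"
      unfolding A A'_def scaleR_sum_right sum_subtractf[symmetric] by (simp add: algebra_simps)
    also have "norm \<dots> \<le> (\<Sum>U\<in>?UU. norm (((D - c U) * ?W U) *\<^sub>R f U))" by (rule norm_sum)
    also have "\<dots> \<le> R" unfolding R_def
    proof (rule sum_mono)
      fix U assume U: "U \<in> ?UU"
      have "0 \<le> (D - c U) * ?W U" using cD[OF U] W0[OF U] by simp
      thus "norm (((D - c U) * ?W U) *\<^sub>R f U) \<le> (D - c U) * ?W U"
        using f[of U] by (simp add: abs_of_nonneg mult_left_le)
    qed
    finally show ?thesis .
  qed
  have A1: "norm A \<le> Z"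
  proof -
    have "norm A \<le> (\<Sum>U\<in>?UU. norm ((c U * ?W U) *\<^sub>R f U))" unfolding A by (rule norm_sum)
    also have "\<dots> \<le> Z" unfolding Z
    proof (rule sum_mono)
      fix U assume U: "U \<in> ?UU"
      have "0 \<le> c U * ?W U" using W0[OF U] by (simp add: c_def)
      thus "norm ((c U * ?W U) *\<^sub>R f U) \<le> c U * ?W U" using f[of U] by (simp add: abs_of_nonneg mult_left_le)
    qed
    finally show ?thesis .
  qed
  have "A' /\<^sub>R Z' - A /\<^sub>R Z = (A' - A) /\<^sub>R Z' + (inverse Z' - inverse Z) *\<^sub>R A"
    by (simp add: scaleR_diff_left scaleR_diff_right)
  also have "norm \<dots> \<le> norm ((A' - A) /\<^sub>R Z') + norm ((inverse Z' - inverse Z) *\<^sub>R A)" by (rule norm_triangle_ineq)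
  also have "norm ((A' - A) /\<^sub>R Z') \<le> R / Z"
  proof -
    have "norm ((A' - A) /\<^sub>R Z') = norm (A' - A) / Z'" using Z'pos by (simp add: divide_inverse mult.commute)
    also have "\<dots> \<le> R / Z" using AA R0 Zpos ZR by (intro frac_le) auto
    finally show ?thesis .
  qed
  also have "norm ((inverse Z' - inverse Z) *\<^sub>R A) \<le> R / Z"
  proof -
    have "\<bar>inverse Z' - inverse Z\<bar> = R / (Z * Z')"
    proof -
      have "inverse Z' - inverse Z = - (R / (Z * Z'))" using Zpos Z'pos ZR by (simp add: field_simps)
      thus ?thesis using R0 Zpos Z'pos by simp
    qed
    hence "norm ((inverse Z' - inverse Z) *\<^sub>R A) = R / (Z * Z') * norm A" by simp
    also have "\<dots> \<le> R / (Z * Z') * Z" using A1 R0 Zpos Z'pos by (intro mult_left_mono) auto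
    also have "\<dots> = R / Z'" using Zpos by simp
    also have "\<dots> \<le> R / Z" using R0 Zpos ZR by (intro divide_left_mono) auto
    finally show ?thesis .
  qed
  finally have main: "norm (A' /\<^sub>R Z' - A /\<^sub>R Z) \<le> 2 * R / Z" by simp
  define S where "S = {U \<in> ?UU. c U < D}"
  define Bad where "Bad = (\<Sum>t | nodes t = n \<and> symmetric_code t. corner_weight a t)"
  have "R = (\<Sum>U\<in>S. (D - c U) * ?W U)"
    unfolding R_def S_def using cD by (intro sum.mono_neutral_right) (force simp: less_le)+
  also have "\<dots> \<le> (\<Sum>U\<in>S. D * ?W U)"
    using W0 by (intro sum_mono mult_right_mono) (auto simp: S_def c_def)
  also have "\<dots> = D * (\<Sum>U\<in>S. ?W U)" by (simp add: sum_distrib_left)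
  finally have RS: "R \<le> D * (\<Sum>U\<in>S. ?W U)" .
  have SB: "(\<Sum>U\<in>S. ?W U) \<le> Bad" unfolding Bad_def
  proof -
    have "\<forall>U\<in>S. \<exists>t. t \<in> codes U \<and> symmetric_code t"
      using card_codes_asymmetric unfolding S_def c_def D_def of_nat_less_iff by blast
    then obtain r where r: "\<And>U. U \<in> S \<Longrightarrow> r U \<in> codes U \<and> symmetric_code (r U)" by metis
    have inj: "inj_on r S"
    proof (rule inj_onI)
      fix U V assume UV: "U \<in> S" "V \<in> S" "r U = r V"
      have "U \<in> ?UU" "V \<in> ?UU" using UV by (auto simp: S_def)
      thus "U = V" using codes_ex1[OF codes_nodes(1)[of U n "r U"] n] r[OF UV(1)] r[OF UV(2)] UV(3) by auto
    qed
    have "(\<Sum>U\<in>S. ?W U) = (\<Sum>U\<in>S. corner_weight a (r U))"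
      using unrooted_weight_code r by (intro sum.cong refl) (auto simp: S_def)
    also have "\<dots> = sum (corner_weight a) (r ` S)" by (simp add: sum.reindex[OF inj])
    also have "\<dots> \<le> (\<Sum>t | nodes t = n \<and> symmetric_code t. corner_weight a t)"
    proof (rule sum_mono2)
      show "finite {t. nodes t = n \<and> symmetric_code t}" by (rule finite_subset[OF _ finite_nodes[of n]]) auto
      show "r ` S \<subseteq> {t. nodes t = n \<and> symmetric_code t}" using r codes_nodes(1) by (auto simp: S_def)
    qed (rule corner_weight_nonneg[OF a])
    finally show "(\<Sum>U\<in>S. ?W U) \<le> (\<Sum>t | nodes t = n \<and> symmetric_code t. corner_weight a t)" .
  qed
  have "R \<le> D * Bad" using RS mult_left_mono[OF SB, of D] Dpos by linarith
  also have "\<dots> \<le> 2 * real n * Bad"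
    unfolding Bad_def by (intro mult_right_mono sum_nonneg corner_weight_nonneg a) (simp add: D_def)
  finally have "R \<le> 2 * real n * (\<Sum>t | nodes t = n \<and> symmetric_code t. corner_weight a t)" unfolding Bad_def .
  hence "2 * R / Z \<le> 2 * (2 * real n * (\<Sum>t | nodes t = n \<and> symmetric_code t. corner_weight a t)) / Z"
    using Zpos by (intro divide_right_mono) auto
  moreover have "A' /\<^sub>R Z' = (\<Sum>U\<in>?UU. ?W U *\<^sub>R f U) /\<^sub>R (\<Sum>U\<in>?UU. ?W U)"
    using Dpos unfolding A'_def Z'_def by simp
  ultimately show "norm ((\<Sum>U\<in>?UU. ?W U *\<^sub>R f U) /\<^sub>R (\<Sum>U\<in>?UU. ?W U)
        - (\<Sum>t | nodes t = n. corner_weight a t *\<^sub>R g t) /\<^sub>R forest_sum a 2 n)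
      \<le> 2 * (2 * real n * (\<Sum>t | nodes t = n \<and> symmetric_code t. corner_weight a t)) / forest_sum a 2 n"
    using main unfolding A_def Z_def by simp
qed

context critical_offspring
begin

text \<open>The bound is a square so that already half of the vertices of a tree contribute about \<open>b\<close> to the
  power of its size; this is used in \<open>symmetric_weight_le\<close>.\<close>

lemma atom_bound: "\<exists>b. 0 < b \<and> b < 1 \<and> (\<forall>k. pmf p k \<le> b\<^sup>2)"
proof -
  obtain k2 where k2: "k2 \<ge> 2" "pmf p k2 > 0" using pmf_ge_2_pos by blast
  have two: "pmf p i + pmf p j \<le> 1" if "i \<noteq> j" for i j
    using measure_pmf.prob_le_1[of p "{i, j}"] that by (simp add: measure_measure_pmf_finite)
  define q where "q = max (1 - pmf p 0) (1 - pmf p k2)"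
  have "pmf p k \<le> q" for k
    using two[of k 0] two[of 0 k2] k2 by (cases "k = 0") (auto simp: q_def)
  moreover have "q < 1" using pmf_0_pos k2 by (simp add: q_def)
  moreover have "q > 0" using two[of 0 k2] k2 pmf_0_pos by (simp add: q_def)
  ultimately show ?thesis by (intro exI[of _ "sqrt q"]) auto
qed

lemma forest_weight_le_power:
  assumes b: "0 < b" "\<And>k. pmf p k \<le> b\<^sup>2"
  shows "forest_weight (pmf p) ts \<le> b ^ (2 * sum_list (map nodes ts))"
proof -
  have list: "prod_list (map (tree_weight (pmf p)) ts) \<le> b ^ (2 * sum_list (map nodes ts))"
    if "\<And>t. t \<in> set ts \<Longrightarrow> tree_weight (pmf p) t \<le> b ^ (2 * nodes t)" for ts
    using that
  proof (induction ts)
    case (Cons t ts)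
    have "tree_weight (pmf p) t * prod_list (map (tree_weight (pmf p)) ts) \<le> b ^ (2 * nodes t) * b ^ (2 * sum_list (map nodes ts))"
      using Cons b forest_weight_nonneg[of "pmf p" ts] by (intro mult_mono) (auto simp: forest_weight_def)
    thus ?case by (simp add: power_add distrib_left)
  qed simp
  have "tree_weight (pmf p) t \<le> b ^ (2 * nodes t)" for t
  proof (induction t)
    case (Node us)
    have "pmf p (length us) * prod_list (map (tree_weight (pmf p)) us) \<le> b\<^sup>2 * b ^ (2 * sum_list (map nodes us))"
      using list[of us] Node b forest_weight_nonneg[of "pmf p" us] by (intro mult_mono) (auto simp: forest_weight_def)
    thus ?case by (simp add: power_add[symmetric])
  qed
  thus ?thesis unfolding forest_weight_def by (intro list)
qed

lemma forest_sum_le_1: "forest_sum (pmf p) r n \<le> 1"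
proof (induction n arbitrary: r)
  case 0
  show ?case by (cases r) (auto simp: forest_sum_def forests_0 forests_empty forest_weight_def)
next
  case (Suc n)
  show ?case
  proof (cases r)
    case 0 thus ?thesis by (simp add: forest_sum_def forests_0)
  next
    case (Suc r')
    have "forest_sum (pmf p) (Suc r') (Suc n) \<le> (\<Sum>k\<le>n. pmf p k * 1)"
      unfolding forest_sum_Suc using Suc.IH by (intro sum_mono mult_left_mono) auto
    also have "\<dots> = measure_pmf.prob p {..n}" by (simp add: measure_measure_pmf_finite)
    finally show ?thesis using measure_pmf.prob_le_1[of p "{..n}"] unfolding Suc by linarith
  qed
qed

lemma forest_weight_periodic: "forest_weight a (concat (replicate r zs)) = forest_weight a zs ^ r"
  by (induction r) (auto simp: forest_weight_def)

text \<open>A symmetric tree is determined by at most half of its vertices, while its weight counts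
  all of them; hence its weight is exponentially small compared with that of the half.\<close>

lemma symmetric_weight_le:
  assumes b: "0 < b" "b < 1" "\<And>k. pmf p k \<le> b\<^sup>2" and n: "n \<ge> 2"
  shows "(\<Sum>t | nodes t = n \<and> symmetric_code t. corner_weight (pmf p) t) \<le> real (n + 1) ^ 3 * b ^ (n - 1) + b ^ (n - 1)"
proof -
  \<comment> \<open>trees that are symmetric under the flip of the root edge are determined by one half \<open>s\<close>, trees with
    a rotational symmetry by the period \<open>zs\<close> and the number \<open>r\<close> of its repetitions\<close>
  define F where "F = {s. 2 * nodes s = n}"
  define fA where "fA s = (case s of Node ts \<Rightarrow> Node (Node ts # ts))" for s
  define G where "G = {(r, zs). r \<in> {2..n} \<and> zs \<in> (\<Union>j\<in>{..n}. \<Union>m\<in>{..n}. forests j m) \<and> nodes (Node (concat (replicate r zs))) = n}"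
  define fB where "fB = (\<lambda>(r :: nat, zs). Node (concat (replicate r zs)))"
  have finF: "finite F"
    by (rule finite_subset[OF _ finite_nodes[of "n div 2"]]) (auto simp: F_def)
  have finG: "finite G"
    by (rule finite_subset[of _ "{2..n} \<times> (\<Union>j\<in>{..n}. \<Union>m\<in>{..n}. forests j m)"]) (auto simp: G_def)
  have nodes_rep: "sum_list (map nodes (concat (replicate r zs))) = r * sum_list (map nodes zs)" for r zs
    by (induction r) auto
  have sub: "{t. nodes t = n \<and> symmetric_code t} \<subseteq> fA ` F \<union> fB ` G"
  proof
    fix t assume "t \<in> {t. nodes t = n \<and> symmetric_code t}"
    hence t: "nodes t = n" "symmetric_code t" by auto
    from t(2) show "t \<in> fA ` F \<union> fB ` G" unfolding symmetric_code_def
    proof (elim disjE exE conjE)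
      fix ts assume ts: "t = Node (Node ts # ts)"
      have "Node ts \<in> F" using t(1) by (simp add: F_def ts)
      moreover have "fA (Node ts) = t" by (simp add: fA_def ts)
      ultimately show ?thesis by blast
    next
      fix ts k assume ts: "t = Node ts" "0 < k" "k < length ts" "rotate k ts = ts"
      have "drop k ts @ take k ts = take k ts @ drop k ts" using ts(3,4) by (simp add: rotate_drop_take)
      \<comment> \<open>two lists that commute are powers of the same list\<close>
      then obtain m m' zs where z: "concat (replicate m zs) = take k ts" "concat (replicate m' zs) = drop k ts"
        using comm_append_are_replicate[of "take k ts" "drop k ts"] by metis
      have "m \<noteq> 0" "m' \<noteq> 0" "zs \<noteq> []" proof -
        have tk: "take k ts \<noteq> []" "drop k ts \<noteq> []" using ts(2,3) by auto
        show "m \<noteq> 0" using z(1) tk(1) by (metis concat.simps(1) replicate_0)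
        show "m' \<noteq> 0" using z(2) tk(2) by (metis concat.simps(1) replicate_0)
        have "concat (replicate m []) = ([] :: planted_tree list)" by (induction m) auto
        thus "zs \<noteq> []" using z(1) tk(1) by metis
      qed
      define r where "r = m + m'"
      have r: "r \<ge> 2" using \<open>m \<noteq> 0\<close> \<open>m' \<noteq> 0\<close> by (simp add: r_def)
      have tsr: "ts = concat (replicate r zs)" using z by (simp add: r_def replicate_add)
      have nn: "n = Suc (r * sum_list (map nodes zs))" using t(1) nodes_rep[of r zs] by (simp add: ts(1) tsr)
      have s1: "sum_list (map nodes zs) \<ge> 1"
        using length_le_nodes[of zs] \<open>zs \<noteq> []\<close> by (cases zs) auto
      have sn: "sum_list (map nodes zs) \<le> n" using r mult_le_mono1[of 1 r "sum_list (map nodes zs)"] unfolding nn by linarith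
      have rn: "r \<le> n" using s1 mult_le_mono2[of 1 "sum_list (map nodes zs)" r] unfolding nn by linarith
      have "zs \<in> forests (length zs) (sum_list (map nodes zs))" by (simp add: forests_def)
      moreover have "length zs \<le> n" using length_le_nodes[of zs] sn by linarith
      ultimately have "(r, zs) \<in> G" using r rn sn t(1) by (auto simp: G_def ts(1) tsr)
      moreover have "fB (r, zs) = t" by (simp add: fB_def ts(1) tsr)
      ultimately show ?thesis by blast
    qed
  qed
  have cw0: "corner_weight (pmf p) t \<ge> 0" for t by (rule corner_weight_nonneg) simp
  have "(\<Sum>t | nodes t = n \<and> symmetric_code t. corner_weight (pmf p) t) \<le> sum (corner_weight (pmf p)) (fA ` F \<union> fB ` G)"
    using sub finF finG cw0 by (intro sum_mono2) auto
  also have "\<dots> \<le> sum (corner_weight (pmf p)) (fA ` F) + sum (corner_weight (pmf p)) (fB ` G)"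
    using finF finG cw0 by (simp add: sum_Un sum_nonneg)
  finally have split: "(\<Sum>t | nodes t = n \<and> symmetric_code t. corner_weight (pmf p) t)
      \<le> sum (corner_weight (pmf p)) (fA ` F) + sum (corner_weight (pmf p)) (fB ` G)" .
  have "sum (corner_weight (pmf p)) (fA ` F) \<le> sum (corner_weight (pmf p) \<circ> fA) F"
    by (rule sum_image_le[OF finF]) (rule cw0)
  also have "\<dots> \<le> (\<Sum>s\<in>F. b ^ (n - 1) * tree_weight (pmf p) s)"
  proof (rule sum_mono)
    fix s assume s: "s \<in> F"
    obtain ts where ts: "s = Node ts" by (cases s)
    have "tree_weight (pmf p) s \<le> b ^ (2 * nodes s)"
      using forest_weight_le_power[OF b(1,3), of "[s]"] by (simp add: forest_weight_def)
    also have "2 * nodes s = n" using s by (simp add: F_def)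
    also have "b ^ n \<le> b ^ (n - 1)" using b by (intro power_decreasing) auto
    finally have "tree_weight (pmf p) s * tree_weight (pmf p) s \<le> b ^ (n - 1) * tree_weight (pmf p) s"
      by (rule mult_right_mono) (rule tree_weight_nonneg, simp)
    thus "(corner_weight (pmf p) \<circ> fA) s \<le> b ^ (n - 1) * tree_weight (pmf p) s"
      by (simp add: fA_def ts corner_weight_def forest_weight_def mult_ac)
  qed
  also have "\<dots> = b ^ (n - 1) * (\<Sum>s\<in>F. tree_weight (pmf p) s)" by (simp add: sum_distrib_left)
  finally have A: "sum (corner_weight (pmf p)) (fA ` F) \<le> b ^ (n - 1) * (\<Sum>s\<in>F. tree_weight (pmf p) s)" .
  have A1: "(\<Sum>s\<in>F. tree_weight (pmf p) s) \<le> 1"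
  proof -
    have "(\<Sum>s\<in>F. tree_weight (pmf p) s) = (\<Sum>f\<in>(\<lambda>s. [s]) ` F. forest_weight (pmf p) f)"
      by (subst sum.reindex) (auto simp: inj_on_def forest_weight_def)
    also have "\<dots> \<le> forest_sum (pmf p) 1 (n div 2)" unfolding forest_sum_def
    proof (rule sum_mono2)
      show "(\<lambda>s. [s]) ` F \<subseteq> forests 1 (n div 2)" by (auto simp: F_def forests_def)
    qed (simp_all add: forest_weight_nonneg)
    also have "\<dots> \<le> 1" by (rule forest_sum_le_1)
    finally show ?thesis .
  qed
  have "sum (corner_weight (pmf p)) (fB ` G) \<le> sum (corner_weight (pmf p) \<circ> fB) G"
    by (rule sum_image_le[OF finG]) (rule cw0)
  also have "\<dots> \<le> (\<Sum>g\<in>G. b ^ (n - 1) * forest_weight (pmf p) (snd g))"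
  proof (rule sum_mono)
    fix g assume "g \<in> G"
    then obtain r zs where g: "g = (r, zs)" "r \<ge> 2" "nodes (Node (concat (replicate r zs))) = n"
      by (auto simp: G_def)
    let ?s = "sum_list (map nodes zs)"
    let ?f = "forest_weight (pmf p) zs"
    have f0: "?f \<ge> 0" by (rule forest_weight_nonneg) simp
    have nn: "n - 1 = r * ?s" using g(3) nodes_rep[of r zs] by simp
    obtain r' where r': "r = Suc r'" "r' \<ge> 1" using g(2) by (cases r) auto
    have "?f ^ r' \<le> (b ^ (2 * ?s)) ^ r'" by (rule power_mono[OF forest_weight_le_power[OF b(1,3)] f0])
    also have "\<dots> = b ^ (2 * ?s * r')" by (rule power_mult[symmetric])
    also have "\<dots> \<le> b ^ (n - 1)"
    proof (rule power_decreasing)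
      have "r * ?s \<le> (2 * r') * ?s" using r' by (intro mult_le_mono1) simp
      thus "n - 1 \<le> 2 * ?s * r'" unfolding nn by (simp add: mult_ac)
    qed (use b in auto)
    finally have "?f ^ r' * ?f \<le> b ^ (n - 1) * ?f" by (rule mult_right_mono[OF _ f0])
    moreover have "corner_weight (pmf p) (fB g) \<le> 1 * ?f ^ r"
      unfolding g fB_def corner_weight_def prod.case planted_tree.case forest_weight_periodic
      by (intro mult_right_mono) (auto simp: pmf_le_1 f0)
    ultimately show "(corner_weight (pmf p) \<circ> fB) g \<le> b ^ (n - 1) * forest_weight (pmf p) (snd g)"
      unfolding r' by (simp add: g mult.commute)
  qed
  also have "\<dots> = b ^ (n - 1) * (\<Sum>g\<in>G. forest_weight (pmf p) (snd g))" by (simp add: sum_distrib_left)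
  finally have B: "sum (corner_weight (pmf p)) (fB ` G) \<le> b ^ (n - 1) * (\<Sum>g\<in>G. forest_weight (pmf p) (snd g))" .
  have B1: "(\<Sum>g\<in>G. forest_weight (pmf p) (snd g)) \<le> real (n + 1) ^ 3"
  proof -
    let ?V = "\<Union>j\<in>{..n}. \<Union>m\<in>{..n}. forests j m"
    have f0: "forest_weight (pmf p) zs \<ge> 0" for zs by (rule forest_weight_nonneg) simp
    have finV: "finite ?V" by auto
    have "(\<Sum>zs\<in>?V. forest_weight (pmf p) zs) = (\<Sum>j\<le>n. \<Sum>zs\<in>(\<Union>m\<in>{..n}. forests j m). forest_weight (pmf p) zs)"
      by (rule sum.UNION_disjoint) (simp, simp, force simp: forests_def)
    also have "\<dots> = (\<Sum>j\<le>n. \<Sum>m\<le>n. \<Sum>zs\<in>forests j m. forest_weight (pmf p) zs)"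
      by (intro sum.cong refl sum.UNION_disjoint) (simp, simp, force simp: forests_def)
    also have "\<dots> \<le> (\<Sum>j\<le>n. \<Sum>m\<le>n. 1)"
      using forest_sum_le_1 unfolding forest_sum_def by (intro sum_mono) auto
    also have "\<dots> = real (n + 1) ^ 2" by (simp add: power2_eq_square algebra_simps)
    finally have V: "(\<Sum>zs\<in>?V. forest_weight (pmf p) zs) \<le> real (n + 1) ^ 2" .
    have "(\<Sum>g\<in>G. forest_weight (pmf p) (snd g)) \<le> (\<Sum>g\<in>{..n} \<times> ?V. forest_weight (pmf p) (snd g))"
      by (rule sum_mono2) (use finV in \<open>auto simp: G_def f0\<close>)
    also have "\<dots> = (\<Sum>r\<le>n. \<Sum>zs\<in>?V. forest_weight (pmf p) zs)"
      unfolding sum.cartesian_product by (simp add: case_prod_beta)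
    also have "\<dots> \<le> (\<Sum>r\<le>n. real (n + 1) ^ 2)" by (intro sum_mono V)
    also have "\<dots> = real (n + 1) ^ 3" by (simp add: power3_eq_cube power2_eq_square)
    finally show ?thesis .
  qed
  have "b ^ (n - 1) * (\<Sum>s\<in>F. tree_weight (pmf p) s) \<le> b ^ (n - 1) * 1"
    "b ^ (n - 1) * (\<Sum>g\<in>G. forest_weight (pmf p) (snd g)) \<le> b ^ (n - 1) * real (n + 1) ^ 3"
    using A1 B1 b(1) by (auto intro!: mult_left_mono)
  thus ?thesis using split A B by (simp add: mult.commute)
qed

end

section \<open>Invariance under tilting\<close>

lemma forest_weight_scale:
  fixes a :: "nat \<Rightarrow> real"
  assumes "c \<noteq> 0"
  shows "forest_weight (\<lambda>k. a k * s ^ k / c) ts * s ^ length ts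
    = forest_weight a ts * s ^ sum_list (map nodes ts) / c ^ sum_list (map nodes ts)"
proof (induction ts)
  case (Cons t ts)
  have "forest_weight (\<lambda>k. a k * s ^ k / c) (t # ts) * s ^ length (t # ts)
      = (tree_weight (\<lambda>k. a k * s ^ k / c) t * s) * (forest_weight (\<lambda>k. a k * s ^ k / c) ts * s ^ length ts)"
    by (simp add: forest_weight_def)
  thus ?case unfolding tree_weight_scale[OF assms] Cons
    by (simp add: forest_weight_def power_add)
qed (simp add: forest_weight_def)

lemma planted_plane_trees_nodes: "planted_plane_trees n = {t. nodes t = n}"
  by (simp add: planted_plane_trees_def card_positions)

text \<open>The constant does not depend on the tree because the out-degrees of a planted tree with \<open>n\<close>
  vertices add up to \<open>n - 1\<close>, and the reduced degrees of an unrooted one to \<open>n - 2\<close>.\<close>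

context
  fixes a :: "nat \<Rightarrow> real" and s c :: real
  assumes s: "s > 0" and c: "c > 0"
begin

lemma planted_weight_tilt:
  "planted_weight (\<lambda>k. a k * s ^ k / c) t = (s ^ nodes t / c ^ nodes t / s) * planted_weight a t"
  using tree_weight_scale[of c a s t] s c unfolding planted_weight_eq by (simp add: field_simps)

lemma unrooted_weight_tilt:
  assumes U: "U \<in> unrooted_plane_trees n"
  shows "unrooted_weight (\<lambda>k. a k * s ^ k / c) U = (s ^ n / c ^ n / s\<^sup>2) * unrooted_weight a U"
proof -
  obtain t where t: "t \<in> codes U" using codes_ne[OF U] by blast
  note n = codes_nodes[OF U t]
  have f: "length (corner_forest t) = 2 \<and> sum_list (map nodes (corner_forest t)) = n"
    using bij_betw_corner_forest[OF n(2)] n(1) by (auto simp: bij_betw_def forests_def)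
  have "forest_weight (\<lambda>k. a k * s ^ k / c) (corner_forest t) * s\<^sup>2 = forest_weight a (corner_forest t) * s ^ n / c ^ n"
    using forest_weight_scale[of c a s "corner_forest t"] c f by simp
  thus ?thesis using n s c
    by (simp add: unrooted_weight_code[OF U t] forest_weight_corner[symmetric] field_simps)
qed

lemma planted_tilt:
  "planted_pmf (\<lambda>k. a k * s ^ k / c) n = planted_pmf a n"
  "planted_sizes (\<lambda>k. a k * s ^ k / c) = planted_sizes a"
proof -
  have pos: "s ^ n / c ^ n / s > 0" for n using s c by simp
  show "planted_pmf (\<lambda>k. a k * s ^ k / c) n = planted_pmf a n"
    unfolding planted_pmf_def
  proof (rule weighted_pmf_scale)
    show "s ^ n / c ^ n / s \<noteq> 0" using s c by simp
  qed (simp add: planted_weight_tilt planted_plane_trees_nodes)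
  show "planted_sizes (\<lambda>k. a k * s ^ k / c) = planted_sizes a"
    unfolding planted_sizes_def planted_weight_tilt zero_less_mult_iff using pos by (metis less_asym)
qed

lemma unrooted_tilt:
  "unrooted_pmf (\<lambda>k. a k * s ^ k / c) n = unrooted_pmf a n"
  "unrooted_sizes (\<lambda>k. a k * s ^ k / c) = unrooted_sizes a"
proof -
  have pos: "s ^ n / c ^ n / s\<^sup>2 > 0" for n using s c by simp
  show "unrooted_pmf (\<lambda>k. a k * s ^ k / c) n = unrooted_pmf a n"
    unfolding unrooted_pmf_def
  proof (rule weighted_pmf_scale)
    show "s ^ n / c ^ n / s\<^sup>2 \<noteq> 0" using s c by simp
  qed (rule unrooted_weight_tilt)
  have "(unrooted_weight (\<lambda>k. a k * s ^ k / c) U > 0) = (unrooted_weight a U > 0)" if "U \<in> unrooted_plane_trees n" for U n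
    unfolding unrooted_weight_tilt[OF that] using pos[of n] by (metis less_asym zero_less_mult_iff)
  thus "unrooted_sizes (\<lambda>k. a k * s ^ k / c) = unrooted_sizes a"
    unfolding unrooted_sizes_def by blast
qed

end

section \<open>Admissible sizes\<close>

lemma sum_pos_iff:
  fixes f :: "'a \<Rightarrow> real"
  assumes "finite A" "\<And>x. x \<in> A \<Longrightarrow> f x \<ge> 0"
  shows "sum f A > 0 \<longleftrightarrow> (\<exists>x\<in>A. f x > 0)"
proof -
  have "sum f A > 0 \<longleftrightarrow> sum f A \<noteq> 0" using sum_nonneg[of A f] assms(2) by (auto simp: less_le)
  also have "\<dots> \<longleftrightarrow> (\<exists>x\<in>A. f x \<noteq> 0)" using sum_nonneg_eq_0_iff[OF assms] by auto
  also have "\<dots> \<longleftrightarrow> (\<exists>x\<in>A. f x > 0)" using assms(2) by (force simp: less_le)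
  finally show ?thesis .
qed

lemma sum_singleton_forests: "(\<Sum>t | nodes t = n. h [t]) = (\<Sum>f\<in>forests 1 n. h f)"
proof (rule sum.reindex_bij_betw)
  show "bij_betw (\<lambda>t. [t]) {t. nodes t = n} (forests 1 n)"
    by (rule bij_betw_byWitness[where f' = hd]) (auto simp: forests_def length_Suc_conv)
qed

lemma sum_tree_weight: "(\<Sum>t | nodes t = n. tree_weight a t) = forest_sum a 1 n"
  unfolding forest_sum_def sum_singleton_forests[symmetric] by (simp add: forest_weight_def)

lemma planted_sizes_eq:
  assumes "\<And>k. a k \<ge> 0" shows "planted_sizes a = {n. forest_sum a 1 n > 0}"
  unfolding sum_tree_weight[symmetric] planted_sizes_def planted_plane_trees_nodes planted_weight_eq
  using sum_pos_iff[OF finite_nodes] tree_weight_nonneg[OF assms] by auto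

lemma unrooted_sizes_eq:
  assumes a: "\<And>k. a k \<ge> 0" shows "unrooted_sizes a = {n. forest_sum a 2 n > 0}"
proof -
  have "(\<exists>U\<in>unrooted_plane_trees n. unrooted_weight a U > 0) \<longleftrightarrow> forest_sum a 2 n > 0" if n: "n \<ge> 2" for n
  proof -
    have "forest_sum a 2 n > 0 \<longleftrightarrow> (\<exists>t\<in>{t. nodes t = n}. corner_weight a t > 0)"
      unfolding sum_corner_weight[OF n, symmetric]
      by (rule sum_pos_iff) (auto intro: corner_weight_nonneg a)
    also have "\<dots> \<longleftrightarrow> (\<exists>U\<in>unrooted_plane_trees n. unrooted_weight a U > 0)"
    proof
      assume "\<exists>t\<in>{t. nodes t = n}. corner_weight a t > 0"
      then obtain t where t: "nodes t = n" "corner_weight a t > 0" by blast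
      with codes_ex1[OF t(1) n] unrooted_weight_code[of _ n t a] show "\<exists>U\<in>unrooted_plane_trees n. unrooted_weight a U > 0" by metis
    next
      assume "\<exists>U\<in>unrooted_plane_trees n. unrooted_weight a U > 0"
      then obtain U where U: "U \<in> unrooted_plane_trees n" "unrooted_weight a U > 0" by blast
      then obtain t where t: "t \<in> codes U" using codes_ne by blast
      thus "\<exists>t\<in>{t. nodes t = n}. corner_weight a t > 0"
        using U unrooted_weight_code[OF U(1) t, of a] codes_nodes(1)[OF U(1) t] by auto
    qed
    finally show ?thesis by simp
  qed
  moreover have "n \<ge> 2" if "forest_sum a 2 n > 0" for n
  proof -
    have "forests 2 n \<noteq> {}" using that by (auto simp: forest_sum_def)
    then obtain f where "f \<in> forests 2 n" by blast
    thus ?thesis using length_le_nodes[of f] by (simp add: forests_def)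
  qed
  ultimately show ?thesis unfolding unrooted_sizes_def by blast
qed

lemma filterlim_enumerate:
  assumes "infinite (S :: nat set)" shows "filterlim (enumerate S) at_top sequentially"
  by (rule filterlim_subseq) (rule strict_mono_enumerate[OF assms])

section \<open>The normal limit law\<close>

lemma char_centred_normal:
  assumes "\<sigma> \<ge> 0"
  shows "char (centred_normal \<sigma>) \<theta> = of_real (exp (- \<theta>\<^sup>2 / 2 * \<sigma>\<^sup>2))" "real_distribution (centred_normal \<sigma>)"
proof -
  have "char (centred_normal \<sigma>) \<theta> = of_real (exp (- \<theta>\<^sup>2 / 2 * \<sigma>\<^sup>2)) \<and> real_distribution (centred_normal \<sigma>)"
  proof (cases "\<sigma> = 0")
    case True
    have "real_distribution (return borel (0 :: real))"
      unfolding real_distribution_def real_distribution_axioms_def by (simp add: prob_space_return)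
    moreover have "char (return borel 0) \<theta> = 1"
      unfolding char_def by (subst integral_return) auto
    ultimately show ?thesis by (simp add: centred_normal_def True)
  next
    case False
    hence s: "\<sigma> > 0" using assms by simp
    interpret N: prob_space std_normal_distribution by (rule prob_space_normal_density) simp
    have "distributed std_normal_distribution lborel (\<lambda>x. x) (normal_density 0 1)"
      by (simp add: distributed_def distr_id2)
    from N.normal_density_affine[OF this, of \<sigma> 0] s
    have D: "distr std_normal_distribution lborel (\<lambda>x. \<sigma> * x) = density lborel (normal_density 0 \<sigma>)"
      by (simp add: distributed_def)
    hence D: "centred_normal \<sigma> = distr std_normal_distribution borel (\<lambda>x. \<sigma> * x)"
      using s by (simp add: centred_normal_def distr_cong[of _ _ borel lborel])
    have "real_distribution (centred_normal \<sigma>)" unfolding D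
      by (rule N.real_distribution_distr) simp
    moreover have "char (centred_normal \<sigma>) \<theta> = char std_normal_distribution (\<theta> * \<sigma>)"
      unfolding D char_def by (subst integral_distr) (auto simp: mult_ac)
    moreover have "\<dots> = of_real (exp (- \<theta>\<^sup>2 / 2 * \<sigma>\<^sup>2))"
      unfolding char_std_normal_distribution by (simp add: power_mult_distrib)
    ultimately show ?thesis by simp
  qed
  thus "char (centred_normal \<sigma>) \<theta> = of_real (exp (- \<theta>\<^sup>2 / 2 * \<sigma>\<^sup>2))" "real_distribution (centred_normal \<sigma>)" by auto
qed


section \<open>Benjamini--Schramm convergence and asymptotic normality\<close>

text \<open>Deleting the root edge affects only the fringe subtree at the root.\<close>

lemma fringe_count_corner:
  assumes "nodes s \<ge> 2"
  shows "\<bar>real (fringe_count t s) - real (forest_fringe_count t (corner_forest s))\<bar> \<le> 1"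
proof -
  obtain ts where ts: "s = Node ts" by (cases s)
  then obtain u us where us: "ts = u # us" using assms by (cases ts) auto
  show ?thesis by (simp add: ts us corner_forest_def forest_fringe_count_def)
qed

lemma benjamini_schramm_convI:
  assumes g: "\<And>k G. G \<in> set_pmf (\<mu> k) \<Longrightarrow> finite (verts (\<phi> G)) \<and> card (verts (\<phi> G)) = N k"
    and N: "\<And>k. N k > 0"
    and lim: "\<And>l Q. (\<lambda>k. measure_pmf.expectation (\<mu> k) (\<lambda>G. real (card {v \<in> verts (\<phi> G). nbhd l (\<phi> G, v) \<simeq>\<^sub>r Q}) / real (N k)))
      \<longlonglongrightarrow> \<P>(x in M. nbhd l (L x) \<simeq>\<^sub>r (Q :: nat rooted_graph))"
  shows "benjamini_schramm_conv (\<lambda>k. map_pmf \<phi> (\<mu> k)) M L"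
  unfolding benjamini_schramm_conv_def local_weak_conv_def
proof (intro allI)
  fix l and Q :: "nat rooted_graph"
  have "\<P>(x in measure_pmf (uniformly_rooted (map_pmf \<phi> (\<mu> k))). nbhd l x \<simeq>\<^sub>r Q)
      = measure_pmf.expectation (\<mu> k) (\<lambda>G. real (card {v \<in> verts (\<phi> G). nbhd l (\<phi> G, v) \<simeq>\<^sub>r Q}) / real (N k))" for k
  proof -
    have "\<P>(x in measure_pmf (uniformly_rooted (map_pmf \<phi> (\<mu> k))). nbhd l x \<simeq>\<^sub>r Q)
      = measure_pmf.expectation (map_pmf \<phi> (\<mu> k)) (\<lambda>G. real (card {v \<in> verts G. nbhd l (G, v) \<simeq>\<^sub>r Q}) / real (card (verts G)))"
    proof (rule prob_uniformly_rooted)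
      fix G assume "G \<in> set_pmf (map_pmf \<phi> (\<mu> k))"
      thus "finite (verts G) \<and> verts G \<noteq> {}" using g N[of k] by fastforce
    qed
    also have "\<dots> = measure_pmf.expectation (\<mu> k) (\<lambda>G. real (card {v \<in> verts (\<phi> G). nbhd l (\<phi> G, v) \<simeq>\<^sub>r Q}) / real (N k))"
      unfolding integral_map_pmf
      by (rule integral_cong_AE) (auto simp: AE_measure_pmf_iff g)
    finally show ?thesis .
  qed
  thus "(\<lambda>k. \<P>(x in measure_pmf (uniformly_rooted (map_pmf \<phi> (\<mu> k))). nbhd l x \<simeq>\<^sub>r Q)) \<longlonglongrightarrow> \<P>(x in M. nbhd l (L x) \<simeq>\<^sub>r Q)"
    using lim by simp
qed

context critical_offspring
begin

definition corner_pmf :: "nat \<Rightarrow> planted_tree pmf" where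
  "corner_pmf n = weighted_pmf {t. nodes t = n} (corner_weight (pmf p))"

lemma planted_expectation:
  fixes h :: "planted_tree \<Rightarrow> 'c::{banach, second_countable_topology}"
  assumes "forest_sum (pmf p) 1 n > 0"
  shows "set_pmf (planted_pmf (pmf p) n) \<subseteq> {t. nodes t = n}"
    "measure_pmf.expectation (planted_pmf (pmf p) n) h = (\<Sum>t | nodes t = n. tree_weight (pmf p) t *\<^sub>R h t) /\<^sub>R forest_sum (pmf p) 1 n"
proof -
  have eq: "planted_pmf (pmf p) n = weighted_pmf {t. nodes t = n} (tree_weight (pmf p))"
    unfolding planted_pmf_def planted_plane_trees_nodes planted_weight_eq ..
  show "set_pmf (planted_pmf (pmf p) n) \<subseteq> {t. nodes t = n}"
    unfolding eq by (rule set_weighted_pmf) (use assms in \<open>simp_all add: sum_tree_weight tree_weight_nonneg\<close>)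
  show "measure_pmf.expectation (planted_pmf (pmf p) n) h = (\<Sum>t | nodes t = n. tree_weight (pmf p) t *\<^sub>R h t) /\<^sub>R forest_sum (pmf p) 1 n"
    unfolding eq sum_tree_weight[symmetric]
    by (rule expectation_weighted_pmf) (use assms in \<open>simp_all add: sum_tree_weight tree_weight_nonneg\<close>)
qed

lemma corner_expectation:
  fixes h :: "planted_tree \<Rightarrow> 'c::{banach, second_countable_topology}"
  assumes n: "n \<ge> 2" "forest_sum (pmf p) 2 n > 0"
  shows "set_pmf (corner_pmf n) \<subseteq> {t. nodes t = n}"
    "measure_pmf.expectation (corner_pmf n) h = (\<Sum>t | nodes t = n. corner_weight (pmf p) t *\<^sub>R h t) /\<^sub>R forest_sum (pmf p) 2 n"
  unfolding corner_pmf_def sum_corner_weight[OF n(1), symmetric]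
  by (rule set_weighted_pmf expectation_weighted_pmf; use n in \<open>simp add: sum_corner_weight corner_weight_nonneg\<close>)+

lemma unrooted_expectation:
  fixes h :: "nat plane_tree set \<Rightarrow> 'c::{banach, second_countable_topology}"
  assumes n: "n \<ge> 2" "forest_sum (pmf p) 2 n > 0"
  shows "set_pmf (unrooted_pmf (pmf p) n) \<subseteq> unrooted_plane_trees n"
    "measure_pmf.expectation (unrooted_pmf (pmf p) n) h
      = (\<Sum>U\<in>unrooted_plane_trees n. unrooted_weight (pmf p) U *\<^sub>R h U) /\<^sub>R (\<Sum>U\<in>unrooted_plane_trees n. unrooted_weight (pmf p) U)"
proof -
  have pos: "(\<Sum>U\<in>unrooted_plane_trees n. unrooted_weight (pmf p) U) > 0"
    by (rule unrooted_corner_compare(1)[where f = "\<lambda>_. 0" and g = "\<lambda>_. 0"]) (use n in auto)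
  have nonneg: "unrooted_weight (pmf p) U \<ge> 0" for U by (simp add: unrooted_weight_def prod_nonneg)
  show "set_pmf (unrooted_pmf (pmf p) n) \<subseteq> unrooted_plane_trees n"
    unfolding unrooted_pmf_def by (rule set_weighted_pmf) (simp_all add: pos nonneg)
  show "measure_pmf.expectation (unrooted_pmf (pmf p) n) h
      = (\<Sum>U\<in>unrooted_plane_trees n. unrooted_weight (pmf p) U *\<^sub>R h U) /\<^sub>R (\<Sum>U\<in>unrooted_plane_trees n. unrooted_weight (pmf p) U)"
    unfolding unrooted_pmf_def by (rule expectation_weighted_pmf) (simp_all add: pos nonneg)
qed

theorem planted_benjamini_schramm:
  assumes N: "filterlim N at_top sequentially" and pos: "\<And>k. forest_sum (pmf p) 1 (N k) > 0"
  shows "benjamini_schramm_conv (\<lambda>k. map_pmf planted_graph (planted_pmf (pmf p) (N k))) (limit_measure p) limit_tree"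
proof (rule benjamini_schramm_convI[where N = N])
  have adm: "admissible (Suc 0) (N k)" for k using forest_sum_pos_imp_admissible[OF pos[of k]] by simp
  note supp = planted_expectation(1)[OF pos]
  show "finite (verts (planted_graph t)) \<and> card (verts (planted_graph t)) = N k" if "t \<in> set_pmf (planted_pmf (pmf p) (N k))" for t k
    using supp[of k] that by (auto simp: planted_graph_def card_positions)
  show "N k > 0" for k using adm[of k] by (simp add: admissible_def)
  have lim: "(\<lambda>k. measure_pmf.expectation (planted_pmf (pmf p) (N k)) (\<lambda>s. real (nbhd_count l Q s) / real (N k)))
      \<longlonglongrightarrow> \<P>(s in limit_measure p. nbhd l (limit_tree s) \<simeq>\<^sub>r Q)" for l Q
  proof (rule nbhd_count_tendsto[OF supp])
    fix t
    have "measure_pmf.expectation (planted_pmf (pmf p) (N k)) (\<lambda>s. real (fringe_count t s))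
        = (\<Sum>f\<in>forests (Suc 0) (N k). forest_weight (pmf p) f * real (forest_fringe_count t f)) / forest_sum (pmf p) (Suc 0) (N k)" for k
      unfolding planted_expectation(2)[OF pos]
      using sum_singleton_forests[of "\<lambda>f. forest_weight (pmf p) f * real (forest_fringe_count t f)" "N k"]
      by (simp add: forest_weight_def forest_fringe_count_def divide_inverse mult.commute)
    thus "(\<lambda>k. measure_pmf.expectation (planted_pmf (pmf p) (N k)) (\<lambda>s. real (fringe_count t s)) / real (N k)) \<longlonglongrightarrow> tree_weight (pmf p) t"
      using forest_fringe_fraction[OF N adm, of t] by simp
  qed
  show "(\<lambda>k. measure_pmf.expectation (planted_pmf (pmf p) (N k)) (\<lambda>t. real (card {v \<in> verts (planted_graph t). nbhd l (planted_graph t, v) \<simeq>\<^sub>r Q}) / real (N k)))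
      \<longlonglongrightarrow> \<P>(s in limit_measure p. nbhd l (limit_tree s) \<simeq>\<^sub>r Q)" for l and Q :: "nat rooted_graph"
    using lim[of l Q] by (simp add: nbhd_count_def)
qed

context
  fixes N :: "nat \<Rightarrow> nat"
  assumes N: "filterlim N at_top sequentially" and pos: "\<And>k. forest_sum (pmf p) 2 (N k) > 0"
begin

lemma admissible_2: "admissible 2 (N k)"
  using forest_sum_pos_imp_admissible[OF pos] .

lemma N_ge_2: "N k \<ge> 2"
  using admissible_2[of k] by (simp add: admissible_def)

lemma corner_nbhd_tendsto:
  "(\<lambda>k. measure_pmf.expectation (corner_pmf (N k)) (\<lambda>s. real (nbhd_count l Q s) / real (N k)))
     \<longlonglongrightarrow> \<P>(s in limit_measure p. nbhd l (limit_tree s) \<simeq>\<^sub>r Q)"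
proof (rule nbhd_count_tendsto[OF corner_expectation(1)[OF N_ge_2 pos]])
  fix t
  let ?E = "\<lambda>k. measure_pmf.expectation (corner_pmf (N k))"
  have int: "integrable (measure_pmf (corner_pmf (N k))) h" for h :: "planted_tree \<Rightarrow> real" and k
    by (rule integrable_measure_pmf_finite) (rule finite_subset[OF corner_expectation(1)[OF N_ge_2 pos]], simp)
  have "?E k (\<lambda>s. real (forest_fringe_count t (corner_forest s)))
      = (\<Sum>f\<in>forests (Suc 1) (N k). forest_weight (pmf p) f * real (forest_fringe_count t f)) / forest_sum (pmf p) (Suc 1) (N k)" for k
  proof -
    have "(\<Sum>s | nodes s = N k. corner_weight (pmf p) s * real (forest_fringe_count t (corner_forest s)))
        = (\<Sum>f\<in>forests 2 (N k). forest_weight (pmf p) f * real (forest_fringe_count t f))"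
      unfolding sum_corner_forest[OF N_ge_2, symmetric]
      by (intro sum.cong refl) (use N_ge_2[of k] in \<open>auto simp: forest_weight_corner\<close>)
    thus ?thesis unfolding corner_expectation(2)[OF N_ge_2 pos]
      by (simp add: divide_inverse mult.commute numeral_2_eq_2)
  qed
  moreover have "admissible (Suc 1) (N k)" for k using admissible_2[of k] by (simp add: numeral_2_eq_2)
  ultimately have lim: "(\<lambda>k. ?E k (\<lambda>s. real (forest_fringe_count t (corner_forest s))) / real (N k)) \<longlonglongrightarrow> tree_weight (pmf p) t"
    using forest_fringe_fraction[OF N, of 1 t] by simp
  have "(\<lambda>k. ?E k (\<lambda>s. real (fringe_count t s)) / real (N k) - ?E k (\<lambda>s. real (forest_fringe_count t (corner_forest s))) / real (N k)) \<longlonglongrightarrow> 0"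
  proof (rule Lim_null_comparison)
    show "(\<lambda>k. 1 / real (N k)) \<longlonglongrightarrow> 0"
      by (rule filterlim_compose[OF lim_1_over_n N])
    have "norm (?E k (\<lambda>s. real (fringe_count t s)) / real (N k) - ?E k (\<lambda>s. real (forest_fringe_count t (corner_forest s))) / real (N k)) \<le> 1 / real (N k)" for k
    proof -
      have "\<bar>?E k (\<lambda>s. real (fringe_count t s)) - ?E k (\<lambda>s. real (forest_fringe_count t (corner_forest s)))\<bar>
          = \<bar>?E k (\<lambda>s. real (fringe_count t s) - real (forest_fringe_count t (corner_forest s)))\<bar>"
        by (subst Bochner_Integration.integral_diff[OF int int]) simp
      also have "\<dots> \<le> ?E k (\<lambda>s. \<bar>real (fringe_count t s) - real (forest_fringe_count t (corner_forest s))\<bar>)"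
        by (rule integral_abs_bound)
      also have "\<dots> \<le> ?E k (\<lambda>s. 1)"
      proof (rule integral_mono_AE[OF int int])
        show "AE s in measure_pmf (corner_pmf (N k)). \<bar>real (fringe_count t s) - real (forest_fringe_count t (corner_forest s))\<bar> \<le> 1"
          unfolding AE_measure_pmf_iff
        proof
          fix s assume "s \<in> set_pmf (corner_pmf (N k))"
          hence "nodes s = N k" using corner_expectation(1)[OF N_ge_2 pos] by blast
          thus "\<bar>real (fringe_count t s) - real (forest_fringe_count t (corner_forest s))\<bar> \<le> 1"
            using fringe_count_corner N_ge_2[of k] by simp
        qed
      qed
      finally show ?thesis by (simp add: diff_divide_distrib[symmetric] divide_right_mono)
    qed
    thus "eventually (\<lambda>k. norm (?E k (\<lambda>s. real (fringe_count t s)) / real (N k) - ?E k (\<lambda>s. real (forest_fringe_count t (corner_forest s))) / real (N k)) \<le> 1 / real (N k)) sequentially"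
      by simp
  qed
  from tendsto_add[OF this lim] show "(\<lambda>k. ?E k (\<lambda>s. real (fringe_count t s)) / real (N k)) \<longlonglongrightarrow> tree_weight (pmf p) t"
    by simp
qed

text \<open>Exponential decay of the symmetric trees against polynomial decay of the total weight.\<close>

lemma symmetric_fraction_tendsto_0:
  "(\<lambda>k. 2 * (2 * real (N k) * (\<Sum>t | nodes t = N k \<and> symmetric_code t. corner_weight (pmf p) t)) / forest_sum (pmf p) 2 (N k)) \<longlonglongrightarrow> 0"
proof -
  obtain b where b: "0 < b" "b < 1" "\<And>k. pmf p k \<le> b\<^sup>2" using atom_bound by blast
  define c where "c = - ln b"
  have c: "c > 0" using b by (simp add: c_def)
  let ?S = "\<lambda>k. \<Sum>t | nodes t = N k \<and> symmetric_code t. corner_weight (pmf p) t"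
  let ?Z = "\<lambda>k. sqrt (N k) * (real (N k) * forest_sum (pmf p) 2 (N k))"
  define h where "h x = 4 * x * (sqrt x * x) * (((x + 1) ^ 3 + 1) * exp (- c * (x - 1)))" for x :: real
  have "(\<lambda>k. 4 * real (N k) * (sqrt (N k) * real (N k)) * ?S k) \<longlonglongrightarrow> 0"
  proof (rule Lim_null_comparison)
    have "(h \<longlongrightarrow> 0) at_top" unfolding h_def using c by real_asymp
    from filterlim_compose[OF this filterlim_compose[OF filterlim_real_sequentially N]]
    show "(\<lambda>k. h (real (N k))) \<longlonglongrightarrow> 0" .
    have "norm (4 * real (N k) * (sqrt (N k) * real (N k)) * ?S k) \<le> h (real (N k))" for k
    proof -
      have S0: "?S k \<ge> 0" by (intro sum_nonneg corner_weight_nonneg) simp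
      have "b ^ (N k - 1) = exp (real (N k - 1) * ln b)" using b by (simp add: exp_of_nat_mult)
      also have "real (N k - 1) * ln b = - c * (real (N k) - 1)" using N_ge_2[of k] by (simp add: c_def of_nat_diff algebra_simps)
      finally have bp: "b ^ (N k - 1) = exp (- c * (real (N k) - 1))" .
      have "?S k \<le> real (N k + 1) ^ 3 * b ^ (N k - 1) + b ^ (N k - 1)"
        by (rule symmetric_weight_le) (use b N_ge_2 in auto)
      also have "\<dots> = ((real (N k) + 1) ^ 3 + 1) * exp (- c * (real (N k) - 1))"
        unfolding bp by (simp add: algebra_simps)
      finally have "4 * real (N k) * (sqrt (N k) * real (N k)) * ?S k \<le> h (real (N k))"
        unfolding h_def by (intro mult_left_mono) auto
      thus ?thesis using S0 by simp
    qed
    thus "eventually (\<lambda>k. norm (4 * real (N k) * (sqrt (N k) * real (N k)) * ?S k) \<le> h (real (N k))) sequentially" by simp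
  qed
  from tendsto_divide[OF this forest_sum_tendsto[OF N admissible_2]] llt_const_pos
  have "(\<lambda>k. 4 * real (N k) * (sqrt (N k) * real (N k)) * ?S k / ?Z k) \<longlonglongrightarrow> 0" by simp
  moreover have "4 * real (N k) * (sqrt (N k) * real (N k)) * ?S k / ?Z k = 2 * (2 * real (N k) * ?S k) / forest_sum (pmf p) 2 (N k)" for k
    using N_ge_2[of k] by (simp add: field_simps)
  ultimately show ?thesis by simp
qed

lemma unrooted_expectation_tendsto:
  fixes f :: "nat \<Rightarrow> nat plane_tree set \<Rightarrow> complex"
  assumes f: "\<And>k U. norm (f k U) \<le> 1"
    and g: "\<And>k U t. U \<in> unrooted_plane_trees (N k) \<Longrightarrow> t \<in> codes U \<Longrightarrow> g k t = f k U"
    and lim: "(\<lambda>k. measure_pmf.expectation (corner_pmf (N k)) (g k)) \<longlonglongrightarrow> L"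
  shows "(\<lambda>k. measure_pmf.expectation (unrooted_pmf (pmf p) (N k)) (f k)) \<longlonglongrightarrow> L"
proof -
  have "(\<lambda>k. measure_pmf.expectation (unrooted_pmf (pmf p) (N k)) (f k) - measure_pmf.expectation (corner_pmf (N k)) (g k)) \<longlonglongrightarrow> 0"
  proof (rule Lim_null_comparison[OF _ symmetric_fraction_tendsto_0], rule always_eventually, rule allI)
    fix k
    show "norm (measure_pmf.expectation (unrooted_pmf (pmf p) (N k)) (f k) - measure_pmf.expectation (corner_pmf (N k)) (g k))
        \<le> 2 * (2 * real (N k) * (\<Sum>t | nodes t = N k \<and> symmetric_code t. corner_weight (pmf p) t)) / forest_sum (pmf p) 2 (N k)"
      unfolding unrooted_expectation(2)[OF N_ge_2 pos] corner_expectation(2)[OF N_ge_2 pos]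
      by (rule unrooted_corner_compare(2)) (use N_ge_2 pos f g in auto)
  qed
  from tendsto_add[OF this lim] show ?thesis by simp
qed

theorem unrooted_benjamini_schramm:
  "benjamini_schramm_conv (\<lambda>k. map_pmf underlying (unrooted_pmf (pmf p) (N k))) (limit_measure p) limit_tree"
proof (rule benjamini_schramm_convI[where N = N])
  show "N k > 0" for k using N_ge_2[of k] by simp
  have card: "finite (verts (underlying U)) \<and> card (verts (underlying U)) = n" if U: "U \<in> unrooted_plane_trees n" for U n
  proof -
    obtain t where t: "t \<in> codes U" using codes_ne[OF U] by blast
    obtain f where "graph_iso_by f (planted_graph t) (underlying U)" using codes_graph_iso[OF U t] by blast
    hence "bij_betw f (positions t) (verts (underlying U))" by (simp add: graph_iso_by_def planted_graph_def)
    thus ?thesis using bij_betw_same_card bij_betw_finite finite_positions card_positions codes_nodes(1)[OF U t] by metis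
  qed
  note supp = unrooted_expectation(1)[OF N_ge_2 pos]
  show "finite (verts (underlying U)) \<and> card (verts (underlying U)) = N k" if "U \<in> set_pmf (unrooted_pmf (pmf p) (N k))" for U k
    using card supp that by blast
  fix l and Q :: "nat rooted_graph"
  let ?h = "\<lambda>k U. real (card {v \<in> verts (underlying U). nbhd l (underlying U, v) \<simeq>\<^sub>r Q}) / real (N k)"
  define f where "f k U = (if U \<in> unrooted_plane_trees (N k) then complex_of_real (?h k U) else 0)" for k U
  have "(\<lambda>k. measure_pmf.expectation (unrooted_pmf (pmf p) (N k)) (f k))
      \<longlonglongrightarrow> complex_of_real (\<P>(s in limit_measure p. nbhd l (limit_tree s) \<simeq>\<^sub>r Q))"
  proof (rule unrooted_expectation_tendsto)
    show "norm (f k U) \<le> 1" for k U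
    proof (cases "U \<in> unrooted_plane_trees (N k)")
      case True
      have "card {v \<in> verts (underlying U). nbhd l (underlying U, v) \<simeq>\<^sub>r Q} \<le> card (verts (underlying U))"
        using card[OF True] by (intro card_mono) auto
      thus ?thesis using True card[OF True] N_ge_2[of k] by (simp add: f_def norm_divide)
    qed (simp add: f_def)
    show "complex_of_real (real (nbhd_count l Q t) / real (N k)) = f k U" if "U \<in> unrooted_plane_trees (N k)" "t \<in> codes U" for k U t
      using that nbhd_count_code[OF that] by (simp add: f_def)
    show "(\<lambda>k. measure_pmf.expectation (corner_pmf (N k)) (\<lambda>t. complex_of_real (real (nbhd_count l Q t) / real (N k))))
        \<longlonglongrightarrow> complex_of_real (\<P>(s in limit_measure p. nbhd l (limit_tree s) \<simeq>\<^sub>r Q))"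
      unfolding integral_complex_of_real by (rule tendsto_of_real[OF corner_nbhd_tendsto])
  qed
  moreover have "measure_pmf.expectation (unrooted_pmf (pmf p) (N k)) (f k) = complex_of_real (measure_pmf.expectation (unrooted_pmf (pmf p) (N k)) (?h k))" for k
    unfolding integral_complex_of_real[symmetric]
  proof (rule integral_cong_AE)
    show "AE U in measure_pmf (unrooted_pmf (pmf p) (N k)). f k U = complex_of_real (?h k U)"
      unfolding AE_measure_pmf_iff using supp[of k] by (auto simp: f_def)
  qed simp_all
  ultimately show "(\<lambda>k. measure_pmf.expectation (unrooted_pmf (pmf p) (N k)) (?h k)) \<longlonglongrightarrow> \<P>(s in limit_measure p. nbhd l (limit_tree s) \<simeq>\<^sub>r Q)"
    by (simp only: tendsto_of_real_iff)
qed

theorem unrooted_degree_clt: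
  assumes d: "d \<ge> 1"
  shows "weak_conv_m
    (\<lambda>k. distr (measure_pmf (unrooted_pmf (pmf p) (N k))) borel
      (\<lambda>U. (real (count_degree d U) - pmf p (d - 1) * real (N k)) / sqrt (real (N k))))
    (centred_normal (sqrt (count_var (d - 1))))"
proof (rule levy_continuity)
  let ?X = "\<lambda>k U. (real (count_degree d U) - pmf p (d - 1) * real (N k)) / sqrt (real (N k))"
  show "real_distribution (distr (measure_pmf (unrooted_pmf (pmf p) (N k))) borel (?X k))" for k
    by (rule prob_space.real_distribution_distr[OF measure_pmf.prob_space_axioms]) simp
  show "real_distribution (centred_normal (sqrt (count_var (d - 1))))"
    by (rule char_centred_normal(2)) (simp add: count_var_nonneg)
  fix \<theta> :: real
  define g where "g k t = cis (\<theta> * ((real (forest_outdegree_count (d - 1) (corner_forest t)) - pmf p (d - 1) * real (N k)) / sqrt (N k)))" for k t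
  have "(\<lambda>k. measure_pmf.expectation (unrooted_pmf (pmf p) (N k)) (\<lambda>U. cis (\<theta> * ?X k U)))
      \<longlonglongrightarrow> of_real (exp (- \<theta>\<^sup>2 / 2 * count_var (d - 1)))"
  proof (rule unrooted_expectation_tendsto)
    show "g k t = cis (\<theta> * ?X k U)" if "U \<in> unrooted_plane_trees (N k)" "t \<in> codes U" for k U t
      unfolding g_def count_degree_code[OF that d] ..
    have "measure_pmf.expectation (corner_pmf (N k)) (g k)
        = (\<Sum>f\<in>forests 2 (N k). of_real (forest_weight (pmf p) f) *
          cis (\<theta> * ((real (forest_outdegree_count (d - 1) f) - pmf p (d - 1) * real (N k)) / sqrt (N k)))) / of_real (forest_sum (pmf p) 2 (N k))" for k
    proof -
      have "(\<Sum>t | nodes t = N k. corner_weight (pmf p) t *\<^sub>R g k t)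
        = (\<Sum>f\<in>forests 2 (N k). of_real (forest_weight (pmf p) f) *
          cis (\<theta> * ((real (forest_outdegree_count (d - 1) f) - pmf p (d - 1) * real (N k)) / sqrt (N k))))"
        unfolding sum_corner_forest[OF N_ge_2, symmetric] g_def
        by (intro sum.cong refl) (use N_ge_2[of k] in \<open>auto simp: forest_weight_corner scaleR_conv_of_real\<close>)
      thus ?thesis unfolding corner_expectation(2)[OF N_ge_2 pos]
        by (simp add: scaleR_conv_of_real divide_inverse mult.commute)
    qed
    thus "(\<lambda>k. measure_pmf.expectation (corner_pmf (N k)) (g k)) \<longlonglongrightarrow> of_real (exp (- \<theta>\<^sup>2 / 2 * count_var (d - 1)))"
      using forest_outdegree_count_char[OF N admissible_2, of \<theta> "d - 1"] by simp
  qed simp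
  moreover have "char (distr (measure_pmf (unrooted_pmf (pmf p) (N k))) borel (?X k)) \<theta>
      = measure_pmf.expectation (unrooted_pmf (pmf p) (N k)) (\<lambda>U. cis (\<theta> * ?X k U))" for k
    unfolding char_def by (subst integral_distr) (auto simp: cis_conv_exp)
  ultimately show "(\<lambda>k. char (distr (measure_pmf (unrooted_pmf (pmf p) (N k))) borel (?X k)) \<theta>)
      \<longlonglongrightarrow> char (centred_normal (sqrt (count_var (d - 1)))) \<theta>"
    unfolding char_centred_normal(1)[OF real_sqrt_ge_zero[OF count_var_nonneg]] by (simp add: count_var_nonneg)
qed

end

end

theorem theorem4p2:
  fixes w :: "nat \<Rightarrow> real"
  assumes "\<And>k. w k \<ge> 0"
    and "w 0 > 0"
    and "\<exists>k\<ge>2. w k > 0"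
    and "conv_radius w > 0"
    and "measure_pmf.expectation (offspring_pmf w) real = 1"
    and "integrable (measure_pmf (offspring_pmf w)) (\<lambda>k. (real k - 1)\<^sup>2)"
  shows
    "benjamini_schramm_conv
       (\<lambda>k. map_pmf planted_graph (planted_pmf w (enumerate (planted_sizes w) k)))
       (limit_measure (offspring_pmf w)) limit_tree
     \<and>
     benjamini_schramm_conv
       (\<lambda>k. map_pmf underlying (unrooted_pmf w (enumerate (unrooted_sizes w) k)))
       (limit_measure (offspring_pmf w)) limit_tree
     \<and>
     (\<forall>d\<ge>1. \<exists>\<sigma>\<ge>0.
        (degree_count_nondegenerate w d \<longrightarrow> \<sigma> > 0) \<and>
        weak_conv_m
          (\<lambda>k. let n = enumerate (unrooted_sizes w) k in
             distr (measure_pmf (unrooted_pmf w n)) borel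
               (\<lambda>U. (real (count_degree d U) - pmf (offspring_pmf w) (d - 1) * real n) / sqrt (real n)))
          (centred_normal \<sigma>))"
proof -
  note pmf_p = pmf_offspring[OF assms(1-4)]
  note crit = critical_offspring_canonical[OF assms]
  interpret critical_offspring "offspring_pmf w" by (rule crit(1))
  let ?p = "pmf (offspring_pmf w)"
  have p_eq: "?p = (\<lambda>k. w k * tau w ^ k / Phi w (tau w))" by (rule ext) (rule pmf_p)
  have pos: "?p k > 0" if "w k > 0" for k using that crit(2,3) by (simp add: pmf_p)
  have planted: "planted_pmf w n = planted_pmf ?p n" "planted_sizes w = {n. forest_sum ?p 1 n > 0}" for n
    using planted_tilt[OF crit(2,3), of w] planted_sizes_eq[of ?p] unfolding p_eq[symmetric] by auto
  have unrooted: "unrooted_pmf w n = unrooted_pmf ?p n" "unrooted_sizes w = {n. forest_sum ?p 2 n > 0}" for n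
    using unrooted_tilt[OF crit(2,3), of w] unrooted_sizes_eq[of ?p] unfolding p_eq[symmetric] by auto
  have inf: "infinite {n. forest_sum ?p 1 n > 0}" "infinite {n. forest_sum ?p 2 n > 0}"
    by (rule forest_sum_set; simp)+
  have "benjamini_schramm_conv
       (\<lambda>k. map_pmf planted_graph (planted_pmf w (enumerate (planted_sizes w) k)))
       (limit_measure (offspring_pmf w)) limit_tree"
    unfolding planted
    by (rule planted_benjamini_schramm[OF filterlim_enumerate[OF inf(1)]]) (use enumerate_in_set[OF inf(1)] in auto)
  moreover have N: "filterlim (enumerate (unrooted_sizes w)) at_top sequentially" "forest_sum ?p 2 (enumerate (unrooted_sizes w) k) > 0" for k
    unfolding unrooted(2) using filterlim_enumerate[OF inf(2)] enumerate_in_set[OF inf(2)] by auto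
  have "benjamini_schramm_conv
       (\<lambda>k. map_pmf underlying (unrooted_pmf w (enumerate (unrooted_sizes w) k)))
       (limit_measure (offspring_pmf w)) limit_tree"
    unfolding unrooted(1) by (rule unrooted_benjamini_schramm[OF N])
  moreover have "\<exists>\<sigma>\<ge>0.
        (degree_count_nondegenerate w d \<longrightarrow> \<sigma> > 0) \<and>
        weak_conv_m
          (\<lambda>k. let n = enumerate (unrooted_sizes w) k in
             distr (measure_pmf (unrooted_pmf w n)) borel
               (\<lambda>U. (real (count_degree d U) - ?p (d - 1) * real n) / sqrt (real n)))
          (centred_normal \<sigma>)" if d: "d \<ge> 1" for d
  proof (intro exI conjI impI)
    show "sqrt (count_var (d - 1)) \<ge> 0" by (simp add: count_var_nonneg)
    show "sqrt (count_var (d - 1)) > 0" if "degree_count_nondegenerate w d"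
    proof -
      from that obtain i j where "w (d - 1) > 0" "0 < i" "i < j" "w i > 0" "w j > 0"
        unfolding degree_count_nondegenerate_def by blast
      hence "count_var (d - 1) > 0" by (intro count_var_pos[of _ i j] pos)
      thus ?thesis by simp
    qed
    show "weak_conv_m
          (\<lambda>k. let n = enumerate (unrooted_sizes w) k in
             distr (measure_pmf (unrooted_pmf w n)) borel
               (\<lambda>U. (real (count_degree d U) - ?p (d - 1) * real n) / sqrt (real n)))
          (centred_normal (sqrt (count_var (d - 1))))"
      unfolding Let_def unrooted(1) by (rule unrooted_degree_clt[OF N d])
  qed
  ultimately show ?thesis by blast
qed

end
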